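(* Let $n\geq 2$ and let $\mathrm{G}(\mathbb{S}^n)$ denote either $\mathrm{LIP}(\mathbb{S}^n)$ or $\mathrm{QC}(\mathbb{S}^n)$. There exists $\epsilon>0$ such that $$\{f\in \mathrm{G}(\mathbb{S}^{n}): \tilde{d}(\mathrm{id},f)<\epsilon\}\subset G(\mathrm{G}_{0}(\mathbb{S}^{n})),$$ where $\tilde{d}(f,g)=\sup\{d_{\mathbb{S}^{n}}(f(x),g(x)):x\in \mathbb{S}^{n}\}$ and $G(\mathrm{G}_0(\mathbb{S}^n))$ is the subgroup of $\mathrm{G}(\mathbb{S}^n)$ generated by $\mathrm{G}_0(\mathbb{S}^n)$.
   Context: $\mathbb{S}^{n}$ is the unit sphere in $\mathbb{R}^{n+1}$ with its standard spherical (geodesic) metric $d_{\mathbb{S}^n}$. $\mathrm{LIP}(\mathbb{S}^{n})$ is the group of orientation preserving homeomorphisms $f:\mathbb{S}^n\to\mathbb{S}^n$ that are bilipschitz, i.e. for which there is $L>0$ with $d_{\mathbb{S}^n}(x,y)/L\le d_{\mathbb{S}^n}(f(x),f(y))\le L\,d_{\mathbb{S}^n}(x,y)$ for all $x,y\in\mathbb{S}^n$. Let $\Omega,\Omega'$ be open subsets of $\mathbb{R}^n$ and $f:\Omega\to\Omega'$ a homeomorphism. For $x_0\in\Omega$ and small $\epsilon>0$ let $D_l(\epsilon)$ and $D_u(\epsilon)$ be the infimum and the supremum, respectively, of $|f(x_0)-y|$ over $y\in f(\partial B_{\mathbb{R}^n}(x_0,\epsilon))$, where $B_{\mathbb{R}^n}(x_0,\epsilon)$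 is the open Euclidean ball, and let $K_{x_0}=\limsup_{\epsilon\to0}D_u(\epsilon)/D_l(\epsilon)$. The map $f$ is $K$-quasiconformal (with $K<\infty$) if $K_{x_0}<K$ for every $x_0\in\Omega$. It is quasiconformal if it is $K$-quasiconformal for some $K$, and locally quasiconformal if every point of $\Omega$ has a neighbourhood on which $f$ is quasiconformal. A homeomorphism $f:\mathbb{S}^n\to\mathbb{S}^n$ is quasiconformal if for every pair of charts $\phi,\psi$ of the standard smooth structure on $\mathbb{S}^n$ the composition $\psi\circ f\circ\phi^{-1}$ is locally quasiconformal where defined. $\mathrm{QC}(\mathbb{S}^{n})$ is the group of orientation preserving quasiconformal homeomorphisms of $\mathbb{S}^n$. $\mathcal{B}$ is the collection of open balls $B_{\mathbb{S}^n}(c,\epsilon)=\{x\in\mathbb{S}^n: d_{\mathbb{S}^n}(x,c)<\epsilon\}$ with $c\in\mathbb{S}^n$ and $\epsilon\in(0,\pi)$. A non-identity $g\in\mathrm{G}(\mathbb{S}^n)$ is supported on $B\in\mathcal{B}$ if $g$ is the identity outside $B$. $\mathrm{G}_0(\mathbb{S}^n)$ is the set of elements of $\mathrm{G}(\mathbb{S}^n)$ which are supported on some element of $\mathcal{B}$. *)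

theory Defs
  imports "HOL-Analysis.Analysis" "HOL-Homology.Homology" "HOL-Algebra.Bij" "HOL-Algebra.Generated_Groups"
begin

text \<open>
  With \<open>'a\<close> in the role of $R^n$, the type \<open>'a \<times> real\<close> (with the library's product norm,
  which is Euclidean) is $R^{n+1}$, and \<open>unit_sphere\<close> is $S^n$.
\<close>

abbreviation unit_sphere :: "('a::euclidean_space \<times> real) set"
  where "unit_sphere \<equiv> sphere 0 1"

text \<open>The geodesic distance of two points of the sphere is the angle between them.\<close>

definition sdist :: "'a::euclidean_space \<times> real \<Rightarrow> 'a \<times> real \<Rightarrow> real"
  where "sdist x y = arccos (x \<bullet> y)"

definition sball :: "'a::euclidean_space \<times> real \<Rightarrow> real \<Rightarrow> ('a \<times> real) set"
  where "sball c \<epsilon> = {x \<in> unit_sphere. sdist x c < \<epsilon>}"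

definition sballs :: "('a::euclidean_space \<times> real) set set"
  where "sballs = {sball c \<epsilon> | c \<epsilon>. c \<in> unit_sphere \<and> \<epsilon> \<in> {0<..<pi}}"

definition sup_dist ::
    "('a::euclidean_space \<times> real \<Rightarrow> 'a \<times> real) \<Rightarrow> ('a \<times> real \<Rightarrow> 'a \<times> real) \<Rightarrow> real"
  where "sup_dist f g = (SUP x \<in> unit_sphere. sdist (f x) (g x))"


text \<open>
  A self-homeomorphism of $S^n$ preserves orientation iff it fixes the fundamental class. As
  $H_n(S^n)$ is infinite cyclic for $n \ge 1$, generated by that class, this says that the induced
  map on $H_n(S^n)$ is the identity, i.e. that the map has degree 1.
\<close>

definition orientation_preserving ::
    "('a::euclidean_space \<times> real \<Rightarrow> 'a \<times> real) \<Rightarrow> bool"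
  where "orientation_preserving f \<longleftrightarrow>
    (\<forall>c \<in> carrier (homology_group (int DIM('a)) (top_of_set (unit_sphere :: ('a \<times> real) set))).
       hom_induced (int DIM('a)) (top_of_set unit_sphere) {} (top_of_set unit_sphere) {} f c = c)"

text \<open>
  As in \<^const>\<open>BijGroup\<close>, a self-map of the sphere is represented by the function that is
  \<^const>\<open>undefined\<close> off the sphere, so that equality of maps is equality in HOL.
\<close>

definition oriented_homeos :: "('a::euclidean_space \<times> real \<Rightarrow> 'a \<times> real) set"
  where "oriented_homeos =
    {f \<in> Bij unit_sphere.
       (\<exists>g. homeomorphism unit_sphere unit_sphere f g) \<and> orientation_preserving f}"

definition bilipschitz :: "('a::euclidean_space \<times> real \<Rightarrow> 'a \<times> real) \<Rightarrow> bool"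
  where "bilipschitz f \<longleftrightarrow>
    (\<exists>L>0. \<forall>x \<in> unit_sphere. \<forall>y \<in> unit_sphere.
       sdist x y / L \<le> sdist (f x) (f y) \<and> sdist (f x) (f y) \<le> L * sdist x y)"

definition LIP :: "('a::euclidean_space \<times> real \<Rightarrow> 'a \<times> real) monoid"
  where "LIP = (BijGroup unit_sphere)
    \<lparr>carrier := {f \<in> oriented_homeos. bilipschitz f}\<rparr>"


text \<open>
  For \<open>x\<^sub>0\<close> in the open domain of a homeomorphism the quotient below is a genuine ratio of a
  maximum and a positive minimum as soon as the closed ball of radius \<open>\<epsilon>\<close> lies in the domain; only
  such \<open>\<epsilon>\<close> matter for the limit superior.
\<close>

definition distortion :: "('a::euclidean_space \<Rightarrow> 'a) \<Rightarrow> 'a \<Rightarrow> ereal"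
  where "distortion f x\<^sub>0 =
    Limsup (at_right 0) (\<lambda>\<epsilon>::real.
      ereal ((SUP y \<in> f ` sphere x\<^sub>0 \<epsilon>. dist (f x\<^sub>0) y) / (INF y \<in> f ` sphere x\<^sub>0 \<epsilon>. dist (f x\<^sub>0) y)))"

definition quasiconformal_on :: "'a::euclidean_space set \<Rightarrow> ('a \<Rightarrow> 'a) \<Rightarrow> bool"
  where "quasiconformal_on \<Omega> f \<longleftrightarrow>
    open \<Omega> \<and> open (f ` \<Omega>) \<and> (\<exists>g. homeomorphism \<Omega> (f ` \<Omega>) f g) \<and>
    (\<exists>K::real. \<forall>x \<in> \<Omega>. distortion f x < ereal K)"

definition locally_quasiconformal_on :: "'a::euclidean_space set \<Rightarrow> ('a \<Rightarrow> 'a) \<Rightarrow> bool"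
  where "locally_quasiconformal_on \<Omega> f \<longleftrightarrow>
    (\<forall>x \<in> \<Omega>. \<exists>W. open W \<and> x \<in> W \<and> W \<subseteq> \<Omega> \<and> quasiconformal_on W f)"


text \<open>\<open>C_on k S f\<close>: on the open set \<open>S\<close> the map \<open>f\<close> is $k$ times continuously differentiable.\<close>

primrec C_on :: "nat \<Rightarrow> 'a::euclidean_space set \<Rightarrow> ('a \<Rightarrow> 'b::euclidean_space) \<Rightarrow> bool" where
  "C_on 0 S f \<longleftrightarrow> continuous_on S f"
| "C_on (Suc k) S f \<longleftrightarrow>
     (\<forall>x \<in> S. f differentiable at x) \<and> (\<forall>v. C_on k S (\<lambda>x. frechet_derivative f (at x) v))"

definition smooth_on :: "'a::euclidean_space set \<Rightarrow> ('a \<Rightarrow> 'b::euclidean_space) \<Rightarrow> bool"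
  where "smooth_on S f \<longleftrightarrow> (\<forall>k. C_on k S f)"

text \<open>
  A coordinate chart is a pair \<open>(U, \<phi>)\<close> of its domain and its coordinate map. The standard smooth
  structure is the maximal smooth atlas containing the stereographic projections from the two
  poles \<open>(0, 1)\<close> and \<open>(0, - 1)\<close>.
\<close>

definition coordinate_chart :: "('a::euclidean_space \<times> real) set \<times> ('a \<times> real \<Rightarrow> 'a) \<Rightarrow> bool"
  where "coordinate_chart = (\<lambda>(U, \<phi>).
    openin (top_of_set unit_sphere) U \<and> open (\<phi> ` U) \<and> (\<exists>g. homeomorphism U (\<phi> ` U) \<phi> g))"

definition smoothly_compatible ::
    "('a::euclidean_space \<times> real) set \<times> ('a \<times> real \<Rightarrow> 'a) \<Rightarrow>
     ('a \<times> real) set \<times> ('a \<times> real \<Rightarrow> 'a) \<Rightarrow> bool"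
  where "smoothly_compatible = (\<lambda>(U, \<phi>) (V, \<psi>).
    smooth_on (\<phi> ` (U \<inter> V)) (\<psi> \<circ> inv_into U \<phi>) \<and>
    smooth_on (\<psi> ` (U \<inter> V)) (\<phi> \<circ> inv_into V \<psi>))"

definition stereographic ::
    "real \<Rightarrow> ('a::euclidean_space \<times> real) set \<times> ('a \<times> real \<Rightarrow> 'a)"
  where "stereographic s = (unit_sphere - {(0, s)}, \<lambda>(x, t). x /\<^sub>R (1 - s * t))"

definition sphere_charts :: "(('a::euclidean_space \<times> real) set \<times> ('a \<times> real \<Rightarrow> 'a)) set"
  where "sphere_charts =
    {c. coordinate_chart c \<and> (\<forall>s \<in> {1, - 1}. smoothly_compatible c (stereographic s))}"

definition quasiconformal :: "('a::euclidean_space \<times> real \<Rightarrow> 'a \<times> real) \<Rightarrow> bool"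
  where "quasiconformal f \<longleftrightarrow>
    (\<forall>(U, \<phi>) \<in> sphere_charts. \<forall>(V, \<psi>) \<in> sphere_charts.
       locally_quasiconformal_on (\<phi> ` {x \<in> U. f x \<in> V}) (\<psi> \<circ> f \<circ> inv_into U \<phi>))"

definition QC :: "('a::euclidean_space \<times> real \<Rightarrow> 'a \<times> real) monoid"
  where "QC = (BijGroup unit_sphere)
    \<lparr>carrier := {f \<in> oriented_homeos. quasiconformal f}\<rparr>"


definition supported_on ::
    "('a::euclidean_space \<times> real \<Rightarrow> 'a \<times> real) \<Rightarrow> ('a \<times> real) set \<Rightarrow> bool"
  where "supported_on g B \<longleftrightarrow>
    g \<noteq> (\<lambda>x \<in> unit_sphere. x) \<and> (\<forall>x \<in> unit_sphere - B. g x = x)"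

definition ball_supported ::
    "('a::euclidean_space \<times> real \<Rightarrow> 'a \<times> real) monoid \<Rightarrow> ('a \<times> real \<Rightarrow> 'a \<times> real) set"
  where "ball_supported G = {g \<in> carrier G. \<exists>B \<in> sballs. supported_on g B}"

end

theory Submission
  imports Defs
begin

text \<open>
  A homeomorphism of the sphere that is the identity on an open set is homotopic to the identity,
  hence preserves orientation, and it is supported on the complement of a small closed ball.
  Therefore it suffices to find, for \<open>f\<close> near the identity, a map \<open>F\<close> in the same class that is the
  identity on one nonempty open set and agrees with \<open>f\<close> on another one: then \<open>f\<close> is the product
  of \<open>F\<close> and \<open>F\<^sup>-\<^sup>1 f\<close>.

  In a stereographic chart \<open>F\<close> comes from an elementary substitute for the torus trick. There is a
  regular homotopy \<open>A s\<close> of immersions of the slab \<open>\<bar>z \<bullet> e\<bar> < 10\<close> into a bounded set, such that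
  \<open>A 1 z = A 0 (2 z)\<close>. Through each \<open>A s\<close> the map \<open>f\<close> lifts to a map of the slab near the identity.
  Passing slowly from the lift at \<open>s = 0\<close> to the one at \<open>s = 1\<close>, which is the first one at half the
  scale, and repeating this under \<open>z \<mapsto> 2 z\<close> gives a self-similar homeomorphism of a half space. It
  moves every point by at most half of the distance to the boundary and so extends by the identity,
  and near one point it is conjugate to \<open>f\<close>. Being pieced together from lifts, translations and
  scalings it inherits the local regularity of \<open>f\<close> with uniform constants.

  For this last claim quasiconformality has to be expressed by a condition that composes with uniform
  constants. Metric quasiconformality implies local quasisymmetry by a discrete length-area argument:
  in a covering by small balls the energy of the logarithm of the distance to an image point
  grows at most linearly in its total oscillation \<open>\<lambda>\<close>, while averaging over a fan of segments bounds
  \<open>\<lambda>\<close> by a small multiple of the energy plus a constant. Hence \<open>\<lambda>\<close> is bounded.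
\<close>

section \<open>Bilipschitz maps and lifts through immersions\<close>

text \<open>Two obstacles shape the construction. First, closeness of \<open>f\<close> to the
  identity in the Euclidean metric, and a single regularity index, are available only on a bounded
  part of the chart, while a self-similar map needs a whole slab at every scale. Immersing the slab
  into a bounded set provides both. The equation \<open>A 1 z = A 0 (2 z)\<close> then asks for a
  regular homotopy from a closed plane curve to the same curve run through twice. By
  Whitney-Graustein the turning number must equal its double, hence vanish: this excludes the circle
  and suggests the figure eight. Second, the extension consists of infinitely many pieces that
  accumulate at a hyperplane. So the regularity notion needs indices that are unchanged by scaling
  and whose composition depends only on the indices of the factors. The pointwise limit superior in
  the definition of quasiconformality offers no elementary bound of this kind; quasisymmetry does.
  The price is the length-area estimate, which is where the dimension has to be at least
  two.\<close>

lemma ball_subset_image_ball: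
  fixes f :: "'a::euclidean_space \<Rightarrow> 'a"
  assumes cont: "continuous_on (cball x r) f" and inj: "inj_on f (cball x r)"
    and m: "\<And>y. y \<in> sphere x r \<Longrightarrow> m \<le> dist (f x) (f y)"
    and r: "0 < r"
  shows "ball (f x) m \<subseteq> f ` ball x r"
proof (cases "m > 0")
  case True
  have op: "open (f ` ball x r)"
    using invariance_of_domain_ball[OF cont r inj] .
  have cl: "closure (f ` ball x r) \<subseteq> f ` cball x r"
    by (intro closure_minimal image_mono ball_subset_cball compact_imp_closed compact_continuous_image cont) auto
  have fr: "frontier (f ` ball x r) \<subseteq> f ` sphere x r"
  proof
    fix w assume w: "w \<in> frontier (f ` ball x r)"
    then have "w \<in> f ` cball x r" "w \<notin> f ` ball x r"
      using cl op by (auto simp: frontier_def interior_open)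
    then show "w \<in> f ` sphere x r" by (force simp: image_iff)
  qed
  show ?thesis
  proof (rule ccontr)
    assume "\<not> ?thesis"
    then have "ball (f x) m - f ` ball x r \<noteq> {}" by blast
    moreover have "f x \<in> ball (f x) m \<inter> f ` ball x r" using r True by auto
    \<comment> \<open>A connected set that meets the image and its complement meets the frontier.
      The frontier lies in the image of the sphere, which keeps distance \<open>m\<close> from
      \<open>f x\<close>.\<close>
    ultimately have "ball (f x) m \<inter> frontier (f ` ball x r) \<noteq> {}"
      using connected_Int_frontier[OF connected_ball, of "f x" m "f ` ball x r"] by blast
    then obtain y where "y \<in> sphere x r" "f y \<in> ball (f x) m" using fr by blast
    then show False using m[of y] by auto
  qed
next
  case False
  then show ?thesis by (metis ball_empty empty_subsetI not_less)
qed

definition bilip :: "real \<Rightarrow> 'a::metric_space set \<Rightarrow> ('a \<Rightarrow> 'a) \<Rightarrow> bool"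
  where "bilip L S f \<longleftrightarrow> 0 < L \<and> (\<forall>x\<in>S. \<forall>y\<in>S. dist x y \<le> L * dist (f x) (f y) \<and> dist (f x) (f y) \<le> L * dist x y)"

lemma bilipD:
  assumes "bilip L S f" "x \<in> S" "y \<in> S"
  shows "dist x y \<le> L * dist (f x) (f y)" "dist (f x) (f y) \<le> L * dist x y"
  using assms by (auto simp: bilip_def)

lemma bilip_subset: "bilip L S f \<Longrightarrow> T \<subseteq> S \<Longrightarrow> bilip L T f"
  by (auto simp: bilip_def)

lemma bilip_inj: "bilip L S f \<Longrightarrow> inj_on f S"
  by (rule inj_onI) (metis bilipD(1) dist_self mult_zero_right dist_le_zero_iff)

lemma bilip_continuous:
  assumes "bilip L S f"
  shows "continuous_on S f"
proof (rule continuous_onI)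
  fix x e assume "x \<in> S" "e > (0::real)"
  moreover have "L > 0" using assms by (simp add: bilip_def)
  ultimately show "\<exists>d>0. \<forall>x'\<in>S. dist x' x < d \<longrightarrow> dist (f x') (f x) \<le> e"
    using bilipD(2)[OF assms] by (intro exI[of _ "e / L"]) (fastforce simp: field_simps)
qed

lemma bilip_inverse:
  assumes "bilip L S f" "\<And>x. x \<in> S \<Longrightarrow> g (f x) = x"
  shows "bilip L (f ` S) g"
  using assms by (auto simp: bilip_def)

lemma bilip_comp:
  assumes "bilip L S f" "bilip M (f ` S) g"
  shows "bilip (L * M) S (g \<circ> f)"
proof -
  have LM: "L > 0" "M > 0" using assms by (auto simp: bilip_def)
  show ?thesis
    unfolding bilip_def
  proof (intro conjI ballI)
    fix x y assume xy: "x \<in> S" "y \<in> S"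
    note b = bilipD[OF assms(1) xy] bilipD[OF assms(2) imageI[OF xy(1)] imageI[OF xy(2)]]
    have "L * dist (f x) (f y) \<le> L * (M * dist (g (f x)) (g (f y)))"
      using b LM by (intro mult_left_mono) auto
    then show "dist x y \<le> L * M * dist ((g \<circ> f) x) ((g \<circ> f) y)" using b by simp
    have "M * dist (f x) (f y) \<le> M * (L * dist x y)"
      using b LM by (intro mult_left_mono) auto
    then show "dist ((g \<circ> f) x) ((g \<circ> f) y) \<le> L * M * dist x y" using b by (simp add: mult_ac)
  qed (use LM in auto)
qed

text \<open>
  The index of \<open>P\<close> is a bound for the distortion: a Lipschitz constant or a quasisymmetry function.
\<close>

locale regularity_class =
  fixes P :: "'i \<Rightarrow> 'a::euclidean_space set \<Rightarrow> ('a \<Rightarrow> 'a) \<Rightarrow> bool"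
  assumes P_cont: "P i S f \<Longrightarrow> continuous_on S f"
    and P_inj: "P i S f \<Longrightarrow> inj_on f S"
    and P_subset: "P i S f \<Longrightarrow> T \<subseteq> S \<Longrightarrow> P i T f"
    and P_cong: "P i S f \<Longrightarrow> (\<And>x. x \<in> S \<Longrightarrow> f x = g x) \<Longrightarrow> P i S g"
    and P_comp: "\<exists>k. \<forall>S f g. P i S f \<longrightarrow> P j (f ` S) g \<longrightarrow> P k S (g \<circ> f)"
    and P_inverse: "open S \<Longrightarrow> P i S f \<Longrightarrow> P i (f ` S) (inv_into S f)"
    and P_bilip: "\<exists>i. \<forall>S f. bilip L S f \<longrightarrow> P i S f"
    and P_scale: "c > 0 \<Longrightarrow> P i S f \<Longrightarrow> P i ((*\<^sub>R) c ` S) (\<lambda>x. c *\<^sub>R f (x /\<^sub>R c))"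
    and P_directed: "\<exists>k. \<forall>S f. P i S f \<or> P j S f \<longrightarrow> P k S f"
begin

text \<open>Choosing the index by \<open>SOME\<close> makes it a function of the two given indices
  alone, independent of the maps and their domains. This keeps the constants uniform over infinitely
  many pieces.\<close>

definition cmp :: "'i \<Rightarrow> 'i \<Rightarrow> 'i"
  where "cmp i j = (SOME k. \<forall>S f g. P i S f \<longrightarrow> P j (f ` S) g \<longrightarrow> P k S (g \<circ> f))"

definition bix :: "real \<Rightarrow> 'i"
  where "bix L = (SOME i. \<forall>S f. bilip L S f \<longrightarrow> P i S f)"

definition ub :: "'i \<Rightarrow> 'i \<Rightarrow> 'i"
  where "ub i j = (SOME k. \<forall>S f. P i S f \<or> P j S f \<longrightarrow> P k S f)"

text \<open>Regularity of the germ at \<open>z\<close>. With a fixed index it passes to maps glued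
  along open sets, whereas \<open>P i\<close> on two sets says nothing about their union.\<close>

definition locP :: "'i \<Rightarrow> 'a \<Rightarrow> ('a \<Rightarrow> 'a) \<Rightarrow> bool"
  where "locP i z f \<longleftrightarrow> (\<exists>V. open V \<and> z \<in> V \<and> P i V f)"

lemma P_cmp: "P i S f \<Longrightarrow> P j (f ` S) g \<Longrightarrow> P (cmp i j) S (g \<circ> f)"
  using someI_ex[OF P_comp[of i j]] unfolding cmp_def by blast

lemma P_bix: "bilip L S f \<Longrightarrow> P (bix L) S f"
  using someI_ex[OF P_bilip[of L]] unfolding bix_def by blast

lemma P_ub: "P i S f \<or> P j S f \<Longrightarrow> P (ub i j) S f"
  using someI_ex[OF P_directed[of i j]] unfolding ub_def by blast

lemma locP_ub: "locP i z f \<or> locP j z f \<Longrightarrow> locP (ub i j) z f"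
  unfolding locP_def using P_ub by blast

lemma locP_cong:
  assumes "locP i z f" "open U" "z \<in> U" "\<And>x. x \<in> U \<Longrightarrow> f x = g x"
  shows "locP i z g"
proof -
  obtain V where V: "open V" "z \<in> V" "P i V f" using assms(1) unfolding locP_def by blast
  have "P i (V \<inter> U) g"
    by (rule P_cong[OF P_subset[OF V(3)]]) (use assms in auto)
  then show ?thesis unfolding locP_def using V assms by (intro exI[of _ "V \<inter> U"]) auto
qed

lemma locP_isCont: "locP i z f \<Longrightarrow> isCont f z"
  unfolding locP_def using P_cont continuous_on_eq_continuous_at by blast

lemma locP_comp:
  assumes f: "locP i z f" and g: "locP j (f z) g"
  shows "locP (cmp i j) z (\<lambda>x. g (f x))"
proof -
  obtain V where V: "open V" "z \<in> V" "P i V f" using f unfolding locP_def by blast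
  obtain W where W: "open W" "f z \<in> W" "P j W g" using g unfolding locP_def by blast
  let ?U = "V \<inter> f -` W"
  have "open ?U" using continuous_open_preimage[OF P_cont[OF V(3)] V(1) W(1)] by simp
  moreover have "P (cmp i j) ?U (g \<circ> f)"
    by (rule P_cmp[OF P_subset[OF V(3)] P_subset[OF W(3)]]) auto
  ultimately show ?thesis unfolding locP_def using V W by (intro exI[of _ ?U]) (auto simp: o_def)
qed

lemma locP_bilip:
  assumes "bilip L V f" "open V" "z \<in> V"
  shows "locP (bix L) z f"
  unfolding locP_def using assms P_bix by blast

lemma locP_scale:
  assumes "locP i (z /\<^sub>R c) f" "c > 0"
  shows "locP i z (\<lambda>x. c *\<^sub>R f (x /\<^sub>R c))"
proof -
  obtain V where V: "open V" "z /\<^sub>R c \<in> V" "P i V f" using assms unfolding locP_def by blast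
  have "open ((*\<^sub>R) c ` V)" using open_scaling[of c V] V assms by simp
  moreover have "z \<in> (*\<^sub>R) c ` V" using V(2) assms by (intro image_eqI[of _ _ "z /\<^sub>R c"]) auto
  ultimately show ?thesis unfolding locP_def using P_scale[OF assms(2) V(3)] by blast
qed

lemma locP_inverse:
  assumes "locP i z f" "open U" "z \<in> U" "\<And>x. x \<in> U \<Longrightarrow> g (f x) = x"
  shows "locP i (f z) g"
proof -
  obtain V where V: "open V" "z \<in> V" "P i V f" using assms(1) unfolding locP_def by blast
  let ?W = "V \<inter> U"
  have P: "P i ?W f" using P_subset[OF V(3)] by blast
  have "open (f ` ?W)" using invariance_of_domain[OF P_cont[OF P] _ P_inj[OF P]] V assms by blast
  moreover have "P i (f ` ?W) g"
    by (rule P_cong[OF P_inverse[OF _ P]]) (use assms V P_inj[OF P] in \<open>auto simp: inv_into_f_f\<close>)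
  ultimately show ?thesis unfolding locP_def using V assms by blast
qed

end

text \<open>The bilipschitz bounds are required only at distances below \<open>r\<close>, so that
  maps which are periodic in some directions qualify.\<close>

definition uniform_immersion :: "real \<Rightarrow> real \<Rightarrow> 'a::euclidean_space set \<Rightarrow> ('a \<Rightarrow> 'a) \<Rightarrow> bool"
  where "uniform_immersion r L S \<beta> \<longleftrightarrow> 0 < r \<and> 0 < L \<and>
    (\<forall>z\<in>S. \<forall>w\<in>S. dist z w < r \<longrightarrow>
       dist z w \<le> L * dist (\<beta> z) (\<beta> w) \<and> dist (\<beta> z) (\<beta> w) \<le> L * dist z w)"

lemma uniform_immersion_bilip:
  assumes "uniform_immersion r L S \<beta>" "V \<subseteq> S" "\<And>x y. x \<in> V \<Longrightarrow> y \<in> V \<Longrightarrow> dist x y < r"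
  shows "bilip L V \<beta>"
  using assms unfolding uniform_immersion_def bilip_def by blast

text \<open>The branch of the multivalued map \<open>\<beta>^-1 f \<beta>\<close> nearest to the
  identity. Two candidates within r/2 of \<open>z\<close> are less than \<open>r\<close> apart,
  where \<beta> is injective.\<close>

definition lift :: "real \<Rightarrow> 'a::euclidean_space set \<Rightarrow> ('a \<Rightarrow> 'a) \<Rightarrow> ('a \<Rightarrow> 'a) \<Rightarrow> 'a \<Rightarrow> 'a"
  where "lift r S \<beta> f z = (THE u. u \<in> S \<and> dist u z < r / 2 \<and> \<beta> u = f (\<beta> z))"

lemma lift_unique:
  assumes im: "uniform_immersion r L S \<beta>" and u: "u \<in> S" "dist u z < r / 2" "\<beta> u = f (\<beta> z)"
  shows "lift r S \<beta> f z = u"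
  unfolding lift_def
proof (rule the_equality)
  fix v assume v: "v \<in> S \<and> dist v z < r / 2 \<and> \<beta> v = f (\<beta> z)"
  have "dist v u < r" using v u(2) dist_triangle2[of v u z] by linarith
  then have "dist v u \<le> L * dist (\<beta> v) (\<beta> u)" using im v u unfolding uniform_immersion_def by blast
  then show "v = u" using v u by simp
qed (use u in auto)

lemma immersion_ball:
  assumes im: "uniform_immersion r L S \<beta>" and z: "cball z d \<subseteq> S" and d: "0 < d" "d < r / 2"
  shows "ball (\<beta> z) (d / L) \<subseteq> \<beta> ` ball z d"
proof (rule ball_subset_image_ball)
  have L: "L > 0" using im by (simp add: uniform_immersion_def)
  have b: "bilip L (cball z d) \<beta>"
  proof (rule uniform_immersion_bilip[OF im z])
    fix x y assume "x \<in> cball z d" "y \<in> cball z d"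
    then show "dist x y < r" using dist_triangle3[of x y z] d by auto
  qed
  show "continuous_on (cball z d) \<beta>" "inj_on \<beta> (cball z d)"
    using bilip_continuous[OF b] bilip_inj[OF b] by auto
  show "0 < d" by fact
  fix y assume "y \<in> sphere z d"
  then show "d / L \<le> dist (\<beta> z) (\<beta> y)"
    using bilipD(1)[OF b, of z y] d L by (auto simp: field_simps)
qed

text \<open>The hypothesis on \<epsilon> puts \<open>f (\<beta> z)\<close> into the ball of radius
  (r/4)/L about \<open>\<beta> z\<close>, which \<beta> covers from within distance r/4 of
  \<open>z\<close>. The lower bilipschitz bound then sharpens r/4 to
  \<open>L * \<epsilon>\<close>.\<close>

lemma lift_props:
  assumes im: "uniform_immersion r L S \<beta>" and z: "cball z (r / 4) \<subseteq> S"
    and f: "dist (f (\<beta> z)) (\<beta> z) \<le> \<epsilon>" and \<epsilon>: "L * \<epsilon> < r / 8"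
  shows "lift r S \<beta> f z \<in> S" "dist (lift r S \<beta> f z) z \<le> L * \<epsilon>" "\<beta> (lift r S \<beta> f z) = f (\<beta> z)"
proof -
  have rL: "r > 0" "L > 0" using im by (auto simp: uniform_immersion_def)
  have "\<epsilon> < r / 4 / L" using \<epsilon> rL by (simp add: field_simps)
  then have "f (\<beta> z) \<in> ball (\<beta> z) (r / 4 / L)" using f by (simp add: dist_commute)
  then obtain u where u: "u \<in> ball z (r / 4)" "\<beta> u = f (\<beta> z)"
    using immersion_ball[OF im z] rL by (auto simp: image_iff)
  have uS: "u \<in> S" "z \<in> S" using z u(1) rL by auto
  have du: "dist u z < r / 4" using u by (simp add: dist_commute)
  then have "dist u z \<le> L * dist (\<beta> u) (\<beta> z)" using im uS rL unfolding uniform_immersion_def by fastforce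
  also have "\<dots> \<le> L * \<epsilon>" using u(2) f rL by simp
  finally have "dist u z \<le> L * \<epsilon>" .
  moreover have "lift r S \<beta> f z = u" using lift_unique[where f = f, OF im uS(1) _ u(2)] du rL by simp
  ultimately show "lift r S \<beta> f z \<in> S" "dist (lift r S \<beta> f z) z \<le> L * \<epsilon>" "\<beta> (lift r S \<beta> f z) = f (\<beta> z)"
    using uS u by auto
qed

context regularity_class
begin

lemma locP_immersion:
  assumes im: "uniform_immersion r L S \<beta>" and z: "z \<in> S" "open S"
  shows "locP (bix L) z \<beta>"
proof (rule locP_bilip)
  have r: "r > 0" using im by (auto simp: uniform_immersion_def)
  show "bilip L (S \<inter> ball z (r / 2)) \<beta>"
  proof (rule uniform_immersion_bilip[OF im])
    fix x y assume "x \<in> S \<inter> ball z (r / 2)" "y \<in> S \<inter> ball z (r / 2)"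
    then show "dist x y < r" using dist_triangle3[of x y z] by auto
  qed auto
qed (use z im in \<open>auto simp: uniform_immersion_def\<close>)

text \<open>Near \<open>z\<close> the lift is the composition of \<beta>, \<open>f\<close> and the
  inverse of \<beta> on one fixed ball \<open>B\<close> about the lifted point, so its index is that
  of a threefold composition.\<close>

lemma locP_lift:
  assumes im: "uniform_immersion r L S \<beta>" and S: "open S" and z: "cball z (r / 2) \<subseteq> S"
    and f: "dist (f (\<beta> z)) (\<beta> z) \<le> \<epsilon>" and \<epsilon>: "L * \<epsilon> < r / 8" and loc: "locP i (\<beta> z) f"
  shows "locP (cmp (cmp (bix L) i) (bix L)) z (lift r S \<beta> f)"
proof -
  have rL: "r > 0" "L > 0" using im by (auto simp: uniform_immersion_def)
  have "cball z (r / 4) \<subseteq> S" using z rL subset_cball[of "r / 4" "r / 2" z] by auto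
  note lp = lift_props[where f = f, OF im this f \<epsilon>]
  define u where "u = lift r S \<beta> f z"
  have u: "u \<in> S" "dist u z < r / 8" "\<beta> u = f (\<beta> z)" using lp \<epsilon> by (auto simp: u_def)
  define B where "B = ball u (r / 4)"
  have BS: "B \<subseteq> S"
  proof
    fix x assume "x \<in> B"
    then have "dist z x \<le> r / 2" using u dist_triangle[of z x u] rL by (auto simp: B_def dist_commute)
    then show "x \<in> S" using z by auto
  qed
  have bB: "bilip L B \<beta>"
  proof (rule uniform_immersion_bilip[OF im BS])
    fix x y assume "x \<in> B" "y \<in> B"
    then show "dist x y < r" using dist_triangle3[of x y u] rL unfolding B_def by auto
  qed
  define b where "b = inv_into B \<beta>"
  have b: "b (\<beta> x) = x" if "x \<in> B" for x
    using that bilip_inj[OF bB] by (simp add: b_def)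
  have oB: "open (\<beta> ` B)"
    using invariance_of_domain[OF bilip_continuous[OF bB] _ bilip_inj[OF bB]] by (simp add: B_def)
  have uB: "u \<in> B" using rL by (simp add: B_def)
  have l\<beta>: "locP (bix L) z \<beta>" using locP_immersion[OF im _ S] subsetD[OF z, of z] rL by simp
  have lb: "locP (bix L) (f (\<beta> z)) b"
    using locP_bilip[OF bilip_inverse[OF bB b] oB] u uB by (metis imageI)
  have comp: "locP (cmp (cmp (bix L) i) (bix L)) z (\<lambda>x. b (f (\<beta> x)))"
    using locP_comp[OF locP_comp[OF l\<beta> loc] lb] .
  have lf: "locP (cmp (bix L) i) z (\<lambda>x. f (\<beta> x))" using locP_comp[OF l\<beta> loc] .
  then obtain V where V: "open V" "z \<in> V" "P (cmp (bix L) i) V (\<lambda>x. f (\<beta> x))" unfolding locP_def by blast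
  define U where "U = (V \<inter> (\<lambda>x. f (\<beta> x)) -` (\<beta> ` B)) \<inter> ball z (r / 8)"
  have "open U" unfolding U_def
    using continuous_open_preimage[OF P_cont[OF V(3)] V(1) oB] open_ball by (rule open_Int)
  moreover have "z \<in> U"
    using V imageI[OF uB, of \<beta>] u(3) rL by (auto simp: U_def)
  moreover have "b (f (\<beta> x)) = lift r S \<beta> f x" if "x \<in> U" for x
  proof -
    have "f (\<beta> x) \<in> \<beta> ` B" using that by (simp add: U_def)
    then obtain w where w: "w \<in> B" "\<beta> w = f (\<beta> x)" by (metis imageE)
    \<comment> \<open>The point \<open>w\<close> is within r/4 of \<open>u\<close>, and both
      \<open>u\<close> and \<open>x\<close> are within r/8 of \<open>z\<close>.\<close>
    have "dist w x < r / 2"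
      using w(1) that u(2) dist_triangle[of w x u] dist_triangle[of u x z] unfolding U_def B_def
      by (auto simp: dist_commute)
    then have "lift r S \<beta> f x = w" using lift_unique[where f = f, OF im _ _ w(2)] w(1) BS by blast
    then show ?thesis using b[OF w(1)] w(2) by simp
  qed
  ultimately show ?thesis using locP_cong[OF comp] by blast
qed

end

section \<open>Interpolation between lifts through different immersions\<close>

definition clamp01 :: "real \<Rightarrow> real" where "clamp01 x = max 0 (min 1 x)"

lemma clamp01_simps [simp]: "x \<le> 0 \<Longrightarrow> clamp01 x = 0" "x \<ge> 1 \<Longrightarrow> clamp01 x = 1"
  by (auto simp: clamp01_def)

lemma clamp01_bounds: "0 \<le> clamp01 x" "clamp01 x \<le> 1"
  by (auto simp: clamp01_def)

lemma clamp01_diff: "x \<le> y \<Longrightarrow> 0 \<le> clamp01 y - clamp01 x \<and> clamp01 y - clamp01 x \<le> y - x"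
  by (auto simp: clamp01_def)

lemma clamp01_lipschitz: "\<bar>clamp01 x - clamp01 y\<bar> \<le> \<bar>x - y\<bar>"
  using clamp01_diff[of x y] clamp01_diff[of y x] by linarith

definition push :: "'a::euclidean_space \<Rightarrow> (real \<Rightarrow> real) \<Rightarrow> 'a \<Rightarrow> 'a"
  where "push e h z = z + h (z \<bullet> e) *\<^sub>R e"

text \<open>Only the component along \<open>e\<close> changes, by an increasing function with slopes
  between 1/M and M; the orthogonal component is kept, and M \<ge> 1 covers it.\<close>

lemma bilip_push:
  fixes e :: "'a::euclidean_space"
  assumes e: "norm e = 1" and M: "M \<ge> 1"
    and h: "\<And>u v. u \<le> v \<Longrightarrow> v - u \<le> M * ((v + h v) - (u + h u)) \<and> (v + h v) - (u + h u) \<le> M * (v - u)"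
  shows "bilip M UNIV (push e h)"
  unfolding bilip_def
proof (intro conjI ballI)
  fix x y :: 'a
  define p where "p = (x - y) - ((x - y) \<bullet> e) *\<^sub>R e"
  define a where "a = (x - y) \<bullet> e"
  define b where "b = (x \<bullet> e + h (x \<bullet> e)) - (y \<bullet> e + h (y \<bullet> e))"
  have ee: "e \<bullet> e = 1" using e by (simp add: norm_eq_1)
  have pe: "p \<bullet> e = 0" by (simp add: p_def inner_diff_left ee)
  have n: "(norm (p + c *\<^sub>R e))\<^sup>2 = (norm p)\<^sup>2 + c\<^sup>2" for c
    using pe ee unfolding power2_norm_eq_inner
    by (simp add: inner_add_left inner_add_right inner_commute power2_eq_square)
  have 1: "x - y = p + a *\<^sub>R e" by (simp add: p_def a_def)
  have 2: "push e h x - push e h y = p + b *\<^sub>R e"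
    by (simp add: p_def b_def push_def algebra_simps inner_diff_left)
  have ab: "\<bar>a\<bar> \<le> M * \<bar>b\<bar>" "\<bar>b\<bar> \<le> M * \<bar>a\<bar>"
  proof -
    have "\<bar>a\<bar> \<le> M * \<bar>b\<bar> \<and> \<bar>b\<bar> \<le> M * \<bar>a\<bar>"
    proof (cases "x \<bullet> e \<le> y \<bullet> e")
      case True
      then have "b \<le> 0" "a \<le> 0" using h[OF True] M unfolding a_def b_def
        by (auto simp: inner_diff_left) (smt (verit, best) mult_le_0_iff mult_less_0_iff)
      then show ?thesis using h[OF True] by (auto simp: a_def b_def inner_diff_left algebra_simps)
    next
      case False
      then have F: "y \<bullet> e \<le> x \<bullet> e" by simp
      then have "b \<ge> 0" "a \<ge> 0" using h[OF F] M unfolding a_def b_def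
        by (auto simp: inner_diff_left) (smt (verit, best) mult_le_0_iff mult_less_0_iff)
      then show ?thesis using h[OF F] by (auto simp: a_def b_def inner_diff_left algebra_simps)
    qed
    then show "\<bar>a\<bar> \<le> M * \<bar>b\<bar>" "\<bar>b\<bar> \<le> M * \<bar>a\<bar>" by auto
  qed
  have key: "norm (p + c *\<^sub>R e) \<le> M * norm (p + d *\<^sub>R e)" if "\<bar>c\<bar> \<le> M * \<bar>d\<bar>" for c d
  proof (rule power2_le_imp_le)
    have "c\<^sup>2 \<le> (M * d)\<^sup>2" using that M by (simp add: abs_le_square_iff[symmetric] abs_mult)
    moreover have "(norm p)\<^sup>2 \<le> M\<^sup>2 * (norm p)\<^sup>2" using M by (simp add: mult_le_cancel_right1)
    ultimately show "(norm (p + c *\<^sub>R e))\<^sup>2 \<le> (M * norm (p + d *\<^sub>R e))\<^sup>2"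
      unfolding n power_mult_distrib by (simp add: algebra_simps)
  qed (use M in auto)
  show "dist x y \<le> M * dist (push e h x) (push e h y)" "dist (push e h x) (push e h y) \<le> M * dist x y"
    unfolding dist_norm 1 2 using key ab by auto
qed (use M in auto)

text \<open>Half-width 10 leaves room for the height changes made when lifts are linked, which stay
  below 9, and for the radius of a lift. The condition \<open>double\<close> scales the height along
  with all other coordinates.\<close>

locale immersion_family =
  fixes A :: "real \<Rightarrow> 'a::euclidean_space \<Rightarrow> 'a" and e :: 'a and r L R :: real
  assumes e: "norm e = 1" and r: "0 < r" "r \<le> 1" and L: "1 \<le> L"
    and imm: "s \<in> {0..1} \<Longrightarrow> uniform_immersion r L {z. \<bar>z \<bullet> e\<bar> < 10} (A s)"
    and lips: "s \<in> {0..1} \<Longrightarrow> s' \<in> {0..1} \<Longrightarrow> \<bar>z \<bullet> e\<bar> < 10 \<Longrightarrow> dist (A s z) (A s' z) \<le> L * \<bar>s - s'\<bar>"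
    and double: "A 1 z = A 0 (2 *\<^sub>R z)"
    and bound: "s \<in> {0..1} \<Longrightarrow> \<bar>z \<bullet> e\<bar> < 10 \<Longrightarrow> norm (A s z) \<le> R"
begin

lemma ee [simp]: "e \<bullet> e = 1"
  using e by (simp add: norm_eq_1)

text \<open>The height function has slope 1 outside an interval of length \<open>d\<close> and slope
  1 + c/d inside; the two conditions on \<open>M\<close> bound this slope and its inverse.\<close>

lemma bilip_push_clamp:
  assumes "M \<ge> 1" "d > 0" "1 \<le> M * (1 + min 0 (c / d))" "1 + max 0 (c / d) \<le> M"
  shows "bilip M UNIV (push e (\<lambda>t. c * clamp01 ((t - a) / d)))"
proof (rule bilip_push[OF e assms(1)])
  fix u v :: real assume uv: "u \<le> v"
  define k where "k = clamp01 ((v - a) / d) - clamp01 ((u - a) / d)"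
  have "(v - a) / d - (u - a) / d = (v - u) / d" by (simp add: diff_divide_distrib)
  then have k: "0 \<le> k" "k \<le> (v - u) / d"
    using clamp01_diff[of "(u - a) / d" "(v - a) / d"] uv assms(2) unfolding k_def
    by (auto simp: divide_right_mono)
  have "c * k \<le> max 0 (c / d) * (v - u)"
  proof (cases "c \<ge> 0")
    case True
    then have "c * k \<le> c * ((v - u) / d)" using k by (intro mult_left_mono) auto
    then show ?thesis using True assms(2) by simp
  next
    case False
    then have "c / d < 0" using assms(2) by (simp add: divide_less_0_iff)
    then show ?thesis using False k by (simp add: max_def mult_le_0_iff)
  qed
  moreover have "c * k \<ge> min 0 (c / d) * (v - u)"
  proof (cases "c \<ge> 0")
    case True
    then show ?thesis using k assms(2) by (simp add: min_def zero_le_divide_iff)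
  next
    case False
    then have "c * k \<ge> c * ((v - u) / d)" using k by (intro mult_left_mono_neg) auto
    moreover have "c / d < 0" using False assms(2) by (simp add: divide_less_0_iff)
    ultimately show ?thesis by (simp add: min_def)
  qed
  moreover have "(v + c * clamp01 ((v - a) / d)) - (u + c * clamp01 ((u - a) / d)) = (v - u) + c * k"
    by (simp add: k_def algebra_simps)
  moreover have "(v - u) * 1 \<le> (v - u) * (M * (1 + min 0 (c / d)))"
    using assms(3) uv by (intro mult_left_mono) auto
  moreover have "(v - u) * (1 + max 0 (c / d)) \<le> (v - u) * M"
    using assms(4) uv by (intro mult_left_mono) auto
  moreover have "M * ((v - u) + min 0 (c / d) * (v - u)) \<le> M * ((v - u) + c * k)"
    using assms(1) calculation(2) by (intro mult_left_mono) auto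
  ultimately show "v - u \<le> M * (v + c * clamp01 ((v - a) / d) - (u + c * clamp01 ((u - a) / d))) \<and>
    v + c * clamp01 ((v - a) / d) - (u + c * clamp01 ((u - a) / d)) \<le> M * (v - u)"
    by (simp add: algebra_simps)
qed

definition slab :: "'a set" where "slab = {z. \<bar>z \<bullet> e\<bar> < 10}"

lemma open_slab: "open slab"
proof -
  have "slab = {z. e \<bullet> z < 10} \<inter> {z. e \<bullet> z > -10}"
    by (auto simp: slab_def inner_commute)
  then show ?thesis using open_halfspace_lt[of e 10] open_halfspace_gt[of "-10" e] by auto
qed

lemma abs_inner_e_le: "\<bar>x \<bullet> e - y \<bullet> e\<bar> \<le> dist x y"
  using Cauchy_Schwarz_ineq2[of "x - y" e] e by (simp add: dist_norm inner_diff_left)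

lemma cball_slab: "\<bar>z \<bullet> e\<bar> \<le> 9 \<Longrightarrow> d < 1 \<Longrightarrow> cball z d \<subseteq> slab"
proof
  fix w assume "\<bar>z \<bullet> e\<bar> \<le> 9" "d < 1" "w \<in> cball z d"
  then show "w \<in> slab" using abs_inner_e_le[of z w] unfolding slab_def by auto
qed

text \<open>The parameter runs from \<open>s0\<close> to \<open>s1\<close> while the height runs
  from 1 to 2, so below and above these heights one sees \<open>A s0\<close> and
  \<open>A s1\<close>.\<close>

definition slow :: "real \<Rightarrow> real \<Rightarrow> 'a \<Rightarrow> 'a"
  where "slow s0 s1 z = A (s0 + (s1 - s0) * clamp01 (z \<bullet> e - 1)) z"

text \<open>Changing the parameter between \<open>z\<close> and \<open>w\<close> moves the image by
  at most dist z w / (2L), half of the separation that a fixed immersion guarantees. This is the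
  origin of the bound 1/(2L^2), and of the constant 2L in the conclusion.\<close>

lemma slow_immersion:
  assumes s: "s0 \<in> {0..1}" "s1 \<in> {0..1}" and d: "\<bar>s1 - s0\<bar> \<le> 1 / (2 * L\<^sup>2)"
  shows "uniform_immersion r (2 * L) slab (slow s0 s1)"
  unfolding uniform_immersion_def
proof (intro conjI ballI impI)
  fix z w assume z: "z \<in> slab" and w: "w \<in> slab" and zw: "dist z w < r"
  define p where "p x = s0 + (s1 - s0) * clamp01 (x \<bullet> e - 1)" for x
  have p01: "p x \<in> {0..1}" for x
  proof -
    define c where "c = clamp01 (x \<bullet> e - 1)"
    have c: "0 \<le> c" "c \<le> 1" using clamp01_bounds by (auto simp: c_def)
    have "p x = (1 - c) * s0 + c * s1" by (simp add: p_def c_def algebra_simps)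
    moreover have "0 \<le> (1 - c) * s0 + c * s1" using s c by simp
    moreover have "(1 - c) * s0 + c * s1 \<le> (1 - c) * 1 + c * 1"
      using s c by (intro add_mono mult_left_mono) auto
    ultimately show ?thesis by simp
  qed
  have "\<bar>p z - p w\<bar> = \<bar>s1 - s0\<bar> * \<bar>clamp01 (z \<bullet> e - 1) - clamp01 (w \<bullet> e - 1)\<bar>"
    by (simp add: p_def abs_mult[symmetric] algebra_simps)
  also have "\<dots> \<le> 1 / (2 * L\<^sup>2) * dist z w"
    using clamp01_lipschitz[of "z \<bullet> e - 1" "w \<bullet> e - 1"] abs_inner_e_le[of z w] d
    by (intro mult_mono) auto
  finally have "L * \<bar>p z - p w\<bar> \<le> L * (1 / (2 * L\<^sup>2) * dist z w)"
    using L by (intro mult_left_mono) auto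
  then have pp: "L * \<bar>p z - p w\<bar> \<le> dist z w / (2 * L)"
    using L by (simp add: power2_eq_square)
  have q: "dist (A (p z) w) (A (p w) w) \<le> dist z w / (2 * L)"
    using lips[OF p01 p01, of w z w] w pp by (auto simp: slab_def)
  have b: "dist z w \<le> L * dist (A (p z) z) (A (p z) w)" "dist (A (p z) z) (A (p z) w) \<le> L * dist z w"
    using imm[OF p01, of z] z w zw unfolding uniform_immersion_def slab_def by blast+
  have sl: "slow s0 s1 z = A (p z) z" "slow s0 s1 w = A (p w) w" by (auto simp: slow_def p_def)
  have LL: "dist z w / (2 * L) \<le> L * dist z w"
  proof -
    have "1 \<le> L * L" using L by (simp add: mult_ge1_I)
    then have "dist z w * 1 \<le> dist z w * (2 * L * L)" by (intro mult_left_mono) auto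
    then show ?thesis using L by (simp add: field_simps)
  qed
  show "dist (slow s0 s1 z) (slow s0 s1 w) \<le> 2 * L * dist z w"
    unfolding sl using dist_triangle[of "A (p z) z" "A (p w) w" "A (p z) w"] b(2) q LL by simp
  have "L * dist (A (p z) z) (A (p z) w) \<le> L * (dist (A (p z) z) (A (p w) w) + dist z w / (2 * L))"
    using dist_triangle2[of "A (p z) z" "A (p z) w" "A (p w) w"] q L by (intro mult_left_mono) (auto simp: dist_commute)
  also have "\<dots> = L * dist (A (p z) z) (A (p w) w) + dist z w / 2"
    using L by (simp add: field_simps)
  finally show "dist z w \<le> 2 * L * dist (slow s0 s1 z) (slow s0 s1 w)"
    unfolding sl using b(1) by simp
qed (use r L in auto)

lemma imm2: "s \<in> {0..1} \<Longrightarrow> uniform_immersion r (2 * L) slab (A s)"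
proof -
  assume s: "s \<in> {0..1}"
  have "slow s s = A s" by (auto simp: slow_def)
  then show ?thesis using slow_immersion[OF s s] L by simp
qed

lemma slow_bound:
  assumes s: "s0 \<in> {0..1}" "s1 \<in> {0..1}" and "z \<in> slab"
  shows "norm (slow s0 s1 z) \<le> R"
proof -
  define c where "c = clamp01 (z \<bullet> e - 1)"
  have c: "0 \<le> c" "c \<le> 1" using clamp01_bounds by (auto simp: c_def)
  have "s0 + (s1 - s0) * c = (1 - c) * s0 + c * s1" by (simp add: algebra_simps)
  moreover have "0 \<le> (1 - c) * s0 + c * s1" using s c by simp
  moreover have "(1 - c) * s0 + c * s1 \<le> (1 - c) * 1 + c * 1"
    using s c by (intro add_mono mult_left_mono) auto
  ultimately show ?thesis using bound[of "s0 + (s1 - s0) * c" z] assms(3) by (auto simp: slow_def c_def slab_def)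
qed

end

text \<open>The ball of radius \<open>R\<close> contains all images of the slab, so nothing is
  assumed about \<open>f\<close> elsewhere. The factor 160 makes every lift, which moves points by
  at most 2L\<epsilon>, move them by less than 1/80; the height estimates absorb this
  margin.\<close>

locale near_identity = regularity_class P + immersion_family A e r L R
  for P :: "'i \<Rightarrow> 'a::euclidean_space set \<Rightarrow> ('a \<Rightarrow> 'a) \<Rightarrow> bool"
    and A :: "real \<Rightarrow> 'a \<Rightarrow> 'a" and e :: 'a and r L R :: real +
  fixes f f' :: "'a \<Rightarrow> 'a" and i :: 'i and \<epsilon> :: real
  assumes f_loc: "norm w \<le> R \<Longrightarrow> locP i w f" and f'_loc: "norm w \<le> R \<Longrightarrow> locP i w f'"
    and f_near: "norm w \<le> R \<Longrightarrow> dist (f w) w \<le> \<epsilon>" and f'_near: "norm w \<le> R \<Longrightarrow> dist (f' w) w \<le> \<epsilon>"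
    and f'_f: "norm w \<le> R \<Longrightarrow> f' (f w) = w" and f_f': "norm w \<le> R \<Longrightarrow> f (f' w) = w"
    and \<epsilon>: "160 * L * \<epsilon> < r"
begin

definition F where "F s = lift r slab (A s) f"
definition F' where "F' s = lift r slab (A s) f'"
definition liftix where "liftix = cmp (cmp (bix (2 * L)) i) (bix (2 * L))"

lemma \<epsilon>': "2 * L * \<epsilon> < r / 8" "2 * L * \<epsilon> < 1 / 80"
  using \<epsilon> r by auto

lemma slow_lift:
  assumes s: "s0 \<in> {0..1}" "s1 \<in> {0..1}" and d: "\<bar>s1 - s0\<bar> \<le> 1 / (2 * L\<^sup>2)" and z: "\<bar>z \<bullet> e\<bar> < 9"
  defines "u \<equiv> lift r slab (slow s0 s1) f z"
  shows "u \<in> slab" "dist u z < r / 8" "dist u z < 1 / 80" "slow s0 s1 u = f (slow s0 s1 z)"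
    "\<bar>u \<bullet> e - z \<bullet> e\<bar> < 1 / 80" "locP liftix z (lift r slab (slow s0 s1) f)"
proof -
  have zs: "cball z (r / 2) \<subseteq> slab" using cball_slab[of z "r / 2"] r z by auto
  then have zs': "cball z (r / 4) \<subseteq> slab" using r subset_cball[of "r / 4" "r / 2" z] by auto
  have "z \<in> slab" using z by (auto simp: slab_def)
  then have n: "norm (slow s0 s1 z) \<le> R" using slow_bound s by blast
  have p: "u \<in> slab" "dist u z \<le> 2 * L * \<epsilon>" "slow s0 s1 u = f (slow s0 s1 z)"
    using lift_props[where f = f, OF slow_immersion[OF s d] zs' f_near[OF n] \<epsilon>'(1)] by (auto simp: u_def)
  then show "u \<in> slab" "dist u z < r / 8" "dist u z < 1 / 80" "slow s0 s1 u = f (slow s0 s1 z)"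
    using \<epsilon>' by auto
  then show "\<bar>u \<bullet> e - z \<bullet> e\<bar> < 1 / 80" using abs_inner_e_le[of u z] by simp
  show "locP liftix z (lift r slab (slow s0 s1) f)"
    unfolding liftix_def by (rule locP_lift[OF slow_immersion[OF s d] open_slab zs f_near[OF n] \<epsilon>'(1) f_loc[OF n]])
qed

lemma slow_same: "slow s s = A s"
  by (auto simp: slow_def)

lemma F_props:
  assumes s: "s \<in> {0..1}" and z: "\<bar>z \<bullet> e\<bar> < 9"
  shows "F s z \<in> slab" "dist (F s z) z < r / 8" "dist (F s z) z < 1 / 80" "A s (F s z) = f (A s z)"
    "\<bar>F s z \<bullet> e - z \<bullet> e\<bar> < 1 / 80" "locP liftix z (F s)"
  using slow_lift[OF s s _ z] L unfolding slow_same F_def by auto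

lemma near_identity_swap: "near_identity P A e r L R f' f i \<epsilon>"
  by unfold_locales (use f_loc f'_loc f_near f'_near f'_f f_f' \<epsilon> in auto)

lemma F'_props:
  assumes s: "s \<in> {0..1}" and z: "\<bar>z \<bullet> e\<bar> < 9"
  shows "F' s z \<in> slab" "dist (F' s z) z < r / 8" "dist (F' s z) z < 1 / 80" "A s (F' s z) = f' (A s z)"
    "\<bar>F' s z \<bullet> e - z \<bullet> e\<bar> < 1 / 80" "locP liftix z (F' s)"
  using near_identity.F_props[OF near_identity_swap s z]
  unfolding near_identity.F_def[OF near_identity_swap] near_identity.liftix_def[OF near_identity_swap] F'_def liftix_def
  by auto

lemma F_unique:
  assumes "s \<in> {0..1}" "u \<in> slab" "dist u z < r / 2" "A s u = f (A s z)"
  shows "F s z = u"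
  unfolding F_def by (rule lift_unique[OF imm2]) (use assms in auto)

lemma F'_unique:
  assumes "s \<in> {0..1}" "u \<in> slab" "dist u z < r / 2" "A s u = f' (A s z)"
  shows "F' s z = u"
  unfolding F'_def by (rule lift_unique[OF imm2]) (use assms in auto)

lemma F_F':
  assumes s: "s \<in> {0..1}" and z: "\<bar>z \<bullet> e\<bar> < 9"
  shows "F s (F' s z) = z"
proof (rule F_unique[OF s])
  show zs: "z \<in> slab" using z by (auto simp: slab_def)
  show "dist z (F' s z) < r / 2" using F'_props(2)[OF s z] r by (simp add: dist_commute)
  show "A s z = f (A s (F' s z))"
    using F'_props(4)[OF s z] f_f' bound[OF s, of z] zs by (simp add: slab_def)
qed

text \<open>From the inside: the push \<open>S\<close>, the slow lift, the push \<open>C\<close>, a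
  translation, \<open>F' s1\<close>, a translation, the push \<open>Q\<close>, a translation,
  \<open>F s1\<close>, a translation.\<close>

definition linkix where
  "linkix = cmp (cmp (cmp (cmp (cmp (cmp (cmp (cmp (cmp (bix 3) liftix) (bix 3)) (bix 1)) liftix) (bix 1)) (bix 17)) (bix 1)) liftix) (bix 1)"

lemma locP_translate: "locP (bix 1) z (\<lambda>x. x + v)"
  by (rule locP_bilip[of _ UNIV]) (auto simp: bilip_def)

text \<open>
  Up to a translation \<open>g\<close> is the composition of \<open>S\<close>, a slow lift \<open>G\<close> of \<open>f\<close>, \<open>C\<close>, \<open>F' s1\<close>, \<open>Q\<close> and \<open>F s1\<close>,
  where \<open>S\<close>, \<open>C\<close> and \<open>Q\<close> only change the height. Low down these three are trivial and \<open>g\<close> is \<open>F s0\<close>.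
  High up \<open>C\<close> carries \<open>G\<close> to \<open>F s1\<close>, which is cancelled by \<open>F' s1\<close>, and then \<open>Q\<close> undoes \<open>C\<close> and \<open>S\<close>.
\<close>

lemma link:
  assumes s: "s0 \<in> {0..1}" "s1 \<in> {0..1}" and d: "\<bar>s1 - s0\<bar> \<le> 1 / (2 * L\<^sup>2)"
  shows "\<exists>g. (\<forall>z. - 1 < z \<bullet> e \<and> z \<bullet> e < 7/2 \<longrightarrow> locP linkix z g \<and> dist (g z) z < 12) \<and>
    (\<forall>z. - 1 < z \<bullet> e \<and> z \<bullet> e < 2/5 \<longrightarrow> g z = F s0 z) \<and>
    (\<forall>z. 9/5 < z \<bullet> e \<and> z \<bullet> e < 7/2 \<longrightarrow> g z = 2 *\<^sub>R e + F s1 (z - 2 *\<^sub>R e))"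
proof -
  \<comment> \<open>\<open>S\<close> raises by 2 between the heights 1/2 and 7/4, \<open>C\<close>
    raises by 2 between 1 and 2, and \<open>Q\<close> lowers by 4 between 3/2 and 23/4; its slope 1
    - 16/17 explains the constant 17. A point below 2/5 stays below the start of each push. A point
    above 9/5 has passed the end of \<open>S\<close>, then that of \<open>C\<close>, and reaches
    \<open>Q\<close> above 29/5, past its end.\<close>
  define S where "S = push e (\<lambda>t. 2 * clamp01 ((t - 1/2) / (5/4)))"
  define C where "C = push e (\<lambda>t. 2 * clamp01 ((t - 1) / 1))"
  define Q where "Q = push e (\<lambda>t. (- 4) * clamp01 ((t - 3/2) / (17/4)))"
  have bS: "bilip 3 UNIV S" unfolding S_def by (rule bilip_push_clamp) auto
  have bC: "bilip 3 UNIV C" unfolding C_def by (rule bilip_push_clamp) auto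
  have bQ: "bilip 17 UNIV Q" unfolding Q_def by (rule bilip_push_clamp) (auto simp: min_def)
  define G where "G = lift r slab (slow s0 s1) f"
  define g where "g z = F s1 (Q (F' s1 (C (G (S z)) + - (2 *\<^sub>R e)) + 2 *\<^sub>R e) + - (2 *\<^sub>R e)) + 2 *\<^sub>R e" for z
  note Gp = slow_lift[OF s d, folded G_def]
  have Se: "S z \<bullet> e = z \<bullet> e + 2 * clamp01 ((z \<bullet> e - 1/2) / (5/4))" "dist (S z) z \<le> 2" for z
    using clamp01_bounds[of "(z \<bullet> e - 1/2) / (5/4)"] e
    unfolding S_def push_def by (auto simp: inner_add_left dist_norm)
  have Ce: "C z \<bullet> e = z \<bullet> e + 2 * clamp01 (z \<bullet> e - 1)" "dist (C z) z \<le> 2" for z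
    using clamp01_bounds[of "z \<bullet> e - 1"] e
    unfolding C_def push_def by (auto simp: inner_add_left dist_norm)
  have Qe: "Q z \<bullet> e = z \<bullet> e - 4 * clamp01 ((z \<bullet> e - 3/2) / (17/4))" "dist (Q z) z \<le> 4" for z
    using clamp01_bounds[of "(z \<bullet> e - 3/2) / (17/4)"] e
    unfolding Q_def push_def by (auto simp: inner_add_left inner_diff_left dist_norm)
  have Qmono: "Q z \<bullet> e \<le> 7/2 + 1/10" if "z \<bullet> e < 15/2 + 1/10" for z
    using that unfolding Qe clamp01_def max_def min_def by (auto simp: field_simps split: if_splits)
  {
    fix z assume z: "- 1 < z \<bullet> e" "z \<bullet> e < 7/2"
    have y: "- 1 < S z \<bullet> e" "S z \<bullet> e < 11/2"
      using z clamp01_bounds[of "(z \<bullet> e - 1/2) / (5/4)"] unfolding Se by auto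
    then have y9: "\<bar>S z \<bullet> e\<bar> < 9" by auto
    have y0: "- 1 - 1/80 < G (S z) \<bullet> e" "G (S z) \<bullet> e < 11/2 + 1/80"
      using Gp(5)[OF y9] y by linarith+
    have c: "- 1 - 1/80 < C (G (S z)) \<bullet> e" "C (G (S z)) \<bullet> e < 15/2 + 1/80"
      using y0 clamp01_bounds[of "G (S z) \<bullet> e - 1"] unfolding Ce by linarith+
    then have c9: "\<bar>(C (G (S z)) + - (2 *\<^sub>R e)) \<bullet> e\<bar> < 9" by (simp add: inner_diff_left)
    define x where "x = F' s1 (C (G (S z)) + - (2 *\<^sub>R e))"
    have x: "- 3 - 1/40 < x \<bullet> e" "x \<bullet> e < 11/2 + 1/40"
      using F'_props(5)[OF s(2) c9] c unfolding x_def[symmetric] inner_add_left inner_minus_left inner_scaleR_left ee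
      by linarith+
    have q: "- 5 - 1/40 < Q (x + 2 *\<^sub>R e) \<bullet> e" "Q (x + 2 *\<^sub>R e) \<bullet> e \<le> 7/2 + 1/10"
      using Qmono[of "x + 2 *\<^sub>R e"] x clamp01_bounds[of "((x + 2 *\<^sub>R e) \<bullet> e - 3/2) / (17/4)"]
      unfolding Qe by (auto simp: inner_add_left)
    then have q9: "\<bar>(Q (x + 2 *\<^sub>R e) + - (2 *\<^sub>R e)) \<bullet> e\<bar> < 9" by (simp add: inner_diff_left)
    have S': "locP (bix 3) z S" using locP_bilip[OF bS] by simp
    have C': "locP (bix 3) w C" for w using locP_bilip[OF bC] by simp
    have Q': "locP (bix 17) w Q" for w using locP_bilip[OF bQ] by simp
    have "locP linkix z g"
      unfolding linkix_def g_def
      apply (rule locP_comp[OF _ locP_translate])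
      apply (rule locP_comp[where g = "F s1"])
       apply (rule locP_comp[OF _ locP_translate])
       apply (rule locP_comp[OF _ Q'])
       apply (rule locP_comp[OF _ locP_translate])
       apply (rule locP_comp[where g = "F' s1"])
        apply (rule locP_comp[OF _ locP_translate])
        apply (rule locP_comp[OF _ C'])
        apply (rule locP_comp[OF S'])
        apply (rule Gp(6)[OF y9])
       apply (rule F'_props(6)[OF s(2) c9])
      using F_props(6)[OF s(2) q9] unfolding x_def .
    moreover have "dist (g z) z < 12"
    proof -
      have "g z = F s1 (Q (x + 2 *\<^sub>R e) + - (2 *\<^sub>R e)) + 2 *\<^sub>R e" by (simp add: g_def x_def)
      then have 1: "dist (g z) (Q (x + 2 *\<^sub>R e)) < 1/80"
        using F_props(3)[OF s(2) q9] by (simp add: dist_norm algebra_simps)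
      have 2: "dist (Q (x + 2 *\<^sub>R e)) (x + 2 *\<^sub>R e) \<le> 4" using Qe by blast
      have 3: "dist (x + 2 *\<^sub>R e) (C (G (S z))) < 1/80"
        using F'_props(3)[OF s(2) c9] by (simp add: dist_norm algebra_simps x_def)
      have 4: "dist (C (G (S z))) (G (S z)) \<le> 2" using Ce by blast
      have 5: "dist (G (S z)) (S z) < 1/80" using Gp(3)[OF y9] .
      have 6: "dist (S z) z \<le> 2" using Se by blast
      show ?thesis
        using 1 2 3 4 5 6 dist_triangle[of "g z" z "Q (x + 2 *\<^sub>R e)"] dist_triangle[of "Q (x + 2 *\<^sub>R e)" z "x + 2 *\<^sub>R e"]
          dist_triangle[of "x + 2 *\<^sub>R e" z "C (G (S z))"] dist_triangle[of "C (G (S z))" z "G (S z)"]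
          dist_triangle[of "G (S z)" z "S z"] by linarith
    qed
    ultimately have "locP linkix z g \<and> dist (g z) z < 12" by blast
  }
  moreover
  {
    fix z assume z: "- 1 < z \<bullet> e" "z \<bullet> e < 2/5"
    have z9: "\<bar>z \<bullet> e\<bar> < 9" using z by auto
    have Sz: "S z = z" using z unfolding S_def push_def by simp
    have y0: "- 1 - 1/80 < G z \<bullet> e" "G z \<bullet> e < 2/5 + 1/80" using Gp(5)[OF z9] z by linarith+
    have Cz: "C (G z) = G z" using y0 unfolding C_def push_def by simp
    have c9: "\<bar>(G z + - (2 *\<^sub>R e)) \<bullet> e\<bar> < 9" using y0 by (simp add: inner_diff_left)
    define x where "x = F' s1 (G z + - (2 *\<^sub>R e))"
    have "x \<bullet> e < 2/5 + 1/40 - 2" using F'_props(5)[OF s(2) c9] y0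
      unfolding x_def[symmetric] inner_add_left inner_minus_left inner_scaleR_left ee by linarith
    then have Qx: "Q (x + 2 *\<^sub>R e) = x + 2 *\<^sub>R e" unfolding Q_def push_def by (simp add: inner_add_left)
    have "g z = G z"
      using F_F'[OF s(2) c9] unfolding g_def Sz Cz x_def[symmetric] Qx by simp
    also have "G z = F s0 z"
    proof (rule F_unique[OF s(1), symmetric])
      show "G z \<in> slab" "dist (G z) z < r / 2" using Gp(1,2)[OF z9] r by auto
      show "A s0 (G z) = f (A s0 z)" using Gp(4)[OF z9] z y0 unfolding slow_def by simp
    qed
    finally have "g z = F s0 z" .
  }
  moreover
  {
    fix z assume z: "9/5 < z \<bullet> e" "z \<bullet> e < 7/2"
    have Sz: "S z = z + 2 *\<^sub>R e" using z unfolding S_def push_def by simp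
    define y where "y = z + 2 *\<^sub>R e"
    have y: "19/5 < y \<bullet> e" "y \<bullet> e < 11/2" using z by (auto simp: y_def inner_add_left)
    then have y9: "\<bar>y \<bullet> e\<bar> < 9" by auto
    have y0: "19/5 - 1/80 < G y \<bullet> e" "G y \<bullet> e < 11/2 + 1/80" using Gp(5)[OF y9] y by linarith+
    have Cy: "C (G y) = G y + 2 *\<^sub>R e" using y0 unfolding C_def push_def by simp
    \<comment> \<open>At heights above 2 the slow lift is a lift through \<open>A s1\<close>, so the
      lift of the inverse map undoes it.\<close>
    have "F' s1 (G y) = y"
    proof (rule F'_unique[OF s(2)])
      show ys: "y \<in> slab" using y9 by (auto simp: slab_def)
      show "dist y (G y) < r / 2" using Gp(2)[OF y9] r by (simp add: dist_commute)
      have "A s1 (G y) = f (A s1 y)" using Gp(4)[OF y9] y y0 unfolding slow_def by simp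
      then show "A s1 y = f' (A s1 (G y))" using f'_f bound[OF s(2), of y] ys by (simp add: slab_def)
    qed
    then have "g z = F s1 (Q (y + 2 *\<^sub>R e) + - (2 *\<^sub>R e)) + 2 *\<^sub>R e"
      unfolding g_def Sz y_def[symmetric] Cy by simp
    moreover have "Q (y + 2 *\<^sub>R e) = z"
      using z unfolding Q_def push_def y_def by (simp add: inner_add_left algebra_simps flip: scaleR_add_left)
    ultimately have "g z = 2 *\<^sub>R e + F s1 (z - 2 *\<^sub>R e)" by simp
  }
  ultimately show ?thesis by (intro exI[of _ g]) blast
qed

end

section \<open>Self-similar homeomorphisms of a half space\<close>

text \<open>By properness the fibre over \<open>y\<close> is compact, and by local injectivity it is
  finite. Choose disjoint sheets around its points. What remains of the preimage of a small closed
  ball is compact and its image misses \<open>y\<close>; a neighbourhood of \<open>y\<close>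
  avoiding that image, inside all images of the sheets, is evenly covered.\<close>

lemma proper_local_homeomorphism_covering_space:
  fixes g :: "'a::euclidean_space \<Rightarrow> 'a"
  assumes X: "open X" and Y: "open Y" and cont: "continuous_on X g" and im: "g ` X = Y"
    and loc: "\<And>z. z \<in> X \<Longrightarrow> \<exists>V. open V \<and> z \<in> V \<and> inj_on g (V \<inter> X)"
    and proper: "\<And>C. compact C \<Longrightarrow> C \<subseteq> Y \<Longrightarrow> compact (X \<inter> g -` C)"
  shows "covering_space X g Y"
proof
  show "continuous_on X g" "g ` X = Y" by fact+
  fix y assume y: "y \<in> Y"
  define Fy where "Fy = X \<inter> g -` {y}"
  have cF: "compact Fy" unfolding Fy_def using proper[of "{y}"] y by auto
  have "\<forall>z. \<exists>V. z \<in> X \<longrightarrow> open V \<and> z \<in> V \<and> inj_on g (V \<inter> X)" using loc by blast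
  then obtain V where V: "\<And>z. z \<in> X \<Longrightarrow> open (V z) \<and> z \<in> V z \<and> inj_on g (V z \<inter> X)" by metis
  have "finite Fy"
  proof -
    have "Fy \<subseteq> (\<Union>z\<in>Fy. V z)" "\<And>z. z \<in> Fy \<Longrightarrow> open (V z)" using V unfolding Fy_def by blast+
    then obtain D where D: "D \<subseteq> Fy" "finite D" "Fy \<subseteq> (\<Union>z\<in>D. V z)"
      using compactE_image[OF cF, of Fy V] by metis
    have "Fy \<subseteq> D"
    proof
      fix x assume x: "x \<in> Fy"
      then obtain z where z: "z \<in> D" "x \<in> V z" using D by blast
      then have "x \<in> V z \<inter> X" "z \<in> V z \<inter> X" "g x = g z" using x D V unfolding Fy_def by auto
      then have "x = z" using V[of z] by (metis IntD2 inj_onD)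
      then show "x \<in> D" using z by simp
    qed
    then show ?thesis using D finite_subset by blast
  qed
  obtain d where d: "d > 0" "\<And>a b. a \<in> Fy \<Longrightarrow> b \<in> Fy \<Longrightarrow> a \<noteq> b \<Longrightarrow> d \<le> dist a b"
  proof (cases "\<exists>a\<in>Fy. \<exists>b\<in>Fy. a \<noteq> b")
    case True
    let ?D = "(\<lambda>(a, b). dist a b) ` ((Fy \<times> Fy) - Id)"
    have "finite ?D" "?D \<noteq> {}" using \<open>finite Fy\<close> True by auto
    then have "Min ?D > 0" "\<And>a b. a \<in> Fy \<Longrightarrow> b \<in> Fy \<Longrightarrow> a \<noteq> b \<Longrightarrow> Min ?D \<le> dist a b"
      by (auto simp: Min_gr_iff intro!: Min_le)
    then show thesis using that by blast
  next
    case False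
    then show thesis using that[of 1] by auto
  qed
  define W where "W z = V z \<inter> X \<inter> ball z (d / 2)" for z
  have W: "open (W z)" "z \<in> W z" "W z \<subseteq> X" "inj_on g (W z)" if "z \<in> Fy" for z
    using V[of z] that X d(1) unfolding W_def Fy_def by (auto intro: inj_on_subset)
  have Wd: "W a \<inter> W b = {}" if "a \<in> Fy" "b \<in> Fy" "a \<noteq> b" for a b
  proof (rule ccontr)
    assume "W a \<inter> W b \<noteq> {}"
    then obtain x where "dist a x < d / 2" "dist b x < d / 2" unfolding W_def by auto
    then have "dist a b < d" using dist_triangle2[of a b x] by linarith
    then show False using d(2)[OF that] by simp
  qed
  obtain \<delta>0 where \<delta>0: "\<delta>0 > 0" "cball y \<delta>0 \<subseteq> Y" using Y y open_contains_cball by blast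
  define D where "D = (X \<inter> g -` (cball y \<delta>0)) - (\<Union>z\<in>Fy. W z)"
  have "compact D" unfolding D_def
    using proper[OF compact_cball \<delta>0(2)] W(1) by (intro compact_diff) auto
  then have cD: "compact (g ` D)"
    by (intro compact_continuous_image continuous_on_subset[OF cont]) (auto simp: D_def)
  have "y \<notin> g ` D" using W(2) unfolding D_def Fy_def by auto
  then have "open (- (g ` D))" "y \<in> - (g ` D)" using compact_imp_closed[OF cD] by auto
  then obtain \<delta>1 where \<delta>1: "\<delta>1 > 0" "ball y \<delta>1 \<subseteq> - (g ` D)" using open_contains_ball by metis
  define T where "T = ball y (min \<delta>0 \<delta>1) \<inter> (\<Inter>z\<in>Fy. g ` W z)"
  have oW: "open (g ` U)" if "z \<in> Fy" "U \<subseteq> W z" "open U" for z U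
    using that W[of z] by (intro invariance_of_domain continuous_on_subset[OF cont] inj_on_subset[OF W(4)]) auto
  have oT: "open T" unfolding T_def using \<open>finite Fy\<close> oW W by (intro open_Int open_INT) auto
  have "y \<in> g ` W z" if "z \<in> Fy" for z
    using W(2)[OF that] that unfolding Fy_def by (metis IntD2 imageI vimage_singleton_eq)
  then have yT: "y \<in> T" unfolding T_def using \<delta>0 \<delta>1 by auto
  define v where "v = (\<lambda>z. W z \<inter> g -` T) ` Fy"
  have TY: "T \<subseteq> Y" unfolding T_def using \<delta>0(2) by auto
  have "\<Union>v = X \<inter> g -` T"
  proof
    show "\<Union>v \<subseteq> X \<inter> g -` T" using W(3) unfolding v_def by auto
    show "X \<inter> g -` T \<subseteq> \<Union>v"
    proof
      fix x assume x: "x \<in> X \<inter> g -` T"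
      then have gx: "dist y (g x) < \<delta>0" "dist y (g x) < \<delta>1" unfolding T_def by auto
      have "g x \<notin> g ` D" using gx(2) \<delta>1(2) by auto
      then have "x \<notin> D" by blast
      then have "x \<in> (\<Union>z\<in>Fy. W z)" unfolding D_def using x gx(1) by auto
      then show "x \<in> \<Union>v" using x unfolding v_def by auto
    qed
  qed
  moreover have "\<forall>u\<in>v. openin (top_of_set X) u"
  proof
    fix u assume "u \<in> v"
    then obtain z where z: "z \<in> Fy" "u = W z \<inter> g -` T" unfolding v_def by blast
    have "open u" unfolding z(2)
      using continuous_open_preimage[OF continuous_on_subset[OF cont W(3)[OF z(1)]] W(1)[OF z(1)] oT] .
    then show "openin (top_of_set X) u" using z W(3) X by (auto simp: openin_open_eq)
  qed
  moreover have "pairwise disjnt v"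
    using Wd unfolding v_def pairwise_def disjnt_def by blast
  moreover have "\<forall>u\<in>v. \<exists>q. homeomorphism u T g q"
  proof
    fix u assume "u \<in> v"
    then obtain z where z: "z \<in> Fy" "u = W z \<inter> g -` T" unfolding v_def by blast
    have ou: "open u" unfolding z(2)
      using continuous_open_preimage[OF continuous_on_subset[OF cont W(3)[OF z(1)]] W(1)[OF z(1)] oT] .
    have "T \<subseteq> g ` W z" using z(1) unfolding T_def by blast
    then have "g ` u = T" unfolding z(2) by blast
    moreover have "continuous_on u g" "inj_on g u"
      unfolding z(2) using W(3)[OF z(1)] W(4)[OF z(1)]
      by (blast intro: continuous_on_subset[OF cont] inj_on_subset)+
    ultimately show "\<exists>q. homeomorphism u T g q"
      using invariance_of_domain_homeomorphism[OF ou, of g] by (metis order_refl)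
  qed
  ultimately show "\<exists>T. y \<in> T \<and> openin (top_of_set Y) T \<and> (\<exists>v. \<Union> v = X \<inter> g -` T \<and>
      (\<forall>u\<in>v. openin (top_of_set X) u) \<and> pairwise disjnt v \<and> (\<forall>u\<in>v. \<exists>q. homeomorphism u T g q))"
    using yT oT TY Y by (intro exI[of _ T]) (auto simp: openin_open_eq)
qed

text \<open>As \<open>Y\<close> is simply connected, the covering has a section \<open>s\<close>.
  Both \<open>s \<circ> g\<close> and the identity are lifts of \<open>g\<close>, and they agree at
  \<open>s y\<close>; as \<open>X\<close> is connected they coincide.\<close>

lemma covering_space_convex_imp_inj:
  fixes g :: "'a::euclidean_space \<Rightarrow> 'a"
  assumes cov: "covering_space X g Y" and X: "convex X" and Y: "convex Y"
  shows "inj_on g X"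
proof (cases "Y = {}")
  case True
  then show ?thesis using covering_space_imp_surjective[OF cov] by simp
next
  case False
  obtain s where s: "continuous_on Y s" "s \<in> Y \<rightarrow> X" "\<And>y. y \<in> Y \<Longrightarrow> g (s y) = y"
    using covering_space_lift[OF cov convex_imp_simply_connected[OF Y] convex_imp_locally_path_connected[OF Y] continuous_on_id]
    by auto
  obtain y where y: "y \<in> Y" using False by blast
  have gX: "g ` X = Y" using covering_space_imp_surjective[OF cov] .
  have cg: "continuous_on X g" using covering_space_imp_continuous[OF cov] .
  have "s (g z) = z" if "z \<in> X" for z
  proof (rule covering_space_lift_unique[OF cov, where f = g and T = X and a = "s y"])
    show "s (g (s y)) = s y" using s(3)[OF y] by simp
    show "continuous_on X g" by fact
    show "g \<in> X \<rightarrow> Y" using gX by auto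
    show "continuous_on X (\<lambda>z. s (g z))" using continuous_on_compose2[OF s(1) cg] gX by simp
    show "(\<lambda>z. s (g z)) \<in> X \<rightarrow> X" using s(2) gX by auto
    show "connected X" using X convex_connected by blast
  qed (use s y that gX in auto)
  then show ?thesis by (metis inj_onI)
qed

text \<open>A displacement of at most a quarter of the height keeps \<open>g\<close> inside the half
  space and makes it proper. Hence its image is open and closed, and \<open>g\<close> is a covering
  of a convex set by a convex set.\<close>

lemma half_space_homeomorphism:
  fixes g :: "'a::euclidean_space \<Rightarrow> 'a"
  assumes e: "norm e = 1"
  defines "X \<equiv> {z. z \<bullet> e < 0}"
  assumes cont: "continuous_on X g"
    and loc: "\<And>z. z \<in> X \<Longrightarrow> \<exists>V. open V \<and> z \<in> V \<and> inj_on g (V \<inter> X)"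
    and disp: "\<And>z. z \<in> X \<Longrightarrow> dist (g z) z \<le> \<bar>z \<bullet> e\<bar> / 4"
  shows "bij_betw g X X"
proof -
  have X: "open X" "convex X" unfolding X_def
    using open_halfspace_lt[of e 0] convex_halfspace_lt[of e 0] by (auto simp: inner_commute)
  have lvl: "\<bar>g z \<bullet> e - z \<bullet> e\<bar> \<le> \<bar>z \<bullet> e\<bar> / 4" if "z \<in> X" for z
    using Cauchy_Schwarz_ineq2[of "g z - z" e] e disp[OF that] by (simp add: dist_norm inner_diff_left)
  have gX: "g z \<in> X" if "z \<in> X" for z
  proof -
    have "z \<bullet> e < 0" using that by (simp add: X_def)
    then have "g z \<bullet> e < 0" using lvl[OF that] by linarith
    then show ?thesis by (simp add: X_def)
  qed
  have proper: "compact (X \<inter> g -` C)" if C: "compact C" "C \<subseteq> X" for C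
  proof (cases "C = {}")
    case False
    obtain B where B: "\<And>w. w \<in> C \<Longrightarrow> norm w \<le> B" using compact_imp_bounded[OF C(1)] bounded_iff by blast
    obtain w0 where w0: "w0 \<in> C" "\<And>w. w \<in> C \<Longrightarrow> w \<bullet> e \<le> w0 \<bullet> e"
      using continuous_attains_sup[OF C(1) False, of "\<lambda>w. w \<bullet> e"]
        continuous_on_inner[OF continuous_on_id continuous_on_const] by blast
    define b where "b = w0 \<bullet> e / 2"
    have b: "b < 0" using w0(1) C(2) unfolding X_def b_def by auto
    \<comment> \<open>If \<open>g z\<close> lies in \<open>C\<close>, the distance of
      \<open>z\<close> from the boundary is at least 4/5 of that of \<open>g z\<close>, and norm z
      \<le> 4B/3. The bounds in \<open>K\<close> are weaker and simpler.\<close>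
    define K where "K = {z. z \<bullet> e \<le> b} \<inter> cball 0 (2 * B)"
    have sub: "X \<inter> g -` C \<subseteq> K"
    proof
      fix z assume z: "z \<in> X \<inter> g -` C"
      then have 1: "g z \<bullet> e \<le> 2 * b" using w0(2)[of "g z"] by (auto simp: b_def)
      then have "z \<bullet> e \<le> b" using lvl[of z] z b unfolding X_def by (auto simp: abs_if split: if_splits)
      moreover have "norm z \<le> 2 * B"
      proof -
        have "\<bar>z \<bullet> e\<bar> \<le> norm z" using Cauchy_Schwarz_ineq2[of z e] e by simp
        then have "norm (z - g z) \<le> norm z / 4" using disp[of z] z by (simp add: dist_norm norm_minus_commute)
        moreover have "norm z \<le> norm (g z) + norm (z - g z)" by (metis add.commute norm_triangle_sub)
        moreover have "norm (g z) \<le> B" using B z by auto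
        ultimately show ?thesis using norm_ge_zero[of "g z"] by linarith
      qed
      ultimately show "z \<in> K" by (simp add: K_def)
    qed
    have KX: "K \<subseteq> X" unfolding K_def X_def using b by auto
    have cK: "compact K"
    proof -
      have "closed {z. z \<bullet> e \<le> b}" using closed_halfspace_le[of e b] by (simp add: inner_commute)
      then show ?thesis unfolding K_def by (metis closed_Int_compact compact_cball)
    qed
    have "closed (K \<inter> g -` C)"
      using continuous_closed_preimage[OF continuous_on_subset[OF cont KX]] compact_imp_closed[OF cK] compact_imp_closed[OF C(1)] by blast
    moreover have "X \<inter> g -` C = K \<inter> (K \<inter> g -` C)" using sub KX by blast
    ultimately show ?thesis using cK compact_Int_closed by metis
  qed auto
  have "open (g ` X)"
  proof (subst open_subopen, clarify)
    fix z assume z: "z \<in> X"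
    obtain V where V: "open V" "z \<in> V" "inj_on g (V \<inter> X)" using loc[OF z] by blast
    have "open (g ` (V \<inter> X))" using V X by (intro invariance_of_domain continuous_on_subset[OF cont]) auto
    then show "\<exists>T. open T \<and> g z \<in> T \<and> T \<subseteq> g ` X" using V z by blast
  qed
  moreover have "closedin (top_of_set X) (g ` X)"
    unfolding closedin_limpt
  proof (intro conjI allI impI)
    show "g ` X \<subseteq> X" using gX by auto
    fix x assume x: "x islimpt g ` X \<and> x \<in> X"
    obtain d where d: "d > 0" "cball x d \<subseteq> X" using x X(1) open_contains_cball by blast
    have "compact (g ` (X \<inter> g -` cball x d))"
      using proper[OF compact_cball d(2)] by (intro compact_continuous_image continuous_on_subset[OF cont]) auto
    then have cl: "closed (g ` (X \<inter> g -` cball x d))" by (rule compact_imp_closed)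
    have "x islimpt (g ` X \<inter> ball x d)"
    proof (rule islimptI)
      fix U assume "x \<in> U" "open U"
      then obtain y where "y \<in> g ` X" "y \<in> U \<inter> ball x d" "y \<noteq> x"
        using islimptE[of x "g ` X" "U \<inter> ball x d"] x d(1) by (metis IntI centre_in_ball open_Int open_ball)
      then show "\<exists>y\<in>g ` X \<inter> ball x d. y \<in> U \<and> y \<noteq> x" by blast
    qed
    then have "x islimpt g ` (X \<inter> g -` cball x d)" by (rule islimpt_subset) auto
    then have "x \<in> g ` (X \<inter> g -` cball x d)" using cl closed_limpt by blast
    then show "x \<in> g ` X" by blast
  qed
  moreover have "g ` X \<noteq> {}"
  proof -
    have "- e \<in> X" using e by (simp add: X_def norm_eq_1)
    then show ?thesis by blast
  qed
  ultimately have gX': "g ` X = X"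
    using connected_clopen[of X] convex_connected[OF X(2)] gX X(1) by (auto simp: openin_open_eq)
  have "inj_on g X"
    using covering_space_convex_imp_inj[OF proper_local_homeomorphism_covering_space[OF X(1) X(1) cont gX' loc proper] X(2) X(2)] .
  then show ?thesis using gX' by (simp add: bij_betw_def)
qed

lemma dist_scaleR_cancel: "dist (c *\<^sub>R x) (c *\<^sub>R y) = \<bar>c\<bar> * dist x (y :: 'a :: real_normed_vector)"
  by (simp add: dist_norm flip: scaleR_diff_right)

context near_identity
begin

text \<open>By \<open>double\<close>, half of the lift at \<open>2 z\<close> through
  \<open>A 0\<close> solves the equation that characterises the lift through \<open>A 1\<close>.
  This identity is what lets consecutive scales be glued.\<close>

lemma F_double:
  assumes "\<bar>w \<bullet> e\<bar> < 4"
  shows "F 1 w = (1/2) *\<^sub>R F 0 (2 *\<^sub>R w)"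
proof (rule F_unique)
  have w2: "\<bar>(2 *\<^sub>R w) \<bullet> e\<bar> < 9" using assms by simp
  have "(0::real) \<in> {0..1}" by simp
  note p = F_props[OF this w2]
  show "(1/2) *\<^sub>R F 0 (2 *\<^sub>R w) \<in> slab"
    using p(5) assms unfolding slab_def mem_Collect_eq inner_scaleR_left by linarith
  have "dist ((1/2) *\<^sub>R F 0 (2 *\<^sub>R w)) w = dist ((1/2) *\<^sub>R F 0 (2 *\<^sub>R w)) ((1/2) *\<^sub>R (2 *\<^sub>R w))" by simp
  also have "\<dots> = (1/2) * dist (F 0 (2 *\<^sub>R w)) (2 *\<^sub>R w)" unfolding dist_scaleR_cancel by simp
  finally show "dist ((1/2) *\<^sub>R F 0 (2 *\<^sub>R w)) w < r / 2" using p(2) r by linarith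
  show "A 1 ((1/2) *\<^sub>R F 0 (2 *\<^sub>R w)) = f (A 1 w)" using p(4) by (simp add: double)
qed simp

definition blockix where "blockix = cmp (cmp (bix 1) linkix) (bix 1)"

text \<open>\<open>m\<close> links of height 2 are stacked, the k-th passing from the parameter k/m
  to (k+1)/m; the bound on 1/m is the one a slow passage needs. The block occupies the heights from
  -4m to -2m, so halving carries its lower end to its upper end.\<close>

lemma block:
  assumes m: "m \<ge> 1" "1 / real m \<le> 1 / (2 * L\<^sup>2)"
  shows "\<exists>B. (\<forall>z. - 4 * real m - 1/8 < z \<bullet> e \<and> z \<bullet> e < - 2 * real m + 1/8 \<longrightarrow>
        locP blockix z B \<and> dist (B z) z < 12) \<and>
     (\<forall>z. - 4 * real m - 1/8 < z \<bullet> e \<and> z \<bullet> e < - 4 * real m + 2/5 \<longrightarrow>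
        B z = F 0 (z + (4 * real m) *\<^sub>R e) - (4 * real m) *\<^sub>R e) \<and>
     (\<forall>z. - 2 * real m - 1/8 < z \<bullet> e \<and> z \<bullet> e < - 2 * real m + 1/8 \<longrightarrow>
        B z = F 1 (z + (2 * real m) *\<^sub>R e) - (2 * real m) *\<^sub>R e)"
proof -
  define LK where "LK k g \<longleftrightarrow> ((\<forall>z. - 1 < z \<bullet> e \<and> z \<bullet> e < 7/2 \<longrightarrow> locP linkix z g \<and> dist (g z) z < 12) \<and>
    (\<forall>z. - 1 < z \<bullet> e \<and> z \<bullet> e < 2/5 \<longrightarrow> g z = F (real k / real m) z) \<and>
    (\<forall>z. 9/5 < z \<bullet> e \<and> z \<bullet> e < 7/2 \<longrightarrow> g z = 2 *\<^sub>R e + F (real (Suc k) / real m) (z - 2 *\<^sub>R e)))" for k g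
  have "\<exists>g. LK k g" if k: "k < m" for k
    unfolding LK_def
  proof (intro link)
    show "real k / real m \<in> {0..1}" "real (Suc k) / real m \<in> {0..1}" using k by auto
    have "real (Suc k) / real m - real k / real m = 1 / real m"
      by (metis add_diff_cancel_left' diff_divide_distrib of_nat_Suc add.commute)
    then show "\<bar>real (Suc k) / real m - real k / real m\<bar> \<le> 1 / (2 * L\<^sup>2)" using m(2) by simp
  qed
  then have "\<forall>k. \<exists>g. k < m \<longrightarrow> LK k g" by blast
  then obtain G where LK: "\<And>k. k < m \<Longrightarrow> LK k (G k)" using choice[of "\<lambda>k g. k < m \<longrightarrow> LK k g"] by blast
  have G: "\<And>k z. k < m \<Longrightarrow> - 1 < z \<bullet> e \<Longrightarrow> z \<bullet> e < 7/2 \<Longrightarrow> locP linkix z (G k) \<and> dist (G k z) z < 12"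
    and G0: "\<And>k z. k < m \<Longrightarrow> - 1 < z \<bullet> e \<Longrightarrow> z \<bullet> e < 2/5 \<Longrightarrow> G k z = F (real k / real m) z"
    and G1: "\<And>k z. k < m \<Longrightarrow> 9/5 < z \<bullet> e \<Longrightarrow> z \<bullet> e < 7/2 \<Longrightarrow> G k z = 2 *\<^sub>R e + F (real (Suc k) / real m) (z - 2 *\<^sub>R e)"
    using LK unfolding LK_def by blast+
  define c where "c k = (4 * real m - 2 * real k) *\<^sub>R e" for k
  define pc where "pc k z = G k (z + c k) + - c k" for k z
  define h where "h z = z \<bullet> e + 4 * real m" for z
  have hc: "(z + c k) \<bullet> e = h z - 2 * real k" for z k by (simp add: h_def c_def inner_add_left)
  \<comment> \<open>Truncation by \<open>nat\<close> and by \<open>min (m - 1)\<close> assigns the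
    margins of width 1/8 below and above the block to the first and to the last link.\<close>
  define idx where "idx z = min (m - 1) (nat \<lfloor>h z / 2\<rfloor>)" for z
  define B where "B z = pc (idx z) z" for z
  \<comment> \<open>Around a seam the lower link is at heights 2 \<plusminus> 1/8, above 9/5, and
    the upper one below 2/5; both are translates of the lift with the parameter (k+1)/m.\<close>
  have step: "pc k z = pc (Suc k) z" if "Suc k < m" "- 1/8 \<le> h z - 2 * real (Suc k)" "h z - 2 * real (Suc k) \<le> 1/8" for k z
  proof -
    have "G k (z + c k) = 2 *\<^sub>R e + F (real (Suc k) / real m) (z + c k - 2 *\<^sub>R e)"
      by (rule G1) (use that hc[of z k] in auto)
    moreover have "G (Suc k) (z + c (Suc k)) = F (real (Suc k) / real m) (z + c (Suc k))"
      by (rule G0) (use that hc[of z "Suc k"] in auto)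
    moreover have "c k = c (Suc k) + 2 *\<^sub>R e" by (simp add: c_def algebra_simps flip: scaleR_add_left)
    ultimately show ?thesis by (simp add: pc_def)
  qed
  have agree: "B z = pc k z" if k: "k < m" and z: "- 1/8 < h z - 2 * real k" "h z - 2 * real k < 2 + 1/8" for k z
  proof -
    consider "h z < 2 * real k" | "2 * real k \<le> h z" "h z < 2 * real (Suc k)" | "2 * real (Suc k) \<le> h z" by linarith
    then show ?thesis
    proof cases
      case 1
      show ?thesis
      proof (cases k)
        case 0
        then have "\<lfloor>h z / 2\<rfloor> \<le> 0" using 1 by (simp add: floor_le_iff)
        then have "idx z = 0" by (simp add: idx_def)
        then show ?thesis using 0 by (simp add: B_def)
      next
        case (Suc k')
        have "\<lfloor>h z / 2\<rfloor> = int k'" using 1 z Suc by (simp add: floor_eq_iff)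
        then have "idx z = k'" using k Suc by (simp add: idx_def)
        moreover have "pc k' z = pc k z" unfolding Suc by (rule step) (use Suc k z 1 in auto)
        ultimately show ?thesis by (simp add: B_def)
      qed
    next
      case 2
      have "\<lfloor>h z / 2\<rfloor> = int k" using 2 by (simp add: floor_eq_iff)
      then have "idx z = k" using k by (simp add: idx_def)
      then show ?thesis by (simp add: B_def)
    next
      case 3
      have fl: "\<lfloor>h z / 2\<rfloor> = int (Suc k)" using 3 z by (simp add: floor_eq_iff)
      show ?thesis
      proof (cases "Suc k < m")
        case True
        then have "idx z = Suc k" using fl by (simp add: idx_def)
        moreover have "pc k z = pc (Suc k) z" by (rule step[OF True]) (use 3 z in auto)
        ultimately show ?thesis by (simp add: B_def)
      next
        case False
        then have "idx z = k" using fl k by (simp add: idx_def)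
        then show ?thesis by (simp add: B_def)
      qed
    qed
  qed
  have ex: "\<exists>k<m. - 1/8 < h z - 2 * real k \<and> h z - 2 * real k < 2 + 1/8"
    if "- 1/8 < h z" "h z < 2 * real m + 1/8" for z
  proof -
    consider "h z \<le> 0" | "0 < h z" "h z < 2 * real m" | "2 * real m \<le> h z" by linarith
    then show ?thesis
    proof cases
      case 1 then show ?thesis using that m by (intro exI[of _ 0]) auto
    next
      case 2
      define k where "k = nat \<lfloor>h z / 2\<rfloor>"
      have "real k = of_int \<lfloor>h z / 2\<rfloor>" using 2 by (simp add: k_def)
      then have "2 * real k \<le> h z" "h z < 2 * real k + 2" by linarith+
      then show ?thesis using 2 by (intro exI[of _ k]) auto
    next
      case 3
      have "real (m - 1) = real m - 1" using m by (simp add: of_nat_diff)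
      then show ?thesis using 3 that m by (intro exI[of _ "m - 1"]) auto
    qed
  qed
  have "locP blockix z B \<and> dist (B z) z < 12" if z: "- 4 * real m - 1/8 < z \<bullet> e" "z \<bullet> e < - 2 * real m + 1/8" for z
  proof -
    obtain k where k: "k < m" "- 1/8 < h z - 2 * real k" "h z - 2 * real k < 2 + 1/8"
      using ex[of z] z by (auto simp: h_def)
    have zc: "- 1 < (z + c k) \<bullet> e" "(z + c k) \<bullet> e < 7/2" using k unfolding hc by auto
    have "locP blockix z (pc k)"
      unfolding blockix_def pc_def
      by (rule locP_comp[OF locP_comp[OF locP_translate] locP_translate]) (use G[OF k(1) zc] in blast)
    moreover have "open {x. - 1/8 < h x - 2 * real k \<and> h x - 2 * real k < 2 + 1/8}"
      unfolding h_def by (intro open_Collect_conj open_Collect_less continuous_intros)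
    ultimately have "locP blockix z B" by (rule locP_cong) (use agree k in auto)
    moreover have "dist (B z) z < 12"
      using G[OF k(1) zc] unfolding agree[OF k] pc_def by (simp add: dist_norm algebra_simps)
    ultimately show ?thesis by blast
  qed
  moreover have "B z = F 0 (z + (4 * real m) *\<^sub>R e) - (4 * real m) *\<^sub>R e"
    if z: "- 4 * real m - 1/8 < z \<bullet> e" "z \<bullet> e < - 4 * real m + 2/5" for z
  proof -
    have hz: "- 1/8 < h z" "h z < 2/5" using z by (auto simp: h_def)
    have "B z = pc 0 z" by (rule agree) (use m hz in auto)
    moreover have "G 0 (z + c 0) = F (real 0 / real m) (z + c 0)"
      by (rule G0) (use m hz hc[of z 0] in auto)
    ultimately show ?thesis by (simp add: pc_def c_def)
  qed
  moreover have "B z = F 1 (z + (2 * real m) *\<^sub>R e) - (2 * real m) *\<^sub>R e"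
    if z: "- 2 * real m - 1/8 < z \<bullet> e" "z \<bullet> e < - 2 * real m + 1/8" for z
  proof -
    have m1: "real (m - 1) = real m - 1" using m by (simp add: of_nat_diff)
    have hz: "2 - 1/8 < h z - 2 * real (m - 1)" "h z - 2 * real (m - 1) < 2 + 1/8" using z m1 by (auto simp: h_def)
    have "B z = pc (m - 1) z" by (rule agree) (use m hz in auto)
    moreover have "G (m - 1) (z + c (m - 1)) = 2 *\<^sub>R e + F (real (Suc (m - 1)) / real m) (z + c (m - 1) - 2 *\<^sub>R e)"
      by (rule G1) (use m hz hc[of z "m - 1"] in auto)
    moreover have "c (m - 1) - 2 *\<^sub>R e = (2 * real m) *\<^sub>R e"
      unfolding c_def m1 by (simp add: algebra_simps flip: scaleR_diff_left)
    moreover have "real (Suc (m - 1)) / real m = 1" using m by simp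
    ultimately show ?thesis using m1 by (simp add: pc_def c_def algebra_simps)
  qed
  ultimately show ?thesis by blast
qed

text \<open>
  The block joins the placement of \<open>f\<close> at scale 1 to its placement at scale 1/2, so its images
  under the powers of \<open>z \<mapsto> 2 z\<close> fit together to a self-similar map of the half space.
\<close>

lemma self_similar_extension:
  assumes m: "m \<ge> 25" "1 / real m \<le> 1 / (2 * L\<^sup>2)"
  shows "\<exists>g. (\<forall>z. z \<bullet> e < 0 \<longrightarrow> locP blockix z g \<and> dist (g z) z \<le> \<bar>z \<bullet> e\<bar> / 4) \<and>
     (\<forall>z. - 4 * real m - 1/8 < z \<bullet> e \<and> z \<bullet> e < - 4 * real m + 1/8 \<longrightarrow>
        g z = F 0 (z + (4 * real m) *\<^sub>R e) - (4 * real m) *\<^sub>R e)"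
proof -
  define T where "T = 2 * real m"
  have T: "T \<ge> 50" using m by (simp add: T_def)
  have m1: "m \<ge> 1" using m by simp
  obtain B where B: "\<And>z. - 2 * T - 1/8 < z \<bullet> e \<Longrightarrow> z \<bullet> e < - T + 1/8 \<Longrightarrow> locP blockix z B \<and> dist (B z) z < 12"
    and B0: "\<And>z. - 2 * T - 1/8 < z \<bullet> e \<Longrightarrow> z \<bullet> e < - 2 * T + 2/5 \<Longrightarrow> B z = F 0 (z + (2 * T) *\<^sub>R e) - (2 * T) *\<^sub>R e"
    and B1: "\<And>z. - T - 1/8 < z \<bullet> e \<Longrightarrow> z \<bullet> e < - T + 1/8 \<Longrightarrow> B z = F 1 (z + T *\<^sub>R e) - T *\<^sub>R e"
    using block[OF m1 m(2)] by (auto simp: T_def)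
  have half: "B u = (1/2) *\<^sub>R B (2 *\<^sub>R u)" if "- T - 1/16 < u \<bullet> e" "u \<bullet> e < - T + 1/8" for u
  proof -
    have "B u = F 1 (u + T *\<^sub>R e) - T *\<^sub>R e" using B1 that by auto
    also have "F 1 (u + T *\<^sub>R e) = (1/2) *\<^sub>R F 0 (2 *\<^sub>R (u + T *\<^sub>R e))"
      by (rule F_double) (use that in \<open>auto simp: inner_add_left\<close>)
    also have "F 0 (2 *\<^sub>R (u + T *\<^sub>R e)) = B (2 *\<^sub>R u) + (2 * T) *\<^sub>R e"
      using B0[of "2 *\<^sub>R u"] that by (simp add: algebra_simps)
    finally show ?thesis by (simp add: scaleR_add_right)
  qed
  define p where "p j = (2::real) powr (real_of_int j)" for j :: int
  have p: "p j > 0" "p (j + 1) = 2 * p j" for j by (auto simp: p_def powr_add)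
  define pc where "pc j z = p j *\<^sub>R B (z /\<^sub>R p j)" for j z
  \<comment> \<open>The strata T p_j < - height \<le> 2 T p_j are half open, hence the ceiling minus
    1.\<close>
  define idx where "idx z = \<lceil>log 2 (- (z \<bullet> e) / T)\<rceil> - 1" for z
  define g where "g z = pc (idx z) z" for z
  have lev: "(z /\<^sub>R p j) \<bullet> e = z \<bullet> e / p j" for z j by (simp only: inner_scaleR_left divide_inverse mult.commute)
  have idx_eq: "idx z = j" if "T < - (z \<bullet> e) / p j" "- (z \<bullet> e) / p j \<le> 2 * T" for z j
  proof -
    define x where "x = - (z \<bullet> e) / T"
    have x: "p j < x" "x \<le> p (j + 1)" using that p[of j] T by (auto simp: x_def field_simps)
    have x0: "x > 0" using x(1) p(1)[of j] by linarith
    have "real_of_int j < log 2 x" using x(1) x0 by (simp add: p_def less_log_iff)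
    moreover have "log 2 x \<le> real_of_int (j + 1)" using x(2) x0 by (simp add: p_def log_le_iff)
    ultimately have "\<lceil>log 2 x\<rceil> = j + 1" by (simp add: ceiling_eq_iff)
    then show ?thesis by (simp add: idx_def x_def)
  qed
  have double: "pc (j + 1) z = pc j z" if "- T - 1/16 < z \<bullet> e / p (j + 1)" "z \<bullet> e / p (j + 1) < - T + 1/8" for z j
  proof -
    have "B (z /\<^sub>R p (j + 1)) = (1/2) *\<^sub>R B (2 *\<^sub>R (z /\<^sub>R p (j + 1)))"
      by (rule half) (use that in \<open>auto simp only: lev\<close>)
    moreover have "2 *\<^sub>R (z /\<^sub>R p (j + 1)) = z /\<^sub>R p j" using p[of j] by simp
    ultimately show ?thesis using p[of j] by (simp add: pc_def)
  qed
  have agree: "g z = pc j z" if "- 2 * T - 1/8 < z \<bullet> e / p j" "z \<bullet> e / p j < - T + 1/8" for z j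
  proof -
    have pj: "z \<bullet> e / p (j + 1) = z \<bullet> e / p j / 2" "z \<bullet> e / p (j - 1) = 2 * (z \<bullet> e / p j)"
      using p[of j] p[of "j - 1"] by (auto simp: field_simps)
    consider "- (z \<bullet> e / p j) \<le> T" | "T < - (z \<bullet> e / p j)" "- (z \<bullet> e / p j) \<le> 2 * T" | "2 * T < - (z \<bullet> e / p j)" by linarith
    then show ?thesis
    proof cases
      case 1
      have "idx z = j - 1" by (rule idx_eq) (use 1 that pj T in auto)
      moreover have "pc (j - 1 + 1) z = pc (j - 1) z" by (rule double) (use 1 that in auto)
      ultimately show ?thesis by (simp add: g_def)
    next
      case 2
      have "idx z = j" by (rule idx_eq) (use 2 in auto)
      then show ?thesis by (simp add: g_def)
    next
      case 3
      have "idx z = j + 1" by (rule idx_eq) (use 3 that pj T in auto)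
      moreover have "pc (j + 1) z = pc j z" by (rule double) (use 3 that pj in auto)
      ultimately show ?thesis by (simp add: g_def)
    qed
  qed
  have "locP blockix z g \<and> dist (g z) z \<le> \<bar>z \<bullet> e\<bar> / 4" if z: "z \<bullet> e < 0" for z
  proof -
    define x where "x = - (z \<bullet> e) / T"
    have x: "x > 0" using z T unfolding x_def by (intro divide_pos_pos) auto
    define j where "j = idx z"
    have "real_of_int j < log 2 x" "log 2 x \<le> real_of_int (j + 1)"
      unfolding j_def idx_def x_def by linarith+
    then have "p j < x" "x \<le> p (j + 1)" using x by (auto simp: p_def less_log_iff log_le_iff)
    then have l: "T < - (z \<bullet> e) / p j" "- (z \<bullet> e) / p j \<le> 2 * T"
      using p[of j] T by (auto simp: x_def field_simps)
    then have l': "- 2 * T - 1/8 < z \<bullet> e / p j" "z \<bullet> e / p j < - T + 1/8" by auto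
    note Bz = B[of "z /\<^sub>R p j", unfolded lev, OF l']
    have "locP blockix z (pc j)" unfolding pc_def using locP_scale[where i = blockix and z = z and c = "p j" and f = B] Bz p by blast
    moreover have "open {x. - 2 * T - 1/8 < x \<bullet> e / p j \<and> x \<bullet> e / p j < - T + 1/8}"
      using p(1)[of j] by (intro open_Collect_conj open_Collect_less continuous_intros) auto
    ultimately have "locP blockix z g" by (rule locP_cong) (use agree l' in auto)
    moreover have "dist (g z) z \<le> \<bar>z \<bullet> e\<bar> / 4"
    proof -
      have "dist (g z) z = dist (p j *\<^sub>R B (z /\<^sub>R p j)) (p j *\<^sub>R (z /\<^sub>R p j))"
        using p(1)[of j] by (simp add: agree[OF l'] pc_def)
      also have "\<dots> = p j * dist (B (z /\<^sub>R p j)) (z /\<^sub>R p j)" using p(1)[of j] unfolding dist_scaleR_cancel by simp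
      also have "\<dots> \<le> p j * 12" using Bz p(1)[of j] by (intro mult_left_mono) auto
      \<comment> \<open>Here m \<ge> 25 enters: a block moves points by less than 12, while its
        points are at least T = 2m \<ge> 50 away from the boundary.\<close>
      also have "\<dots> \<le> p j * (T / 4)" using T p(1)[of j] by (intro mult_left_mono) auto
      also have "\<dots> \<le> \<bar>z \<bullet> e\<bar> / 4" using l(1) p(1)[of j] z by (simp add: field_simps)
      finally show ?thesis .
    qed
    ultimately show ?thesis by blast
  qed
  moreover have "g z = F 0 (z + (4 * real m) *\<^sub>R e) - (4 * real m) *\<^sub>R e"
    if z: "- 4 * real m - 1/8 < z \<bullet> e" "z \<bullet> e < - 4 * real m + 1/8" for z
  proof -
    have p0: "p 0 = 1" by (simp add: p_def)
    have "g z = pc 0 z" by (rule agree) (use z p0 T in \<open>auto simp: T_def\<close>)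
    also have "\<dots> = B z" by (simp add: pc_def p0)
    also have "\<dots> = F 0 (z + (2 * T) *\<^sub>R e) - (2 * T) *\<^sub>R e" by (rule B0) (use z in \<open>auto simp: T_def\<close>)
    finally show ?thesis by (simp add: T_def)
  qed
  ultimately show ?thesis by (intro exI[of _ g]) blast
qed

end

context near_identity
begin

lemma F_dist:
  assumes s: "s \<in> {0..1}" and z: "\<bar>z \<bullet> e\<bar> < 9"
  shows "dist (F s z) z \<le> 2 * L * \<epsilon>"
proof -
  have zs: "cball z (r / 4) \<subseteq> slab" using cball_slab[of z "r / 4"] r z by auto
  have "z \<in> slab" using z by (auto simp: slab_def)
  then have n: "norm (A s z) \<le> R" using bound s by (auto simp: slab_def)
  show ?thesis
    using lift_props(2)[where f = f, OF imm2[OF s] zs f_near[OF n] \<epsilon>'(1)] by (simp add: F_def)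
qed

definition gix where "gix = cmp (cmp (bix 1) blockix) (bix 1)"

text \<open>Translating upwards by \<kappa> = 4m brings the lower end of the block, where the map is
  \<open>F 0\<close>, to the origin; there \<open>A 0\<close> semiconjugates \<open>g\<close> to
  \<open>f\<close>. The displacement bound 1/4 is relaxed to 1/2 so that the inverse satisfies it
  too.\<close>

lemma half_space_map:
  assumes m: "m \<ge> 25" "1 / real m \<le> 1 / (2 * L\<^sup>2)"
  defines "\<kappa> \<equiv> 4 * real m"
  shows "\<exists>g g'. homeomorphism UNIV UNIV g g' \<and> (\<forall>z. \<kappa> \<le> z \<bullet> e \<longrightarrow> g z = z \<and> g' z = z) \<and>
    (\<forall>z. z \<bullet> e < \<kappa> \<longrightarrow> locP gix z g \<and> locP gix z g') \<and>
    (\<forall>z. dist (g z) z \<le> \<bar>\<kappa> - z \<bullet> e\<bar> / 2 \<and> dist (g' z) z \<le> \<bar>\<kappa> - z \<bullet> e\<bar> / 2) \<and>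
    (\<forall>z. norm z < 1/8 \<longrightarrow> A 0 (g z) = f (A 0 z) \<and> dist (g z) z \<le> 2 * L * \<epsilon>)"
proof -
  obtain h where h: "\<And>z. z \<bullet> e < 0 \<Longrightarrow> locP blockix z h \<and> dist (h z) z \<le> \<bar>z \<bullet> e\<bar> / 4"
    and h0: "\<And>z. - \<kappa> - 1/8 < z \<bullet> e \<Longrightarrow> z \<bullet> e < - \<kappa> + 1/8 \<Longrightarrow> h z = F 0 (z + \<kappa> *\<^sub>R e) - \<kappa> *\<^sub>R e"
    using self_similar_extension[OF m] unfolding \<kappa>_def by auto
  define X where "X = {z :: 'a. z \<bullet> e < 0}"
  have bij: "bij_betw h X X"
    unfolding X_def
  proof (rule half_space_homeomorphism[OF e])
    show "continuous_on {z. z \<bullet> e < 0} h"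
      using h locP_isCont by (auto intro!: continuous_at_imp_continuous_on)
    fix z assume "z \<in> {z. z \<bullet> e < 0}"
    then have hz: "locP blockix z h" "dist (h z) z \<le> \<bar>z \<bullet> e\<bar> / 4" using h[of z] by auto
    then show "dist (h z) z \<le> \<bar>z \<bullet> e\<bar> / 4" by blast
    obtain V where V: "open V" "z \<in> V" "P blockix V h" using hz unfolding locP_def by blast
    have "inj_on h (V \<inter> {z. z \<bullet> e < 0})" by (rule inj_on_subset[OF P_inj[OF V(3)]]) auto
    then show "\<exists>V. open V \<and> z \<in> V \<and> inj_on h (V \<inter> {z. z \<bullet> e < 0})"
      using V by blast
  qed
  define c where "c = \<kappa> *\<^sub>R e"
  define Y where "Y = {z :: 'a. z \<bullet> e < \<kappa>}"
  define g where "g z = (if z \<in> Y then h (z + - c) + c else z)" for z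
  have ce: "(z + - c) \<bullet> e = z \<bullet> e - \<kappa>" "(z + c) \<bullet> e = z \<bullet> e + \<kappa>" for z
    by (auto simp: c_def inner_diff_left inner_add_left)
  have Y: "z \<in> Y \<longleftrightarrow> z + - c \<in> X" for z using ce[of z] unfolding X_def Y_def by auto
  have Y': "z \<in> X \<longleftrightarrow> z + c \<in> Y" for z using ce[of z] unfolding X_def Y_def by auto
  have oY: "open Y" using open_halfspace_lt[of e \<kappa>] by (simp add: Y_def inner_commute)
  have gY: "bij_betw g Y Y"
  proof -
    have t: "bij_betw (\<lambda>z. z + - c) Y X"
      by (rule bij_betw_byWitness[where f' = "\<lambda>z. z + c"]) (simp_all add: image_subset_iff Y' flip: Y)
    have t': "bij_betw (\<lambda>z. z + c) X Y"
      by (rule bij_betw_byWitness[where f' = "\<lambda>z. z + - c"]) (simp_all add: image_subset_iff Y' flip: Y)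
    have "bij_betw ((\<lambda>z. z + c) \<circ> h \<circ> (\<lambda>z. z + - c)) Y Y"
      using bij_betw_trans[OF t bij_betw_trans[OF bij t']] by (simp add: o_assoc)
    then show ?thesis by (rule bij_betw_cong[THEN iffD1, rotated]) (simp add: g_def)
  qed
  have "bij_betw g (- Y) (- Y)" by (rule bij_betw_cong[THEN iffD1, OF _ bij_betw_id]) (simp add: g_def)
  then have bg: "bij g" using bij_betw_combine[OF gY, of "- Y" "- Y"] by simp
  define g' where "g' = inv_into UNIV g"
  have gg': "g (g' z) = z" "g' (g z) = z" for z
    using bg by (auto simp: g'_def bij_is_inj surj_f_inv_f bij_is_surj)
  have gYY: "g z \<in> Y" if "z \<in> Y" for z using gY that by (auto simp: bij_betw_def)
  have g'Y: "g' z \<in> Y \<longleftrightarrow> z \<in> Y" for z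
    using gYY[of "g' z"] gg' by (metis g_def)
  have d: "dist (g z) z \<le> \<bar>\<kappa> - z \<bullet> e\<bar> / 4" for z
  proof (cases "z \<in> Y")
    case True
    then have "dist (h (z + - c)) (z + - c) \<le> \<bar>z \<bullet> e - \<kappa>\<bar> / 4"
      using conjunct2[OF h[of "z + - c"]] Y[of z] unfolding X_def mem_Collect_eq ce by blast
    moreover have "dist (g z) z = dist (h (z + - c)) (z + - c)" using True by (simp add: g_def dist_norm algebra_simps)
    ultimately show ?thesis by simp
  next
    case False
    then show ?thesis by (simp add: g_def)
  qed
  have d2: "dist (g z) z \<le> \<bar>\<kappa> - z \<bullet> e\<bar> / 2" for z
    using d[of z] abs_ge_zero[of "\<kappa> - z \<bullet> e"] by argo
  have d': "dist (g' z) z \<le> \<bar>\<kappa> - z \<bullet> e\<bar> / 2" for z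
  proof -
    have 1: "dist z (g' z) \<le> \<bar>\<kappa> - g' z \<bullet> e\<bar> / 4" using d[of "g' z"] gg' by simp
    have 2: "\<bar>z \<bullet> e - g' z \<bullet> e\<bar> \<le> dist z (g' z)" by (rule abs_inner_e_le)
    have "\<bar>\<kappa> - g' z \<bullet> e\<bar> \<le> \<bar>\<kappa> - z \<bullet> e\<bar> + \<bar>z \<bullet> e - g' z \<bullet> e\<bar>" by linarith
    then have "\<bar>\<kappa> - g' z \<bullet> e\<bar> \<le> \<bar>\<kappa> - z \<bullet> e\<bar> + \<bar>\<kappa> - g' z \<bullet> e\<bar> / 4" using 1 2 by (meson add_left_mono order_trans)
    then have "\<bar>\<kappa> - g' z \<bullet> e\<bar> \<le> 2 * \<bar>\<kappa> - z \<bullet> e\<bar>" by argo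
    then show ?thesis using 1 by (simp add: dist_commute)
  qed
  have lg: "locP gix z g" if "z \<in> Y" for z
  proof (rule locP_cong)
    show "locP gix z (\<lambda>z. h (z + - c) + c)" unfolding gix_def
      by (rule locP_comp[OF locP_comp[OF locP_translate] locP_translate]) (use h Y that in \<open>auto simp: X_def\<close>)
  qed (use oY that in \<open>auto simp: g_def\<close>)
  have lg': "locP gix z g'" if "z \<in> Y" for z
    using locP_inverse[OF lg[of "g' z"] open_UNIV _ gg'(2)] g'Y that gg' by auto
  \<comment> \<open>On the hyperplane and beyond it, continuity follows from the displacement bound
    alone, because a point of \<open>Y\<close> is at most as far from the hyperplane as from any
    point outside \<open>Y\<close>.\<close>
  have cont: "continuous_on UNIV k"
    if k: "\<And>z. z \<in> Y \<Longrightarrow> isCont k z" "\<And>z. dist (k z) z \<le> \<bar>\<kappa> - z \<bullet> e\<bar> / 2" "\<And>z. z \<notin> Y \<Longrightarrow> k z = z" for k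
  proof (rule continuous_at_imp_continuous_on, intro ballI)
    fix w
    show "isCont k w"
    proof (cases "w \<in> Y")
      case False
      have "dist (k z) (k w) \<le> 2 * dist z w" for z
      proof (cases "z \<in> Y")
        case True
        have "\<bar>\<kappa> - z \<bullet> e\<bar> \<le> dist z w"
          using True False abs_inner_e_le[of z w] unfolding Y_def mem_Collect_eq by linarith
        then have "dist (k z) z \<le> dist z w" using k(2)[of z] by simp
        then show ?thesis using k(3)[OF False] dist_triangle[of "k z" w z] by simp
      next
        case Fz: False
        then show ?thesis using k(3)[OF False] k(3)[OF Fz] by simp
      qed
      then show ?thesis unfolding continuous_at_eps_delta
        by (metis (no_types, opaque_lifting) half_gt_zero less_divide_eq_numeral1(1) mult.commute order.strict_trans1)
    qed (use k in auto)
  qed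
  have "continuous_on UNIV g"
  proof (rule cont)
    fix z show "isCont g z" if "z \<in> Y" using locP_isCont[OF lg[OF that]] .
    show "dist (g z) z \<le> \<bar>\<kappa> - z \<bullet> e\<bar> / 2" by (rule d2)
    show "g z = z" if "z \<notin> Y" using that by (simp add: g_def)
  qed
  moreover have "continuous_on UNIV g'"
  proof (rule cont)
    fix z show "isCont g' z" if "z \<in> Y" using locP_isCont[OF lg'[OF that]] .
    show "dist (g' z) z \<le> \<bar>\<kappa> - z \<bullet> e\<bar> / 2" by (rule d')
    show "g' z = z" if "z \<notin> Y" using that gg'(2)[of z] by (simp add: g_def)
  qed
  ultimately have "homeomorphism UNIV UNIV g g'"
    using gg' unfolding homeomorphism_def by (metis UNIV_I surjI)
  moreover have "\<forall>z. \<kappa> \<le> z \<bullet> e \<longrightarrow> g z = z \<and> g' z = z"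
    using gg'(2) by (metis Y_def g_def mem_Collect_eq not_le)
  moreover have "\<forall>z. norm z < 1/8 \<longrightarrow> A 0 (g z) = f (A 0 z) \<and> dist (g z) z \<le> 2 * L * \<epsilon>"
  proof (intro allI impI)
    fix z :: 'a assume z: "norm z < 1/8"
    have ze: "\<bar>z \<bullet> e\<bar> < 1/8" using abs_inner_e_le[of z 0] z by simp
    have "\<kappa> \<ge> 100" using m by (simp add: \<kappa>_def)
    then have "z \<in> Y" using ze unfolding Y_def by auto
    then have "g z = h (z + - c) + c" by (simp add: g_def)
    also have "h (z + - c) = F 0 (z + - c + \<kappa> *\<^sub>R e) - \<kappa> *\<^sub>R e"
      by (rule h0) (use ze ce[of z] in auto)
    finally have "g z = F 0 z" by (simp add: c_def)
    moreover have z9: "\<bar>z \<bullet> e\<bar> < 9" using ze by simp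
    ultimately show "A 0 (g z) = f (A 0 z) \<and> dist (g z) z \<le> 2 * L * \<epsilon>"
      using F_props(4)[of 0 z] F_dist[of 0 z] by simp
  qed
  moreover have "\<forall>z. z \<bullet> e < \<kappa> \<longrightarrow> locP gix z g \<and> locP gix z g'" using lg lg' by (simp add: Y_def)
  moreover have "\<forall>z. dist (g z) z \<le> \<bar>\<kappa> - z \<bullet> e\<bar> / 2 \<and> dist (g' z) z \<le> \<bar>\<kappa> - z \<bullet> e\<bar> / 2"
    using d2 d' by blast
  ultimately show ?thesis by blast
qed

end

section \<open>Immersed slabs\<close>

definition cy :: "real \<Rightarrow> real \<Rightarrow> real \<Rightarrow> real"
  where "cy c d x = c * cos x + d * cos (2 * x)"

definition cX :: "real \<Rightarrow> real \<Rightarrow> real \<Rightarrow> real"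
  where "cX c d x = - (c\<^sup>2 * sin (2 * x) / 2 + d\<^sup>2 * sin (4 * x) / 4 + 2 * c * d * (sin x + sin (3 * x) / 3))"

definition cY :: "real \<Rightarrow> real \<Rightarrow> real \<Rightarrow> real"
  where "cY c d x = c * sin x + d * sin (2 * x) / 2"

definition cp :: "real \<Rightarrow> real \<Rightarrow> real \<Rightarrow> real"
  where "cp c d x = 1 - 2 * (cy c d x)\<^sup>2"

text \<open>The mean of the square of \<open>cy c d\<close> is (c^2 + d^2)/2, so the normalisation
  removes the constant term of 1 - 2 y^2. Therefore its antiderivative is a trigonometric polynomial
  and the curve closes up.\<close>

lemma cX_deriv:
  assumes "c\<^sup>2 + d\<^sup>2 = 1"
  shows "(cX c d has_real_derivative cp c d x) (at x)"
proof -
  have 1: "(cX c d has_real_derivative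
      - (c\<^sup>2 * cos (2 * x) + d\<^sup>2 * cos (4 * x) + 2 * c * d * (cos x + cos (3 * x)))) (at x)"
    unfolding cX_def by (auto intro!: derivative_eq_intros simp: field_simps)
  have c2: "cos (2 * x) = 2 * (cos x)\<^sup>2 - 1" by (rule cos_double_cos)
  have c4: "cos (4 * x) = 2 * (cos (2 * x))\<^sup>2 - 1" using cos_double_cos[of "2 * x"] by simp
  have c3: "cos x + cos (3 * x) = 2 * cos (2 * x) * cos x"
    using cos_plus_cos[of "3 * x" x] by (simp add: add.commute)
  have "- (c\<^sup>2 * C + d\<^sup>2 * (2 * C\<^sup>2 - 1) + 2 * c * d * (2 * C * K)) =
      (c\<^sup>2 + d\<^sup>2) - 2 * (c * K + d * C)\<^sup>2 - c\<^sup>2 * (C - (2 * K\<^sup>2 - 1))" for C K :: real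
    by (simp add: power2_eq_square algebra_simps)
  from this[of "cos (2 * x)" "cos x"]
  have "- (c\<^sup>2 * cos (2 * x) + d\<^sup>2 * cos (4 * x) + 2 * c * d * (cos x + cos (3 * x)))
      = (c\<^sup>2 + d\<^sup>2) - 2 * (cy c d x)\<^sup>2"
    unfolding c3 c4 cy_def using c2 by simp
  then show ?thesis using 1 assms by (simp add: cp_def)
qed

lemma cY_deriv: "(cY c d has_real_derivative cy c d x) (at x)"
  unfolding cY_def cy_def by (auto intro!: derivative_eq_intros simp: field_simps)

lemma abs_cos_sin_bound:
  assumes "c\<^sup>2 + d\<^sup>2 = (1::real)"
  shows "\<bar>c\<bar> \<le> 1" "\<bar>d\<bar> \<le> 1"
  using assms by (metis abs_le_square_iff abs_one le_add_same_cancel1 le_add_same_cancel2 one_power2 zero_le_power2)+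

lemma abs_mult_le1: "\<bar>a\<bar> \<le> 1 \<Longrightarrow> \<bar>b\<bar> \<le> B \<Longrightarrow> \<bar>a * b\<bar> \<le> (B::real)"
  by (metis abs_ge_zero abs_mult mult_left_le_one_le order_trans)

lemma cy_bound:
  assumes "c\<^sup>2 + d\<^sup>2 = 1"
  shows "\<bar>cy c d x\<bar> \<le> 2" "\<bar>cp c d x\<bar> \<le> 9"
proof -
  have "\<bar>c * cos x\<bar> \<le> 1" "\<bar>d * cos (2 * x)\<bar> \<le> 1"
    using abs_cos_sin_bound[OF assms] by (auto intro!: abs_mult_le1)
  then show 1: "\<bar>cy c d x\<bar> \<le> 2" unfolding cy_def by linarith
  have "(cy c d x)\<^sup>2 \<le> 2\<^sup>2" using 1 by (metis abs_le_square_iff abs_numeral)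
  then have "(cy c d x)\<^sup>2 \<le> 4" by simp
  then show "\<bar>cp c d x\<bar> \<le> 9" unfolding cp_def using zero_le_power2[of "cy c d x"] by linarith
qed

lemma cXY_bound:
  assumes "c\<^sup>2 + d\<^sup>2 = 1"
  shows "\<bar>cX c d x\<bar> \<le> 4" "\<bar>cY c d x\<bar> \<le> 2"
proof -
  note cd = abs_cos_sin_bound[OF assms]
  have cc: "\<bar>c\<^sup>2\<bar> \<le> 1" "\<bar>d\<^sup>2\<bar> \<le> 1" "\<bar>c * d\<bar> \<le> 1"
    using cd by (auto simp: abs_square_le_1 intro: abs_mult_le1)
  have "\<bar>c\<^sup>2 * sin (2 * x)\<bar> \<le> 1" "\<bar>d\<^sup>2 * sin (4 * x)\<bar> \<le> 1"
    using abs_mult_le1[OF cc(1) abs_sin_le_one] abs_mult_le1[OF cc(2) abs_sin_le_one] by auto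
  moreover have "\<bar>(c * d) * (sin x + sin (3 * x) / 3)\<bar> \<le> 4/3"
  proof (rule abs_mult_le1[OF cc(3)])
    show "\<bar>sin x + sin (3 * x) / 3\<bar> \<le> 4/3"
      using abs_sin_le_one[of x] abs_sin_le_one[of "3 * x"] by linarith
  qed
  ultimately show "\<bar>cX c d x\<bar> \<le> 4" unfolding cX_def mult.assoc by linarith
  have "\<bar>c * sin x\<bar> \<le> 1" "\<bar>d * sin (2 * x)\<bar> \<le> 1" using cd by (auto intro!: abs_mult_le1)
  then show "\<bar>cY c d x\<bar> \<le> 2" unfolding cY_def by linarith
qed

lemma lipschitz_of_deriv:
  fixes f :: "real \<Rightarrow> real"
  assumes "\<And>x. (f has_real_derivative f' x) (at x)" "\<And>x. \<bar>f' x\<bar> \<le> B"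
  shows "\<bar>f v - f u\<bar> \<le> B * \<bar>v - u\<bar>"
proof -
  have "norm (f v - f u) \<le> B * norm (v - u)"
    by (rule field_differentiable_bound[of UNIV]) (use assms in \<open>auto intro: has_field_derivative_at_within\<close>)
  then show ?thesis by simp
qed

lemma cy_lip:
  assumes "c\<^sup>2 + d\<^sup>2 = 1"
  shows "\<bar>cy c d v - cy c d u\<bar> \<le> 3 * \<bar>v - u\<bar>"
proof (rule lipschitz_of_deriv)
  fix x
  show "(cy c d has_real_derivative - c * sin x - 2 * d * sin (2 * x)) (at x)"
    unfolding cy_def by (auto intro!: derivative_eq_intros)
  have "\<bar>c * sin x\<bar> \<le> 1" "\<bar>d * sin (2 * x)\<bar> \<le> 1"
    using abs_cos_sin_bound[OF assms] by (auto intro!: abs_mult_le1)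
  then show "\<bar>- c * sin x - 2 * d * sin (2 * x)\<bar> \<le> 3" unfolding abs_le_iff by (simp add: mult.assoc)
qed

lemma cp_lip:
  assumes "c\<^sup>2 + d\<^sup>2 = 1"
  shows "\<bar>cp c d v - cp c d u\<bar> \<le> 24 * \<bar>v - u\<bar>"
proof -
  have "cp c d v - cp c d u = - 2 * ((cy c d v - cy c d u) * (cy c d v + cy c d u))"
    by (simp add: cp_def power2_eq_square algebra_simps)
  then have "\<bar>cp c d v - cp c d u\<bar> = 2 * (\<bar>cy c d v - cy c d u\<bar> * \<bar>cy c d v + cy c d u\<bar>)"
    by (simp add: abs_mult)
  also have "\<dots> \<le> 2 * (3 * \<bar>v - u\<bar> * 4)"
    using cy_lip[OF assms, of v u] cy_bound(1)[OF assms, of v] cy_bound(1)[OF assms, of u]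
    by (intro mult_left_mono mult_mono) linarith+
  finally show ?thesis by simp
qed

lemma first_order:
  fixes f :: "real \<Rightarrow> real"
  assumes d: "\<And>x. (f has_real_derivative f' x) (at x)"
    and l: "\<And>u v. \<bar>f' v - f' u\<bar> \<le> B * \<bar>v - u\<bar>" and B: "B \<ge> 0"
  shows "\<bar>f v - f u - f' u * (v - u)\<bar> \<le> B * (v - u)\<^sup>2"
proof -
  have "\<bar>f v - f u - f' u * (v - u)\<bar> \<le> B * \<bar>v - u\<bar> * \<bar>v - u\<bar>"
  proof -
    have "\<exists>z. \<bar>z - u\<bar> \<le> \<bar>v - u\<bar> \<and> f v - f u = (v - u) * f' z"
    proof (cases "u < v")
      case True
      obtain z where "u < z" "z < v" "f v - f u = (v - u) * f' z" using MVT2[OF True, of f f'] d by auto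
      then show ?thesis by (intro exI[of _ z]) auto
    next
      case False
      show ?thesis
      proof (cases "v = u")
        case False
        with \<open>\<not> u < v\<close> have lt: "v < u" by simp
        obtain z where "v < z" "z < u" "f u - f v = (u - v) * f' z" using MVT2[OF lt, of f f'] d by auto
        then show ?thesis by (intro exI[of _ z]) (auto simp: algebra_simps)
      qed auto
    qed
    then obtain z where z: "\<bar>z - u\<bar> \<le> \<bar>v - u\<bar>" "f v - f u = (v - u) * f' z" by blast
    have "f v - f u - f' u * (v - u) = (f' z - f' u) * (v - u)" unfolding z(2) by (simp add: algebra_simps)
    then have "\<bar>f v - f u - f' u * (v - u)\<bar> = \<bar>f' z - f' u\<bar> * \<bar>v - u\<bar>" by (simp add: abs_mult)
    also have "\<dots> \<le> (B * \<bar>v - u\<bar>) * \<bar>v - u\<bar>"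
      using l[of z u] mult_left_mono[OF z(1) B] by (intro mult_right_mono) auto
    finally show ?thesis .
  qed
  then show ?thesis by (simp add: power2_eq_square abs_mult[symmetric] mult.assoc)
qed

definition on_plane :: "'a::euclidean_space \<Rightarrow> 'a \<Rightarrow> (real \<Rightarrow> real \<Rightarrow> real) \<Rightarrow> (real \<Rightarrow> real \<Rightarrow> real) \<Rightarrow> 'a \<Rightarrow> 'a"
  where "on_plane b e f1 f2 z =
    z + (f1 (z \<bullet> b) (z \<bullet> e) - z \<bullet> b) *\<^sub>R b + (f2 (z \<bullet> b) (z \<bullet> e) - z \<bullet> e) *\<^sub>R e"

lemma on_plane_norm:
  assumes be: "norm b = 1" "norm e = 1" "b \<bullet> e = 0"
  shows "(dist (on_plane b e f1 f2 z) (on_plane b e g1 g2 w))\<^sup>2 = (dist z w)\<^sup>2 - (z \<bullet> b - w \<bullet> b)\<^sup>2 - (z \<bullet> e - w \<bullet> e)\<^sup>2 +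
    (f1 (z \<bullet> b) (z \<bullet> e) - g1 (w \<bullet> b) (w \<bullet> e))\<^sup>2 + (f2 (z \<bullet> b) (z \<bullet> e) - g2 (w \<bullet> b) (w \<bullet> e))\<^sup>2"
proof -
  define D where "D = z - w"
  define h where "h = f1 (z \<bullet> b) (z \<bullet> e) - g1 (w \<bullet> b) (w \<bullet> e) - D \<bullet> b"
  define k where "k = f2 (z \<bullet> b) (z \<bullet> e) - g2 (w \<bullet> b) (w \<bullet> e) - D \<bullet> e"
  have bb: "b \<bullet> b = 1" "e \<bullet> e = 1" "e \<bullet> b = 0" using be by (auto simp: norm_eq_1 inner_commute)
  have "on_plane b e f1 f2 z - on_plane b e g1 g2 w = D + h *\<^sub>R b + k *\<^sub>R e"
    by (simp add: on_plane_def D_def h_def k_def inner_diff_left algebra_simps)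
  then have "(dist (on_plane b e f1 f2 z) (on_plane b e g1 g2 w))\<^sup>2 = (D + h *\<^sub>R b + k *\<^sub>R e) \<bullet> (D + h *\<^sub>R b + k *\<^sub>R e)"
    by (simp add: dist_norm power2_norm_eq_inner)
  also have "\<dots> = D \<bullet> D + 2 * h * (D \<bullet> b) + 2 * k * (D \<bullet> e) + h\<^sup>2 + k\<^sup>2"
    using bb be(3) by (simp add: inner_add_left inner_add_right inner_commute power2_eq_square algebra_simps)
  also have "\<dots> = D \<bullet> D - (D \<bullet> b)\<^sup>2 - (D \<bullet> e)\<^sup>2 + (h + D \<bullet> b)\<^sup>2 + (k + D \<bullet> e)\<^sup>2"
    by (simp add: power2_eq_square algebra_simps)
  finally show ?thesis by (simp add: h_def k_def D_def inner_diff_left dist_norm power2_norm_eq_inner)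
qed

text \<open>Bessel's inequality, read off from the norm formula with the planar part replaced by
  zero.\<close>

lemma plane_part_le:
  fixes z w :: "'a::euclidean_space"
  assumes be: "norm b = 1" "norm e = 1" "b \<bullet> e = 0"
  shows "(z \<bullet> b - w \<bullet> b)\<^sup>2 + (z \<bullet> e - w \<bullet> e)\<^sup>2 \<le> (dist z w)\<^sup>2"
proof -
  have "0 \<le> (dist (on_plane b e (\<lambda>_ _. 0) (\<lambda>_ _. 0) z) (on_plane b e (\<lambda>_ _. 0) (\<lambda>_ _. 0) w))\<^sup>2" by simp
  then show ?thesis unfolding on_plane_norm[OF be] by simp
qed

lemma on_plane_upper:
  assumes be: "norm b = 1" "norm e = 1" "b \<bullet> e = 0" and M: "M \<ge> 1"
    and u: "(f1 (z \<bullet> b) (z \<bullet> e) - f1 (w \<bullet> b) (w \<bullet> e))\<^sup>2 + (f2 (z \<bullet> b) (z \<bullet> e) - f2 (w \<bullet> b) (w \<bullet> e))\<^sup>2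
      \<le> M\<^sup>2 * ((z \<bullet> b - w \<bullet> b)\<^sup>2 + (z \<bullet> e - w \<bullet> e)\<^sup>2)"
  shows "dist (on_plane b e f1 f2 z) (on_plane b e f1 f2 w) \<le> M * dist z w"
proof (rule power2_le_imp_le)
  define Q where "Q = (dist z w)\<^sup>2 - ((z \<bullet> b - w \<bullet> b)\<^sup>2 + (z \<bullet> e - w \<bullet> e)\<^sup>2)"
  have "M\<^sup>2 * Q + M\<^sup>2 * ((z \<bullet> b - w \<bullet> b)\<^sup>2 + (z \<bullet> e - w \<bullet> e)\<^sup>2) = M\<^sup>2 * (dist z w)\<^sup>2"
    by (simp add: Q_def flip: distrib_left)
  moreover have "1 * Q \<le> M\<^sup>2 * Q" using plane_part_le[OF be, of z w] M by (intro mult_right_mono) (auto simp: Q_def)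
  ultimately have QM: "Q + M\<^sup>2 * ((z \<bullet> b - w \<bullet> b)\<^sup>2 + (z \<bullet> e - w \<bullet> e)\<^sup>2) \<le> M\<^sup>2 * (dist z w)\<^sup>2" by linarith
  then show "(dist (on_plane b e f1 f2 z) (on_plane b e f1 f2 w))\<^sup>2 \<le> (M * dist z w)\<^sup>2"
    unfolding on_plane_norm[OF be] power_mult_distrib using u QM unfolding Q_def by linarith
qed (use M in auto)

lemma on_plane_lower:
  assumes be: "norm b = 1" "norm e = 1" "b \<bullet> e = 0" and M: "M \<ge> 1"
    and u: "(z \<bullet> b - w \<bullet> b)\<^sup>2 + (z \<bullet> e - w \<bullet> e)\<^sup>2
     \<le> M\<^sup>2 * ((f1 (z \<bullet> b) (z \<bullet> e) - f1 (w \<bullet> b) (w \<bullet> e))\<^sup>2 + (f2 (z \<bullet> b) (z \<bullet> e) - f2 (w \<bullet> b) (w \<bullet> e))\<^sup>2)"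
  shows "dist z w \<le> M * dist (on_plane b e f1 f2 z) (on_plane b e f1 f2 w)"
proof (rule power2_le_imp_le)
  define Q where "Q = (dist z w)\<^sup>2 - ((z \<bullet> b - w \<bullet> b)\<^sup>2 + (z \<bullet> e - w \<bullet> e)\<^sup>2)"
  define N where "N = (f1 (z \<bullet> b) (z \<bullet> e) - f1 (w \<bullet> b) (w \<bullet> e))\<^sup>2 + (f2 (z \<bullet> b) (z \<bullet> e) - f2 (w \<bullet> b) (w \<bullet> e))\<^sup>2"
  have "(dist (on_plane b e f1 f2 z) (on_plane b e f1 f2 w))\<^sup>2 = Q + N"
    unfolding on_plane_norm[OF be] Q_def N_def by simp
  then have "M\<^sup>2 * (dist (on_plane b e f1 f2 z) (on_plane b e f1 f2 w))\<^sup>2 = M\<^sup>2 * Q + M\<^sup>2 * N"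
    by (simp add: distrib_left)
  moreover have "1 * Q \<le> M\<^sup>2 * Q" using plane_part_le[OF be, of z w] M by (intro mult_right_mono) (auto simp: Q_def)
  ultimately have QN: "Q + M\<^sup>2 * N \<le> M\<^sup>2 * (dist (on_plane b e f1 f2 z) (on_plane b e f1 f2 w))\<^sup>2" by linarith
  then show "(dist z w)\<^sup>2 \<le> (M * dist (on_plane b e f1 f2 z) (on_plane b e f1 f2 w))\<^sup>2"
    unfolding power_mult_distrib using u QN unfolding N_def Q_def by linarith
qed (use M in auto)

text \<open>
  The curve \<open>(cX, cY)\<close> is closed and immersed, because its velocity \<open>(1 - 2 y\<^sup>2, y)\<close> never
  vanishes and has mean zero when \<open>y = c cos x + d cos 2x\<close> with \<open>c\<^sup>2 + d\<^sup>2 = 1\<close>. Hence rotating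
  \<open>(c, d)\<close> from \<open>(1, 0)\<close> to \<open>(0, 1)\<close> is a regular homotopy from a figure eight to the same figure
  eight traversed twice; \<open>ribbon\<close> is a tubular neighbourhood of it, shrunk into itself.
\<close>

definition ribbon1 :: "real \<Rightarrow> real \<Rightarrow> real \<Rightarrow> real"
  where "ribbon1 s x t = ((1 + s) * cX (cos (pi * s / 2)) (sin (pi * s / 2)) x - t * cy (cos (pi * s / 2)) (sin (pi * s / 2)) x) / 8000"

definition ribbon2 :: "real \<Rightarrow> real \<Rightarrow> real \<Rightarrow> real"
  where "ribbon2 s x t = ((1 + s) * cY (cos (pi * s / 2)) (sin (pi * s / 2)) x + t * cp (cos (pi * s / 2)) (sin (pi * s / 2)) x) / 8000"

definition ribbon :: "'a::euclidean_space \<Rightarrow> 'a \<Rightarrow> real \<Rightarrow> 'a \<Rightarrow> 'a"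
  where "ribbon e b s = on_plane b e (ribbon1 s) (ribbon2 s)"

text \<open>The height stays within 1/1000, so ribbons in several directions can be composed. The
  divisor 8000 is chosen for this and for the contraction property below.\<close>

lemma ribbon_bound:
  assumes s: "s \<in> {0..1}" and t: "\<bar>t\<bar> \<le> 1/1000"
  shows "\<bar>ribbon1 s x t\<bar> \<le> 1" "\<bar>ribbon2 s x t\<bar> \<le> 1/1000"
proof -
  define c d where "c = cos (pi * s / 2)" and "d = sin (pi * s / 2)"
  have cd: "c\<^sup>2 + d\<^sup>2 = 1" by (simp add: c_def d_def)
  have "\<bar>(1 + s) * cX c d x\<bar> \<le> 2 * 4" "\<bar>(1 + s) * cY c d x\<bar> \<le> 2 * 2"
    unfolding abs_mult using s cXY_bound[OF cd, of x] by (intro mult_mono; auto)+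
  moreover have "\<bar>t * cy c d x\<bar> \<le> 1/1000 * 2" "\<bar>t * cp c d x\<bar> \<le> 1/1000 * 9"
    unfolding abs_mult using t cy_bound[OF cd, of x] by (intro mult_mono; auto)+
  ultimately have "\<bar>ribbon1 s x t\<bar> \<le> 1 \<and> \<bar>ribbon2 s x t\<bar> \<le> 1/1000"
    unfolding ribbon1_def ribbon2_def c_def[symmetric] d_def[symmetric] abs_le_iff by argo
  then show "\<bar>ribbon1 s x t\<bar> \<le> 1" "\<bar>ribbon2 s x t\<bar> \<le> 1/1000" by blast+
qed

text \<open>The constant 1 matters: pairs of points at distance below 1/2000 stay that close, so the
  local lower bound of the next ribbon still applies to their images.\<close>

lemma ribbon_upper:
  assumes s: "s \<in> {0..1}" and t: "\<bar>t\<bar> \<le> 1/1000" "\<bar>t'\<bar> \<le> 1/1000"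
  shows "(ribbon1 s x t - ribbon1 s x' t')\<^sup>2 + (ribbon2 s x t - ribbon2 s x' t')\<^sup>2 \<le> (x - x')\<^sup>2 + (t - t')\<^sup>2"
proof -
  define c d where "c = cos (pi * s / 2)" and "d = sin (pi * s / 2)"
  have cd: "c\<^sup>2 + d\<^sup>2 = 1" by (simp add: c_def d_def)
  define h k where "h = \<bar>x - x'\<bar>" and "k = \<bar>t - t'\<bar>"
  have hk: "h \<ge> 0" "k \<ge> 0" by (auto simp: h_def k_def)
  have gen: "8000 * (u / 8000 - v / 8000) = u - v" for u v :: real by simp
  have X: "\<bar>cX c d x - cX c d x'\<bar> \<le> 9 * h" unfolding h_def
    by (rule lipschitz_of_deriv[OF cX_deriv[OF cd]]) (rule cy_bound(2)[OF cd])
  have Y: "\<bar>cY c d x - cY c d x'\<bar> \<le> 2 * h" unfolding h_def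
    by (rule lipschitz_of_deriv[OF cY_deriv]) (rule cy_bound(1)[OF cd])
  have "\<bar>(1 + s) * (cX c d x - cX c d x')\<bar> \<le> 2 * (9 * h)" "\<bar>(1 + s) * (cY c d x - cY c d x')\<bar> \<le> 2 * (2 * h)"
    unfolding abs_mult using s X Y by (intro mult_mono; auto)+
  moreover have "\<bar>(t - t') * cy c d x\<bar> \<le> k * 2" "\<bar>(t - t') * cp c d x\<bar> \<le> k * 9"
    unfolding abs_mult k_def using cy_bound[OF cd, of x] by (intro mult_mono; auto)+
  moreover have "\<bar>t' * (cy c d x - cy c d x')\<bar> \<le> 1/1000 * (3 * h)" "\<bar>t' * (cp c d x - cp c d x')\<bar> \<le> 1/1000 * (24 * h)"
    unfolding abs_mult h_def using t cy_lip[OF cd, of x x'] cp_lip[OF cd, of x x'] by (intro mult_mono; auto)+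
  ultimately have "\<bar>8000 * (ribbon1 s x t - ribbon1 s x' t')\<bar> \<le> 20 * (h + k)" "\<bar>8000 * (ribbon2 s x t - ribbon2 s x' t')\<bar> \<le> 20 * (h + k)"
    using hk unfolding ribbon1_def ribbon2_def c_def[symmetric] d_def[symmetric] gen abs_le_iff
    by (simp_all add: algebra_simps)
  then have "\<bar>ribbon1 s x t - ribbon1 s x' t'\<bar> \<le> (h + k) / 2 \<and> \<bar>ribbon2 s x t - ribbon2 s x' t'\<bar> \<le> (h + k) / 2"
    using hk unfolding abs_le_iff by argo
  then have "(ribbon1 s x t - ribbon1 s x' t')\<^sup>2 \<le> ((h + k) / 2)\<^sup>2" "(ribbon2 s x t - ribbon2 s x' t')\<^sup>2 \<le> ((h + k) / 2)\<^sup>2"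
    using hk by (auto intro!: abs_le_square_iff[THEN iffD1])
  moreover have "2 * ((h + k) / 2)\<^sup>2 \<le> h\<^sup>2 + k\<^sup>2"
    using sum_squares_bound[of h k] by (simp add: power2_eq_square algebra_simps)
  moreover have "h\<^sup>2 = (x - x')\<^sup>2" "k\<^sup>2 = (t - t')\<^sup>2" by (auto simp: h_def k_def)
  ultimately show ?thesis by linarith
qed

text \<open>To first order the map has the orthogonal columns a(p, q) and (-q, p), where (p, q) is
  the velocity of the curve, so it stretches by at least the square root of 7/16. The remainders are
  at most h/16 because \<open>h\<close> and the width of the ribbon are small. The resulting factor
  1/9 gives 24000 = 3 * 8000.\<close>

lemma ribbon_lower:
  assumes s: "s \<in> {0..1}" and t: "\<bar>t\<bar> \<le> 1/1000" "\<bar>t'\<bar> \<le> 1/1000" and x: "\<bar>x - x'\<bar> < 1/2000"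
  shows "(x - x')\<^sup>2 + (t - t')\<^sup>2 \<le> 24000\<^sup>2 * ((ribbon1 s x t - ribbon1 s x' t')\<^sup>2 + (ribbon2 s x t - ribbon2 s x' t')\<^sup>2)"
proof -
  define c d where "c = cos (pi * s / 2)" and "d = sin (pi * s / 2)"
  have cd: "c\<^sup>2 + d\<^sup>2 = 1" by (simp add: c_def d_def)
  define h k where "h = x - x'" and "k = t - t'"
  define p q where "p = cp c d x'" and "q = cy c d x'"
  define a where "a = 1 + s"
  define r1 where "r1 = a * (cX c d x - cX c d x' - p * h) - t * (cy c d x - q)"
  define r2 where "r2 = a * (cY c d x - cY c d x' - q * h) + t * (cp c d x - p)"
  have "\<bar>cX c d x - cX c d x' - p * h\<bar> \<le> 24 * h\<^sup>2" unfolding h_def p_def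
    by (rule first_order[OF cX_deriv[OF cd] cp_lip[OF cd]]) simp
  moreover have "\<bar>cY c d x - cY c d x' - q * h\<bar> \<le> 3 * h\<^sup>2" unfolding h_def q_def
    by (rule first_order[OF cY_deriv cy_lip[OF cd]]) simp
  ultimately have "\<bar>a * (cX c d x - cX c d x' - p * h)\<bar> \<le> 2 * (24 * h\<^sup>2)" "\<bar>a * (cY c d x - cY c d x' - q * h)\<bar> \<le> 2 * (3 * h\<^sup>2)"
    unfolding abs_mult a_def using s by (intro mult_mono; auto)+
  moreover have "\<bar>t * (cy c d x - q)\<bar> \<le> 1/1000 * (3 * \<bar>h\<bar>)" "\<bar>t * (cp c d x - p)\<bar> \<le> 1/1000 * (24 * \<bar>h\<bar>)"
    unfolding abs_mult h_def p_def q_def using t cy_lip[OF cd, of x x'] cp_lip[OF cd, of x x'] by (intro mult_mono; auto)+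
  moreover have "h\<^sup>2 \<le> 1/2000 * \<bar>h\<bar>"
    using mult_right_mono[of "\<bar>h\<bar>" "1/2000" "\<bar>h\<bar>"] x by (simp add: h_def power2_eq_square)
  ultimately have r: "\<bar>r1\<bar> \<le> \<bar>h\<bar> / 16" "\<bar>r2\<bar> \<le> \<bar>h\<bar> / 16"
    unfolding r1_def r2_def using abs_ge_zero[of h] by linarith+
  have gen: "8000 * (u / 8000 - v / 8000) = u - v" for u v :: real by simp
  have e1: "8000 * (ribbon1 s x t - ribbon1 s x' t') = (a * p * h - k * q) + r1"
    unfolding ribbon1_def c_def[symmetric] d_def[symmetric] r1_def a_def p_def q_def k_def gen by (simp add: algebra_simps)
  have e2: "8000 * (ribbon2 s x t - ribbon2 s x' t') = (a * q * h + k * p) + r2"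
    unfolding ribbon2_def c_def[symmetric] d_def[symmetric] r2_def a_def p_def q_def k_def gen by (simp add: algebra_simps)
  have half: "(m + r)\<^sup>2 \<ge> m\<^sup>2 / 2 - r\<^sup>2" for m r :: real
    using zero_le_power2[of "m + 2 * r"] by (simp add: power2_eq_square algebra_simps)
  have "(a * p * h - k * q)\<^sup>2 + (a * q * h + k * p)\<^sup>2 = (a\<^sup>2 * h\<^sup>2 + k\<^sup>2) * (p\<^sup>2 + q\<^sup>2)"
    by (simp add: power2_eq_square algebra_simps)
  also have "\<dots> \<ge> (h\<^sup>2 + k\<^sup>2) * (7/16)"
  proof (intro mult_mono)
    have "1 \<le> a\<^sup>2" using s by (simp add: a_def)
    then show "h\<^sup>2 + k\<^sup>2 \<le> a\<^sup>2 * h\<^sup>2 + k\<^sup>2" using mult_right_mono[of 1 "a\<^sup>2" "h\<^sup>2"] by simp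
    \<comment> \<open>Completing the square in (1 - 2 q^2)^2 + q^2 gives the minimal speed.\<close>
    have "p\<^sup>2 + q\<^sup>2 = 7/16 + (2 * q\<^sup>2 - 3/4)\<^sup>2"
      by (simp add: p_def q_def cp_def power2_eq_square algebra_simps)
    then show "7/16 \<le> p\<^sup>2 + q\<^sup>2" by simp
  qed auto
  finally have "(h\<^sup>2 + k\<^sup>2) * (7/16) \<le> (a * p * h - k * q)\<^sup>2 + (a * q * h + k * p)\<^sup>2" .
  moreover have "r1\<^sup>2 \<le> h\<^sup>2 / 256" "r2\<^sup>2 \<le> h\<^sup>2 / 256"
    using r abs_le_square_iff[of r1 "h / 16"] abs_le_square_iff[of r2 "h / 16"] by (auto simp: power_divide)
  ultimately have "(h\<^sup>2 + k\<^sup>2) / 9 \<le> (8000 * (ribbon1 s x t - ribbon1 s x' t'))\<^sup>2 + (8000 * (ribbon2 s x t - ribbon2 s x' t'))\<^sup>2"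
    using half[of "a * p * h - k * q" r1] half[of "a * q * h + k * p" r2] zero_le_power2[of h] zero_le_power2[of k]
    unfolding e1 e2 by argo
  then show ?thesis unfolding h_def k_def power_mult_distrib by simp
qed

lemma ribbon_slab:
  assumes be: "norm b = 1" "norm e = 1" "b \<bullet> e = 0" and s: "s \<in> {0..1}" and z: "\<bar>z \<bullet> e\<bar> \<le> 1/1000"
  shows "\<bar>ribbon e b s z \<bullet> e\<bar> \<le> 1/1000" "\<bar>ribbon e b s z \<bullet> b\<bar> \<le> 1"
proof -
  have "b \<bullet> b = 1" "e \<bullet> e = 1" "e \<bullet> b = 0" using be by (auto simp: norm_eq_1 inner_commute)
  then have "ribbon e b s z \<bullet> e = ribbon2 s (z \<bullet> b) (z \<bullet> e)" "ribbon e b s z \<bullet> b = ribbon1 s (z \<bullet> b) (z \<bullet> e)"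
    using be by (auto simp: ribbon_def on_plane_def inner_add_left)
  then show "\<bar>ribbon e b s z \<bullet> e\<bar> \<le> 1/1000" "\<bar>ribbon e b s z \<bullet> b\<bar> \<le> 1"
    using ribbon_bound[OF s z] by simp_all
qed

lemma ribbon_immersion:
  assumes be: "norm b = 1" "norm e = 1" "b \<bullet> e = 0" and s: "s \<in> {0..1}"
    and z: "\<bar>z \<bullet> e\<bar> \<le> 1/1000" "\<bar>w \<bullet> e\<bar> \<le> 1/1000"
  shows "dist (ribbon e b s z) (ribbon e b s w) \<le> dist z w"
    and "dist z w < 1/2000 \<Longrightarrow> dist z w \<le> 24000 * dist (ribbon e b s z) (ribbon e b s w)"
proof -
  show "dist (ribbon e b s z) (ribbon e b s w) \<le> dist z w"
    using on_plane_upper[OF be, of 1] ribbon_upper[OF s z] unfolding ribbon_def by simp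
  assume d: "dist z w < 1/2000"
  have "\<bar>z \<bullet> b - w \<bullet> b\<bar> \<le> dist z w"
    using Cauchy_Schwarz_ineq2[of "z - w" b] be by (simp add: dist_norm inner_diff_left)
  then show "dist z w \<le> 24000 * dist (ribbon e b s z) (ribbon e b s w)"
    unfolding ribbon_def using d by (intro on_plane_lower[OF be] ribbon_lower[OF s z]) auto
qed

lemma ribbon_param:
  assumes be: "norm b = 1" "norm e = 1" "b \<bullet> e = 0" and s: "s \<in> {0..1}" "s' \<in> {0..1}"
    and z: "\<bar>z \<bullet> e\<bar> \<le> 1/1000"
  shows "dist (ribbon e b s z) (ribbon e b s' z) \<le> \<bar>s - s'\<bar>"
proof -
  define c where "c \<sigma> = cos (pi * \<sigma> / 2)" for \<sigma>
  define d where "d \<sigma> = sin (pi * \<sigma> / 2)" for \<sigma>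
  have cd: "(c \<sigma>)\<^sup>2 + (d \<sigma>)\<^sup>2 = 1" for \<sigma> by (simp add: c_def d_def)
  note b1 = abs_cos_sin_bound[OF cd]
  have pi: "\<bar>pi / 2\<bar> \<le> 2" using pi_less_4 pi_gt_zero by auto
  have lc: "\<bar>c s - c s'\<bar> \<le> 2 * \<bar>s - s'\<bar>"
  proof (rule lipschitz_of_deriv)
    fix x show "(c has_real_derivative - sin (pi * x / 2) * (pi / 2)) (at x)"
      unfolding c_def by (auto intro!: derivative_eq_intros)
    show "\<bar>- sin (pi * x / 2) * (pi / 2)\<bar> \<le> 2"
      using abs_mult_le1[OF _ pi, of "- sin (pi * x / 2)"] by simp
  qed
  have ld: "\<bar>d s - d s'\<bar> \<le> 2 * \<bar>s - s'\<bar>"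
  proof (rule lipschitz_of_deriv)
    fix x show "(d has_real_derivative cos (pi * x / 2) * (pi / 2)) (at x)"
      unfolding d_def by (auto intro!: derivative_eq_intros)
    show "\<bar>cos (pi * x / 2) * (pi / 2)\<bar> \<le> 2"
      using abs_mult_le1[OF _ pi, of "cos (pi * x / 2)"] by simp
  qed
  define \<delta> where "\<delta> = \<bar>s - s'\<bar>"
  have \<delta>: "\<delta> \<ge> 0" by (simp add: \<delta>_def)
  have pr: "\<bar>u * v - u' * v'\<bar> \<le> B' * \<bar>u - u'\<bar> + B * \<bar>v - v'\<bar>" if "\<bar>u'\<bar> \<le> B" "\<bar>v\<bar> \<le> B'" for u v u' v' B B' :: real
  proof -
    have "u * v - u' * v' = v * (u - u') + u' * (v - v')" by (simp add: algebra_simps)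
    then have "\<bar>u * v - u' * v'\<bar> \<le> \<bar>v\<bar> * \<bar>u - u'\<bar> + \<bar>u'\<bar> * \<bar>v - v'\<bar>"
      by (metis abs_mult abs_triangle_ineq)
    then show ?thesis using that mult_right_mono[of "\<bar>v\<bar>" B' "\<bar>u - u'\<bar>"] mult_right_mono[of "\<bar>u'\<bar>" B "\<bar>v - v'\<bar>"] by simp
  qed
  have sm: "\<bar>u * v\<bar> \<le> B" if "\<bar>u\<bar> \<le> B" "\<bar>v\<bar> \<le> 1" for u v B :: real
    using abs_mult_le1[OF that(2,1)] by (simp add: mult.commute)
  have cc: "\<bar>c s * c s - c s' * c s'\<bar> \<le> 4 * \<delta>" "\<bar>d s * d s - d s' * d s'\<bar> \<le> 4 * \<delta>" "\<bar>c s * d s - c s' * d s'\<bar> \<le> 4 * \<delta>"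
    using pr[OF b1(1)[of s'] b1(1)[of s], of "c s" "c s'"] pr[OF b1(2)[of s'] b1(2)[of s], of "d s" "d s'"]
      pr[OF b1(1)[of s'] b1(2)[of s], of "c s" "d s'"] lc ld unfolding \<delta>_def[symmetric] by linarith+
  define x t where "x = z \<bullet> b" and "t = z \<bullet> e"
  have t: "\<bar>t\<bar> \<le> 1/1000" using z by (simp add: t_def)
  have y: "\<bar>cy (c s) (d s) x - cy (c s') (d s') x\<bar> \<le> 4 * \<delta>"
  proof -
    have "cy (c s) (d s) x - cy (c s') (d s') x = (c s - c s') * cos x + (d s - d s') * cos (2 * x)"
      by (simp add: cy_def algebra_simps)
    moreover have "\<bar>(c s - c s') * cos x\<bar> \<le> 2 * \<delta>" "\<bar>(d s - d s') * cos (2 * x)\<bar> \<le> 2 * \<delta>"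
      using lc ld by (auto intro!: sm simp: \<delta>_def)
    ultimately show ?thesis unfolding abs_le_iff by argo
  qed
  have Y: "\<bar>cY (c s) (d s) x - cY (c s') (d s') x\<bar> \<le> 3 * \<delta>"
  proof -
    have "cY (c s) (d s) x - cY (c s') (d s') x = (c s - c s') * sin x + (d s - d s') * sin (2 * x) / 2"
      by (simp add: cY_def algebra_simps diff_divide_distrib)
    moreover have "\<bar>(c s - c s') * sin x\<bar> \<le> 2 * \<delta>" "\<bar>(d s - d s') * sin (2 * x)\<bar> \<le> 2 * \<delta>"
      using lc ld by (auto intro!: sm simp: \<delta>_def)
    ultimately show ?thesis unfolding abs_le_iff by argo
  qed
  have X: "\<bar>cX (c s) (d s) x - cX (c s') (d s') x\<bar> \<le> 14 * \<delta>"
  proof -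
    have "cX (c s) (d s) x - cX (c s') (d s') x = - ((c s * c s - c s' * c s') * sin (2 * x) / 2 + (d s * d s - d s' * d s') * sin (4 * x) / 4
      + 2 * ((c s * d s - c s' * d s') * sin x) + 2/3 * ((c s * d s - c s' * d s') * sin (3 * x)))"
      by (simp add: cX_def power2_eq_square algebra_simps diff_divide_distrib add_divide_distrib)
    moreover have "\<bar>(c s * c s - c s' * c s') * sin (2 * x)\<bar> \<le> 4 * \<delta>" "\<bar>(d s * d s - d s' * d s') * sin (4 * x)\<bar> \<le> 4 * \<delta>"
      "\<bar>(c s * d s - c s' * d s') * sin x\<bar> \<le> 4 * \<delta>" "\<bar>(c s * d s - c s' * d s') * sin (3 * x)\<bar> \<le> 4 * \<delta>"
      using cc by (auto intro!: sm)
    ultimately show ?thesis using \<delta> unfolding abs_le_iff by argo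
  qed
  have p: "\<bar>cp (c s) (d s) x - cp (c s') (d s') x\<bar> \<le> 32 * \<delta>"
    using pr[OF cy_bound(1)[OF cd[of s'], of x] cy_bound(1)[OF cd[of s], of x], of "cy (c s) (d s) x" "cy (c s') (d s') x"] y
    unfolding cp_def power2_eq_square by argo
  have 1: "\<bar>(1 + s) * cX (c s) (d s) x - (1 + s') * cX (c s') (d s') x\<bar> \<le> 32 * \<delta>"
    using pr[of "1 + s'" 2 "cX (c s) (d s) x" 4 "1 + s" "cX (c s') (d s') x"] s cXY_bound(1)[OF cd[of s], of x] X by (auto simp: \<delta>_def)
  have 2: "\<bar>(1 + s) * cY (c s) (d s) x - (1 + s') * cY (c s') (d s') x\<bar> \<le> 8 * \<delta>"
    using pr[of "1 + s'" 2 "cY (c s) (d s) x" 2 "1 + s" "cY (c s') (d s') x"] s cXY_bound(2)[OF cd[of s], of x] Y by (auto simp: \<delta>_def)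
  have 3: "\<bar>t * (cy (c s) (d s) x - cy (c s') (d s') x)\<bar> \<le> 4 * \<delta>" "\<bar>t * (cp (c s) (d s) x - cp (c s') (d s') x)\<bar> \<le> 32 * \<delta>"
    using t y p by (auto intro!: abs_mult_le1)
  have e: "8000 * (u / 8000 - v / 8000) = u - v" for u v :: real by simp
  have "8000 * (ribbon1 s x t - ribbon1 s' x t) = ((1 + s) * cX (c s) (d s) x - (1 + s') * cX (c s') (d s') x) - t * (cy (c s) (d s) x - cy (c s') (d s') x)"
    "8000 * (ribbon2 s x t - ribbon2 s' x t) = ((1 + s) * cY (c s) (d s) x - (1 + s') * cY (c s') (d s') x) + t * (cp (c s) (d s) x - cp (c s') (d s') x)"
    unfolding ribbon1_def ribbon2_def c_def[symmetric] d_def[symmetric] e by (simp_all add: algebra_simps)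
  then have "\<bar>ribbon1 s x t - ribbon1 s' x t\<bar> \<le> \<delta> / 2 \<and> \<bar>ribbon2 s x t - ribbon2 s' x t\<bar> \<le> \<delta> / 2"
    using 1 2 3 \<delta> unfolding abs_le_iff by argo
  then have "(ribbon1 s x t - ribbon1 s' x t)\<^sup>2 \<le> (\<delta> / 2)\<^sup>2" "(ribbon2 s x t - ribbon2 s' x t)\<^sup>2 \<le> (\<delta> / 2)\<^sup>2"
    using \<delta> by (auto intro!: abs_le_square_iff[THEN iffD1])
  moreover have "(\<delta> / 2)\<^sup>2 + (\<delta> / 2)\<^sup>2 \<le> \<delta>\<^sup>2" by (simp add: power_divide)
  moreover have "(dist (ribbon e b s z) (ribbon e b s' z))\<^sup>2 = (ribbon1 s x t - ribbon1 s' x t)\<^sup>2 + (ribbon2 s x t - ribbon2 s' x t)\<^sup>2"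
    unfolding ribbon_def on_plane_norm[OF be] x_def t_def by simp
  ultimately have "(dist (ribbon e b s z) (ribbon e b s' z))\<^sup>2 \<le> \<delta>\<^sup>2" by linarith
  then show ?thesis using \<delta> unfolding \<delta>_def by (rule power2_le_imp_le)
qed

text \<open>For s = 1 only the second harmonic is left. Its antiderivatives carry an additional
  factor 1/2, which the factor 1 + s in the ribbon compensates.\<close>

lemma ribbon_double:
  assumes "norm b = 1" "b \<bullet> e = 0"
  shows "ribbon e b 1 z = ribbon e b 0 (z + (z \<bullet> b) *\<^sub>R b)"
proof -
  have bb: "b \<bullet> b = 1" using assms by (simp add: norm_eq_1)
  have "ribbon1 1 x t = ribbon1 0 (2 * x) t" "ribbon2 1 x t = ribbon2 0 (2 * x) t" for x t
    by (auto simp: ribbon1_def ribbon2_def cX_def cY_def cy_def cp_def)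
  then show ?thesis
    using assms bb unfolding ribbon_def on_plane_def
    by (simp add: inner_add_left algebra_simps) (simp flip: scaleR_add_left)
qed

text \<open>Each ribbon bounds the coordinate in its own direction and leaves those in the other
  directions orthogonal to \<open>e\<close> alone, so the composition over all of them maps the slab
  into a bounded set.\<close>

primrec ribbons :: "'a::euclidean_space \<Rightarrow> 'a list \<Rightarrow> real \<Rightarrow> 'a \<Rightarrow> 'a" where
  "ribbons e [] s z = z"
| "ribbons e (b # bs) s z = ribbon e b s (ribbons e bs s z)"

lemma Basis_orthonormal:
  assumes "e \<in> Basis" "b \<in> Basis - {e}"
  shows "norm b = 1" "norm e = 1" "b \<bullet> e = 0"
  using assms inner_not_same_Basis[of b e] by auto

lemma ribbon_other:
  assumes "e \<in> Basis" "b \<in> Basis - {e}" "b' \<in> Basis - {e}" "b' \<noteq> b"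
  shows "ribbon e b s z \<bullet> b' = z \<bullet> b'"
  using assms inner_not_same_Basis[of b b'] inner_not_same_Basis[of e b']
  by (auto simp: ribbon_def on_plane_def inner_add_left)

lemma ribbons_slab:
  assumes e: "e \<in> Basis" and bs: "set bs \<subseteq> Basis - {e}" and s: "s \<in> {0..1}" and z: "\<bar>z \<bullet> e\<bar> \<le> 1/1000"
  shows "\<bar>ribbons e bs s z \<bullet> e\<bar> \<le> 1/1000 \<and> (\<forall>b\<in>set bs. \<bar>ribbons e bs s z \<bullet> b\<bar> \<le> 1)"
  using bs
proof (induction bs)
  case (Cons b bs)
  then have IH: "\<bar>ribbons e bs s z \<bullet> e\<bar> \<le> 1/1000" "\<And>b'. b' \<in> set bs \<Longrightarrow> \<bar>ribbons e bs s z \<bullet> b'\<bar> \<le> 1" by auto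
  have b: "b \<in> Basis - {e}" using Cons.prems by simp
  note be = Basis_orthonormal[OF e b]
  have "\<bar>ribbons e (b # bs) s z \<bullet> b'\<bar> \<le> 1" if "b' \<in> set (b # bs)" for b'
  proof (cases "b' = b")
    case True
    then show ?thesis using ribbon_slab(2)[OF be s IH(1)] by simp
  next
    case False
    moreover have "b' \<in> Basis - {e}" using that Cons.prems by auto
    ultimately show ?thesis using ribbon_other[OF e b, of b'] IH(2)[of b'] that by simp
  qed
  then show ?case using ribbon_slab(1)[OF be s IH(1)] by simp
qed (use z in auto)

lemma ribbons_immersion:
  assumes e: "e \<in> Basis" and bs: "set bs \<subseteq> Basis - {e}" and s: "s \<in> {0..1}"
    and z: "\<bar>z \<bullet> e\<bar> \<le> 1/1000" and w: "\<bar>w \<bullet> e\<bar> \<le> 1/1000"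
  shows "dist (ribbons e bs s z) (ribbons e bs s w) \<le> dist z w \<and>
    (dist z w < 1/2000 \<longrightarrow> dist z w \<le> 24000 ^ length bs * dist (ribbons e bs s z) (ribbons e bs s w))"
  using bs
proof (induction bs)
  case (Cons b bs)
  have b: "b \<in> Basis - {e}" using Cons.prems by simp
  note be = Basis_orthonormal[OF e b]
  define z' w' where "z' = ribbons e bs s z" and "w' = ribbons e bs s w"
  have IH: "dist z' w' \<le> dist z w" "dist z w < 1/2000 \<Longrightarrow> dist z w \<le> 24000 ^ length bs * dist z' w'"
    using Cons by (auto simp: z'_def w'_def)
  have sl: "\<bar>z' \<bullet> e\<bar> \<le> 1/1000" "\<bar>w' \<bullet> e\<bar> \<le> 1/1000"
    using ribbons_slab[OF e _ s z, of bs] ribbons_slab[OF e _ s w, of bs] Cons.prems by (auto simp: z'_def w'_def)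
  note im = ribbon_immersion[OF be s sl]
  have "dist z w \<le> 24000 ^ length (b # bs) * dist (ribbon e b s z') (ribbon e b s w')" if "dist z w < 1/2000"
  proof -
    have "dist z' w' \<le> 24000 * dist (ribbon e b s z') (ribbon e b s w')" using im(2) IH(1) that by simp
    then have "24000 ^ length bs * dist z' w' \<le> 24000 ^ length bs * (24000 * dist (ribbon e b s z') (ribbon e b s w'))"
      by (intro mult_left_mono) auto
    moreover have "24000 ^ length (b # bs) * dist (ribbon e b s z') (ribbon e b s w') =
        24000 ^ length bs * (24000 * dist (ribbon e b s z') (ribbon e b s w'))" by simp
    ultimately show ?thesis using IH(2)[OF that] by linarith
  qed
  then show ?case using im(1) IH(1) unfolding z'_def w'_def by auto
qed auto

lemma ribbons_param:
  assumes e: "e \<in> Basis" and bs: "set bs \<subseteq> Basis - {e}" and s: "s \<in> {0..1}" "s' \<in> {0..1}"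
    and z: "\<bar>z \<bullet> e\<bar> \<le> 1/1000"
  shows "dist (ribbons e bs s z) (ribbons e bs s' z) \<le> real (length bs) * \<bar>s - s'\<bar>"
  using bs
proof (induction bs)
  case (Cons b bs)
  have b: "b \<in> Basis - {e}" using Cons.prems by simp
  note be = Basis_orthonormal[OF e b]
  define z' w' where "z' = ribbons e bs s z" and "w' = ribbons e bs s' z"
  have sl: "\<bar>z' \<bullet> e\<bar> \<le> 1/1000" "\<bar>w' \<bullet> e\<bar> \<le> 1/1000"
    using ribbons_slab[OF e _ s(1) z, of bs] ribbons_slab[OF e _ s(2) z, of bs] Cons.prems by (auto simp: z'_def w'_def)
  have "dist (ribbon e b s z') (ribbon e b s' w') \<le> dist (ribbon e b s z') (ribbon e b s w') + dist (ribbon e b s w') (ribbon e b s' w')"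
    by (rule dist_triangle)
  also have "\<dots> \<le> dist z' w' + \<bar>s - s'\<bar>"
    by (intro add_mono ribbon_immersion(1)[OF be s(1) sl] ribbon_param[OF be s sl(2)])
  also have "\<dots> \<le> real (length bs) * \<bar>s - s'\<bar> + \<bar>s - s'\<bar>" using Cons by (simp add: z'_def w'_def)
  finally show ?case by (simp add: z'_def w'_def algebra_simps)
qed auto

definition dbl :: "'a::euclidean_space \<Rightarrow> 'a \<Rightarrow> 'a"
  where "dbl b z = z + (z \<bullet> b) *\<^sub>R b"

text \<open>Ribbons in other directions neither use nor change the coordinate along
  \<open>b\<close>. In the induction for the doubling property this moves a doubling past the
  ribbons already composed.\<close>

lemma ribbons_dbl:
  assumes e: "e \<in> Basis" and bs: "set bs \<subseteq> Basis - {e}" and b: "b \<in> Basis - {e}" "b \<notin> set bs"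
  shows "ribbons e bs s (dbl b z) = dbl b (ribbons e bs s z)"
  using bs b(2)
proof (induction bs)
  case (Cons b' bs)
  have b': "b' \<in> Basis - {e}" "b' \<noteq> b" using Cons.prems by auto
  have o: "b \<bullet> b' = 0" "b \<bullet> e = 0" "b' \<bullet> b = 0" "e \<bullet> b = 0"
    using b'(1,2) b(1) e inner_not_same_Basis by (metis DiffD1 DiffD2 insertI1)+
  show ?case using Cons o by (simp add: ribbon_def on_plane_def dbl_def inner_add_left algebra_simps)
qed auto

lemma ribbons_double:
  assumes e: "e \<in> Basis" and bs: "set bs \<subseteq> Basis - {e}" "distinct bs"
  shows "ribbons e bs 1 z = ribbons e bs 0 (z + (\<Sum>b\<in>set bs. (z \<bullet> b) *\<^sub>R b))"
  using bs
proof (induction bs)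
  case (Cons b bs)
  have b: "b \<in> Basis - {e}" using Cons.prems by simp
  note be = Basis_orthonormal[OF e b]
  define w where "w = z + (\<Sum>b\<in>set bs. (z \<bullet> b) *\<^sub>R b)"
  have "ribbons e (b # bs) 1 z = ribbon e b 0 (dbl b (ribbons e bs 0 w))"
    using Cons ribbon_double[OF be(1,3)] by (simp add: w_def dbl_def)
  also have "dbl b (ribbons e bs 0 w) = ribbons e bs 0 (dbl b w)"
    using ribbons_dbl[OF e _ b, of bs] Cons.prems by simp
  also have "dbl b w = z + (\<Sum>b\<in>set (b # bs). (z \<bullet> b) *\<^sub>R b)"
  proof -
    have "(\<Sum>x\<in>set bs. (z \<bullet> x) *\<^sub>R x) \<bullet> b = 0"
      unfolding inner_sum_left using Cons.prems b inner_not_same_Basis by (intro sum.neutral) auto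
    then have "w \<bullet> b = z \<bullet> b" by (simp add: w_def inner_add_left)
    then show ?thesis using Cons.prems by (simp add: dbl_def w_def algebra_simps)
  qed
  finally show ?case by simp
qed auto

text \<open>Heights below 10 are sent to heights of at most 1/1000, where the ribbons live. The
  factor 1 + s doubles the height between s = 0 and s = 1, as the ribbons do for the other
  coordinates.\<close>

definition squeeze :: "'a::euclidean_space \<Rightarrow> real \<Rightarrow> 'a \<Rightarrow> 'a"
  where "squeeze e s = push e (\<lambda>t. ((1 + s) / 20000 - 1) * t)"

lemma squeeze_bilip:
  assumes e: "norm e = 1" and s: "s \<in> {0..1}"
  shows "bilip 20000 UNIV (squeeze e s)"
  unfolding squeeze_def
proof (rule bilip_push[OF e])
  fix u v :: real assume uv: "u \<le> v"
  have "(v + ((1 + s) / 20000 - 1) * v) - (u + ((1 + s) / 20000 - 1) * u) = (1 + s) * (v - u) / 20000"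
    by (simp add: field_simps)
  moreover have "v - u \<le> (1 + s) * (v - u)" "(1 + s) * (v - u) \<le> 2 * (v - u)"
    using s uv mult_right_mono[of 1 "1 + s" "v - u"] mult_right_mono[of "1 + s" 2 "v - u"] by auto
  ultimately show "v - u \<le> 20000 * (v + ((1 + s) / 20000 - 1) * v - (u + ((1 + s) / 20000 - 1) * u)) \<and>
           v + ((1 + s) / 20000 - 1) * v - (u + ((1 + s) / 20000 - 1) * u) \<le> 20000 * (v - u)"
    using uv by (intro conjI) argo+
qed simp

lemma squeeze_inner:
  assumes "norm e = 1"
  shows "squeeze e s z \<bullet> e = (1 + s) * (z \<bullet> e) / 20000"
  using assms by (simp add: squeeze_def push_def inner_add_left norm_eq_1 field_simps)

lemma immersion_family_exists:
  fixes e :: "'a::euclidean_space"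
  assumes e: "e \<in> Basis"
  obtains bs r L R where "set bs = Basis - {e}" "immersion_family (\<lambda>s z. ribbons e bs s (squeeze e s z)) e r L R"
proof -
  obtain bs where bs: "set bs = Basis - {e}" "distinct bs"
    using finite_distinct_list[of "Basis - {e}"] by auto
  have e1: "norm e = 1" "e \<bullet> e = 1" using e by auto
  define k where "k = length bs"
  define L where "L = 20000 * 24000 ^ k + real k + 1"
  have L1: "L \<ge> 20000 * 24000 ^ k" "L \<ge> real k + 1" "L \<ge> 20000" "L \<ge> 1"
  proof -
    have "1 \<le> (24000::real) ^ k" by simp
    then show "L \<ge> 20000 * 24000 ^ k" "L \<ge> real k + 1" "L \<ge> 20000" "L \<ge> 1" unfolding L_def by linarith+
  qed
  define A where "A s z = ribbons e bs s (squeeze e s z)" for s z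
  have sl: "\<bar>squeeze e s z \<bullet> e\<bar> \<le> 1/1000" if "s \<in> {0..1}" "\<bar>z \<bullet> e\<bar> < 10" for s z
  proof -
    have "\<bar>(1 + s) * (z \<bullet> e)\<bar> \<le> 2 * 10" unfolding abs_mult using that by (intro mult_mono) auto
    then show ?thesis unfolding squeeze_inner[OF e1(1)] by simp
  qed
  \<comment> \<open>The radius is 1/2000, the scale of the ribbons, divided by the Lipschitz
    constant 20000 of the squeezing. Every coordinate of the image is at most 1 in absolute value,
    whence the bound by the dimension.\<close>
  have "immersion_family A e (1/40000000) L (real DIM('a))"
  proof
    fix s :: real assume s: "s \<in> {0..1}"
    show "uniform_immersion (1/40000000) L {z. \<bar>z \<bullet> e\<bar> < 10} (A s)"
      unfolding uniform_immersion_def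
    proof (intro conjI ballI impI)
      fix z w assume z: "z \<in> {z. \<bar>z \<bullet> e\<bar> < 10}" "w \<in> {z. \<bar>z \<bullet> e\<bar> < 10}" and d: "dist z w < 1/40000000"
      define z' w' where "z' = squeeze e s z" and "w' = squeeze e s w"
      have b: "dist z w \<le> 20000 * dist z' w'" "dist z' w' \<le> 20000 * dist z w"
        using bilipD[OF squeeze_bilip[OF e1(1) s]] by (auto simp: z'_def w'_def)
      have "dist z' w' < 1/2000" using b(2) d by simp
      moreover have "\<bar>z' \<bullet> e\<bar> \<le> 1/1000" "\<bar>w' \<bullet> e\<bar> \<le> 1/1000" using sl[OF s] z by (auto simp: z'_def w'_def)
      ultimately have r: "dist (A s z) (A s w) \<le> dist z' w'" "dist z' w' \<le> 24000 ^ k * dist (A s z) (A s w)"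
        using ribbons_immersion[OF e _ s, of bs z' w'] bs by (auto simp: A_def k_def z'_def w'_def)
      have "dist z w \<le> 20000 * (24000 ^ k * dist (A s z) (A s w))" using b(1) r(2) by linarith
      also have "\<dots> \<le> L * dist (A s z) (A s w)" using L1(1) by (simp flip: mult.assoc add: mult_right_mono)
      finally show "dist z w \<le> L * dist (A s z) (A s w)" .
      have "dist (A s z) (A s w) \<le> 20000 * dist z w" using b r by linarith
      also have "\<dots> \<le> L * dist z w" using L1 by (intro mult_right_mono) auto
      finally show "dist (A s z) (A s w) \<le> L * dist z w" .
    qed (use L1 in auto)
  next
    fix s s' :: real and z :: 'a assume s: "s \<in> {0..1}" "s' \<in> {0..1}" and z: "\<bar>z \<bullet> e\<bar> < 10"
    have "dist (squeeze e s z) (squeeze e s' z) = \<bar>s - s'\<bar> * \<bar>z \<bullet> e\<bar> / 20000"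
    proof -
      have "squeeze e s z - squeeze e s' z = ((s - s') * (z \<bullet> e) / 20000) *\<^sub>R e"
      proof -
        have "((1 + s) / 20000 - 1) * (z \<bullet> e) - ((1 + s') / 20000 - 1) * (z \<bullet> e) = (s - s') * (z \<bullet> e) / 20000"
          by (simp add: field_simps)
        then show ?thesis by (simp add: squeeze_def push_def flip: scaleR_diff_left)
      qed
      then show ?thesis using e1 by (simp add: dist_norm abs_mult)
    qed
    also have "\<dots> \<le> \<bar>s - s'\<bar>" using z mult_left_mono[of "\<bar>z \<bullet> e\<bar>" 20000 "\<bar>s - s'\<bar>"] by simp
    finally have 1: "dist (squeeze e s z) (squeeze e s' z) \<le> \<bar>s - s'\<bar>" .
    have "dist (A s z) (A s' z) \<le> dist (A s z) (ribbons e bs s (squeeze e s' z)) + dist (ribbons e bs s (squeeze e s' z)) (A s' z)"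
      by (rule dist_triangle)
    also have "dist (A s z) (ribbons e bs s (squeeze e s' z)) \<le> dist (squeeze e s z) (squeeze e s' z)"
      using ribbons_immersion[OF e _ s(1) sl[OF s(1) z] sl[OF s(2) z], of bs] bs by (simp add: A_def)
    also have "dist (ribbons e bs s (squeeze e s' z)) (A s' z) \<le> real k * \<bar>s - s'\<bar>"
      using ribbons_param[OF e _ s sl[OF s(2) z], of bs] bs by (simp add: A_def k_def)
    finally have "dist (A s z) (A s' z) \<le> (real k + 1) * \<bar>s - s'\<bar>" using 1 by (simp add: algebra_simps)
    also have "\<dots> \<le> L * \<bar>s - s'\<bar>" using L1 by (intro mult_right_mono) auto
    finally show "dist (A s z) (A s' z) \<le> L * \<bar>s - s'\<bar>" .
  next
    fix z
    define y where "y = squeeze e 1 z"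
    have "y + (\<Sum>b\<in>set bs. (y \<bullet> b) *\<^sub>R b) = squeeze e 0 (2 *\<^sub>R z)"
    proof (rule euclidean_eqI)
      fix b :: 'a assume b: "b \<in> Basis"
      have s: "(\<Sum>b\<in>set bs. (y \<bullet> b) *\<^sub>R b) \<bullet> b = (\<Sum>b'\<in>set bs. if b' = b then y \<bullet> b else 0)"
        unfolding inner_sum_left
      proof (rule sum.cong[OF refl])
        fix b' assume "b' \<in> set bs"
        then have "b' \<in> Basis" using bs(1) by blast
        then show "(y \<bullet> b') *\<^sub>R b' \<bullet> b = (if b' = b then y \<bullet> b else 0)" using b by (simp add: inner_Basis)
      qed
      have s': "(\<Sum>b\<in>set bs. (y \<bullet> b) *\<^sub>R b) \<bullet> b = (if b = e then 0 else y \<bullet> b)"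
        unfolding s using b by (simp add: bs(1))
      have ye: "y \<bullet> e = 2 * (z \<bullet> e) / 20000" unfolding y_def squeeze_inner[OF e1(1)] by simp
      have yb: "y \<bullet> b = z \<bullet> b" if "b \<noteq> e"
        using that b e by (simp add: y_def squeeze_def push_def inner_add_left inner_diff_left inner_Basis)
      show "(y + (\<Sum>b\<in>set bs. (y \<bullet> b) *\<^sub>R b)) \<bullet> b = squeeze e 0 (2 *\<^sub>R z) \<bullet> b"
      proof (cases "b = e")
        case True
        have "squeeze e 0 (2 *\<^sub>R z) \<bullet> e = 2 * (z \<bullet> e) / 20000" unfolding squeeze_inner[OF e1(1)] by simp
        then show ?thesis using ye s' True by (simp add: inner_add_left)
      next
        case False
        then have "squeeze e 0 (2 *\<^sub>R z) \<bullet> b = 2 * (z \<bullet> b)"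
          using b e by (simp add: squeeze_def push_def inner_add_left inner_diff_left inner_Basis)
        then show ?thesis using yb s' False by (simp add: inner_add_left)
      qed
    qed
    then show "A 1 z = A 0 (2 *\<^sub>R z)"
      unfolding A_def using ribbons_double[OF e _ bs(2), of y] bs(1) by (simp add: y_def)
  next
    fix s :: real and z :: 'a assume s: "s \<in> {0..1}" and z: "\<bar>z \<bullet> e\<bar> < 10"
    have "norm (A s z) \<le> (\<Sum>b\<in>Basis. \<bar>A s z \<bullet> b\<bar>)" by (rule norm_le_l1)
    also have "\<dots> \<le> (\<Sum>b\<in>(Basis::'a set). 1)"
    proof (rule sum_mono)
      fix b :: 'a assume "b \<in> Basis"
      then show "\<bar>A s z \<bullet> b\<bar> \<le> 1"
      proof (cases "b = e")
        case True
        have "\<bar>A s z \<bullet> e\<bar> \<le> 1/1000" using ribbons_slab[OF e _ s sl[OF s z], of bs] bs(1) by (simp add: A_def)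
        then show ?thesis unfolding True by linarith
      next
        case False
        then have "b \<in> set bs" using bs(1) \<open>b \<in> Basis\<close> by simp
        moreover have "set bs \<subseteq> Basis - {e}" using bs(1) by simp
        ultimately show ?thesis using ribbons_slab[OF e _ s sl[OF s z], of bs] unfolding A_def by blast
      qed
    qed
    finally show "norm (A s z) \<le> real DIM('a)" by simp
  qed (use e1 L1 in auto)
  then show thesis using that bs unfolding A_def by blast
qed

section \<open>Global bilipschitz maps with the germ of the immersion\<close>

lemma bilip_UNIV_homeomorphism:
  fixes a :: "'a::euclidean_space \<Rightarrow> 'a"
  assumes a: "bilip L UNIV a"
  obtains a' where "homeomorphism UNIV UNIV a a'" "bilip L UNIV a'"
proof -
  have L: "L > 0" using a by (simp add: bilip_def)
  have "open (range a)" using invariance_of_domain[OF bilip_continuous[OF a] open_UNIV bilip_inj[OF a]] .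
  \<comment> \<open>By the lower bilipschitz bound, preimages of a convergent sequence form a Cauchy
    sequence.\<close>
  moreover have "closed (range a)"
    unfolding closed_sequential_limits
  proof (intro allI impI)
    fix y l assume y: "(\<forall>n. y n \<in> range a) \<and> y \<longlonglongrightarrow> l"
    then have "\<forall>n. \<exists>x. y n = a x" by blast
    then obtain x where x: "\<And>n. y n = a (x n)" using choice[of "\<lambda>n x. y n = a x"] by blast
    have "Cauchy x"
    proof (rule metric_CauchyI)
      fix \<epsilon> :: real assume "\<epsilon> > 0"
      then have "\<epsilon> / L > 0" using L by simp
      moreover have "Cauchy y" using y LIMSEQ_imp_Cauchy by blast
      ultimately obtain M where M: "\<And>m n. m \<ge> M \<Longrightarrow> n \<ge> M \<Longrightarrow> dist (y m) (y n) < \<epsilon> / L"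
        using metric_CauchyD by blast
      have "dist (x m) (x n) < \<epsilon>" if "m \<ge> M" "n \<ge> M" for m n
        using bilipD(1)[OF a, of "x m" "x n"] M[OF that] L by (simp add: x field_simps)
      then show "\<exists>M. \<forall>m\<ge>M. \<forall>n\<ge>M. dist (x m) (x n) < \<epsilon>" by blast
    qed
    then obtain c where c: "x \<longlonglongrightarrow> c" using Cauchy_convergent_iff convergent_def by blast
    have "isCont a c" using bilip_continuous[OF a] by (simp add: continuous_on_eq_continuous_at)
    then have "(\<lambda>n. a (x n)) \<longlonglongrightarrow> a c" using c isCont_tendsto_compose by blast
    moreover have "y = (\<lambda>n. a (x n))" using x by auto
    ultimately have "y \<longlonglongrightarrow> a c" by simp
    then have "l = a c" using y LIMSEQ_unique by blast
    then show "l \<in> range a" by simp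
  qed
  ultimately have r: "range a = UNIV" using clopen[of "range a"] by auto
  have i: "inv_into UNIV a (a x) = x" for x using bilip_inj[OF a] by simp
  have b': "bilip L UNIV (inv_into UNIV a)" using bilip_inverse[OF a, of "inv_into UNIV a"] i r by simp
  have "homeomorphism UNIV UNIV a (inv_into UNIV a)"
    unfolding homeomorphism_def using r i bilip_continuous[OF a] bilip_continuous[OF b']
    by (auto simp: f_inv_into_f) (metis i rangeI)
  then show thesis using that b' by blast
qed

definition clampc :: "real \<Rightarrow> real" where "clampc x = max (- 1/20) (min (1/20) x)"

lemma clampc: "\<bar>clampc x\<bar> \<le> 1/20" "\<bar>clampc x - clampc y\<bar> \<le> \<bar>x - y\<bar>" "\<bar>x\<bar> \<le> 1/20 \<Longrightarrow> clampc x = x"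
  by (auto simp: clampc_def)

lemma lipschitz_of_deriv_on:
  fixes f :: "real \<Rightarrow> real"
  assumes "\<And>x. (f has_real_derivative f' x) (at x)" "\<And>x. \<bar>x\<bar> \<le> 1/20 \<Longrightarrow> \<bar>f' x\<bar> \<le> B"
  shows "\<bar>f (clampc v) - f (clampc u)\<bar> \<le> B * \<bar>v - u\<bar>"
proof -
  have "B \<ge> 0" using assms(2)[of 0] by simp
  have "norm (f (clampc v) - f (clampc u)) \<le> B * norm (clampc v - clampc u)"
    by (rule field_differentiable_bound[of "{- 1/20..1/20}" f f'])
      (use assms clampc(1)[of u] clampc(1)[of v] in \<open>auto intro: has_field_derivative_at_within simp: abs_le_iff\<close>)
  also have "\<dots> \<le> B * \<bar>v - u\<bar>" using clampc(2)[of v u] \<open>B \<ge> 0\<close> by (intro mult_left_mono) auto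
  finally show ?thesis by simp
qed

text \<open>
  Near the origin the ribbon is a small perturbation of a linear similarity; freezing the
  perturbation outside a small square gives a global bilipschitz map with the same germ.
\<close>

lemma ribbon_extension:
  assumes be: "norm b = 1" "norm e = 1" "b \<bullet> e = 0"
  shows "\<exists>a. bilip 12000 UNIV a \<and> (\<forall>z. norm z < 1/20 \<longrightarrow> a z = ribbon e b 0 z)"
proof -
  define q where "q x t = t * (1 - cos x)" for x t :: real
  \<comment> \<open>The linear part (- x - t, x - t) / 8000 of the ribbon at the origin is a
    similarity. The remaining terms are Lipschitz with a small constant on the square of half side
    1/20, and clamping extends them with the same constant.\<close>
  define g1 where "g1 x t = (- x - t + ((clampc x - sin (2 * clampc x) / 2) + clampc t * (1 - cos (clampc x)))) / 8000" for x t
  define g2 where "g2 x t = (x - t + ((sin (clampc x) - clampc x) + clampc t * (1 - cos (2 * clampc x)))) / 8000" for x t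
  define a where "a = on_plane b e g1 g2"
  have cosb: "\<bar>1 - cos x\<bar> \<le> x\<^sup>2 / 2" for x :: real
  proof -
    have "(sin (x / 2))\<^sup>2 \<le> (x / 2)\<^sup>2" using abs_sin_x_le_abs_x[of "x / 2"] abs_le_square_iff[of "sin (x / 2)" "x / 2"] by blast
    moreover have "cos x = 1 - 2 * (sin (x / 2))\<^sup>2" using cos_double_sin[of "x / 2"] by simp
    ultimately show ?thesis by (simp add: power_divide)
  qed
  {
    fix x t x' t' :: real
    define h k where "h = \<bar>x - x'\<bar>" and "k = \<bar>t - t'\<bar>"
    define X X' T T' where "X = clampc x" and "X' = clampc x'" and "T = clampc t" and "T' = clampc t'"
    have cl: "\<bar>X\<bar> \<le> 1/20" "\<bar>X'\<bar> \<le> 1/20" "\<bar>T\<bar> \<le> 1/20" "\<bar>T'\<bar> \<le> 1/20" "\<bar>X - X'\<bar> \<le> h" "\<bar>T - T'\<bar> \<le> k"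
      unfolding X_def X'_def T_def T'_def h_def k_def using clampc by auto
    have sq: "y\<^sup>2 \<le> 1/400" if "\<bar>y\<bar> \<le> 1/20" for y :: real
      using abs_le_square_iff[of y "1/20"] that by (simp add: power2_eq_square)
    have 1: "\<bar>(X - sin (2 * X) / 2) - (X' - sin (2 * X') / 2)\<bar> \<le> 1/200 * h" unfolding X_def X'_def h_def
    proof (rule lipschitz_of_deriv_on[where f = "\<lambda>x. x - sin (2 * x) / 2"])
      fix y :: real
      show "((\<lambda>x. x - sin (2 * x) / 2) has_real_derivative 1 - cos (2 * y)) (at y)" by (auto intro!: derivative_eq_intros)
      assume "\<bar>y\<bar> \<le> 1/20"
      then show "\<bar>1 - cos (2 * y)\<bar> \<le> 1/200" using cosb[of "2 * y"] sq[of y] by (simp add: power_mult_distrib)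
    qed
    have 2: "\<bar>(sin X - X) - (sin X' - X')\<bar> \<le> 1/800 * h" unfolding X_def X'_def h_def
    proof (rule lipschitz_of_deriv_on[where f = "\<lambda>x. sin x - x"])
      fix y :: real
      show "((\<lambda>x. sin x - x) has_real_derivative cos y - 1) (at y)" by (auto intro!: derivative_eq_intros)
      assume "\<bar>y\<bar> \<le> 1/20"
      then show "\<bar>cos y - 1\<bar> \<le> 1/800" using cosb[of y] sq[of y] by (simp add: abs_minus_commute)
    qed
    have 3: "\<bar>T * (1 - cos (m * X)) - T' * (1 - cos (m * X'))\<bar> \<le> k / 100 + h / 10" if m: "m \<in> {1, 2}" for m :: real
    proof -
      have "T * (1 - cos (m * X)) - T' * (1 - cos (m * X')) = (T - T') * (1 - cos (m * X)) + T' * (cos (m * X') - cos (m * X))"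
        by (simp add: algebra_simps)
      moreover have "\<bar>(T - T') * (1 - cos (m * X))\<bar> \<le> k * (1/100)"
        unfolding abs_mult using cosb[of "m * X"] sq[OF cl(1)] cl m by (intro mult_mono) (auto simp: power_mult_distrib)
      moreover have "\<bar>cos (m * X') - cos (m * X)\<bar> \<le> 2 * \<bar>X' - X\<bar>"
      proof (rule lipschitz_of_deriv[where f = "\<lambda>y. cos (m * y)"])
        fix y
        show "((\<lambda>y. cos (m * y)) has_real_derivative - (m * sin (m * y))) (at y)"
          by (auto intro!: derivative_eq_intros)
        show "\<bar>- (m * sin (m * y))\<bar> \<le> 2"
          using m abs_sin_le_one[of "m * y"] order_trans[OF abs_sin_le_one[of y], of 2] by (auto simp: abs_mult)
      qed
      then have "\<bar>T' * (cos (m * X') - cos (m * X))\<bar> \<le> 1/20 * (2 * h)"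
        unfolding abs_mult using cl by (intro mult_mono) (auto simp: abs_minus_commute)
      ultimately show ?thesis unfolding abs_le_iff by argo
    qed
    define r1 where "r1 = ((X - sin (2 * X) / 2) - (X' - sin (2 * X') / 2)) + (T * (1 - cos X) - T' * (1 - cos X'))"
    define r2 where "r2 = ((sin X - X) - (sin X' - X')) + (T * (1 - cos (2 * X)) - T' * (1 - cos (2 * X')))"
    have hk: "h \<ge> 0" "k \<ge> 0" by (auto simp: h_def k_def)
    have r: "\<bar>r1\<bar> \<le> (h + k) / 8 \<and> \<bar>r2\<bar> \<le> (h + k) / 8"
      using 1 2 3[of 1] 3[of 2] hk unfolding r1_def r2_def abs_le_iff by (simp; argo)
    have e: "8000 * (u / 8000 - v / 8000) = u - v" for u v :: real by simp
    have e1: "8000 * (g1 x t - g1 x' t') = - ((x - x') + (t - t')) + r1"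
      "8000 * (g2 x t - g2 x' t') = ((x - x') - (t - t')) + r2"
      unfolding g1_def g2_def r1_def r2_def X_def X'_def T_def T'_def e by (simp_all add: algebra_simps)
    have xh: "\<bar>x - x'\<bar> = h" "\<bar>t - t'\<bar> = k" by (auto simp: h_def k_def)
    have "\<bar>g1 x t - g1 x' t'\<bar> \<le> (h + k) / 2 \<and> \<bar>g2 x t - g2 x' t'\<bar> \<le> (h + k) / 2"
      using e1 r xh hk by (auto simp: abs_if split: if_splits)
    then have "(g1 x t - g1 x' t')\<^sup>2 \<le> ((h + k) / 2)\<^sup>2" "(g2 x t - g2 x' t')\<^sup>2 \<le> ((h + k) / 2)\<^sup>2"
      using hk by (auto intro!: abs_le_square_iff[THEN iffD1])
    moreover have s2: "2 * ((h + k) / 2)\<^sup>2 \<le> h\<^sup>2 + k\<^sup>2"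
      using sum_squares_bound[of h k] by (simp add: power2_eq_square algebra_simps)
    moreover have hk2: "h\<^sup>2 = (x - x')\<^sup>2" "k\<^sup>2 = (t - t')\<^sup>2" by (auto simp: h_def k_def)
    ultimately have up: "(g1 x t - g1 x' t')\<^sup>2 + (g2 x t - g2 x' t')\<^sup>2 \<le> (x - x')\<^sup>2 + (t - t')\<^sup>2" by linarith
    have half: "(m + r)\<^sup>2 \<ge> m\<^sup>2 / 2 - r\<^sup>2" for m r :: real
      using zero_le_power2[of "m + 2 * r"] by (simp add: power2_eq_square algebra_simps)
    have "r1\<^sup>2 \<le> ((h + k) / 8)\<^sup>2" "r2\<^sup>2 \<le> ((h + k) / 8)\<^sup>2"
      using r hk by (auto intro!: abs_le_square_iff[THEN iffD1])
    moreover have "((h + k) / 8)\<^sup>2 = ((h + k) / 2)\<^sup>2 / 16" by (simp add: power_divide)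
    moreover have "(- ((x - x') + (t - t')))\<^sup>2 + ((x - x') - (t - t'))\<^sup>2 = 2 * (h\<^sup>2 + k\<^sup>2)"
      unfolding hk2 by (simp add: power2_eq_square algebra_simps)
    ultimately have "(h\<^sup>2 + k\<^sup>2) / 2 \<le> (8000 * (g1 x t - g1 x' t'))\<^sup>2 + (8000 * (g2 x t - g2 x' t'))\<^sup>2"
      using half[of "- ((x - x') + (t - t'))" r1] half[of "(x - x') - (t - t')" r2] s2 zero_le_power2[of h] zero_le_power2[of k]
      unfolding e1 by argo
    moreover have sq_num: "(8000::real)\<^sup>2 = 64000000" "(12000::real)\<^sup>2 = 144000000" by simp_all
    ultimately have "(x - x')\<^sup>2 + (t - t')\<^sup>2 \<le> 12000\<^sup>2 * ((g1 x t - g1 x' t')\<^sup>2 + (g2 x t - g2 x' t')\<^sup>2)"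
      using zero_le_power2[of "g1 x t - g1 x' t'"] zero_le_power2[of "g2 x t - g2 x' t'"]
      unfolding hk2[symmetric] power_mult_distrib sq_num by argo
    note this up
  } note g = this
  have "bilip 12000 UNIV a"
    unfolding bilip_def a_def
  proof (intro conjI ballI)
    fix z w :: 'a
    show "dist z w \<le> 12000 * dist (on_plane b e g1 g2 z) (on_plane b e g1 g2 w)"
      by (rule on_plane_lower[OF be]) (use g in auto)
    have "dist (on_plane b e g1 g2 z) (on_plane b e g1 g2 w) \<le> 1 * dist z w"
      by (rule on_plane_upper[OF be]) (use g in auto)
    then show "dist (on_plane b e g1 g2 z) (on_plane b e g1 g2 w) \<le> 12000 * dist z w"
      using zero_le_dist[of z w] by linarith
  qed simp
  moreover have "a z = ribbon e b 0 z" if z: "norm z < 1/20" for z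
  proof -
    have "\<bar>z \<bullet> b\<bar> \<le> 1/20" "\<bar>z \<bullet> e\<bar> \<le> 1/20"
      using Cauchy_Schwarz_ineq2[of z b] Cauchy_Schwarz_ineq2[of z e] be z by auto
    then have c: "clampc (z \<bullet> b) = z \<bullet> b" "clampc (z \<bullet> e) = z \<bullet> e" using clampc(3) by auto
    have "1 - 2 * (cos x)\<^sup>2 = - cos (2 * x)" for x :: real using cos_double_cos[of x] by simp
    then have rb: "ribbon1 0 x t = (- (sin (2 * x) / 2) - t * cos x) / 8000" "ribbon2 0 x t = (sin x - t * cos (2 * x)) / 8000" for x t
      by (auto simp: ribbon1_def ribbon2_def cX_def cY_def cy_def cp_def)
    have num: "- x - t + ((x - s / 2) + t * (1 - c)) = - (s / 2) - t * c" "x - t + ((s - x) + t * (1 - c)) = s - t * c" for x t s c :: real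
      by (simp_all add: algebra_simps)
    have "g1 (z \<bullet> b) (z \<bullet> e) = ribbon1 0 (z \<bullet> b) (z \<bullet> e)" "g2 (z \<bullet> b) (z \<bullet> e) = ribbon2 0 (z \<bullet> b) (z \<bullet> e)"
      unfolding g1_def g2_def c num rb by simp_all
    then show ?thesis by (simp add: a_def ribbon_def on_plane_def)
  qed
  ultimately show ?thesis by blast
qed

lemma ribbons_extension:
  assumes e: "e \<in> Basis" and bs: "set bs \<subseteq> Basis - {e}"
  shows "\<exists>a M \<rho>. bilip M UNIV a \<and> \<rho> > 0 \<and> (\<forall>z. norm z < \<rho> \<longrightarrow> a z = ribbons e bs 0 z)"
    and "ribbons e bs 0 0 = 0"
proof -
  have r0: "ribbon e b 0 0 = 0" for b :: 'a
    by (simp add: ribbon_def on_plane_def ribbon1_def ribbon2_def cX_def cY_def)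
  show z: "ribbons e bs 0 0 = 0" for bs by (induction bs) (auto simp: r0)
  show "\<exists>a M \<rho>. bilip M UNIV a \<and> \<rho> > 0 \<and> (\<forall>z. norm z < \<rho> \<longrightarrow> a z = ribbons e bs 0 z)"
    using bs
  proof (induction bs)
    case Nil
    show ?case by (rule exI[of _ "\<lambda>z. z"], rule exI[of _ 1], rule exI[of _ 1]) (auto simp: bilip_def)
  next
    case (Cons b bs)
    then obtain a M \<rho> where a: "bilip M UNIV a" "\<rho> > 0" "\<And>z. norm z < \<rho> \<Longrightarrow> a z = ribbons e bs 0 z" by auto
    have b: "b \<in> Basis - {e}" using Cons.prems by simp
    obtain a1 where a1: "bilip 12000 UNIV a1" "\<And>z. norm z < 1/20 \<Longrightarrow> a1 z = ribbon e b 0 z"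
      using ribbon_extension[OF Basis_orthonormal[OF e b]] by blast
    have M: "M > 0" using a(1) by (simp add: bilip_def)
    have "a 0 = 0" using a(2) a(3)[of 0] z by simp
    have "(a1 \<circ> a) z = ribbons e (b # bs) 0 z" if "norm z < min \<rho> (1 / (20 * M))" for z
    proof -
      have "dist (a z) (a 0) \<le> M * dist z 0" using bilipD(2)[OF a(1)] by blast
      also have "\<dots> < 1/20" using that M by (simp add: field_simps)
      finally have "norm (a z) < 1/20" using \<open>a 0 = 0\<close> by simp
      then show ?thesis using a1(2) a(3)[of z] that by simp
    qed
    moreover have "bilip (M * 12000) UNIV (a1 \<circ> a)" using bilip_comp[OF a(1) bilip_subset[OF a1(1)]] by simp
    moreover have "min \<rho> (1 / (20 * M)) > 0" using a M by simp
    ultimately show ?case by blast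
  qed
qed

text \<open>\<open>A 0\<close> is only an immersion of a slab, while the transplanted map has to
  live on the whole space. A global homeomorphism with the same germ at the origin suffices, since
  \<open>f\<close> has to be recovered only near one point.\<close>

lemma family_extension:
  assumes e: "e \<in> Basis" and bs: "set bs \<subseteq> Basis - {e}"
  shows "\<exists>a M \<rho>. bilip M UNIV a \<and> \<rho> > 0 \<and> (\<forall>z. norm z < \<rho> \<longrightarrow> a z = ribbons e bs 0 (squeeze e 0 z)) \<and> a 0 = 0"
proof -
  obtain a M \<rho> where a: "bilip M UNIV a" "\<rho> > 0" "\<And>z. norm z < \<rho> \<Longrightarrow> a z = ribbons e bs 0 z"
    using ribbons_extension(1)[OF e bs] by blast
  have e1: "norm e = 1" using e by simp
  have sb: "bilip 20000 UNIV (squeeze e 0)" by (rule squeeze_bilip[OF e1]) simp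
  have s0: "squeeze e 0 0 = 0" by (simp add: squeeze_def push_def)
  have "(a \<circ> squeeze e 0) z = ribbons e bs 0 (squeeze e 0 z)" if "norm z < \<rho> / 20000" for z
  proof -
    have "norm (squeeze e 0 z) \<le> 20000 * norm z" using bilipD(2)[OF sb, of z 0] s0 by simp
    then show ?thesis using a(3)[of "squeeze e 0 z"] that by simp
  qed
  moreover have "bilip (20000 * M) UNIV (a \<circ> squeeze e 0)" using bilip_comp[OF sb bilip_subset[OF a(1)]] by simp
  moreover have "(a \<circ> squeeze e 0) 0 = 0" using a(3)[of 0] a(2) s0 ribbons_extension(2)[OF e bs] by simp
  moreover have "\<rho> / 20000 > 0" using a(2) by simp
  ultimately show ?thesis by blast
qed

section \<open>Metric quasiconformality implies quasisymmetry\<close>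

lemma measure_ball [simp]: "r \<ge> 0 \<Longrightarrow> measure lborel (ball (c :: 'a::euclidean_space) r) = unit_ball_vol (real DIM('a)) * r ^ DIM('a)"
  by (rule content_ball)

lemma bounded_fmeasurable:
  fixes S :: "'a::euclidean_space set"
  shows "bounded S \<Longrightarrow> S \<in> sets borel \<Longrightarrow> S \<in> fmeasurable lborel"
  by (auto intro!: fmeasurableI emeasure_bounded_finite)

lemma disjoint_balls_packing:
  fixes c :: "'i \<Rightarrow> 'a::euclidean_space"
  assumes I: "finite I" and \<rho>: "\<And>i. i \<in> I \<Longrightarrow> \<rho> i \<ge> 0"
    and dis: "\<And>i j. i \<in> I \<Longrightarrow> j \<in> I \<Longrightarrow> i \<noteq> j \<Longrightarrow> ball (c i) (\<rho> i) \<inter> ball (c j) (\<rho> j) = {}"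
    and sub: "\<And>i. i \<in> I \<Longrightarrow> ball (c i) (\<rho> i) \<subseteq> ball p R" and R: "R \<ge> 0"
  shows "(\<Sum>i\<in>I. \<rho> i ^ DIM('a)) \<le> R ^ DIM('a)"
proof -
  let ?V = "unit_ball_vol (real DIM('a))"
  have V: "?V > 0" by (rule unit_ball_vol_pos) simp
  have "?V * (\<Sum>i\<in>I. \<rho> i ^ DIM('a)) = (\<Sum>i\<in>I. measure lborel (ball (c i) (\<rho> i)))"
    using \<rho> by (simp add: sum_distrib_left)
  also have "\<dots> = measure lborel (\<Union>i\<in>I. ball (c i) (\<rho> i))"
    by (rule measure_finite_Union[symmetric])
      (use I dis emeasure_bounded_finite[OF bounded_ball] in \<open>auto simp: disjoint_family_on_def less_top\<close>)
  also have "\<dots> \<le> measure lborel (ball p R)"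
    by (rule measure_mono_fmeasurable) (use sub I in \<open>auto intro: bounded_fmeasurable\<close>)
  also have "\<dots> = ?V * R ^ DIM('a)" using R by simp
  finally show ?thesis using V by simp
qed

text \<open>The set is the shadow of a ball seen from \<open>p\<close>. Its angular size is
  comparable to \<kappa>, so inside the ball of radius \<open>s\<close> it lies in a tube of length
  about \<open>s\<close> and width about s\<kappa>, which balls centred on the axis cover. If
  \<open>p\<close> is within 10r of \<open>y\<close>, then \<kappa> \<ge> 1/11 and the whole ball
  will do. A measurable superset is produced to make the integration below immediate.\<close>

lemma fan_measure:
  fixes p x y :: "'a::euclidean_space"
  assumes p: "p \<in> cball x s" and s: "s > 0" and r: "0 < r"
  defines "n \<equiv> DIM('a)" and "\<kappa> \<equiv> r / (r + dist y p)"
  shows "\<exists>M. M \<in> sets lborel \<and> bounded M \<and>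
    {z \<in> cball x s. closed_segment p z \<inter> ball y (5 * r) \<noteq> {}} \<subseteq> M \<and>
    measure lborel M \<le> 6 * 120 ^ n * \<kappa> ^ (n - 1) * (unit_ball_vol (real n) * s ^ n)"
proof (cases "dist y p \<le> 10 * r")
  case True
  have n: "n > 0" by (simp add: n_def)
  have V: "unit_ball_vol (real n) > 0" by (rule unit_ball_vol_pos) simp
  have "r + dist y p > 0" using r by (simp add: add_pos_nonneg)
  then have "1/11 \<le> \<kappa>" using True by (simp add: \<kappa>_def field_simps)
  then have "(1/11) ^ (n - 1) \<le> \<kappa> ^ (n - 1)" by (intro power_mono) auto
  then have "1 \<le> 11 ^ (n - 1) * \<kappa> ^ (n - 1)" by (simp add: power_one_over field_simps)
  also have "\<dots> \<le> (6 * 120 ^ n) * \<kappa> ^ (n - 1)"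
  proof (rule mult_right_mono)
    have "(11::real) ^ (n - 1) \<le> 120 ^ (n - 1)" by (intro power_mono) auto
    also have "\<dots> \<le> 120 ^ n" by (intro power_increasing) auto
    finally have "(11::real) ^ (n - 1) \<le> 120 ^ n" .
    moreover have "(0::real) \<le> 120 ^ n" by simp
    ultimately show "(11::real) ^ (n - 1) \<le> 6 * 120 ^ n" by linarith
    show "0 \<le> \<kappa> ^ (n - 1)" using r by (simp add: \<kappa>_def)
  qed
  finally have c: "1 \<le> 6 * 120 ^ n * \<kappa> ^ (n - 1)" .
  have "measure lborel (ball x (2 * s) \<inter> cball x s) = unit_ball_vol (real n) * s ^ n"
  proof -
    have "ball x (2 * s) \<inter> cball x s = cball x s" using s by auto
    then show ?thesis using content_cball[of s x] s by (simp add: n_def)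
  qed
  also have "\<dots> \<le> 6 * 120 ^ n * \<kappa> ^ (n - 1) * (unit_ball_vol (real n) * s ^ n)"
    using mult_right_mono[OF c, of "unit_ball_vol (real n) * s ^ n"] V s by simp
  finally show ?thesis
    by (intro exI[of _ "ball x (2 * s) \<inter> cball x s"]) (use s in auto)
next
  case False
  define d where "d = dist y p"
  have d: "d > 10 * r" "d > 0" using False r by (auto simp: d_def)
  \<comment> \<open>If the segment from \<open>p\<close> to \<open>z\<close> meets the ball in a
    point \<open>w\<close>, then \<open>z\<close> is the image of \<open>w\<close> under a dilation
    about \<open>p\<close> by at most 4s/d; it magnifies the distance of \<open>w\<close> from
    \<open>y\<close>, less than 5r, to at most \<open>R\<close>.\<close>
  define R where "R = 20 * s * r / d"
  have R: "R > 0" using s r d by (simp add: R_def)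
  have R2: "R \<le> 2 * s"
  proof -
    have "20 * s * r \<le> 2 * s * d" using d s by simp
    then show ?thesis using d by (simp add: R_def field_simps)
  qed
  define u where "u = (y - p) /\<^sub>R d"
  have nu: "norm u = 1" using d by (simp add: u_def d_def dist_norm)
  define N where "N = nat \<lfloor>4 * s / R\<rfloor>"
  define M where "M = (\<Union>j\<in>{..N}. ball (p + (real j * R) *\<^sub>R u) (3 * R))"
  have sub: "{z \<in> cball x s. closed_segment p z \<inter> ball y (5 * r) \<noteq> {}} \<subseteq> M"
  proof
    fix z assume "z \<in> {z \<in> cball x s. closed_segment p z \<inter> ball y (5 * r) \<noteq> {}}"
    then obtain w where z: "z \<in> cball x s" and w: "w \<in> closed_segment p z" "dist y w < 5 * r" by auto
    obtain \<theta> where \<theta>: "0 \<le> \<theta>" "\<theta> \<le> 1" "w = (1 - \<theta>) *\<^sub>R p + \<theta> *\<^sub>R z" using w(1) by (auto simp: closed_segment_def)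
    have wp: "w - p = \<theta> *\<^sub>R (z - p)" using \<theta>(3) by (simp add: algebra_simps)
    have "dist w p \<ge> d - 5 * r" using w(2) dist_triangle[of y p w] by (simp add: d_def)
    then have wd: "dist w p \<ge> d / 2" using d by linarith
    have zp: "norm (z - p) \<le> 2 * s" using z p dist_triangle3[of z p x] by (simp add: dist_norm)
    have "dist w p = \<theta> * norm (z - p)" using wp \<theta> by (simp add: dist_norm)
    also have "\<dots> \<le> \<theta> * (2 * s)" using zp \<theta> by (intro mult_left_mono) auto
    finally have ts: "d / 2 \<le> \<theta> * (2 * s)" using wd by simp
    then have \<theta>0: "\<theta> > 0" using d s \<theta>(1) by (cases "\<theta> = 0") auto
    have inv: "1 / \<theta> \<le> 4 * s / d" using ts \<theta>0 d by (simp add: field_simps)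
    define \<tau> where "\<tau> = d / \<theta>"
    have \<tau>: "0 \<le> \<tau>" "\<tau> \<le> 4 * s" using inv d \<theta>0 by (auto simp: \<tau>_def field_simps)
    have "z - p = (1 / \<theta>) *\<^sub>R (w - p)" using wp \<theta>0 by simp
    also have "\<dots> = \<tau> *\<^sub>R u + (1 / \<theta>) *\<^sub>R (w - y)"
      using d by (simp add: \<tau>_def u_def algebra_simps)
    finally have "z - (p + \<tau> *\<^sub>R u) = (1 / \<theta>) *\<^sub>R (w - y)" by (simp add: algebra_simps)
    then have "dist z (p + \<tau> *\<^sub>R u) = (1 / \<theta>) * dist y w" using \<theta>0 by (simp add: dist_norm norm_minus_commute)
    also have "\<dots> \<le> (4 * s / d) * (5 * r)" using inv w(2) \<theta>0 s d by (intro mult_mono) auto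
    finally have 1: "dist z (p + \<tau> *\<^sub>R u) \<le> R" by (simp add: R_def)
    define j where "j = nat \<lfloor>\<tau> / R\<rfloor>"
    have jr: "real j = of_int \<lfloor>\<tau> / R\<rfloor>" using \<tau> R by (simp add: j_def)
    have "real j \<le> \<tau> / R" "\<tau> / R < real j + 1" unfolding jr by linarith+
    then have "\<bar>\<tau> - real j * R\<bar> \<le> R" using R by (simp add: field_simps abs_le_iff)
    moreover have "dist (p + \<tau> *\<^sub>R u) (p + (real j * R) *\<^sub>R u) = \<bar>\<tau> - real j * R\<bar>"
      using nu by (simp add: dist_norm flip: scaleR_diff_left)
    ultimately have "dist z (p + (real j * R) *\<^sub>R u) \<le> 2 * R"
      using 1 dist_triangle[of z "p + (real j * R) *\<^sub>R u" "p + \<tau> *\<^sub>R u"] by linarith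
    then have "z \<in> ball (p + (real j * R) *\<^sub>R u) (3 * R)" using R by (simp add: dist_commute)
    moreover have "j \<le> N" unfolding j_def N_def using \<tau> R by (intro nat_mono floor_mono divide_right_mono) auto
    ultimately show "z \<in> M" by (auto simp: M_def)
  qed
  have V: "unit_ball_vol (real n) > 0" by (rule unit_ball_vol_pos) simp
  have n1: "n = Suc (n - 1)" by (simp add: n_def)
  have Rn: "(3 * R) ^ n = 3 ^ n * (R * R ^ (n - 1))" using n1 by (metis power_Suc power_mult_distrib)
  have sn: "s ^ n = s * s ^ (n - 1)" using n1 by (metis power_Suc)
  have "measure lborel M \<le> (\<Sum>j\<in>{..N}. measure lborel (ball (p + (real j * R) *\<^sub>R u) (3 * R)))"
    unfolding M_def by (rule measure_UNION_le) auto
  also have "\<dots> = (real N + 1) * (unit_ball_vol (real n) * (3 * R) ^ n)" using R by (simp add: n_def)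
  also have "\<dots> \<le> (6 * s / R) * (unit_ball_vol (real n) * (3 * R) ^ n)"
  proof (rule mult_right_mono)
    have "real N \<le> 4 * s / R" using s R by (simp add: N_def)
    moreover have "1 \<le> 2 * s / R" using R2 R by simp
    moreover have "6 * s / R = 4 * s / R + 2 * s / R" by (simp flip: add_divide_distrib)
    ultimately show "real N + 1 \<le> 6 * s / R" by linarith
  qed (use V R in auto)
  also have "\<dots> = 6 * 3 ^ n * unit_ball_vol (real n) * s * R ^ (n - 1)"
    unfolding Rn using R by simp
  also have "\<dots> \<le> 6 * 3 ^ n * unit_ball_vol (real n) * s * (40 * s * \<kappa>) ^ (n - 1)"
  proof -
    have "R \<le> 40 * s * \<kappa>"
    proof -
      have "r / d \<le> 2 * \<kappa>" using d r by (simp add: \<kappa>_def d_def[symmetric] field_simps)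
      then have "(20 * s) * (r / d) \<le> (20 * s) * (2 * \<kappa>)" using s by (intro mult_left_mono) auto
      then show ?thesis by (simp add: R_def)
    qed
    then have "R ^ (n - 1) \<le> (40 * s * \<kappa>) ^ (n - 1)" using R by (intro power_mono) auto
    then show ?thesis using V s by (intro mult_left_mono) auto
  qed
  also have "\<dots> = (6 * 3 ^ n * 40 ^ (n - 1)) * \<kappa> ^ (n - 1) * (unit_ball_vol (real n) * s ^ n)"
    unfolding sn by (simp add: power_mult_distrib mult_ac)
  also have "\<dots> \<le> 6 * 120 ^ n * \<kappa> ^ (n - 1) * (unit_ball_vol (real n) * s ^ n)"
  proof -
    have "(3::real) ^ n * 40 ^ (n - 1) \<le> 3 ^ n * 40 ^ n" by (intro mult_left_mono power_increasing) auto
    also have "\<dots> = 120 ^ n" by (simp flip: power_mult_distrib)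
    finally have "6 * (3::real) ^ n * 40 ^ (n - 1) \<le> 6 * 120 ^ n" by simp
    moreover have "\<kappa> \<ge> 0" using r by (simp add: \<kappa>_def)
    ultimately show ?thesis using V s by (intro mult_right_mono) auto
  qed
  finally have "measure lborel M \<le> 6 * 120 ^ n * \<kappa> ^ (n - 1) * (unit_ball_vol (real n) * s ^ n)" .
  moreover have "M \<in> sets lborel" "bounded M" unfolding M_def by auto
  ultimately show ?thesis using sub by blast
qed

text \<open>If every \<open>z\<close> violated the bound, integration over the ball would contradict
  the measure estimates. The summand 1 leaves the strict gap that produces the
  contradiction.\<close>

lemma averaging:
  fixes x :: "'a::euclidean_space" and M :: "'i \<Rightarrow> 'a set"
  assumes I: "finite I" and w: "\<And>i. i \<in> I \<Longrightarrow> w i \<ge> 0" and s: "s > 0"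
    and M: "\<And>i. i \<in> I \<Longrightarrow> M i \<in> sets lborel \<and> bounded (M i)"
    and b: "\<And>i. i \<in> I \<Longrightarrow> measure lborel (M i) \<le> c i * (unit_ball_vol (real DIM('a)) * s ^ DIM('a))"
  obtains z where "z \<in> cball x s" "(\<Sum>i\<in>{i \<in> I. z \<in> M i}. w i) \<le> (\<Sum>i\<in>I. w i * c i) + 1"
proof -
  define W where "W = unit_ball_vol (real DIM('a)) * s ^ DIM('a)"
  have W: "W > 0" unfolding W_def using s unit_ball_vol_pos[of "real DIM('a)"] by simp
  define T where "T = (\<Sum>i\<in>I. w i * c i) + 1"
  have "\<exists>z\<in>cball x s. (\<Sum>i\<in>I. w i * indicator (M i) z) \<le> T"
  proof (rule ccontr)
    assume "\<not> ?thesis"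
    then have gt: "\<And>z. z \<in> cball x s \<Longrightarrow> T < (\<Sum>i\<in>I. w i * indicator (M i) z)" by force
    have int: "integrable lborel (\<lambda>z. w i * indicator (M i) z :: real)" if "i \<in> I" for i
      using M[OF that] emeasure_bounded_finite[of "M i"] by (intro integrable_mult_right) (auto simp: less_top)
    have intc: "integrable lborel (\<lambda>z. T * indicator (cball x s) z :: real)"
      using emeasure_bounded_finite[OF bounded_cball, of x s] by (intro integrable_mult_right) (auto simp: less_top)
    have "T * W = (\<integral>z. T * indicator (cball x s) z \<partial>lborel)"
      using content_cball[of s x] s by (simp add: W_def)
    also have "\<dots> \<le> (\<integral>z. (\<Sum>i\<in>I. w i * indicator (M i) z) \<partial>lborel)"
    proof (rule integral_mono[OF intc])
      show "integrable lborel (\<lambda>z. \<Sum>i\<in>I. w i * indicator (M i) z)" using int by auto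
      fix z
      have "0 \<le> (\<Sum>i\<in>I. w i * indicator (M i) z)" using w by (intro sum_nonneg) auto
      then show "T * indicator (cball x s) z \<le> (\<Sum>i\<in>I. w i * indicator (M i) z)"
        using gt[of z] by (auto simp: indicator_def)
    qed
    also have "\<dots> = (\<Sum>i\<in>I. w i * measure lborel (M i))"
      using int M by (subst Bochner_Integration.integral_sum) (auto intro!: sum.cong)
    also have "\<dots> \<le> (\<Sum>i\<in>I. w i * (c i * W))"
      using b w by (intro sum_mono mult_left_mono) (auto simp: W_def)
    also have "\<dots> = (\<Sum>i\<in>I. w i * c i) * W" by (simp add: sum_distrib_right mult.assoc)
    also have "\<dots> = T * W - W" by (simp add: T_def algebra_simps)
    finally show False using W by simp
  qed
  then obtain z where z: "z \<in> cball x s" "(\<Sum>i\<in>I. w i * indicator (M i) z) \<le> T" by blast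
  have "(\<Sum>i\<in>{i \<in> I. z \<in> M i}. w i) = (\<Sum>i\<in>I. if z \<in> M i then w i else 0)"
    using I by (simp add: sum.inter_filter)
  also have "\<dots> = (\<Sum>i\<in>I. w i * indicator (M i) z)" by (intro sum.cong) (auto simp: indicator_def)
  finally show thesis using that z by (simp add: T_def)
qed

text \<open>The connected image of \<open>S\<close> contains the interval between the two values,
  and each piece meeting \<open>S\<close> covers at most a length 2 w_i of it. Comparing lengths
  avoids the choice of a chain of pieces.\<close>

lemma variation_bound:
  fixes v :: "'a::topological_space \<Rightarrow> real"
  assumes S: "connected S" "continuous_on S v" and J: "finite J" "S \<subseteq> (\<Union>i\<in>J. U i)"
    and w: "\<And>i. i \<in> J \<Longrightarrow> 0 \<le> w i"
    and osc: "\<And>i a b. i \<in> J \<Longrightarrow> a \<in> U i \<inter> S \<Longrightarrow> b \<in> U i \<inter> S \<Longrightarrow> \<bar>v a - v b\<bar> \<le> w i"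
    and pq: "p \<in> S" "q \<in> S"
  shows "\<bar>v p - v q\<bar> \<le> 2 * (\<Sum>i\<in>{i \<in> J. S \<inter> U i \<noteq> {}}. w i)"
proof -
  define J' where "J' = {i \<in> J. S \<inter> U i \<noteq> {}}"
  have "\<forall>i\<in>J'. \<exists>z. z \<in> S \<inter> U i" by (auto simp: J'_def)
  then obtain z where z: "\<And>i. i \<in> J' \<Longrightarrow> z i \<in> S \<inter> U i" by metis
  have con: "connected (v ` S)" using S connected_continuous_image by blast
  have key: "b - a \<le> 2 * (\<Sum>i\<in>J'. w i)" if "a \<in> v ` S" "b \<in> v ` S" "a \<le> b" for a b
  proof -
    have "{a..b} \<subseteq> v ` S" using con that by (metis connected_contains_Icc)
    also have "\<dots> \<subseteq> (\<Union>i\<in>J'. {v (z i) - w i..v (z i) + w i})"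
    proof
      fix c assume "c \<in> v ` S"
      then obtain y where y: "y \<in> S" "c = v y" by blast
      then obtain i where i: "i \<in> J" "y \<in> U i" using J by blast
      then have "i \<in> J'" using y by (auto simp: J'_def)
      then have "\<bar>v y - v (z i)\<bar> \<le> w i" using osc[OF i(1), of y "z i"] z y i by blast
      then have "c \<in> {v (z i) - w i..v (z i) + w i}" using y by auto
      then show "c \<in> (\<Union>i\<in>J'. {v (z i) - w i..v (z i) + w i})" using \<open>i \<in> J'\<close> by blast
    qed
    finally have sub: "{a..b} \<subseteq> (\<Union>i\<in>J'. {v (z i) - w i..v (z i) + w i})" .
    have fin: "finite J'" using J by (simp add: J'_def)
    have "b - a = measure lborel {a..b}" using that by simp
    also have "\<dots> \<le> measure lborel (\<Union>i\<in>J'. {v (z i) - w i..v (z i) + w i})"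
    proof (rule measure_mono_fmeasurable[OF sub])
      have "bounded (\<Union>i\<in>J'. {v (z i) - w i..v (z i) + w i})" using fin by auto
      then show "(\<Union>i\<in>J'. {v (z i) - w i..v (z i) + w i}) \<in> fmeasurable lborel"
        using fin by (intro bounded_fmeasurable) auto
    qed simp
    also have "\<dots> \<le> (\<Sum>i\<in>J'. measure lborel {v (z i) - w i..v (z i) + w i})"
      using fin by (intro measure_UNION_le) auto
    also have "\<dots> = (\<Sum>i\<in>J'. 2 * w i)" using w by (intro sum.cong) (auto simp: J'_def)
    finally show ?thesis by (simp add: sum_distrib_left)
  qed
  have "v p \<in> v ` S" "v q \<in> v ` S" using pq by auto
  then show ?thesis unfolding J'_def[symmetric] using key[of "v p" "v q"] key[of "v q" "v p"] by (cases "v p \<le> v q") auto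
qed

lemma sum_buckets:
  fixes g :: "'i \<Rightarrow> real" and k :: "'i \<Rightarrow> nat"
  assumes "finite I" "\<And>i. i \<in> I \<Longrightarrow> k i \<le> N"
    and "\<And>j. j \<le> N \<Longrightarrow> (\<Sum>i\<in>{i \<in> I. k i = j}. g i) \<le> B j"
  shows "(\<Sum>i\<in>I. g i) \<le> (\<Sum>j\<le>N. B j)"
proof -
  have "(\<Sum>i\<in>I. g i) = (\<Sum>j\<le>N. \<Sum>i\<in>{i \<in> I. k i = j}. g i)"
    using assms(1,2) by (intro sum.group[symmetric]) auto
  also have "\<dots> \<le> (\<Sum>j\<le>N. B j)" using assms(3) by (intro sum_mono) auto
  finally show ?thesis .
qed

lemma dyadic_index:
  fixes x :: real
  assumes "x \<ge> 1"
  obtains k :: nat where "2 ^ k \<le> x" "x < 2 ^ Suc k"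
proof -
  obtain m where m: "x < 2 ^ m" using real_arch_pow[of 2 x] by auto
  define k where "k = (LEAST m. x < 2 ^ m)"
  have k: "x < 2 ^ k" unfolding k_def by (rule LeastI[of _ m]) (rule m)
  have "k \<noteq> 0" using k assms by (cases k) auto
  then obtain k' where k': "k = Suc k'" by (cases k) auto
  have "\<not> x < 2 ^ k'" using not_less_Least[of k' "\<lambda>m. x < 2 ^ m"] k' unfolding k_def by simp
  then show thesis using that[of k'] k k' by simp
qed

lemma card_close_nats:
  fixes J :: "nat set"
  assumes "finite J" "\<And>i j. i \<in> J \<Longrightarrow> j \<in> J \<Longrightarrow> real i - real j \<le> B" "B \<ge> 0"
  shows "real (card J) \<le> B + 1"
proof (cases "J = {}")
  case False
  have sub: "J \<subseteq> {Min J..Max J}" using assms(1) by auto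
  have "Min J \<le> Max J" using assms(1) False by simp
  then have "real (card {Min J..Max J}) = real (Max J) - real (Min J) + 1" by (simp add: of_nat_diff)
  moreover have "real (Max J) - real (Min J) \<le> B" using assms(2)[of "Max J" "Min J"] assms(1) False by simp
  moreover have "card J \<le> card {Min J..Max J}" using sub by (intro card_mono) auto
  ultimately show ?thesis by linarith
qed (use assms in auto)

text \<open>A crude Young inequality: the left side is at most the n-th power of the larger of the
  two numbers.\<close>

lemma young_power:
  fixes a b :: real
  assumes "a \<ge> 0" "b \<ge> 0" "n > 0"
  shows "a * b ^ (n - 1) \<le> a ^ n + b ^ n"
proof -
  obtain m where n: "n = Suc m" using assms(3) by (cases n) auto
  show ?thesis
  proof (cases "a \<le> b")
    case True
    then have "a * b ^ m \<le> b * b ^ m" using assms by (intro mult_right_mono) auto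
    moreover have "0 \<le> a * a ^ m" using assms by simp
    ultimately show ?thesis unfolding n by (simp only: power_Suc diff_Suc_1)
  next
    case False
    then have "a * b ^ m \<le> a * a ^ m" using assms by (intro mult_left_mono power_mono) auto
    moreover have "0 \<le> b * b ^ m" using assms by simp
    ultimately show ?thesis unfolding n by (simp only: power_Suc diff_Suc_1)
  qed
qed

section \<open>Coverings of bounded energy for metrically quasiconformal maps\<close>

definition rad :: "('a::euclidean_space \<Rightarrow> 'a) \<Rightarrow> 'a \<Rightarrow> real \<Rightarrow> real"
  where "rad f y \<epsilon> = (SUP z\<in>cball y \<epsilon>. dist (f y) (f z))"

definition metric_ratio :: "real \<Rightarrow> ('a::euclidean_space \<Rightarrow> 'a) \<Rightarrow> 'a \<Rightarrow> real \<Rightarrow> bool"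
  where "metric_ratio K f y \<epsilon> \<longleftrightarrow> (\<forall>a\<in>sphere y \<epsilon>. \<forall>b\<in>sphere y \<epsilon>. dist (f y) (f a) \<le> K * dist (f y) (f b))"

text \<open>The image of the open ball is open, hence contained in the interior of the closed ball
  of radius \<open>rad f y \<epsilon>\<close>; so the maximum can only be attained on the
  sphere.\<close>

lemma rad_attained:
  assumes f: "continuous_on (cball y \<epsilon>) f" "inj_on f (cball y \<epsilon>)" and \<epsilon>: "0 < \<epsilon>"
  shows "z \<in> cball y \<epsilon> \<Longrightarrow> dist (f y) (f z) \<le> rad f y \<epsilon>"
    and "\<exists>a\<in>sphere y \<epsilon>. dist (f y) (f a) = rad f y \<epsilon>"
    and "rad f y \<epsilon> > 0"
proof -
  have cont: "continuous_on (cball y \<epsilon>) (\<lambda>z. dist (f y) (f z))"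
    by (intro continuous_intros f)
  have bdd: "bdd_above ((\<lambda>z. dist (f y) (f z)) ` cball y \<epsilon>)"
    using compact_continuous_image[OF cont compact_cball] by (simp add: bounded_imp_bdd_above compact_imp_bounded)
  show le: "dist (f y) (f z) \<le> rad f y \<epsilon>" if "z \<in> cball y \<epsilon>" for z
    unfolding rad_def using cSUP_upper[OF that bdd] .
  obtain a where a: "a \<in> cball y \<epsilon>" "\<And>z. z \<in> cball y \<epsilon> \<Longrightarrow> dist (f y) (f z) \<le> dist (f y) (f a)"
    using continuous_attains_sup[OF compact_cball _ cont] \<epsilon> by auto
  have ra: "dist (f y) (f a) = rad f y \<epsilon>"
    using le[OF a(1)] a(2) \<epsilon> unfolding rad_def by (intro antisym cSUP_least) auto
  have "f ` ball y \<epsilon> \<subseteq> interior (cball (f y) (rad f y \<epsilon>))"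
    by (rule interior_maximal) (use le invariance_of_domain_ball[OF f(1) \<epsilon> f(2)] in auto)
  then have "a \<notin> ball y \<epsilon>" using ra by force
  then have as: "a \<in> sphere y \<epsilon>" using a(1) by auto
  then show "\<exists>a\<in>sphere y \<epsilon>. dist (f y) (f a) = rad f y \<epsilon>" using ra by blast
  have "f a \<noteq> f y" using f(2) a(1) as \<epsilon> by (metis centre_in_cball inj_onD dist_self less_imp_le mem_sphere order_less_irrefl)
  then show "rad f y \<epsilon> > 0" using ra by (metis zero_less_dist_iff)
qed

text \<open>The scale below which the ratio is bounded depends on the point, with no uniformity.
  This forces coverings by balls of variable radii.\<close>

locale metric_qc =
  fixes f :: "'a::euclidean_space \<Rightarrow> 'a" and \<Omega> :: "'a set" and K :: real
  assumes \<Omega>: "open \<Omega>" and cont: "continuous_on \<Omega> f" and inj: "inj_on f \<Omega>" and K: "K \<ge> 1"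
    and ratio: "y \<in> \<Omega> \<Longrightarrow> \<exists>\<epsilon>0>0. \<forall>\<epsilon>. 0 < \<epsilon> \<and> \<epsilon> < \<epsilon>0 \<longrightarrow> metric_ratio K f y \<epsilon>"
begin

lemma rad_facts:
  assumes "cball y \<epsilon> \<subseteq> \<Omega>" "0 < \<epsilon>"
  shows "z \<in> cball y \<epsilon> \<Longrightarrow> dist (f y) (f z) \<le> rad f y \<epsilon>"
    and "\<exists>a\<in>sphere y \<epsilon>. dist (f y) (f a) = rad f y \<epsilon>"
    and "rad f y \<epsilon> > 0"
    and "metric_ratio K f y \<epsilon> \<Longrightarrow> ball (f y) (rad f y \<epsilon> / K) \<subseteq> f ` ball y \<epsilon>"
proof -
  have c: "continuous_on (cball y \<epsilon>) f" "inj_on f (cball y \<epsilon>)"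
    using continuous_on_subset[OF cont assms(1)] inj_on_subset[OF inj assms(1)] by auto
  note r = rad_attained[OF c assms(2)]
  show "z \<in> cball y \<epsilon> \<Longrightarrow> dist (f y) (f z) \<le> rad f y \<epsilon>" "\<exists>a\<in>sphere y \<epsilon>. dist (f y) (f a) = rad f y \<epsilon>" "rad f y \<epsilon> > 0"
    using r by auto
  assume "metric_ratio K f y \<epsilon>"
  then show "ball (f y) (rad f y \<epsilon> / K) \<subseteq> f ` ball y \<epsilon>"
    using r(2) K unfolding metric_ratio_def
    by (intro ball_subset_image_ball[OF c _ assms(2)]) (auto simp: field_simps)
qed

lemma rad_mono:
  assumes "cball y \<epsilon>' \<subseteq> \<Omega>" "0 < \<epsilon>" "\<epsilon> \<le> \<epsilon>'"
  shows "rad f y \<epsilon> \<le> rad f y \<epsilon>'"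
proof -
  have s: "cball y \<epsilon> \<subseteq> cball y \<epsilon>'" using assms(3) by (rule subset_cball)
  have "cball y \<epsilon> \<subseteq> \<Omega>" using s assms(1) by blast
  then obtain a where "a \<in> sphere y \<epsilon>" "dist (f y) (f a) = rad f y \<epsilon>" using rad_facts(2) assms(2) by blast
  then show ?thesis using rad_facts(1)[OF assms(1), of a] assms by auto
qed

text \<open>
  Metric quasiconformality gives no doubling at a given scale, but if doubling fails at all small
  scales then \<open>f\<close> is flat at \<open>y\<close>, which is even better for the energy estimate.
\<close>

lemma good_radius:
  assumes y: "y \<in> \<Omega>" and \<eta>: "\<eta> > 0" and \<delta>: "\<delta> > 0"
  obtains r where "0 < r" "r \<le> \<eta>" "cball y (5 * r) \<subseteq> \<Omega>" "rad f y (5 * r) \<le> \<delta>" "metric_ratio K f y r"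
    "rad f y (5 * r) \<le> 25 * rad f y r \<or> rad f y (5 * r) \<le> \<eta> * r"
proof -
  obtain \<epsilon>0 where e0: "\<epsilon>0 > 0" "\<And>\<epsilon>. 0 < \<epsilon> \<Longrightarrow> \<epsilon> < \<epsilon>0 \<Longrightarrow> metric_ratio K f y \<epsilon>" using ratio[OF y] by blast
  obtain \<epsilon>1 where e1: "\<epsilon>1 > 0" "cball y \<epsilon>1 \<subseteq> \<Omega>" using \<Omega> y open_contains_cball by blast
  have "isCont f y" using cont \<Omega> y continuous_on_eq_continuous_at by blast
  then obtain \<epsilon>2 where e2: "\<epsilon>2 > 0" "\<And>z. dist z y < \<epsilon>2 \<Longrightarrow> dist (f z) (f y) < \<delta>"
    using \<delta> unfolding continuous_at_eps_delta by blast
  define r0 where "r0 = min (min \<epsilon>0 \<epsilon>1) (min \<epsilon>2 \<eta>) / 6"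
  have r0: "0 < r0" "6 * r0 \<le> \<epsilon>0" "6 * r0 \<le> \<epsilon>1" "6 * r0 \<le> \<epsilon>2" "6 * r0 \<le> \<eta>"
    using e0 e1 e2 \<eta> by (auto simp: r0_def)
  define \<rho> where "\<rho> k = r0 / 5 ^ k" for k :: nat
  have \<rho>: "0 < \<rho> k" "\<rho> k \<le> r0" for k
    using r0(1) by (auto simp: \<rho>_def divide_le_eq mult_le_cancel_left1)
  have \<rho>5: "5 * \<rho> (Suc k) = \<rho> k" for k by (simp add: \<rho>_def)
  have sub: "cball y (5 * \<rho> k) \<subseteq> \<Omega>" for k
    using e1(2) subset_cball[of "5 * \<rho> k" \<epsilon>1 y] \<rho>(2)[of k] r0 by (auto simp: subset_iff)
  have small: "rad f y (5 * \<rho> k) \<le> \<delta>" for k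
  proof -
    obtain a where "a \<in> sphere y (5 * \<rho> k)" "dist (f y) (f a) = rad f y (5 * \<rho> k)"
      using rad_facts(2)[OF sub[of k]] \<rho>(1)[of k] by (meson zero_less_mult_iff zero_less_numeral)
    moreover have "5 * \<rho> k < \<epsilon>2" using \<rho>[of k] r0 by linarith
    ultimately show ?thesis using e2(2)[of a] by (auto simp: dist_commute)
  qed
  have "\<exists>k. rad f y (5 * \<rho> k) \<le> 25 * rad f y (\<rho> k) \<or> rad f y (5 * \<rho> k) \<le> \<eta> * \<rho> k"
  proof (rule ccontr)
    assume "\<not> ?thesis"
    then have n: "25 * rad f y (\<rho> k) < rad f y (5 * \<rho> k)" "\<eta> * \<rho> k < rad f y (5 * \<rho> k)" for k by (auto simp: not_le)
    \<comment> \<open>If doubling fails at every step, dividing the radius by 5 divides the image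
      radius by more than 25 = 5^2. Then the image radius decays quadratically and finally falls
      below the assumed linear lower bound.\<close>
    have dec: "25 ^ k * rad f y (\<rho> k) \<le> \<delta>" for k
    proof (induction k)
      case 0
      have "rad f y (\<rho> 0) \<le> rad f y (5 * \<rho> 0)" by (rule rad_mono[OF sub]) (use \<rho>(1)[of 0] in auto)
      then show ?case using small[of 0] by simp
    next
      case (Suc k)
      have "25 * rad f y (\<rho> (Suc k)) \<le> rad f y (\<rho> k)" using n(1)[of "Suc k"] by (simp add: \<rho>5)
      then have "25 ^ k * (25 * rad f y (\<rho> (Suc k))) \<le> 25 ^ k * rad f y (\<rho> k)" by (intro mult_left_mono) auto
      moreover have "25 ^ Suc k * rad f y (\<rho> (Suc k)) = 25 ^ k * (25 * rad f y (\<rho> (Suc k)))" by simp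
      ultimately show ?case using Suc by linarith
    qed
    obtain k where k: "5 * \<delta> / (\<eta> * r0) < 5 ^ k" using real_arch_pow[of 5] by auto
    have "\<eta> * \<rho> (Suc k) < rad f y (\<rho> k)" using n(2)[of "Suc k"] by (simp add: \<rho>5)
    then have "25 ^ k * (\<eta> * \<rho> (Suc k)) \<le> \<delta>" using dec[of k] by (smt (verit) mult_left_mono zero_le_power)
    moreover have "25 ^ k * (\<eta> * \<rho> (Suc k)) = 5 ^ k * (\<eta> * r0) / 5"
    proof -
      have "(25::real) ^ k = 5 ^ k * 5 ^ k" by (simp flip: power_mult_distrib)
      then show ?thesis by (simp add: \<rho>_def)
    qed
    moreover have "5 * \<delta> < 5 ^ k * (\<eta> * r0)" using k \<eta> r0(1) by (simp add: field_simps)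
    ultimately show False by linarith
  qed
  then obtain k where k: "rad f y (5 * \<rho> k) \<le> 25 * rad f y (\<rho> k) \<or> rad f y (5 * \<rho> k) \<le> \<eta> * \<rho> k" by blast
  have "\<rho> k \<le> \<eta>" "\<rho> k < \<epsilon>0" using \<rho>[of k] r0 by linarith+
  then show thesis using that[of "\<rho> k"] \<rho>(1)[of k] sub small e0(2) k by blast
qed

text \<open>Two clamped values differ by at most 2D and are at least half of \<open>max l u\<close>,
  which bounds the difference of their logarithms. For u > 2L both values are clamped to
  \<open>L\<close>.\<close>

lemma clamped_log_oscillation:
  fixes l L u D a b :: real
  assumes l: "0 < l" "l < L" and D: "0 \<le> D" "D \<le> l / 8" and a: "\<bar>a - u\<bar> \<le> D" and b: "\<bar>b - u\<bar> \<le> D"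
  shows "\<bar>ln (max l (min L a)) - ln (max l (min L b))\<bar> \<le> (if u \<le> 2 * L then 4 * D / max l u else 0)"
proof (cases "u \<le> 2 * L")
  case False
  then have "L \<le> a" "L \<le> b" using a b D l by linarith+
  then show ?thesis using False by (simp add: min_def)
next
  case True
  define m where "m = max l u"
  have m: "m > 0" using l by (simp add: m_def)
  have lo: "m / 2 \<le> max l (min L c)" if "\<bar>c - u\<bar> \<le> D" for c
    using that D l True unfolding m_def by (auto simp: max_def min_def abs_le_iff)
  have key: "ln (max l (min L c)) - ln (max l (min L d)) \<le> 4 * D / m" if c: "\<bar>c - u\<bar> \<le> D" and d: "\<bar>d - u\<bar> \<le> D" for c d
  proof -
    define c' d' where "c' = max l (min L c)" and "d' = max l (min L d)"
    have p: "c' \<ge> m / 2" "d' \<ge> m / 2" using lo c d by (auto simp: c'_def d'_def)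
    then have p0: "c' > 0" "d' > 0" using m by linarith+
    have "ln c' - ln d' = ln (c' / d')" using p0 by (simp add: ln_div)
    also have "\<dots> \<le> c' / d' - 1" using p0 by (intro ln_le_minus_one) auto
    also have "\<dots> = (c' - d') / d'" using p0 by (simp add: field_simps)
    also have "\<dots> \<le> (2 * D) / d'"
    proof (rule divide_right_mono)
      have "\<bar>c - d\<bar> \<le> 2 * D" using c d by linarith
      then show "c' - d' \<le> 2 * D" using D unfolding c'_def d'_def by (auto simp: max_def min_def abs_le_iff)
    qed (use p0 in auto)
    also have "\<dots> \<le> (2 * D) / (m / 2)" using p m D by (intro divide_left_mono) auto
    finally show ?thesis by (simp add: c'_def d'_def)
  qed
  have "\<bar>ln (max l (min L a)) - ln (max l (min L b))\<bar> \<le> 4 * D / m"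
    using key[OF a b] key[OF b a] by (simp add: abs_le_iff)
  then show ?thesis using True by (simp add: m_def)
qed

text \<open>A discrete form of the fact that the n-energy of the logarithm of |f - f x| between the
  levels \<open>l\<close> and \<open>L\<close> is bounded by a multiple of ln (L / l). In a Vitali
  subfamily, flat balls are summed by volume in the domain. The other balls have images containing
  disjoint balls of comparable size, which are summed by volume in the target: each dyadic annulus
  about \<open>f x\<close> contributes a bounded amount, and there are about ln (L / l)
  annuli.\<close>

lemma bounded_energy_cover:
  assumes x: "cball x s \<subseteq> \<Omega>" and s: "s > 0" and l: "0 < l" "l < L"
  defines "v \<equiv> \<lambda>z. ln (max l (min L (dist (f x) (f z))))"
  shows "\<exists>I r w. finite I \<and> I \<subseteq> cball x s \<and> (\<forall>y\<in>I. 0 < r y \<and> r y \<le> s \<and> 0 \<le> w y) \<and>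
    (\<forall>y\<in>I. \<forall>y'\<in>I. y \<noteq> y' \<longrightarrow> ball y (r y) \<inter> ball y' (r y') = {}) \<and>
    cball x s \<subseteq> (\<Union>y\<in>I. ball y (5 * r y)) \<and>
    (\<forall>y\<in>I. \<forall>z\<in>ball y (5 * r y). \<forall>z'\<in>ball y (5 * r y). \<bar>v z - v z'\<bar> \<le> w y) \<and>
    (\<Sum>y\<in>I. w y ^ DIM('a)) \<le> 1 + (400 * K) ^ DIM('a) * (2 * ln (L / l) + 3)"
proof -
  define n where "n = DIM('a)"
  have n: "n > 0" by (simp add: n_def)
  \<comment> \<open>The second bound limits the energy of all flat balls together to (8 \<eta> s /
    l)^n \<le> 1; the first keeps all radii below \<open>s\<close>.\<close>
  define \<eta> where "\<eta> = min s (l / (8 * s))"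
  have \<eta>: "\<eta> > 0" "\<eta> \<le> s" "8 * \<eta> * s \<le> l"
  proof -
    show "\<eta> > 0" "\<eta> \<le> s" using s l by (auto simp: \<eta>_def)
    have "\<eta> \<le> l / (8 * s)" by (simp add: \<eta>_def)
    then show "8 * \<eta> * s \<le> l" using s by (simp add: field_simps)
  qed
  define good where "good y r \<longleftrightarrow> 0 < r \<and> r \<le> \<eta> \<and> cball y (5 * r) \<subseteq> \<Omega> \<and> rad f y (5 * r) \<le> l / 8 \<and> metric_ratio K f y r \<and>
    (rad f y (5 * r) \<le> 25 * rad f y r \<or> rad f y (5 * r) \<le> \<eta> * r)" for y r
  have "\<forall>y. \<exists>r. y \<in> cball x s \<longrightarrow> good y r"
  proof (intro allI)
    fix y
    show "\<exists>r. y \<in> cball x s \<longrightarrow> good y r"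
    proof (cases "y \<in> cball x s")
      case True
      then have y: "y \<in> \<Omega>" using x by blast
      have l8: "l / 8 > 0" using l by simp
      show ?thesis using good_radius[OF y \<eta>(1) l8] unfolding good_def by metis
    qed auto
  qed
  then obtain r where r: "\<And>y. y \<in> cball x s \<Longrightarrow> good y (r y)" using choice[of "\<lambda>y r. y \<in> cball x s \<longrightarrow> good y r"] by blast
  have cov: "cball x s \<subseteq> (\<Union>y\<in>cball x s. ball y (r y))" using r unfolding good_def by force
  obtain C where C: "C \<subseteq> cball x s" "finite C" "cball x s \<subseteq> (\<Union>y\<in>C. ball y (r y))"
    by (rule compactE_image[OF compact_cball[of x s], of "cball x s" "\<lambda>y. ball y (r y)"])
      (use cov in auto)
  have rC: "0 < r y \<and> r y \<le> \<eta>" if "y \<in> C" for y using r[of y] C(1) that unfolding good_def by blast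
  obtain I where I: "I \<subseteq> C" "pairwise (\<lambda>i j. disjnt (ball i (r i)) (ball j (r j))) I"
    "cball x s \<subseteq> (\<Union>i\<in>I. ball i (5 * r i))"
    by (rule Vitali_covering_lemma_balls[OF C(3) rC])
  have fI: "finite I" using I(1) C(2) finite_subset by blast
  have Is: "I \<subseteq> cball x s" using I(1) C(1) by blast
  have rI: "good y (r y)" if "y \<in> I" for y using r Is that by blast
  have dis: "ball y (r y) \<inter> ball y' (r y') = {}" if "y \<in> I" "y' \<in> I" "y \<noteq> y'" for y y'
    using I(2) that unfolding pairwise_def disjnt_def by blast
  define D where "D y = rad f y (5 * r y)" for y
  define u where "u y = dist (f x) (f y)" for y
  define w where "w y = (if u y \<le> 2 * L then 4 * D y / max l (u y) else 0)" for y
  have D: "0 < D y" "D y \<le> l / 8" if "y \<in> I" for y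
    using rI[OF that] rad_facts(3)[of y "5 * r y"] unfolding good_def D_def by auto
  have w0: "0 \<le> w y" if "y \<in> I" for y using D[OF that] l by (simp add: w_def)
  have osc: "\<bar>v z - v z'\<bar> \<le> w y" if "y \<in> I" "z \<in> ball y (5 * r y)" "z' \<in> ball y (5 * r y)" for y z z'
  proof -
    have "\<bar>dist (f x) (f z) - u y\<bar> \<le> D y" if "z \<in> ball y (5 * r y)" for z
    proof -
      have "dist (f y) (f z) \<le> D y" unfolding D_def
        by (rule rad_facts(1)) (use rI[OF \<open>y \<in> I\<close>] that in \<open>auto simp: good_def\<close>)
      then show ?thesis
        using dist_triangle[of "f x" "f z" "f y"] dist_triangle[of "f x" "f y" "f z"] unfolding u_def
        by (simp add: abs_le_iff dist_commute)
    qed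
    then show ?thesis unfolding v_def w_def
      using clamped_log_oscillation[OF l, of "D y"] D[OF that(1)] that by (simp add: less_imp_le)
  qed
  define bad where "bad y \<longleftrightarrow> D y \<le> \<eta> * r y" for y
  have Ebad: "(\<Sum>y\<in>{y \<in> I. bad y}. w y ^ n) \<le> 1"
  proof -
    have "w y ^ n \<le> (4 * \<eta> / l) ^ n * r y ^ n" if y: "y \<in> I" "bad y" for y
    proof -
      have "4 * D y / max l (u y) \<le> 4 * D y / l" using D[OF y(1)] l by (intro divide_left_mono) auto
      also have "\<dots> \<le> 4 * (\<eta> * r y) / l" using y(2) l by (intro divide_right_mono) (auto simp: bad_def)
      finally have "w y \<le> (4 * \<eta> / l) * r y" using rI[OF y(1)] \<eta> l by (simp add: w_def good_def)
      then have "w y ^ n \<le> ((4 * \<eta> / l) * r y) ^ n" using w0[OF y(1)] by (intro power_mono) auto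
      then show ?thesis by (simp only: power_mult_distrib[of "4 * \<eta> / l" "r y" n])
    qed
    then have "(\<Sum>y\<in>{y \<in> I. bad y}. w y ^ n) \<le> (\<Sum>y\<in>{y \<in> I. bad y}. (4 * \<eta> / l) ^ n * r y ^ n)"
      by (intro sum_mono) auto
    also have "\<dots> = (4 * \<eta> / l) ^ n * (\<Sum>y\<in>{y \<in> I. bad y}. r y ^ n)" by (simp add: sum_distrib_left)
    also have "\<dots> \<le> (4 * \<eta> / l) ^ n * (2 * s) ^ n"
    proof (rule mult_left_mono)
      show "(\<Sum>y\<in>{y \<in> I. bad y}. r y ^ n) \<le> (2 * s) ^ n" unfolding n_def
      proof (rule disjoint_balls_packing[where c = "\<lambda>y. y"])
        fix y assume y: "y \<in> {y \<in> I. bad y}"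
        then have "dist x y \<le> s" "0 < r y" "r y \<le> s" using Is rI[of y] \<eta> unfolding good_def by auto
        then show "0 \<le> r y" by simp
        show "ball y (r y) \<subseteq> ball x (2 * s)"
        proof
          fix z assume "z \<in> ball y (r y)"
          then show "z \<in> ball x (2 * s)" using \<open>dist x y \<le> s\<close> \<open>r y \<le> s\<close> dist_triangle[of x z y] by auto
        qed
      qed (use fI dis s in auto)
    qed (use \<eta> l in auto)
    also have "\<dots> = (8 * \<eta> * s / l) ^ n"
    proof -
      have "(4 * \<eta> / l) * (2 * s) = 8 * \<eta> * s / l" by simp
      then show ?thesis by (metis power_mult_distrib)
    qed
    also have "\<dots> \<le> 1" using \<eta> l s by (intro power_le_one) auto
    finally show ?thesis .
  qed
  \<comment> \<open>Balls whose centres are mapped farther than 2L from \<open>f x\<close> have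
    weight zero, so only these remain.\<close>
  define J where "J = {y \<in> I. \<not> bad y \<and> u y \<le> 2 * L}"
  define m where "m y = max l (u y)" for y
  define d where "d y = rad f y (r y) / K" for y
  have J: "y \<in> I" "rad f y (5 * r y) \<le> 25 * (K * d y)" "0 < d y" "d y \<le> l / 8" "ball (f y) (d y) \<subseteq> f ` ball y (r y)"
    "ball y (r y) \<subseteq> \<Omega>" if "y \<in> J" for y
  proof -
    have g: "good y (r y)" and nb: "\<not> D y \<le> \<eta> * r y" using that rI by (auto simp: J_def bad_def)
    have c: "cball y (r y) \<subseteq> cball y (5 * r y)" using g unfolding good_def by (intro subset_cball) auto
    have c': "cball y (r y) \<subseteq> \<Omega>" using c g unfolding good_def by blast
    show "y \<in> I" using that by (simp add: J_def)
    show "rad f y (5 * r y) \<le> 25 * (K * d y)" using g nb K by (simp add: good_def D_def d_def)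
    have rp: "rad f y (r y) > 0" using rad_facts(3)[OF c'] g by (simp add: good_def)
    then show "0 < d y" using K by (simp add: d_def)
    have "rad f y (r y) \<le> rad f y (5 * r y)" by (rule rad_mono) (use g in \<open>auto simp: good_def\<close>)
    then have "rad f y (r y) \<le> l / 8" using g by (simp add: good_def)
    moreover have "d y \<le> rad f y (r y)" using rp K by (simp add: d_def divide_le_eq mult_le_cancel_left1)
    ultimately show "d y \<le> l / 8" by simp
    show "ball (f y) (d y) \<subseteq> f ` ball y (r y)" unfolding d_def
      by (rule rad_facts(4)[OF c']) (use g in \<open>auto simp: good_def\<close>)
    show "ball y (r y) \<subseteq> \<Omega>" using c' by auto
  qed
  have fJ: "finite J" using fI by (simp add: J_def)
  have "\<forall>y. \<exists>k::nat. 2 ^ k \<le> m y / l \<and> m y / l < 2 ^ Suc k"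
  proof
    fix y
    have "m y / l \<ge> 1" using l by (simp add: m_def)
    then show "\<exists>k::nat. 2 ^ k \<le> m y / l \<and> m y / l < 2 ^ Suc k" by (rule dyadic_index) blast
  qed
  then obtain k :: "'a \<Rightarrow> nat" where k: "\<And>y. 2 ^ k y \<le> m y / l" "\<And>y. m y / l < 2 ^ Suc (k y)" by metis
  define lam where "lam = ln (L / l)"
  have lam: "lam > 0" using l by (simp add: lam_def)
  \<comment> \<open>The number of dyadic annuli between \<open>l\<close> and 2L; as ln 2 \<ge> 1/2,
    it is at most about 2 ln (L / l) + 2.\<close>
  define N where "N = nat \<lfloor>2 * lam + 2\<rfloor>"
  have kN: "k y \<le> N" if "y \<in> J" for y
  proof -
    have "m y \<le> 2 * L" using that l by (simp add: J_def m_def)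
    then have "m y / l \<le> 2 * (L / l)" using l by (simp add: divide_right_mono)
    then have "2 ^ k y \<le> 2 * (L / l)" using k(1)[of y] by linarith
    then have "ln (2 ^ k y) \<le> ln (2 * (L / l))" using l by (subst ln_le_cancel_iff) auto
    moreover have "ln (2 * (L / l)) = ln 2 + lam" using l unfolding lam_def by (subst ln_mult) auto
    moreover have "ln (2 ^ k y) = real (k y) * ln 2" by (simp add: ln_realpow)
    ultimately have 1: "real (k y) * ln 2 \<le> ln 2 + lam" by simp
    have "1/2 \<le> ln (2::real)" using ln2_ge_two_thirds by linarith
    then have "real (k y) * (1/2) \<le> real (k y) * ln 2" by (intro mult_left_mono) auto
    moreover have "ln (2::real) \<le> 1" using ln_le_minus_one[of 2] by simp
    ultimately have "real (k y) \<le> 2 * lam + 2" using 1 by linarith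
    then show ?thesis unfolding N_def by (rule le_nat_floor)
  qed
  have "(\<Sum>y\<in>J. (d y / m y) ^ n) \<le> (\<Sum>j\<le>N. 4 ^ n)"
  proof (rule sum_buckets[OF fJ kN])
    fix j
    have "(\<Sum>y\<in>{y \<in> J. k y = j}. (d y / m y) ^ n) \<le> (\<Sum>y\<in>{y \<in> J. k y = j}. d y ^ n / (2 ^ j * l) ^ n)"
    proof (rule sum_mono)
      fix y assume y: "y \<in> {y \<in> J. k y = j}"
      have "2 ^ j * l \<le> m y" using k(1)[of y] y l by (simp add: field_simps)
      then have "(d y / m y) ^ n \<le> (d y / (2 ^ j * l)) ^ n"
        using J(3)[of y] y l by (intro power_mono divide_left_mono) (auto intro!: mult_pos_pos simp: m_def)
      then show "(d y / m y) ^ n \<le> d y ^ n / (2 ^ j * l) ^ n" by (simp add: power_divide)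
    qed
    also have "\<dots> = (\<Sum>y\<in>{y \<in> J. k y = j}. d y ^ n) / (2 ^ j * l) ^ n" by (simp add: sum_divide_distrib)
    also have "\<dots> \<le> (4 * (2 ^ j * l)) ^ n / (2 ^ j * l) ^ n"
    proof (rule divide_right_mono)
      \<comment> \<open>Balls of the j-th annulus have centres within 2 * 2^j l of
        \<open>f x\<close> and radii at most l/8, so they lie in the ball of radius 4 * 2^j
        l.\<close>
      show "(\<Sum>y\<in>{y \<in> J. k y = j}. d y ^ n) \<le> (4 * (2 ^ j * l)) ^ n" unfolding n_def
      proof (rule disjoint_balls_packing[where c = f])
        fix y assume y: "y \<in> {y \<in> J. k y = j}"
        show "0 \<le> d y" using J(3)[of y] y by simp
        have "m y < 2 ^ Suc (k y) * l" using k(2)[of y] l by (simp only: pos_divide_less_eq)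
        moreover have "u y \<le> m y" by (simp add: m_def)
        ultimately have "u y < 2 * (2 ^ j * l)" using y by simp
        moreover have "1 * l \<le> 2 ^ j * l" using l by (intro mult_right_mono) auto
        moreover have "d y \<le> l / 8" using J(4)[of y] y by blast
        ultimately have "u y < 2 * (2 ^ j * l)" "d y \<le> 2 * (2 ^ j * l)" using l by linarith+
        then show "ball (f y) (d y) \<subseteq> ball (f x) (4 * (2 ^ j * l))"
          using dist_triangle[of "f x" _ "f y"] unfolding u_def subset_iff mem_ball by (smt (verit))
      next
        fix y y' assume y: "y \<in> {y \<in> J. k y = j}" "y' \<in> {y \<in> J. k y = j}" "y \<noteq> y'"
        have "f ` ball y (r y) \<inter> f ` ball y' (r y') = f ` (ball y (r y) \<inter> ball y' (r y'))"
          by (rule inj_on_image_Int[OF inj, symmetric]) (use J(6) y in auto)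
        also have "\<dots> = {}" using dis[of y y'] J(1) y by auto
        finally show "ball (f y) (d y) \<inter> ball (f y') (d y') = {}" using J(5)[of y] J(5)[of y'] y by blast
      qed (use fJ l in auto)
    qed (use l in auto)
    also have "\<dots> = 4 ^ n" using l by (simp add: power_mult_distrib)
    finally show "(\<Sum>y\<in>{y \<in> J. k y = j}. (d y / m y) ^ n) \<le> 4 ^ n" .
  qed
  also have "\<dots> \<le> 4 ^ n * (2 * lam + 3)"
  proof -
    have "real N \<le> 2 * lam + 2" using lam by (simp add: N_def)
    then have "4 ^ n * (real N + 1) \<le> 4 ^ n * (2 * lam + 3)" by (intro mult_left_mono) auto
    then show ?thesis by (simp add: algebra_simps)
  qed
  finally have Ed: "(\<Sum>y\<in>J. (d y / m y) ^ n) \<le> 4 ^ n * (2 * lam + 3)" .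
  have "(\<Sum>y\<in>I. w y ^ n) = (\<Sum>y\<in>{y \<in> I. bad y}. w y ^ n) + (\<Sum>y\<in>{y \<in> I. \<not> bad y}. w y ^ n)"
    using fI by (subst sum.union_disjoint[symmetric]) (auto intro!: sum.cong)
  also have "(\<Sum>y\<in>{y \<in> I. \<not> bad y}. w y ^ n) = (\<Sum>y\<in>J. w y ^ n)"
    using fI n by (intro sum.mono_neutral_right) (auto simp: J_def w_def)
  also have "\<dots> \<le> (\<Sum>y\<in>J. (100 * K) ^ n * (d y / m y) ^ n)"
  proof (rule sum_mono)
    fix y assume y: "y \<in> J"
    have "w y = 4 * D y / m y" using y by (simp add: w_def J_def m_def)
    also have "\<dots> \<le> 4 * (25 * (K * d y)) / m y"
      using J(2)[OF y] l by (intro divide_right_mono) (auto simp: D_def m_def)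
    finally have "w y \<le> (100 * K) * (d y / m y)" by simp
    then have "w y ^ n \<le> ((100 * K) * (d y / m y)) ^ n" using w0[OF J(1)[OF y]] by (intro power_mono) auto
    then show "w y ^ n \<le> (100 * K) ^ n * (d y / m y) ^ n" by (simp only: power_mult_distrib[of "100 * K" "d y / m y" n])
  qed
  also have "\<dots> \<le> (100 * K) ^ n * (4 ^ n * (2 * lam + 3))"
    using Ed K by (simp flip: sum_distrib_left)
  also have "\<dots> = (400 * K) ^ n * (2 * lam + 3)"
  proof -
    have "(100 * K) * 4 = 400 * K" by simp
    then have "(100 * K) ^ n * 4 ^ n = (400 * K) ^ n" by (metis power_mult_distrib)
    then show ?thesis by (metis mult.assoc)
  qed
  finally have E: "(\<Sum>y\<in>I. w y ^ n) \<le> 1 + (400 * K) ^ n * (2 * lam + 3)" using Ebad by linarith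
  have 1: "\<forall>y\<in>I. 0 < r y \<and> r y \<le> s \<and> 0 \<le> w y"
  proof
    fix y assume y: "y \<in> I"
    show "0 < r y \<and> r y \<le> s \<and> 0 \<le> w y" using rI[OF y] w0[OF y] \<eta>(2) unfolding good_def by auto
  qed
  have 2: "\<forall>y\<in>I. \<forall>y'\<in>I. y \<noteq> y' \<longrightarrow> ball y (r y) \<inter> ball y' (r y') = {}" using dis by blast
  have 3: "\<forall>y\<in>I. \<forall>z\<in>ball y (5 * r y). \<forall>z'\<in>ball y (5 * r y). \<bar>v z - v z'\<bar> \<le> w y" using osc by blast
  have 4: "(\<Sum>y\<in>I. w y ^ DIM('a)) \<le> 1 + (400 * K) ^ DIM('a) * (2 * ln (L / l) + 3)"
    using E by (simp only: n_def lam_def)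
  show ?thesis
    by (rule exI[of _ I], rule exI[of _ r], rule exI[of _ w]) (intro conjI fI Is 1 2 I(3) 3 4)
qed

end

section \<open>The ring estimate and weak quasisymmetry\<close>

lemma geometric_sum_le:
  assumes "0 \<le> b" "b < (1::real)"
  shows "(\<Sum>i\<le>m. b ^ i) \<le> 1 / (1 - b)"
  using assms by (simp add: sum_gp0 divide_right_mono)

text \<open>
  The points \<open>P j\<close> lie on spheres whose radii are equally spaced, so they are spread out along a
  set of dimension one; this makes a weight that grows slowly towards the point integrable.
\<close>

lemma spread_points_average:
  fixes x y :: "'a::euclidean_space" and P :: "nat \<Rightarrow> 'a"
  assumes s: "s > 0" and r: "0 < r" "r \<le> s" and y: "y \<in> cball x s" and N: "N > 0" "real N \<ge> 4 * s / r"
    and P: "\<And>j. j \<in> {1..N} \<Longrightarrow> dist x (P j) = s / 2 + s / (2 * real N) * real j"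
    and k: "\<And>j. j \<in> {1..N} \<Longrightarrow> 2 ^ k j \<le> 4 * s / (r + dist y (P j))"
  shows "(\<Sum>j\<in>{1..N}. (3/2) ^ k j) \<le> 68 * real N"
proof -
  define m where "m = (MAX j\<in>{1..N}. k j)"
  have km: "k j \<le> m" if "j \<in> {1..N}" for j unfolding m_def using that by (intro Max_ge) auto
  have "(\<Sum>j\<in>{1..N}. (3/2) ^ k j) \<le> (\<Sum>i\<le>m. (3/2) ^ i * (17 * real N / 2 ^ i))"
  proof (rule sum_buckets[OF _ km])
    fix i
    define J where "J = {j \<in> {1..N}. k j = i}"
    have "real (card J) \<le> 17 * real N / 2 ^ i"
    proof (cases "J = {}")
      case False
      then obtain j0 where j0: "j0 \<in> J" by blast
      have close: "\<bar>dist x (P j) - dist x y\<bar> \<le> 4 * s / 2 ^ i" if "j \<in> J" for j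
      proof -
        have "r + dist y (P j) > 0" using r by (simp add: add_pos_nonneg)
        moreover have "2 ^ i \<le> 4 * s / (r + dist y (P j))" using k[of j] that by (auto simp: J_def)
        ultimately have "r + dist y (P j) \<le> 4 * s / 2 ^ i" by (simp add: field_simps)
        then show ?thesis
          using r dist_triangle[of x "P j" y] dist_triangle[of x y "P j"] by (simp add: abs_le_iff dist_commute)
      qed
      \<comment> \<open>The spacing s/(2N) of the radii allows 16N/2^i + 1 indices in a bucket. As
        \<open>N\<close> is at least 4s/r, the 1 is absorbed, which turns 16 into 17.\<close>
      have N2: "1 \<le> real N / 2 ^ i"
      proof -
        have "2 ^ i \<le> 4 * s / (r + dist y (P j0))" using k[of j0] j0 by (auto simp: J_def)
        also have "\<dots> \<le> 4 * s / r" using s r by (intro divide_left_mono) (auto intro!: mult_pos_pos add_pos_nonneg)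
        finally have "2 ^ i \<le> real N" using N(2) by linarith
        then show ?thesis by simp
      qed
      have "real (card J) \<le> 16 * real N / 2 ^ i + 1"
      proof (rule card_close_nats)
        fix j j' assume j: "j \<in> J" "j' \<in> J"
        have "s / (2 * real N) * (real j - real j') = dist x (P j) - dist x (P j')"
          using P[of j] P[of j'] j by (simp add: J_def right_diff_distrib)
        also have "\<dots> \<le> 8 * s / 2 ^ i" using close[OF j(1)] close[OF j(2)] by (simp add: abs_le_iff)
        finally have "s * (real j - real j') \<le> s * (16 * real N / 2 ^ i)" using N(1) by (simp add: field_simps)
        then show "real j - real j' \<le> 16 * real N / 2 ^ i" using s by (simp only: mult_le_cancel_left_pos)
      qed (auto simp: J_def)
      moreover have "17 * real N / 2 ^ i = 16 * real N / 2 ^ i + real N / 2 ^ i" by (simp flip: add_divide_distrib)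
      ultimately show ?thesis using N2 by linarith
    qed auto
    then have "(3/2) ^ i * real (card J) \<le> (3/2) ^ i * (17 * real N / 2 ^ i)" by (intro mult_left_mono) auto
    then show "(\<Sum>j\<in>{j \<in> {1..N}. k j = i}. (3/2) ^ k j) \<le> (3/2) ^ i * (17 * real N / 2 ^ i)"
      by (simp add: J_def mult.commute)
  qed auto
  \<comment> \<open>The weight 3/2 is below 2, the rate at which the buckets shrink, so the series
    converges; its sum 4 gives 68 = 17 * 4.\<close>
  also have "\<dots> = 17 * real N * (\<Sum>i\<le>m. (3/4) ^ i)"
    by (simp add: sum_distrib_left power_divide mult_ac flip: power_mult_distrib)
  also have "\<dots> \<le> 17 * real N * 4"
  proof (rule mult_left_mono)
    show "(\<Sum>i\<le>m. (3/4) ^ i) \<le> (4::real)" using geometric_sum_le[of "3/4" m] by simp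
  qed simp
  finally show ?thesis by simp
qed

text \<open>In a dyadic shell about \<open>p\<close> the sum of the n-th powers is comparable to the
  volume of the disjoint balls divided by that of the shell, hence at most 2^n. Summed over all
  shells this would grow with their number; the factor b^k makes the sum converge.\<close>

lemma packed_kappa_sum:
  fixes p :: "'a::euclidean_space" and k :: "'a \<Rightarrow> nat"
  assumes I: "finite I" and r: "\<And>y. y \<in> I \<Longrightarrow> 0 < r y" and s: "s > 0"
    and dis: "\<And>y y'. y \<in> I \<Longrightarrow> y' \<in> I \<Longrightarrow> y \<noteq> y' \<Longrightarrow> ball y (r y) \<inter> ball y' (r y') = {}"
    and k: "\<And>y. y \<in> I \<Longrightarrow> 2 ^ k y \<le> 4 * s / (r y + dist y p) \<and> 4 * s / (r y + dist y p) < 2 ^ Suc (k y)"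
    and b: "0 \<le> b" "b < 1"
  shows "(\<Sum>y\<in>I. (r y / (r y + dist y p)) ^ DIM('a) * b ^ k y) \<le> 2 ^ DIM('a) / (1 - b)"
proof -
  define n where "n = DIM('a)"
  define m where "m = (if I = {} then 0 else MAX y\<in>I. k y)"
  have km: "k y \<le> m" if "y \<in> I" for y unfolding m_def using that I by auto
  have "(\<Sum>y\<in>I. (r y / (r y + dist y p)) ^ n * b ^ k y) \<le> (\<Sum>i\<le>m. 2 ^ n * b ^ i)"
  proof (rule sum_buckets[OF I km])
    fix i
    define J where "J = {y \<in> I. k y = i}"
    define R where "R = 4 * s / 2 ^ i"
    have R: "R > 0" using s by (simp add: R_def)
    have J: "r y + dist y p \<le> R" "R / 2 < r y + dist y p" "0 < r y" if "y \<in> J" for y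
    proof -
      have ry: "r y > 0" using that r by (auto simp: J_def)
      then have pos: "r y + dist y p > 0" by (simp add: add_pos_nonneg)
      have kk: "2 ^ i \<le> 4 * s / (r y + dist y p)" "4 * s / (r y + dist y p) < 2 * 2 ^ i"
        using k[of y] that by (auto simp: J_def)
      show "r y + dist y p \<le> R" "R / 2 < r y + dist y p" "0 < r y"
        using kk pos ry by (auto simp: R_def field_simps)
    qed
    have "(\<Sum>y\<in>J. (r y / (r y + dist y p)) ^ n) \<le> (\<Sum>y\<in>J. r y ^ n / (R / 2) ^ n)"
    proof (rule sum_mono)
      fix y assume y: "y \<in> J"
      have "r y / (r y + dist y p) \<le> r y / (R / 2)"
        using J[OF y] R by (intro divide_left_mono) (auto intro!: mult_pos_pos)
      moreover have "0 \<le> r y / (r y + dist y p)" using J[OF y] by (simp add: add_nonneg_nonneg)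
      ultimately have "(r y / (r y + dist y p)) ^ n \<le> (r y / (R / 2)) ^ n" by (intro power_mono)
      then show "(r y / (r y + dist y p)) ^ n \<le> r y ^ n / (R / 2) ^ n" by (simp only: power_divide)
    qed
    also have "\<dots> = (\<Sum>y\<in>J. r y ^ n) / (R / 2) ^ n" by (simp add: sum_divide_distrib)
    also have "\<dots> \<le> R ^ n / (R / 2) ^ n"
    proof (rule divide_right_mono)
      show "(\<Sum>y\<in>J. r y ^ n) \<le> R ^ n" unfolding n_def
      proof (rule disjoint_balls_packing[where c = "\<lambda>y. y"])
        fix y assume y: "y \<in> J"
        show "ball y (r y) \<subseteq> ball p R"
        proof
          fix z assume "z \<in> ball y (r y)"
          then show "z \<in> ball p R" using J(1)[OF y] dist_triangle[of p z y] by (auto simp: dist_commute)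
        qed
        show "0 \<le> r y" using J(3)[OF y] by simp
      qed (use I dis R in \<open>auto simp: J_def\<close>)
    qed (use R in auto)
    also have "\<dots> = 2 ^ n" using R by (simp add: power_divide)
    finally have "(\<Sum>y\<in>J. (r y / (r y + dist y p)) ^ n) * b ^ i \<le> 2 ^ n * b ^ i" using b by (intro mult_right_mono) auto
    then show "(\<Sum>y\<in>{y \<in> I. k y = i}. (r y / (r y + dist y p)) ^ n * b ^ k y) \<le> 2 ^ n * b ^ i"
      by (simp add: J_def sum_distrib_right)
  qed
  also have "\<dots> = 2 ^ n * (\<Sum>i\<le>m. b ^ i)" by (simp add: sum_distrib_left)
  also have "\<dots> \<le> 2 ^ n * (1 / (1 - b))"
    using geometric_sum_le[OF b] by (intro mult_left_mono) auto
  finally show ?thesis by (simp add: n_def)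
qed

context metric_qc
begin

text \<open>Let \<open>p\<close> and \<open>q\<close> lie on one sphere, with images at distances at
  most \<open>l\<close> and at least \<open>L\<close>. Joining both to a random point
  \<open>z\<close> gives ln (L / l) \<le> 4 + 4 C2 (S p + S q), where \<open>S a\<close> sums the
  weights times the angular sizes to the power n - 1, seen from \<open>a\<close>. Plain Hoelder
  would lose a logarithm, since the n-th powers of the angular sizes need not be summable uniformly.
  So Young's inequality is used with weights that favour balls near \<open>a\<close>: the angular
  part then converges, and the energy part becomes small on average over the spheres. The free
  parameter \<theta> makes the energy coefficient as small as desired.\<close>

lemma ring_estimate_aux:
  assumes n2: "DIM('a) \<ge> 2" and x: "cball x s \<subseteq> \<Omega>" and s: "s > 0" and l: "0 < l" "l < L"
    and pq: "\<And>t. s / 2 \<le> t \<Longrightarrow> t \<le> s \<Longrightarrow> \<exists>p\<in>sphere x t. dist (f x) (f p) \<le> l"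
      "\<And>t. s / 2 \<le> t \<Longrightarrow> t \<le> s \<Longrightarrow> \<exists>q\<in>sphere x t. L \<le> dist (f x) (f q)"
    and \<theta>: "0 < \<theta>" "\<theta> \<le> 1" and c: "c > 1" "c ^ (DIM('a) * (DIM('a) - 1)) = 3/2"
  defines "n \<equiv> DIM('a)"
  shows "ln (L / l) \<le> 4 + 8 * (6 * 120 ^ n) * (68 * \<theta> * (1 + (400 * K) ^ n * (2 * ln (L / l) + 3)) + (1 / \<theta>) ^ n * (2 ^ n / (1 - (1 / c) ^ n)))"
proof -
  define lam where "lam = ln (L / l)"
  define v where "v z = ln (max l (min L (dist (f x) (f z))))" for z
  obtain I r w where Iall: "finite I \<and> I \<subseteq> cball x s \<and> (\<forall>y\<in>I. 0 < r y \<and> r y \<le> s \<and> 0 \<le> w y) \<and>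
    (\<forall>y\<in>I. \<forall>y'\<in>I. y \<noteq> y' \<longrightarrow> ball y (r y) \<inter> ball y' (r y') = {}) \<and>
    cball x s \<subseteq> (\<Union>y\<in>I. ball y (5 * r y)) \<and>
    (\<forall>y\<in>I. \<forall>z\<in>ball y (5 * r y). \<forall>z'\<in>ball y (5 * r y).
      \<bar>ln (max l (min L (dist (f x) (f z)))) - ln (max l (min L (dist (f x) (f z'))))\<bar> \<le> w y) \<and>
    (\<Sum>y\<in>I. w y ^ DIM('a)) \<le> 1 + (400 * K) ^ DIM('a) * (2 * ln (L / l) + 3)"
    using bounded_energy_cover[OF x s l] by (elim exE)
  have I: "finite I" "I \<subseteq> cball x s" "\<And>y. y \<in> I \<Longrightarrow> 0 < r y \<and> r y \<le> s \<and> 0 \<le> w y"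
    "\<And>y y'. y \<in> I \<Longrightarrow> y' \<in> I \<Longrightarrow> y \<noteq> y' \<Longrightarrow> ball y (r y) \<inter> ball y' (r y') = {}"
    "cball x s \<subseteq> (\<Union>y\<in>I. ball y (5 * r y))"
    "\<And>y z z'. y \<in> I \<Longrightarrow> z \<in> ball y (5 * r y) \<Longrightarrow> z' \<in> ball y (5 * r y) \<Longrightarrow>
       \<bar>ln (max l (min L (dist (f x) (f z)))) - ln (max l (min L (dist (f x) (f z'))))\<bar> \<le> w y"
    "(\<Sum>y\<in>I. w y ^ DIM('a)) \<le> 1 + (400 * K) ^ DIM('a) * (2 * ln (L / l) + 3)"
    using Iall by blast+
  have I6: "\<bar>v z - v z'\<bar> \<le> w y" if "y \<in> I" "z \<in> ball y (5 * r y)" "z' \<in> ball y (5 * r y)" for y z z'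
    using I(6)[OF that] by (simp add: v_def)
  define E where "E = (\<Sum>y\<in>I. w y ^ n)"
  define C2 where "C2 = (6 * 120 ^ n :: real)"
  define C3 where "C3 = 2 ^ n / (1 - (1 / c) ^ n)"
  have n: "n \<ge> 2" using n2 by (simp add: n_def)
  have c1: "0 < 1 / c" "1 / c < 1" "(1 / c) ^ n < 1" using c n by (auto simp: power_less_one_iff)
  \<comment> \<open>The spheres have to be dense at the scale of the smallest ball of the
    cover.\<close>
  obtain N :: nat where N: "N > 0" "\<And>y. y \<in> I \<Longrightarrow> real N \<ge> 4 * s / r y"
  proof -
    define B where "B = (\<Sum>y\<in>I. 4 * s / r y)"
    have "4 * s / r y \<le> B" if "y \<in> I" for y
      unfolding B_def using I(1,3) s that by (intro member_le_sum) (auto intro: divide_nonneg_nonneg simp: less_imp_le)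
    then show thesis using that[of "Suc (nat \<lceil>B\<rceil>)"] by (smt (verit) of_nat_Suc real_nat_ceiling_ge zero_less_Suc)
  qed
  define t where "t j = s / 2 + s / (2 * real N) * real j" for j :: nat
  have t: "s / 2 \<le> t j" "t j \<le> s" if "j \<in> {1..N}" for j
  proof -
    have "s / (2 * real N) * real j \<le> s / (2 * real N) * real N" using that s by (intro mult_left_mono) auto
    then show "t j \<le> s" using N(1) by (simp add: t_def)
    show "s / 2 \<le> t j" using s by (simp add: t_def)
  qed
  have "\<forall>j. \<exists>p. j \<in> {1..N} \<longrightarrow> dist x p = t j \<and> dist (f x) (f p) \<le> l" using pq(1) t by (metis mem_sphere)
  then obtain P where P: "\<And>j. j \<in> {1..N} \<Longrightarrow> dist x (P j) = t j \<and> dist (f x) (f (P j)) \<le> l" by metis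
  have "\<forall>j. \<exists>p. j \<in> {1..N} \<longrightarrow> dist x p = t j \<and> L \<le> dist (f x) (f p)" using pq(2) t by (metis mem_sphere)
  then obtain Q where Q: "\<And>j. j \<in> {1..N} \<Longrightarrow> dist x (Q j) = t j \<and> L \<le> dist (f x) (f (Q j))" by metis
  define S where "S p = (\<Sum>y\<in>I. w y * (r y / (r y + dist y p)) ^ (n - 1))" for p
  have ave: "(\<Sum>j\<in>{1..N}. S (Z j)) \<le> real N * (68 * \<theta> * E + (1 / \<theta>) ^ n * C3)"
    if Z: "\<And>j. j \<in> {1..N} \<Longrightarrow> dist x (Z j) = t j" for Z
  proof -
    define R where "R j y = r y + dist y (Z j)" for j y
    have R: "0 < R j y" "R j y \<le> 4 * s" if "j \<in> {1..N}" "y \<in> I" for j y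
    proof -
      have "dist x y \<le> s" "r y \<le> s" "0 < r y" using I(2) I(3)[of y] that by auto
      moreover have "dist x (Z j) \<le> s" using Z t that by simp
      ultimately show "R j y \<le> 4 * s" "0 < R j y" unfolding R_def using dist_triangle3[of y "Z j" x] zero_le_dist[of y "Z j"] by linarith+
    qed
    have "\<forall>j y. \<exists>k::nat. j \<in> {1..N} \<longrightarrow> y \<in> I \<longrightarrow> 2 ^ k \<le> 4 * s / R j y \<and> 4 * s / R j y < 2 ^ Suc k"
    proof (intro allI)
      fix j y
      show "\<exists>k::nat. j \<in> {1..N} \<longrightarrow> y \<in> I \<longrightarrow> 2 ^ k \<le> 4 * s / R j y \<and> 4 * s / R j y < 2 ^ Suc k"
      proof (cases "j \<in> {1..N} \<and> y \<in> I")
        case True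
        then have "1 \<le> 4 * s / R j y" using R[of j y] by simp
        then show ?thesis by (rule dyadic_index) blast
      qed blast
    qed
    then obtain k :: "nat \<Rightarrow> 'a \<Rightarrow> nat" where
      k: "\<And>j y. j \<in> {1..N} \<Longrightarrow> y \<in> I \<Longrightarrow> 2 ^ k j y \<le> 4 * s / R j y \<and> 4 * s / R j y < 2 ^ Suc (k j y)"
      by metis
    define \<kappa> where "\<kappa> j y = r y / R j y" for j y
    have \<kappa>: "0 \<le> \<kappa> j y" if "j \<in> {1..N}" "y \<in> I" for j y using R[OF that] I(3)[of y] that by (simp add: \<kappa>_def)
    have young: "w y * \<kappa> j y ^ (n - 1) \<le> \<theta> * (w y ^ n * (3/2) ^ k j y) + (1 / \<theta>) ^ n * (\<kappa> j y ^ n * ((1 / c) ^ n) ^ k j y)"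
      if "j \<in> {1..N}" "y \<in> I" for j y
    proof -
      \<comment> \<open>Young's inequality is applied to w u^(n-1) and \<kappa>/u. The choice of
        \<open>c\<close> makes the n-th power of u^(n-1) grow like (3/2)^k, the rate that averaging
        over the spheres tolerates, while (\<kappa>/u)^n gains the decay c^(-nk).\<close>
      define u where "u = \<theta> * c ^ k j y"
      have u: "u > 0" using \<theta> c by (simp add: u_def)
      have w: "0 \<le> w y" using I(3) that by simp
      have "w y * u ^ (n - 1) * (\<kappa> j y / u) ^ (n - 1) \<le> (w y * u ^ (n - 1)) ^ n + (\<kappa> j y / u) ^ n"
        by (rule young_power) (use w u \<kappa>[OF that] n in auto)
      moreover have "w y * u ^ (n - 1) * (\<kappa> j y / u) ^ (n - 1) = w y * \<kappa> j y ^ (n - 1)"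
        using u by (simp add: power_divide)
      moreover have "(w y * u ^ (n - 1)) ^ n \<le> \<theta> * (w y ^ n * (3/2) ^ k j y)"
      proof -
        have "(u ^ (n - 1)) ^ n = \<theta> ^ (n * (n - 1)) * (c ^ (n * (n - 1))) ^ k j y"
          by (simp add: u_def power_mult_distrib mult_ac flip: power_mult)
        also have "\<dots> = \<theta> ^ (n * (n - 1)) * (3/2) ^ k j y" by (simp only: n_def c(2))
        finally have e: "(u ^ (n - 1)) ^ n = \<theta> ^ (n * (n - 1)) * (3/2) ^ k j y" .
        have "n * (n - 1) \<ge> 1" using n by simp
        then have "\<theta> ^ (n * (n - 1)) \<le> \<theta> ^ 1" using \<theta> by (intro power_decreasing) auto
        then have "\<theta> ^ (n * (n - 1)) * (w y ^ n * (3/2) ^ k j y) \<le> \<theta> * (w y ^ n * (3/2) ^ k j y)"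
          using w by (intro mult_right_mono) auto
        moreover have "(w y * u ^ (n - 1)) ^ n = \<theta> ^ (n * (n - 1)) * (w y ^ n * (3/2) ^ k j y)"
          unfolding power_mult_distrib e by simp
        ultimately show ?thesis by simp
      qed
      moreover have "(\<kappa> j y / u) ^ n = (1 / \<theta>) ^ n * (\<kappa> j y ^ n * ((1 / c) ^ n) ^ k j y)"
        by (simp add: u_def power_divide power_mult_distrib mult_ac flip: power_mult)
      ultimately show ?thesis by linarith
    qed
    have "(\<Sum>j\<in>{1..N}. S (Z j)) \<le> (\<Sum>j\<in>{1..N}. \<theta> * (\<Sum>y\<in>I. w y ^ n * (3/2) ^ k j y) + (1 / \<theta>) ^ n * C3)"
    proof (rule sum_mono)
      fix j assume j: "j \<in> {1..N}"
      have "S (Z j) \<le> (\<Sum>y\<in>I. \<theta> * (w y ^ n * (3/2) ^ k j y) + (1 / \<theta>) ^ n * (\<kappa> j y ^ n * ((1 / c) ^ n) ^ k j y))"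
        unfolding S_def by (rule sum_mono) (use young[OF j] in \<open>simp add: \<kappa>_def R_def\<close>)
      also have "\<dots> = \<theta> * (\<Sum>y\<in>I. w y ^ n * (3/2) ^ k j y) + (1 / \<theta>) ^ n * (\<Sum>y\<in>I. \<kappa> j y ^ n * ((1 / c) ^ n) ^ k j y)"
        by (simp add: sum.distrib sum_distrib_left)
      also have "(\<Sum>y\<in>I. \<kappa> j y ^ n * ((1 / c) ^ n) ^ k j y) \<le> C3"
        unfolding \<kappa>_def R_def C3_def n_def
        by (rule packed_kappa_sum[OF I(1) _ s I(4)]) (use I(3) k[OF j] c1 in \<open>auto simp: R_def n_def\<close>)
      finally show "S (Z j) \<le> \<theta> * (\<Sum>y\<in>I. w y ^ n * (3/2) ^ k j y) + (1 / \<theta>) ^ n * C3"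
        using \<theta> by (simp add: mult_left_mono)
    qed
    also have "\<dots> = \<theta> * (\<Sum>y\<in>I. w y ^ n * (\<Sum>j\<in>{1..N}. (3/2) ^ k j y)) + real N * ((1 / \<theta>) ^ n * C3)"
      by (simp add: sum.distrib sum_distrib_left sum.swap[of _ I])
    also have "(\<Sum>y\<in>I. w y ^ n * (\<Sum>j\<in>{1..N}. (3/2) ^ k j y)) \<le> (\<Sum>y\<in>I. w y ^ n * (68 * real N))"
    proof (rule sum_mono, rule mult_left_mono)
      fix y assume y: "y \<in> I"
      show "(\<Sum>j\<in>{1..N}. (3/2) ^ k j y) \<le> 68 * real N"
      proof (rule spread_points_average[OF s])
        show "0 < r y" "r y \<le> s" "y \<in> cball x s" using I(2,3) y by auto
        show "N > 0" "4 * s / r y \<le> real N" using N y by auto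
        fix j assume j: "j \<in> {1..N}"
        show "dist x (Z j) = s / 2 + s / (2 * real N) * real j" using Z[OF j] by (simp add: t_def)
        show "2 ^ k j y \<le> 4 * s / (r y + dist y (Z j))" using k[OF j y] by (simp add: R_def)
      qed
      show "0 \<le> w y ^ n" using I(3) y by simp
    qed
    also have "(\<Sum>y\<in>I. w y ^ n * (68 * real N)) = 68 * real N * E" by (simp add: E_def sum_distrib_right mult.commute)
    finally show ?thesis using \<theta> by (simp add: algebra_simps mult_left_mono)
  qed
  have S0: "0 \<le> S p" for p unfolding S_def using I(3) by (intro sum_nonneg) (auto simp: less_imp_le)
  define T where "T = 2 * (68 * \<theta> * E + (1 / \<theta>) ^ n * C3)"
  \<comment> \<open>Averaging the sum over all spheres yields one sphere on which both fans are
    cheap.\<close>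
  have "\<exists>j\<in>{1..N}. S (P j) + S (Q j) \<le> T"
  proof (rule ccontr)
    assume "\<not> ?thesis"
    then have "\<And>j. j \<in> {1..N} \<Longrightarrow> T < S (P j) + S (Q j)" by (meson not_le)
    then have "(\<Sum>j\<in>{1..N}. T) < (\<Sum>j\<in>{1..N}. S (P j) + S (Q j))"
      using N(1) by (intro sum_strict_mono) auto
    then show False using ave[of P] ave[of Q] P Q by (simp add: sum.distrib T_def algebra_simps)
  qed
  then obtain j where j: "j \<in> {1..N}" "S (P j) + S (Q j) \<le> T" by blast
  define p q where "p = P j" and "q = Q j"
  have pW: "p \<in> cball x s" "q \<in> cball x s" using P[OF j(1)] Q[OF j(1)] t[OF j(1)] by (auto simp: p_def q_def)
  have V: "lam = v q - v p"
  proof -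
    have "v p = ln l" "v q = ln L" using P[OF j(1)] Q[OF j(1)] l by (auto simp: v_def p_def q_def max_def min_def)
    then show ?thesis using l by (simp add: lam_def ln_div)
  qed
  have fan: "\<exists>M. \<forall>y\<in>I. M y \<in> sets lborel \<and> bounded (M y) \<and>
    {z \<in> cball x s. closed_segment a z \<inter> ball y (5 * r y) \<noteq> {}} \<subseteq> M y \<and>
    measure lborel (M y) \<le> C2 * (r y / (r y + dist y a)) ^ (n - 1) * (unit_ball_vol (real n) * s ^ n)"
    if a: "a \<in> cball x s" for a
    unfolding C2_def n_def by (rule bchoice) (use fan_measure[OF a s] I(3) in blast)
  obtain M where M: "\<And>y. y \<in> I \<Longrightarrow> M y \<in> sets lborel \<and> bounded (M y) \<and>
    {z \<in> cball x s. closed_segment p z \<inter> ball y (5 * r y) \<noteq> {}} \<subseteq> M y \<and>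
    measure lborel (M y) \<le> C2 * (r y / (r y + dist y p)) ^ (n - 1) * (unit_ball_vol (real n) * s ^ n)"
    using fan[OF pW(1)] by blast
  obtain M' where M': "\<And>y. y \<in> I \<Longrightarrow> M' y \<in> sets lborel \<and> bounded (M' y) \<and>
    {z \<in> cball x s. closed_segment q z \<inter> ball y (5 * r y) \<noteq> {}} \<subseteq> M' y \<and>
    measure lborel (M' y) \<le> C2 * (r y / (r y + dist y q)) ^ (n - 1) * (unit_ball_vol (real n) * s ^ n)"
    using fan[OF pW(2)] by blast
  define cc where "cc y = C2 * (r y / (r y + dist y p)) ^ (n - 1) + C2 * (r y / (r y + dist y q)) ^ (n - 1)" for y
  obtain z where z: "z \<in> cball x s" "(\<Sum>y\<in>{y \<in> I. z \<in> M y \<union> M' y}. w y) \<le> (\<Sum>y\<in>I. w y * cc y) + 1"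
  proof (rule averaging[OF I(1) _ s, where M = "\<lambda>y. M y \<union> M' y" and c = cc and x = x and w = w])
    fix y assume y: "y \<in> I"
    show "0 \<le> w y" using I(3) y by simp
    show "M y \<union> M' y \<in> sets lborel \<and> bounded (M y \<union> M' y)" using M[OF y] M'[OF y] by auto
    have "measure lborel (M y \<union> M' y) \<le> measure lborel (M y) + measure lborel (M' y)"
      using M[OF y] M'[OF y] by (intro measure_Un_le) auto
    also have "\<dots> \<le> cc y * (unit_ball_vol (real n) * s ^ n)"
      using M[OF y] M'[OF y] by (simp add: cc_def distrib_right)
    finally show "measure lborel (M y \<union> M' y) \<le> cc y * (unit_ball_vol (real DIM('a)) * s ^ DIM('a))" by (simp add: n_def)
  qed
  have seg: "\<bar>v a - v z\<bar> \<le> 2 * (\<Sum>y\<in>{y \<in> I. z \<in> M y \<union> M' y}. w y)"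
    if a: "a \<in> cball x s" and sub: "\<And>y. y \<in> I \<Longrightarrow> {z \<in> cball x s. closed_segment a z \<inter> ball y (5 * r y) \<noteq> {}} \<subseteq> M y \<union> M' y" for a
  proof -
    have cs: "closed_segment a z \<subseteq> cball x s" using a z(1) by (intro closed_segment_subset convex_cball)
    have "\<bar>v a - v z\<bar> \<le> 2 * (\<Sum>y\<in>{y \<in> I. closed_segment a z \<inter> ball y (5 * r y) \<noteq> {}}. w y)"
    proof (rule variation_bound)
      show "continuous_on (closed_segment a z) v" unfolding v_def
        using l continuous_on_subset[OF cont] cs x by (intro continuous_intros) (auto simp: max_def)
      show "finite I" "closed_segment a z \<subseteq> (\<Union>y\<in>I. ball y (5 * r y))" using I(1,5) cs by auto
      show "0 \<le> w y" if "y \<in> I" for y using I(3)[OF that] by simp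
      show "\<bar>v b - v c\<bar> \<le> w y" if "y \<in> I" "b \<in> ball y (5 * r y) \<inter> closed_segment a z" "c \<in> ball y (5 * r y) \<inter> closed_segment a z" for y b c
        using I6 that by blast
    qed auto
    also have "\<dots> \<le> 2 * (\<Sum>y\<in>{y \<in> I. z \<in> M y \<union> M' y}. w y)"
      using I(1,3) sub z(1) by (intro mult_left_mono sum_mono2) auto
    finally show ?thesis .
  qed
  \<comment> \<open>The difference of the values at \<open>q\<close> and \<open>p\<close> is split
    at \<open>z\<close>; each segment contributes twice the weights of the balls it meets.\<close>
  have "lam \<le> 4 * (\<Sum>y\<in>{y \<in> I. z \<in> M y \<union> M' y}. w y)"
    using seg[OF pW(1)] seg[OF pW(2)] M M' unfolding V abs_le_iff by force
  also have "\<dots> \<le> 4 * ((\<Sum>y\<in>I. w y * cc y) + 1)" using z(2) by simp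
  also have "(\<Sum>y\<in>I. w y * cc y) = C2 * (S p + S q)"
    unfolding S_def cc_def by (simp add: sum_distrib_left sum.distrib algebra_simps)
  also have "4 * (C2 * (S p + S q) + 1) \<le> 4 * (C2 * T + 1)" using j(2) by (simp add: p_def q_def C2_def)
  finally have "lam \<le> 4 + 8 * C2 * (68 * \<theta> * E + (1 / \<theta>) ^ n * C3)" by (simp add: T_def algebra_simps)
  also have "\<dots> \<le> 4 + 8 * C2 * (68 * \<theta> * (1 + (400 * K) ^ n * (2 * lam + 3)) + (1 / \<theta>) ^ n * C3)"
    using I(7)[folded n_def lam_def] \<theta> by (intro add_left_mono mult_left_mono add_right_mono) (auto simp: E_def C2_def)
  finally show ?thesis by (simp add: lam_def C2_def C3_def)
qed

end

context metric_qc
begin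

text \<open>Take for \<open>L\<close> and \<open>l\<close> the distances of the images of
  \<open>a\<close> and \<open>b\<close> from \<open>f x\<close>. The ring estimate bounds ln (L / l)
  by a constant plus a small multiple of itself, which is absorbed.\<close>

lemma weak_quasisymmetry:
  assumes n2: "DIM('a) \<ge> 2"
  shows "\<exists>H\<ge>1. \<forall>x a b. cball x (dist x b) \<subseteq> \<Omega> \<longrightarrow> dist x a \<le> dist x b / 2 \<longrightarrow> dist (f x) (f a) \<le> H * dist (f x) (f b)"
proof -
  define n where "n = DIM('a)"
  define C2 where "C2 = (6 * 120 ^ n :: real)"
  define K' where "K' = (400 * K) ^ n"
  define c where "c = root (n * (n - 1)) (3/2)"
  have nn: "n * (n - 1) > 0" using n2 by (simp add: n_def)
  have c: "c > 1" "c ^ (n * (n - 1)) = 3/2" using nn by (auto simp: c_def)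
  have C2: "C2 \<ge> 1" 
  proof -
    have "(1::real) \<le> 120 ^ n" by simp
    then show ?thesis unfolding C2_def by linarith
  qed
  have K': "K' \<ge> 1" unfolding K'_def using K by (intro one_le_power) simp
  \<comment> \<open>Chosen so that the coefficient of ln (L / l) on the right becomes 1/2.\<close>
  define \<theta> where "\<theta> = 1 / (8 * C2 * 68 * K' * 4)"
  have "1 \<le> C2 * K'" using C2 K' by (simp add: mult_ge1_I)
  then have \<theta>: "0 < \<theta>" "\<theta> \<le> 1" unfolding \<theta>_def using C2 K' by (auto simp: divide_le_eq)
  define B where "B = 4 + 8 * C2 * (68 * \<theta> * (1 + K' * 3) + (1 / \<theta>) ^ n * (2 ^ n / (1 - (1 / c) ^ n)))"
  have main: "ln (L / l) \<le> 2 * B"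
    if "cball x s \<subseteq> \<Omega>" "s > 0" "0 < l" "l < L"
      "\<And>t. s / 2 \<le> t \<Longrightarrow> t \<le> s \<Longrightarrow> \<exists>p\<in>sphere x t. dist (f x) (f p) \<le> l"
      "\<And>t. s / 2 \<le> t \<Longrightarrow> t \<le> s \<Longrightarrow> \<exists>q\<in>sphere x t. L \<le> dist (f x) (f q)" for x s l L
  proof -
    have "ln (L / l) \<le> 4 + 8 * C2 * (68 * \<theta> * (1 + K' * (2 * ln (L / l) + 3)) + (1 / \<theta>) ^ n * (2 ^ n / (1 - (1 / c) ^ n)))"
      using ring_estimate_aux[OF n2 that \<theta> c(1)] c(2) unfolding C2_def K'_def n_def by simp
    also have "\<dots> = B + (8 * C2 * 68 * K' * 2 * \<theta>) * ln (L / l)" by (simp add: B_def algebra_simps)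
    also have "8 * C2 * 68 * K' * 2 * \<theta> = 1/2" using C2 K' by (simp add: \<theta>_def)
    finally show ?thesis by simp
  qed
  define H where "H = exp (max 0 (2 * B))"
  have H: "H \<ge> 1" by (simp add: H_def)
  have "dist (f x) (f a) \<le> H * dist (f x) (f b)"
    if sub: "cball x (dist x b) \<subseteq> \<Omega>" and ab: "dist x a \<le> dist x b / 2" for x a b
  proof (cases "x = b \<or> dist (f x) (f a) \<le> dist (f x) (f b)")
    case True
    then show ?thesis
    proof
      assume "x = b"
      then show ?thesis using ab by simp
    next
      assume "dist (f x) (f a) \<le> dist (f x) (f b)"
      then show ?thesis using mult_right_mono[OF H, of "dist (f x) (f b)"] by simp
    qed
  next
    case False
    define s l L where "s = dist x b" and "l = dist (f x) (f b)" and "L = dist (f x) (f a)"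
    have s: "s > 0" and lL: "l < L" using False by (auto simp: s_def l_def L_def)
    have ins: "x \<in> \<Omega>" "b \<in> \<Omega>" using sub by auto
    then have "f x \<noteq> f b" using inj False by (metis inj_onD)
    then have l: "l > 0" by (simp add: l_def)
    \<comment> \<open>Otherwise the image of the open ball of radius \<open>t\<close> would contain
      a ball about \<open>f x\<close> of radius larger than \<open>l\<close>, hence
      \<open>f b\<close>, although \<open>b\<close> is at distance s \<ge> t from
      \<open>x\<close>.\<close>
    have P: "\<exists>p\<in>sphere x t. dist (f x) (f p) \<le> l" if t: "s / 2 \<le> t" "t \<le> s" for t
    proof (rule ccontr)
      assume "\<not> ?thesis"
      then have gt: "\<And>p. p \<in> sphere x t \<Longrightarrow> l < dist (f x) (f p)" by force
      have t0: "t > 0" using t s by linarith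
      have ct: "cball x t \<subseteq> \<Omega>" using sub t by (auto simp: s_def)
      then have c': "continuous_on (cball x t) f" "inj_on f (cball x t)"
        using continuous_on_subset[OF cont] inj_on_subset[OF inj] by auto
      have "continuous_on (sphere x t) (\<lambda>p. dist (f x) (f p))"
        by (intro continuous_intros continuous_on_subset[OF c'(1)]) auto
      moreover have "sphere x t \<noteq> {}" using t0 by simp
      ultimately obtain p0 where p0: "p0 \<in> sphere x t" "\<And>p. p \<in> sphere x t \<Longrightarrow> dist (f x) (f p0) \<le> dist (f x) (f p)"
        using continuous_attains_inf[OF compact_sphere] by metis
      have "ball (f x) (dist (f x) (f p0)) \<subseteq> f ` ball x t" using ball_subset_image_ball[OF c' p0(2) t0] by blast
      moreover have "f b \<in> ball (f x) (dist (f x) (f p0))" using gt[OF p0(1)] by (simp add: l_def)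
      ultimately obtain b' where b': "b' \<in> ball x t" "f b = f b'" by blast
      then have "b = b'" using inj ins ct by (metis ball_subset_cball inj_onD subsetD)
      then show False using b' t by (simp add: s_def)
    qed
    \<comment> \<open>As t \<ge> s/2, the point \<open>a\<close> lies in the ball of radius
      \<open>t\<close>, and the maximal image distance over that ball is attained on its
      sphere.\<close>
    have Q: "\<exists>q\<in>sphere x t. L \<le> dist (f x) (f q)" if t: "s / 2 \<le> t" "t \<le> s" for t
    proof -
      have t0: "t > 0" using t s by linarith
      have ct: "cball x t \<subseteq> \<Omega>" using sub t by (auto simp: s_def)
      have "a \<in> cball x t" using ab t by (simp add: s_def)
      then have "L \<le> rad f x t" using rad_facts(1)[OF ct t0] by (simp add: L_def)
      then show ?thesis using rad_facts(2)[OF ct t0] by metis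
    qed
    have "ln (L / l) \<le> 2 * B" by (rule main[OF _ s l lL P Q]) (use sub in \<open>auto simp: s_def\<close>)
    then have "ln (L / l) \<le> max 0 (2 * B)" by simp
    then have "exp (ln (L / l)) \<le> H" unfolding H_def by simp
    moreover have "L / l > 0" using l lL by simp
    ultimately have "L / l \<le> H" by simp
    then show ?thesis using l by (simp add: L_def l_def field_simps)
  qed
  then show ?thesis using H by blast
qed

end

section \<open>Quasisymmetric maps\<close>

definition qs :: "(real \<Rightarrow> real) \<Rightarrow> 'a::metric_space set \<Rightarrow> ('a \<Rightarrow> 'a) \<Rightarrow> bool"
  where "qs H S f \<longleftrightarrow> continuous_on S f \<and> inj_on f S \<and>
    (\<forall>M. \<forall>x\<in>S. \<forall>a\<in>S. \<forall>b\<in>S.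
      (dist x a \<le> M * dist x b \<longrightarrow> dist (f x) (f a) \<le> H M * dist (f x) (f b)) \<and>
      (dist (f x) (f a) \<le> M * dist (f x) (f b) \<longrightarrow> dist x a \<le> H M * dist x b))"

text \<open>If \<open>a\<close> is 4^m times as far from \<open>x\<close> as \<open>b\<close>, the
  segment from \<open>x\<close> to \<open>a\<close> carries \<open>m\<close> points at geometrically
  growing distances. Weak quasisymmetry keeps their images at distance at least l/H^2 from each
  other and within H A of \<open>f x\<close>. As A \<le> M l, packing bounds
  \<open>m\<close>.\<close>

lemma qs_inverse_direction:
  fixes f :: "'a::euclidean_space \<Rightarrow> 'a"
  assumes B: "convex B" and inj: "inj_on f B" and H: "H \<ge> 1"
    and fw: "\<And>x a b. x \<in> B \<Longrightarrow> a \<in> B \<Longrightarrow> b \<in> B \<Longrightarrow> dist x a \<le> dist x b \<Longrightarrow> dist (f x) (f a) \<le> H * dist (f x) (f b)"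
  shows "\<exists>N\<ge>0. \<forall>x\<in>B. \<forall>a\<in>B. \<forall>b\<in>B. dist (f x) (f a) \<le> M * dist (f x) (f b) \<longrightarrow> dist x a \<le> N * dist x b"
proof -
  define n where "n = DIM('a)"
  obtain m :: nat where m: "(4 * H ^ 3 * M) ^ n < real m" using reals_Archimedean2 by blast
  have "dist x a \<le> 4 ^ m * dist x b"
    if x: "x \<in> B" "a \<in> B" "b \<in> B" and le: "dist (f x) (f a) \<le> M * dist (f x) (f b)" for x a b
  proof (rule ccontr)
    assume "\<not> ?thesis"
    then have gt: "4 ^ m * dist x b < dist x a" by simp
    define A l \<beta> where "A = dist (f x) (f a)" and "l = dist (f x) (f b)" and "\<beta> = dist x b"
    have xa: "x \<noteq> a" using gt zero_le_dist[of x b] by (metis dist_self mult_nonneg_nonneg not_le zero_le_numeral zero_le_power)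
    then have A: "A > 0" using inj x by (auto simp: A_def inj_on_def)
    have "x \<noteq> b" using le A by (auto simp: A_def)
    then have l: "l > 0" and \<beta>: "\<beta> > 0" using inj x by (auto simp: l_def \<beta>_def inj_on_def)
    define u where "u = (a - x) /\<^sub>R dist x a"
    have nu: "norm u = 1" using xa by (simp add: u_def dist_norm norm_minus_commute)
    define c where "c j = x + (4 ^ j * \<beta>) *\<^sub>R u" for j :: nat
    have cB: "c j \<in> B" if "j \<le> m" for j
    proof -
      define t where "t = 4 ^ j * \<beta> / dist x a"
      have "4 ^ j * \<beta> \<le> 4 ^ m * \<beta>" using that \<beta> by (intro mult_right_mono power_increasing) auto
      then have "4 ^ j * \<beta> \<le> dist x a" using gt unfolding \<beta>_def by linarith
      then have t: "0 \<le> t" "t \<le> 1" using \<beta> xa by (auto simp: t_def)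
      have "c j = (1 - t) *\<^sub>R x + t *\<^sub>R a" by (simp add: c_def u_def t_def algebra_simps divide_inverse)
      then show ?thesis using B x t by (simp add: convexD_alt)
    qed
    have dc: "dist x (c j) = 4 ^ j * \<beta>" for j using nu \<beta> by (simp add: c_def dist_norm)
    have dcc: "4 ^ i * \<beta> \<le> dist (c i) (c j)" if "i < j" for i j
    proof -
      have "c j - c i = ((4 ^ j - 4 ^ i) * \<beta>) *\<^sub>R u" by (simp add: c_def algebra_simps)
      then have "dist (c i) (c j) = \<bar>(4 ^ j - 4 ^ i) * \<beta>\<bar>" using nu by (metis dist_norm mult.right_neutral norm_minus_commute norm_scaleR)
      moreover have "(4::real) ^ Suc i \<le> 4 ^ j" using that by (intro power_increasing) auto
      then have "(4::real) ^ i \<le> 4 ^ j - 4 ^ i" using zero_le_power[of "4::real" i] by (simp; linarith)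
      then have "4 ^ i * \<beta> \<le> (4 ^ j - 4 ^ i) * \<beta>" using \<beta> by (intro mult_right_mono) auto
      ultimately show ?thesis by linarith
    qed
    have far: "l \<le> H * H * dist (f (c i)) (f (c j))" if "i < j" "j \<le> m" for i j
    proof -
      have "dist (c i) x \<le> dist (c i) (c j)" using dcc[OF that(1)] dc[of i] by (simp add: dist_commute)
      then have "dist (f (c i)) (f x) \<le> H * dist (f (c i)) (f (c j))" using fw cB x that by simp
      moreover have "dist x b \<le> dist x (c i)" unfolding dc using \<beta> by (simp add: \<beta>_def[symmetric] mult_le_cancel_right1)
      then have "l \<le> H * dist (f x) (f (c i))" unfolding l_def using fw cB x that by simp
      ultimately show ?thesis using H by (smt (verit, ccfv_threshold) dist_commute mult.assoc mult_left_mono)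
    qed
    \<comment> \<open>Half of the separation l/H^2 of the images, so the balls of this radius are
      disjoint; comparison with the enclosing radius 2HA gives the factor 4 H^3 M.\<close>
    define \<rho> where "\<rho> = l / (2 * (H * H))"
    have HH: "H * H \<ge> 1" using H by (simp add: mult_ge1_I)
    have \<rho>: "\<rho> > 0" "\<rho> \<le> l / 2" using l HH unfolding \<rho>_def by (auto simp: field_simps mult_le_cancel_left1)
    have lA: "l \<le> H * A"
    proof -
      have "1 * dist x b \<le> 4 ^ m * dist x b" by (intro mult_right_mono) auto
      then have "dist x b \<le> dist x a" using gt by linarith
      then show ?thesis unfolding l_def A_def using fw x by blast
    qed
    have "(\<Sum>j\<in>{1..m}. \<rho> ^ n) \<le> (2 * H * A) ^ n" unfolding n_def
    proof (rule disjoint_balls_packing[where c = "\<lambda>j. f (c j)" and p = "f x"])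
      fix i j assume ij: "i \<in> {1..m}" "j \<in> {1..m}" "i \<noteq> j"
      have "2 * \<rho> \<le> dist (f (c i)) (f (c j))"
      proof (cases "i < j")
        case True
        then show ?thesis using far[OF True] ij HH by (simp add: \<rho>_def divide_le_eq mult.commute)
      next
        case False
        then have "j < i" using ij by simp
        then show ?thesis using far[of j i] ij HH by (simp add: \<rho>_def divide_le_eq mult.commute dist_commute)
      qed
      then show "ball (f (c i)) \<rho> \<inter> ball (f (c j)) \<rho> = {}"
        by (intro disjoint_ballI) simp
    next
      fix j assume j: "j \<in> {1..m}"
      have "4 ^ j * \<beta> \<le> 4 ^ m * \<beta>" using j \<beta> by (intro mult_right_mono power_increasing) auto
      then have "dist x (c j) \<le> dist x a" unfolding dc using gt by (simp add: \<beta>_def)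
      then have "dist (f x) (f (c j)) \<le> H * A" unfolding A_def using fw x cB j by simp
      show "ball (f (c j)) \<rho> \<subseteq> ball (f x) (2 * H * A)"
      proof
        fix t assume "t \<in> ball (f (c j)) \<rho>"
        then have "dist (f (c j)) t < \<rho>" by simp
        then have "dist (f x) t < 2 * (H * A)"
          using \<open>dist (f x) (f (c j)) \<le> H * A\<close> \<rho> lA l dist_triangle[of "f x" t "f (c j)"] by linarith
        then show "t \<in> ball (f x) (2 * H * A)" by (simp add: mult.assoc)
      qed
    qed (use \<rho> H A in auto)
    then have "real m * \<rho> ^ n \<le> (2 * H * A) ^ n" by simp
    also have "\<dots> \<le> (2 * H * (M * l)) ^ n"
      using le H A by (intro power_mono mult_left_mono) (auto simp: A_def l_def)
    also have "2 * H * (M * l) = (4 * H ^ 3 * M) * \<rho>"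
      using H by (simp add: \<rho>_def power3_eq_cube)
    finally have "real m * \<rho> ^ n \<le> (4 * H ^ 3 * M) ^ n * \<rho> ^ n" by (simp only: power_mult_distrib)
    then show False using m \<rho>(1) by (simp add: mult_le_cancel_right)
  qed
  then show ?thesis by (intro exI[of _ "4 ^ m"]) auto
qed

text \<open>Two points of the small ball are less than 2\<delta> apart, so the balls on which weak
  quasisymmetry is applied stay in the ball of radius 4\<delta>. The admissible ratio is raised from
  1/2 by factors 3/2, and the packing argument supplies the inverse direction.\<close>

lemma (in metric_qc) local_quasisymmetry:
  assumes n2: "DIM('a) \<ge> 2" and B: "ball x0 (4 * \<delta>) \<subseteq> \<Omega>" "\<delta> > 0"
  shows "\<exists>H. qs H (ball x0 \<delta>) f"
proof -
  obtain H where H: "H \<ge> 1" "\<And>x a b. cball x (dist x b) \<subseteq> \<Omega> \<Longrightarrow> dist x a \<le> dist x b / 2 \<Longrightarrow> dist (f x) (f a) \<le> H * dist (f x) (f b)"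
    using weak_quasisymmetry[OF n2] by blast
  define U where "U = ball x0 \<delta>"
  have sub: "cball x (dist x b) \<subseteq> \<Omega>" if "x \<in> U" "b \<in> U" for x b
  proof
    fix z assume "z \<in> cball x (dist x b)"
    then have "dist x0 z < 4 * \<delta>"
      using that dist_triangle[of x0 z x] dist_triangle3[of x b x0] B(2) unfolding U_def by simp
    then show "z \<in> \<Omega>" using B by auto
  qed
  have UO: "U \<subseteq> \<Omega>" using B(1) B(2) by (auto simp: U_def)
  have cU: "convex U" by (simp add: U_def)
  have step: "\<exists>G\<ge>1. \<forall>x\<in>U. \<forall>a\<in>U. \<forall>b\<in>U. dist x a \<le> (1/2) * (3/2) ^ k * dist x b \<longrightarrow> dist (f x) (f a) \<le> G * dist (f x) (f b)" for k
  proof (induction k)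
    case 0
    then show ?case using H sub by (intro exI[of _ H]) auto
  next
    case (Suc k)
    then obtain G where G: "G \<ge> 1" "\<And>x a b. x \<in> U \<Longrightarrow> a \<in> U \<Longrightarrow> b \<in> U \<Longrightarrow> dist x a \<le> (1/2) * (3/2) ^ k * dist x b \<Longrightarrow> dist (f x) (f a) \<le> G * dist (f x) (f b)"
      by blast
    have "dist (f x) (f a) \<le> ((1 + H) * G) * dist (f x) (f b)"
      if x: "x \<in> U" "a \<in> U" "b \<in> U" and d: "dist x a \<le> (1/2) * (3/2) ^ Suc k * dist x b" for x a b
    proof -
      \<comment> \<open>The point two thirds of the way from \<open>x\<close> to \<open>a\<close>:
        it reduces the ratio by the factor 2/3, and \<open>a\<close> is at half the distance from a'
        that \<open>x\<close> is, as weak quasisymmetry requires.\<close>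
      define a' where "a' = (1/3) *\<^sub>R x + (2/3) *\<^sub>R a"
      have a'U: "a' \<in> U" unfolding a'_def using convexD[OF cU x(1,2), of "1/3" "2/3"] by simp
      have e1: "x - a' = (2/3) *\<^sub>R (x - a)" "a' - a = (1/3) *\<^sub>R (x - a)"
        by (simp_all add: a'_def algebra_simps flip: scaleR_add_left scaleR_diff_left)
      then have "dist x a' = (2/3) * dist x a" "dist a' a = (1/3) * dist x a" by (simp_all add: dist_norm)
      then have 1: "dist x a' \<le> (1/2) * (3/2) ^ k * dist x b" "dist a' a \<le> dist a' x / 2" using d by (simp_all add: dist_commute)
      have "dist (f x) (f a') \<le> G * dist (f x) (f b)" using G(2)[OF x(1) a'U x(3) 1(1)] .
      moreover have "dist (f a') (f a) \<le> H * dist (f a') (f x)" using H(2)[OF sub[OF a'U x(1)] 1(2)] .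
      moreover have "dist (f x) (f a) \<le> dist (f x) (f a') + dist (f a') (f a)" by (rule dist_triangle)
      ultimately have "dist (f x) (f a) \<le> (1 + H) * dist (f x) (f a')" by (simp add: algebra_simps dist_commute)
      also have "\<dots> \<le> (1 + H) * (G * dist (f x) (f b))"
        using H \<open>dist (f x) (f a') \<le> G * dist (f x) (f b)\<close> by (intro mult_left_mono) auto
      finally show ?thesis by (simp add: mult.assoc)
    qed
    moreover have "(1 + H) * G \<ge> 1" using H(1) G(1) by (intro mult_ge1_I) auto
    ultimately show ?case by blast
  qed
  have fw: "\<exists>G\<ge>1. \<forall>x\<in>U. \<forall>a\<in>U. \<forall>b\<in>U. dist x a \<le> M * dist x b \<longrightarrow> dist (f x) (f a) \<le> G * dist (f x) (f b)" for M
  proof -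
    obtain k where k: "2 * M < (3/2) ^ k" using real_arch_pow[of "3/2"] by auto
    obtain G where G: "G \<ge> 1" "\<And>x a b. x \<in> U \<Longrightarrow> a \<in> U \<Longrightarrow> b \<in> U \<Longrightarrow> dist x a \<le> (1/2) * (3/2) ^ k * dist x b \<Longrightarrow> dist (f x) (f a) \<le> G * dist (f x) (f b)"
      using step[of k] by blast
    have "M * dist x b \<le> (1/2) * (3/2) ^ k * dist x b" for x b :: 'a
      using k by (intro mult_right_mono) auto
    then show ?thesis using G by (meson order_trans)
  qed
  have injU: "inj_on f U" using inj_on_subset[OF inj UO] .
  obtain G1 where G1: "G1 \<ge> 1" "\<And>x a b. x \<in> U \<Longrightarrow> a \<in> U \<Longrightarrow> b \<in> U \<Longrightarrow> dist x a \<le> dist x b \<Longrightarrow> dist (f x) (f a) \<le> G1 * dist (f x) (f b)"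
    using fw[of 1] by auto
  have bw: "\<exists>N\<ge>0. \<forall>x\<in>U. \<forall>a\<in>U. \<forall>b\<in>U. dist (f x) (f a) \<le> M * dist (f x) (f b) \<longrightarrow> dist x a \<le> N * dist x b" for M
    using qs_inverse_direction[OF cU injU G1(1)] G1(2) by blast
  have "\<forall>M. \<exists>G. \<forall>x\<in>U. \<forall>a\<in>U. \<forall>b\<in>U. (dist x a \<le> M * dist x b \<longrightarrow> dist (f x) (f a) \<le> G * dist (f x) (f b)) \<and>
      (dist (f x) (f a) \<le> M * dist (f x) (f b) \<longrightarrow> dist x a \<le> G * dist x b)"
  proof
    fix M
    obtain G where G: "\<And>x a b. x \<in> U \<Longrightarrow> a \<in> U \<Longrightarrow> b \<in> U \<Longrightarrow> dist x a \<le> M * dist x b \<Longrightarrow> dist (f x) (f a) \<le> G * dist (f x) (f b)"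
      using fw[of M] by blast
    obtain N where N: "\<And>x a b. x \<in> U \<Longrightarrow> a \<in> U \<Longrightarrow> b \<in> U \<Longrightarrow> dist (f x) (f a) \<le> M * dist (f x) (f b) \<Longrightarrow> dist x a \<le> N * dist x b"
      using bw[of M] by blast
    have mx: "G * d \<le> max G N * d" "N * d \<le> max G N * d" if "d \<ge> 0" for d :: real using that by (auto intro: mult_right_mono)
    have "(dist x a \<le> M * dist x b \<longrightarrow> dist (f x) (f a) \<le> max G N * dist (f x) (f b)) \<and>
      (dist (f x) (f a) \<le> M * dist (f x) (f b) \<longrightarrow> dist x a \<le> max G N * dist x b)" if "x \<in> U" "a \<in> U" "b \<in> U" for x a b
      using G[OF that] N[OF that] mx(1)[of "dist (f x) (f b)"] mx(2)[of "dist x b"] by force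
    then show "\<exists>G. \<forall>x\<in>U. \<forall>a\<in>U. \<forall>b\<in>U. (dist x a \<le> M * dist x b \<longrightarrow> dist (f x) (f a) \<le> G * dist (f x) (f b)) \<and>
      (dist (f x) (f a) \<le> M * dist (f x) (f b) \<longrightarrow> dist x a \<le> G * dist x b)" by blast
  qed
  from choice[OF this] obtain G where "\<forall>M. \<forall>x\<in>U. \<forall>a\<in>U. \<forall>b\<in>U. (dist x a \<le> M * dist x b \<longrightarrow> dist (f x) (f a) \<le> G M * dist (f x) (f b)) \<and>
      (dist (f x) (f a) \<le> M * dist (f x) (f b) \<longrightarrow> dist x a \<le> G M * dist x b)" by blast
  then have "qs G U f" unfolding qs_def using injU continuous_on_subset[OF cont UO] by blast
  then show ?thesis unfolding U_def by blast
qed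

lemma qsD:
  assumes "qs H S f" "x \<in> S" "a \<in> S" "b \<in> S"
  shows "dist x a \<le> M * dist x b \<Longrightarrow> dist (f x) (f a) \<le> H M * dist (f x) (f b)"
    and "dist (f x) (f a) \<le> M * dist (f x) (f b) \<Longrightarrow> dist x a \<le> H M * dist x b"
  using assms unfolding qs_def by blast+

lemma qs_mono:
  assumes "qs H S f" "\<And>M. H M \<le> H' M"
  shows "qs H' S f"
proof -
  have *: "H M * d \<le> H' M * d" if "d \<ge> 0" for M d :: real using assms(2) that by (rule mult_right_mono)
  have "dist (f x) (f a) \<le> H' M * dist (f x) (f b)" if "x \<in> S" "a \<in> S" "b \<in> S" "dist x a \<le> M * dist x b" for x a b M
    using order_trans[OF qsD(1)[OF assms(1) that] *] by simp
  moreover have "dist x a \<le> H' M * dist x b" if "x \<in> S" "a \<in> S" "b \<in> S" "dist (f x) (f a) \<le> M * dist (f x) (f b)" for x a b M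
    using order_trans[OF qsD(2)[OF assms(1) that] *] by simp
  ultimately show ?thesis using assms(1) unfolding qs_def by blast
qed

lemma bilip_mono:
  assumes "bilip L S f" "L \<le> M"
  shows "bilip M S f"
proof -
  have *: "L * d \<le> M * d" if "d \<ge> 0" for d :: real using assms(2) that by (rule mult_right_mono)
  have "dist x y \<le> M * dist (f x) (f y) \<and> dist (f x) (f y) \<le> M * dist x y" if "x \<in> S" "y \<in> S" for x y
    using order_trans[OF bilipD(1)[OF assms(1) that] *] order_trans[OF bilipD(2)[OF assms(1) that] *] by simp
  then show ?thesis using assms by (simp add: bilip_def)
qed

text \<open>The second clause of \<open>qs\<close> is the first one for the inverse map, so
  inversion keeps the index; scaling keeps it because only ratios of distances occur. For
  compositions the two directions give H'(H M) and H(H' M), and their maximum is taken.\<close>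

interpretation qs_class: regularity_class "qs :: (real \<Rightarrow> real) \<Rightarrow> 'a::euclidean_space set \<Rightarrow> ('a \<Rightarrow> 'a) \<Rightarrow> bool"
proof
  fix i j :: "real \<Rightarrow> real" and S T :: "'a set" and f g :: "'a \<Rightarrow> 'a" and c L :: real
  show "qs i S f \<Longrightarrow> continuous_on S f" "qs i S f \<Longrightarrow> inj_on f S" by (auto simp: qs_def)
  show "qs i T f" if "qs i S f" "T \<subseteq> S"
    using that continuous_on_subset[of S f T] inj_on_subset[of f S T] unfolding qs_def by blast
  show "qs i S g" if q: "qs i S f" and e: "\<And>x. x \<in> S \<Longrightarrow> f x = g x"
  proof -
    have "continuous_on S g" "inj_on g S"
      using q e continuous_on_cong[OF refl e, of S] inj_on_cong[of S f g] by (simp_all add: qs_def)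
    then show ?thesis using qsD[OF q] unfolding qs_def by (simp flip: e)
  qed
  have mx: "H M * d \<le> max (H M) (H' M) * d" "H' M * d \<le> max (H M) (H' M) * d" if "d \<ge> 0" for H H' :: "real \<Rightarrow> real" and M d :: real
    using that by (auto intro: mult_right_mono)
  show "\<exists>k. \<forall>S f g. qs i S f \<longrightarrow> qs j (f ` S) g \<longrightarrow> qs k S (g \<circ> f :: 'a \<Rightarrow> 'a)"
  proof (intro exI[of _ "\<lambda>M. max (j (i M)) (i (j M))"] allI impI)
    fix S :: "'a set" and f g :: "'a \<Rightarrow> 'a" assume f: "qs i S f" and g: "qs j (f ` S) g"
    have "dist (g (f x)) (g (f a)) \<le> max (j (i M)) (i (j M)) * dist (g (f x)) (g (f b))"
      if "x \<in> S" "a \<in> S" "b \<in> S" "dist x a \<le> M * dist x b" for x a b M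
      using qsD(1)[OF g, of "f x" "f a" "f b" "i M"] qsD(1)[OF f that] that(1-3)
        mx(1)[of "dist (g (f x)) (g (f b))" "\<lambda>M. j (i M)" M "\<lambda>M. i (j M)"] by force
    moreover have "dist x a \<le> max (j (i M)) (i (j M)) * dist x b"
      if "x \<in> S" "a \<in> S" "b \<in> S" "dist (g (f x)) (g (f a)) \<le> M * dist (g (f x)) (g (f b))" for x a b M
      using qsD(2)[OF f, of x a b "j M"] qsD(2)[OF g _ _ _ that(4)] that(1-3)
        mx(2)[of "dist x b" "\<lambda>M. i (j M)" M "\<lambda>M. j (i M)"] by force
    ultimately show "qs (\<lambda>M. max (j (i M)) (i (j M))) S (g \<circ> f)"
      using f g continuous_on_compose[of S f g] comp_inj_on[of f S g] unfolding qs_def o_def by blast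
  qed
  show "qs i (f ` S) (inv_into S f)" if S: "open S" and f: "qs i S f"
  proof -
    have inj: "inj_on f S" and cont: "continuous_on S f" using f by (auto simp: qs_def)
    have "continuous_on (f ` S) (inv_into S f)"
      using continuous_on_inverse_open[OF S cont order_refl, of "inv_into S f"] inj by simp
    moreover have "inj_on (inv_into S f) (f ` S)" by (simp add: inj_on_inv_into)
    ultimately show ?thesis unfolding qs_def using qsD[OF f] inj by auto
  qed
  show "\<exists>i. \<forall>S f. bilip L S f \<longrightarrow> qs i S (f :: 'a \<Rightarrow> 'a)"
  proof (intro exI[of _ "\<lambda>M. L * L * M"] allI impI)
    fix S :: "'a set" and f :: "'a \<Rightarrow> 'a" assume f: "bilip L S f"
    have L: "L > 0" using f by (simp add: bilip_def)
    \<comment> \<open>The control function is also evaluated at negative ratios; there the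
      hypothesis forces all distances concerned to vanish.\<close>
    have neg: "a \<le> L * L * M * b" if a: "a \<le> L * a'" and a': "a' \<le> M * b'" and b: "b' \<le> L * b" "b \<le> L * b'" and nn: "0 \<le> a'" "0 \<le> b'" "0 \<le> b" for a a' b b' M :: real
    proof (cases "M \<ge> 0")
      case True
      have "a \<le> L * (M * b')" using a a' L by (smt (verit) mult_left_mono)
      also have "\<dots> \<le> L * (M * (L * b))" using b True L by (intro mult_left_mono) auto
      finally show ?thesis by (simp add: mult_ac)
    next
      case False
      then have "M * b' \<le> 0" using nn by (simp add: mult_le_0_iff)
      then have "a' = 0" "M * b' = 0" using a' nn by linarith+
      then have "b' = 0" "b = 0" using False b nn by auto
      then show ?thesis using a \<open>a' = 0\<close> by simp
    qed
    have "dist (f x) (f a) \<le> L * L * M * dist (f x) (f b)" if "x \<in> S" "a \<in> S" "b \<in> S" "dist x a \<le> M * dist x b" for x a b M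
      by (rule neg[OF _ that(4)]) (use bilipD[OF f that(1,2)] bilipD[OF f that(1,3)] in auto)
    moreover have "dist x a \<le> L * L * M * dist x b" if "x \<in> S" "a \<in> S" "b \<in> S" "dist (f x) (f a) \<le> M * dist (f x) (f b)" for x a b M
      by (rule neg[OF _ that(4)]) (use bilipD[OF f that(1,2)] bilipD[OF f that(1,3)] in auto)
    ultimately show "qs (\<lambda>M. L * L * M) S f"
      unfolding qs_def using bilip_continuous[OF f] bilip_inj[OF f] by blast
  qed
  show "qs i ((*\<^sub>R) c ` S) (\<lambda>x. c *\<^sub>R f (x /\<^sub>R c))" if c: "c > 0" and f: "qs i S f"
  proof -
    have e: "(c *\<^sub>R x) /\<^sub>R c = x" for x :: 'a using c by simp
    have d: "dist (c *\<^sub>R x) (c *\<^sub>R y) = c * dist x y" for x y :: 'a using c by (simp add: dist_scaleR_cancel)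
    have "continuous_on ((*\<^sub>R) c ` S) (\<lambda>x. c *\<^sub>R f (x /\<^sub>R c))"
    proof -
      have "continuous_on ((*\<^sub>R) c ` S) (\<lambda>x. x /\<^sub>R c)" by (intro continuous_intros)
      moreover have "(\<lambda>x. x /\<^sub>R c) ` (*\<^sub>R) c ` S = S" by (simp only: image_image e image_ident)
      ultimately have "continuous_on ((*\<^sub>R) c ` S) (f \<circ> (\<lambda>x. x /\<^sub>R c))"
        using f by (intro continuous_on_compose) (simp_all add: qs_def)
      then show ?thesis unfolding o_def by (rule continuous_on_scaleR[OF continuous_on_const])
    qed
    moreover have "inj_on (\<lambda>x. c *\<^sub>R f (x /\<^sub>R c)) ((*\<^sub>R) c ` S)"
    proof (rule inj_onI, clarify)
      fix x y assume xy: "x \<in> S" "y \<in> S" "c *\<^sub>R f ((c *\<^sub>R x) /\<^sub>R c) = c *\<^sub>R f ((c *\<^sub>R y) /\<^sub>R c)"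
      then have "f x = f y" using c unfolding e by simp
      then have "x = y" using f xy(1,2) by (auto simp: qs_def inj_on_def)
      then show "c *\<^sub>R x = c *\<^sub>R y" by simp
    qed
    moreover have "(dist (c *\<^sub>R x) (c *\<^sub>R a) \<le> M * dist (c *\<^sub>R x) (c *\<^sub>R b) \<longrightarrow>
        dist (c *\<^sub>R f x) (c *\<^sub>R f a) \<le> i M * dist (c *\<^sub>R f x) (c *\<^sub>R f b)) \<and>
      (dist (c *\<^sub>R f x) (c *\<^sub>R f a) \<le> M * dist (c *\<^sub>R f x) (c *\<^sub>R f b) \<longrightarrow>
        dist (c *\<^sub>R x) (c *\<^sub>R a) \<le> i M * dist (c *\<^sub>R x) (c *\<^sub>R b))" if "x \<in> S" "a \<in> S" "b \<in> S" for x a b M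
    proof -
      have r: "c * p \<le> q * (c * t) \<longleftrightarrow> p \<le> q * t" for p q t :: real using c by (simp add: mult.left_commute)
      show ?thesis unfolding d r using qsD[OF f that] by blast
    qed
    ultimately show ?thesis unfolding qs_def ball_simps e by blast
  qed
  show "\<exists>k. \<forall>S f. qs i S f \<or> qs j S f \<longrightarrow> qs k S (f :: 'a \<Rightarrow> 'a)"
  proof (intro exI[of _ "\<lambda>M. max (i M) (j M)"] allI impI)
    fix S :: "'a set" and f :: "'a \<Rightarrow> 'a" assume "qs i S f \<or> qs j S f"
    then show "qs (\<lambda>M. max (i M) (j M)) S f" by (rule disjE) (erule qs_mono, simp)+
  qed
qed

interpretation lip_class: regularity_class "bilip :: real \<Rightarrow> 'a::euclidean_space set \<Rightarrow> ('a \<Rightarrow> 'a) \<Rightarrow> bool"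
proof
  fix i j :: real and S T :: "'a set" and f g :: "'a \<Rightarrow> 'a" and c L :: real
  show "bilip i S f \<Longrightarrow> continuous_on S f" by (rule bilip_continuous)
  show "bilip i S f \<Longrightarrow> inj_on f S" by (rule bilip_inj)
  show "bilip i S f \<Longrightarrow> T \<subseteq> S \<Longrightarrow> bilip i T f" by (rule bilip_subset)
  show "bilip i S f \<Longrightarrow> (\<And>x. x \<in> S \<Longrightarrow> f x = g x) \<Longrightarrow> bilip i S g" by (simp add: bilip_def)
  show "\<exists>k. \<forall>S f g. bilip i S f \<longrightarrow> bilip j (f ` S) g \<longrightarrow> bilip k S (g \<circ> f :: 'a \<Rightarrow> 'a)" using bilip_comp by blast
  show "bilip i (f ` S) (inv_into S f)" if "open S" "bilip i S f"
    using bilip_inverse[OF that(2)] bilip_inj[OF that(2)] by simp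
  show "\<exists>i. \<forall>S f. bilip L S f \<longrightarrow> bilip i S (f :: 'a \<Rightarrow> 'a)" by blast
  show "bilip i ((*\<^sub>R) c ` S) (\<lambda>x. c *\<^sub>R f (x /\<^sub>R c))" if "c > 0" "bilip i S f"
    using that by (simp add: bilip_def dist_scaleR_cancel mult.left_commute)
  show "\<exists>k. \<forall>S f. bilip i S f \<or> bilip j S f \<longrightarrow> bilip k S (f :: 'a \<Rightarrow> 'a)"
  proof (intro exI[of _ "max i j"] allI impI)
    fix S :: "'a set" and f :: "'a \<Rightarrow> 'a" assume "bilip i S f \<or> bilip j S f"
    then show "bilip (max i j) S f" by (rule disjE) (erule bilip_mono, simp)+
  qed
qed

section \<open>Interpolation in Euclidean space\<close>

context regularity_class
begin

text \<open>
  The map \<open>g\<close> is the identity beyond a hyperplane, and the displacement bound takes the place of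
  regularity on that hyperplane and at infinity.
\<close>

definition tame :: "'i \<Rightarrow> real \<Rightarrow> ('a \<Rightarrow> 'a) \<Rightarrow> bool"
  where "tame j \<kappa> h \<longleftrightarrow>
    (\<forall>z. locP j z h \<or> (\<forall>z'. dist (h z') z' \<le> dist z' z / 2)) \<and> (\<forall>z. dist (h z) z \<le> (\<kappa> + norm z) / 2)"

text \<open>For \<open>z\<close> on the hyperplane, the distance of \<open>z'\<close> from the
  hyperplane is at most its distance from \<open>z\<close>, so the displacement bound becomes the
  second alternative of \<open>tame\<close>.\<close>

lemma tame_half_space:
  assumes e: "norm e = 1" and j: "\<And>z. z \<bullet> e < \<kappa> \<Longrightarrow> locP j z h" and id: "\<And>z. \<kappa> \<le> z \<bullet> e \<Longrightarrow> h z = z"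
    and d: "\<And>z. dist (h z) z \<le> \<bar>\<kappa> - z \<bullet> e\<bar> / 2" and \<kappa>: "\<kappa> \<ge> 0"
  shows "tame (ub j (bix 1)) \<kappa> h"
  unfolding tame_def
proof (intro conjI allI)
  fix z
  have ze: "\<bar>x \<bullet> e\<bar> \<le> norm x" for x using Cauchy_Schwarz_ineq2[of x e] e by simp
  have "\<bar>\<kappa> - z \<bullet> e\<bar> \<le> \<kappa> + norm z" using ze[of z] \<kappa> by (simp add: abs_le_iff)
  then show "dist (h z) z \<le> (\<kappa> + norm z) / 2" using d[of z] by simp
  consider "z \<bullet> e < \<kappa>" | "z \<bullet> e = \<kappa>" | "\<kappa> < z \<bullet> e" by linarith
  then show "locP (ub j (bix 1)) z h \<or> (\<forall>z'. dist (h z') z' \<le> dist z' z / 2)"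
  proof cases
    case 1
    then show ?thesis using locP_ub j by blast
  next
    case 2
    have "dist (h z') z' \<le> dist z' z / 2" for z'
      using d[of z'] ze[of "z' - z"] 2 by (simp add: dist_norm inner_diff_left abs_minus_commute)
    then show ?thesis by blast
  next
    case 3
    have "open {x. \<kappa> < x \<bullet> e}" by (simp add: open_halfspace_component_gt open_Collect_less continuous_on_inner)
    moreover have "bilip 1 {x. \<kappa> < x \<bullet> e} h" unfolding bilip_def using id by auto
    ultimately have "locP (bix 1) z h" using locP_bilip 3 by blast
    then show ?thesis using locP_ub by blast
  qed
qed

text \<open>\<open>R\<close> and \<epsilon> depend on the immersion family alone and are fixed
  before \<open>f\<close> and its index, so closeness is required independently of the distortion.
  Only \<open>j\<close> depends on the index of \<open>f\<close>.\<close>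

lemma interpolation:
  "\<exists>R \<epsilon>. 0 < \<epsilon> \<and> 0 \<le> R \<and> (\<forall>f f' i.
    (\<forall>w. norm w \<le> R \<longrightarrow> locP i w f \<and> locP i w f' \<and> dist (f w) w \<le> \<epsilon> \<and> dist (f' w) w \<le> \<epsilon> \<and> f' (f w) = w \<and> f (f' w) = w) \<longrightarrow>
    (\<exists>a a' M g g' j \<kappa> U V. homeomorphism UNIV UNIV a a' \<and> bilip M UNIV a \<and> bilip M UNIV a' \<and>
      homeomorphism UNIV UNIV g g' \<and> tame j \<kappa> g \<and> tame j \<kappa> g' \<and>
      open U \<and> U \<noteq> {} \<and> (\<forall>z\<in>U. g z = z) \<and> open V \<and> V \<noteq> {} \<and> (\<forall>w\<in>V. a (g (a' w)) = f w)))"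
proof -
  obtain e :: 'a where eB: "e \<in> Basis" using nonempty_Basis by blast
  obtain bs r L R where bs: "set bs = Basis - {e}"
    and fam: "immersion_family (\<lambda>s z. ribbons e bs s (squeeze e s z)) e r L R"
    using immersion_family_exists[OF eB] .
  define A where "A = (\<lambda>s z. ribbons e bs s (squeeze e s z))"
  have fam: "immersion_family A e r L R" using fam by (simp add: A_def)
  interpret immersion_family A e r L R by (rule fam)
  obtain a M \<rho> where a: "bilip M UNIV a" "\<rho> > 0" "\<And>z. norm z < \<rho> \<Longrightarrow> a z = A 0 z"
    using family_extension[OF eB, of bs] bs unfolding A_def by blast
  obtain a' where a': "homeomorphism UNIV UNIV a a'" "bilip M UNIV a'" using bilip_UNIV_homeomorphism[OF a(1)] .
  obtain m :: nat where m: "max 25 (2 * L\<^sup>2) < real m" using reals_Archimedean2 by blast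
  have L0: "0 < 2 * L\<^sup>2" using L by simp
  have m25: "m \<ge> 25" and mL: "1 / real m \<le> 1 / (2 * L\<^sup>2)"
    using m L0 by (simp, intro divide_left_mono) auto
  define \<kappa> where "\<kappa> = 4 * real m"
  \<comment> \<open>The first bound serves the lifts. The second keeps \<open>g z\<close> within the
    radius \<rho> inside which \<open>a\<close> agrees with the immersion.\<close>
  define \<epsilon> where "\<epsilon> = min (r / (320 * L)) (\<rho> / (8 * L))"
  have \<epsilon>: "0 < \<epsilon>" "160 * L * \<epsilon> < r" "2 * L * \<epsilon> < \<rho> / 2"
  proof -
    have Lp: "L > 0" using L by simp
    show "0 < \<epsilon>" using r a(2) Lp by (simp add: \<epsilon>_def)
    have "\<epsilon> \<le> r / (320 * L)" "\<epsilon> \<le> \<rho> / (8 * L)" by (auto simp: \<epsilon>_def)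
    then have "320 * (L * \<epsilon>) \<le> r" "8 * (L * \<epsilon>) \<le> \<rho>" using Lp by (auto simp: field_simps)
    then show "160 * L * \<epsilon> < r" "2 * L * \<epsilon> < \<rho> / 2" using r(1) a(2) by auto
  qed
  note \<epsilon>_small = \<epsilon>(3)
  have R0: "0 \<le> R" using bound[of 0 0] norm_ge_zero[of "A 0 0"] by (simp del: norm_ge_zero)
  show ?thesis
  proof (rule exI[of _ R], rule exI[of _ \<epsilon>], intro conjI allI impI)
    fix f f' i
    assume near: "\<forall>w. norm w \<le> R \<longrightarrow> locP i w f \<and> locP i w f' \<and> dist (f w) w \<le> \<epsilon> \<and> dist (f' w) w \<le> \<epsilon> \<and> f' (f w) = w \<and> f (f' w) = w"
    interpret near_identity P A e r L R f f' i \<epsilon>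
      by unfold_locales (use near \<epsilon> in auto)
    obtain g g' where g: "homeomorphism UNIV UNIV g g'" "\<And>z. \<kappa> \<le> z \<bullet> e \<Longrightarrow> g z = z \<and> g' z = z"
      "\<And>z. z \<bullet> e < \<kappa> \<Longrightarrow> locP gix z g \<and> locP gix z g'"
      "\<And>z. dist (g z) z \<le> \<bar>\<kappa> - z \<bullet> e\<bar> / 2 \<and> dist (g' z) z \<le> \<bar>\<kappa> - z \<bullet> e\<bar> / 2"
      "\<And>z. norm z < 1/8 \<Longrightarrow> A 0 (g z) = f (A 0 z) \<and> dist (g z) z \<le> 2 * L * \<epsilon>"
      using half_space_map[OF m25 mL] unfolding \<kappa>_def by blast
    have \<kappa>0: "\<kappa> \<ge> 0" by (simp add: \<kappa>_def)
    have t: "tame (ub gix (bix 1)) \<kappa> g" "tame (ub gix (bix 1)) \<kappa> g'"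
      by (rule tame_half_space[OF e _ _ _ \<kappa>0]; use g in blast)+
    define U where "U = {z. \<kappa> < z \<bullet> e}"
    have U: "open U" "U \<noteq> {}" "\<forall>z\<in>U. g z = z"
    proof -
      show "open U" unfolding U_def by (simp add: open_Collect_less continuous_on_inner)
      have "((\<kappa> + 1) *\<^sub>R e) \<bullet> e > \<kappa>" by simp
      then show "U \<noteq> {}" unfolding U_def by blast
      show "\<forall>z\<in>U. g z = z" using g(2) by (simp add: U_def)
    qed
    \<comment> \<open>On this image both \<open>z\<close> and \<open>g z\<close> lie where
      \<open>a\<close> agrees with \<open>A 0\<close>, so \<open>a\<close> turns the semiconjugacy
      into an equation for \<open>f\<close>.\<close>
    define V where "V = a ` ball 0 (min (1/8) (\<rho> / 2))"
    have V: "open V" "V \<noteq> {}"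
    proof -
      show "open V" unfolding V_def
        using invariance_of_domain[OF continuous_on_subset[OF bilip_continuous[OF a(1)]] _ inj_on_subset[OF bilip_inj[OF a(1)]]] by simp
      show "V \<noteq> {}" using a(2) by (simp add: V_def)
    qed
    have eq: "\<forall>w\<in>V. a (g (a' w)) = f w"
    proof
      fix w assume "w \<in> V"
      then obtain z where z: "norm z < 1/8" "norm z < \<rho> / 2" "w = a z" by (auto simp: V_def)
      have "norm (g z) \<le> dist (g z) z + norm z" by (metis dist_norm norm_triangle_sub add.commute)
      then have "norm (g z) < \<rho>" using g(5)[OF z(1)] z(2) \<epsilon>_small by linarith
      then have "a (g z) = A 0 (g z)" by (rule a(3))
      also have "\<dots> = f (A 0 z)" using g(5)[OF z(1)] by simp
      also have "A 0 z = a z" using a(3)[of z] z(2) a(2) by simp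
      finally show "a (g (a' w)) = f w" using z(3) homeomorphism_apply1[OF a'(1), of z] by simp
    qed
    show "\<exists>a a' M g g' j \<kappa> U V. homeomorphism UNIV UNIV a a' \<and> bilip M UNIV a \<and> bilip M UNIV a' \<and>
      homeomorphism UNIV UNIV g g' \<and> tame j \<kappa> g \<and> tame j \<kappa> g' \<and>
      open U \<and> U \<noteq> {} \<and> (\<forall>z\<in>U. g z = z) \<and> open V \<and> V \<noteq> {} \<and> (\<forall>w\<in>V. a (g (a' w)) = f w)"
      using a'(1) a(1) a'(2) g(1) t U V eq by blast
  qed (use \<epsilon> R0 in auto)
qed

end

text \<open>
  Pointwise quasisymmetry: unlike in \<^const>\<open>qs\<close> the radius may depend on \<open>p\<close> and \<open>M\<close>. With a common \<open>H\<close>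
  for all points this is invariant under changes of charts, and it implies metric quasiconformality.
\<close>

definition pq :: "(real \<Rightarrow> real) \<Rightarrow> 'a::metric_space set \<Rightarrow> 'a \<Rightarrow> ('a \<Rightarrow> 'b::metric_space) \<Rightarrow> bool"
  where "pq H S p f \<longleftrightarrow> (\<forall>M. \<exists>\<delta>>0. \<forall>a\<in>S. \<forall>b\<in>S.
    dist b p < \<delta> \<longrightarrow> dist a p \<le> M * dist b p \<longrightarrow> dist (f a) (f p) \<le> H M * dist (f b) (f p))"

lemma pqE:
  assumes "pq H S p f"
  obtains \<delta> where "\<delta> > 0" "\<And>a b. a \<in> S \<Longrightarrow> b \<in> S \<Longrightarrow> dist b p < \<delta> \<Longrightarrow> dist a p \<le> M * dist b p \<Longrightarrow> dist (f a) (f p) \<le> H M * dist (f b) (f p)"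
  using assms unfolding pq_def by blast

lemma pq_mono:
  assumes "pq H S p f" "\<And>M. H M \<le> H' M"
  shows "pq H' S p f"
  unfolding pq_def
proof
  fix M
  obtain \<delta> where \<delta>: "\<delta> > 0" "\<And>a b. a \<in> S \<Longrightarrow> b \<in> S \<Longrightarrow> dist b p < \<delta> \<Longrightarrow> dist a p \<le> M * dist b p \<Longrightarrow> dist (f a) (f p) \<le> H M * dist (f b) (f p)"
    using pqE[OF assms(1)] by blast
  have "H M * dist (f b) (f p) \<le> H' M * dist (f b) (f p)" for b
    using assms(2) by (intro mult_right_mono) auto
  then show "\<exists>\<delta>>0. \<forall>a\<in>S. \<forall>b\<in>S. dist b p < \<delta> \<longrightarrow> dist a p \<le> M * dist b p \<longrightarrow> dist (f a) (f p) \<le> H' M * dist (f b) (f p)"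
    using \<delta> by (intro exI[of _ \<delta>]) (auto intro: order_trans)
qed

text \<open>The radius is divided by 1 + |M|, so that not only \<open>b\<close> but also the farther
  point \<open>a\<close> is forced into \<open>U\<close>.\<close>

lemma pq_local:
  assumes pq: "pq H (S \<inter> U) p f" and U: "open U" "p \<in> U"
  shows "pq H S p f"
  unfolding pq_def
proof
  fix M
  obtain \<delta> where \<delta>: "\<delta> > 0" "\<And>a b. a \<in> S \<inter> U \<Longrightarrow> b \<in> S \<inter> U \<Longrightarrow> dist b p < \<delta> \<Longrightarrow> dist a p \<le> M * dist b p \<Longrightarrow> dist (f a) (f p) \<le> H M * dist (f b) (f p)"
    using pqE[OF pq] by blast
  obtain \<eta> where \<eta>: "\<eta> > 0" "ball p \<eta> \<subseteq> U" using U openE by blast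
  define d where "d = min \<delta> (\<eta> / (1 + \<bar>M\<bar>))"
  have M: "1 + \<bar>M\<bar> > 0" by simp
  have "d \<le> \<eta> / (1 + \<bar>M\<bar>)" by (simp add: d_def)
  then have "d * (1 + \<bar>M\<bar>) \<le> \<eta>" using M by (simp only: pos_le_divide_eq)
  then have d: "(1 + \<bar>M\<bar>) * d \<le> \<eta>" "d > 0" "d \<le> \<delta>"
    using \<delta>(1) \<eta>(1) M by (simp_all only: mult.commute) (simp_all add: d_def)
  show "\<exists>\<delta>>0. \<forall>a\<in>S. \<forall>b\<in>S. dist b p < \<delta> \<longrightarrow> dist a p \<le> M * dist b p \<longrightarrow> dist (f a) (f p) \<le> H M * dist (f b) (f p)"
  proof (intro exI[of _ d] conjI ballI impI)
    fix a b assume ab: "a \<in> S" "b \<in> S" "dist b p < d" "dist a p \<le> M * dist b p"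
    have "(1 + \<bar>M\<bar>) * dist b p < (1 + \<bar>M\<bar>) * d" using ab(3) by (intro mult_strict_left_mono) auto
    moreover have "M * dist b p \<le> (1 + \<bar>M\<bar>) * dist b p" "1 * dist b p \<le> (1 + \<bar>M\<bar>) * dist b p"
      by (intro mult_right_mono; simp)+
    ultimately have "dist a p < \<eta>" "dist b p < \<eta>" using d(1) ab(4) by linarith+
    then have "a \<in> U" "b \<in> U" using \<eta>(2) by (auto simp: dist_commute subset_iff)
    then show "dist (f a) (f p) \<le> H M * dist (f b) (f p)" using \<delta>(2)[of a b] ab d(3) by auto
  qed (use d in auto)
qed

lemma pq_cong:
  assumes "pq H S p f" "p \<in> S" "\<And>x. x \<in> S \<Longrightarrow> f x = g x"
  shows "pq H S p g"
  using assms unfolding pq_def by simp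

lemma pq_subset: "pq H S p f \<Longrightarrow> T \<subseteq> S \<Longrightarrow> pq H T p f"
  unfolding pq_def by (meson subsetD)

lemma pq_comp:
  assumes f: "pq H S p f" "continuous_on S f" "p \<in> S" and g: "pq H' (f ` S) (f p) g"
  shows "pq (\<lambda>M. H' (H M)) S p (g \<circ> f)"
  unfolding pq_def
proof
  fix M
  obtain \<delta> where \<delta>: "\<delta> > 0" "\<And>a b. a \<in> S \<Longrightarrow> b \<in> S \<Longrightarrow> dist b p < \<delta> \<Longrightarrow> dist a p \<le> M * dist b p \<Longrightarrow> dist (f a) (f p) \<le> H M * dist (f b) (f p)"
    using pqE[OF f(1)] by blast
  obtain \<eta> where \<eta>: "\<eta> > 0" "\<And>a b. a \<in> f ` S \<Longrightarrow> b \<in> f ` S \<Longrightarrow> dist b (f p) < \<eta> \<Longrightarrow> dist a (f p) \<le> H M * dist b (f p) \<Longrightarrow> dist (g a) (g (f p)) \<le> H' (H M) * dist (g b) (g (f p))"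
    using pqE[OF g] by blast
  obtain d where d: "d > 0" "\<And>b. b \<in> S \<Longrightarrow> dist b p < d \<Longrightarrow> dist (f b) (f p) < \<eta>"
    using f(2,3) \<eta>(1) unfolding continuous_on_iff by blast
  show "\<exists>\<delta>>0. \<forall>a\<in>S. \<forall>b\<in>S. dist b p < \<delta> \<longrightarrow> dist a p \<le> M * dist b p \<longrightarrow>
      dist ((g \<circ> f) a) ((g \<circ> f) p) \<le> H' (H M) * dist ((g \<circ> f) b) ((g \<circ> f) p)"
    using \<delta> d \<eta>(2) by (intro exI[of _ "min \<delta> d"]) auto
qed

lemma pq_pointwise_bilip:
  assumes c: "c > 0" and \<delta>: "\<delta> > 0" and C0: "C \<ge> 0"
    and b: "\<And>a. a \<in> S \<Longrightarrow> dist a p < \<delta> \<Longrightarrow> c * dist a p \<le> dist (f a) (f p) \<and> dist (f a) (f p) \<le> C * c * dist a p"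
  shows "pq (\<lambda>M. C * M) S p f"
proof (rule pq_local[of _ _ "ball p \<delta>"])
  show "pq (\<lambda>M. C * M) (S \<inter> ball p \<delta>) p f"
    unfolding pq_def
  proof (intro allI exI[of _ \<delta>] conjI ballI impI)
    fix M x y assume x: "x \<in> S \<inter> ball p \<delta>" and y: "y \<in> S \<inter> ball p \<delta>" and le: "dist x p \<le> M * dist y p"

    have *: "dist (f x) (f p) \<le> C * c * dist x p" "c * dist y p \<le> dist (f y) (f p)" "c * dist x p \<le> C * c * dist x p"
      using b[of x] b[of y] x y by (auto simp: dist_commute)
    show "dist (f x) (f p) \<le> C * M * dist (f y) (f p)"
    proof (cases "x = p")
      case True
      then show ?thesis using le C0 by (cases "y = p") (auto simp: zero_le_mult_iff)
    next
      case False
      then have xp: "dist x p > 0" by simp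
      then have "0 < M * dist y p" using le by linarith
      then have yp: "M > 0" "y \<noteq> p" by (auto simp: zero_less_mult_iff)
      have C: "C > 0" using *(3) xp c by (auto simp: mult_le_cancel_right mult_le_cancel_right1)
      have "C * c * dist x p \<le> C * c * (M * dist y p)" using le C c by (intro mult_left_mono) auto
      also have "\<dots> = C * M * (c * dist y p)" by simp
      also have "\<dots> \<le> C * M * dist (f y) (f p)" using *(2) C yp by (intro mult_left_mono) auto
      finally show ?thesis using *(1) by linarith
    qed
  qed (use \<delta> in auto)
qed (use \<delta> in auto)

lemma qs_pq:
  assumes "qs H U f" "open U" "p \<in> U"
  shows "pq H UNIV p f"
proof (rule pq_local[of _ _ U])
  show "pq H (UNIV \<inter> U) p f"
    unfolding pq_def using qsD(1)[OF assms(1,3)] by (intro allI exI[of _ 1]) (auto simp: dist_commute)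
qed (use assms in auto)

text \<open>Bisection along the segment. The local bound has a fixed centre, which fits the Bolzano
  principle: a short interval containing \<open>t\<close> is split at \<open>t\<close>.\<close>

lemma locally_lipschitz_imp_lipschitz:
  fixes h :: "'a::real_normed_vector \<Rightarrow> 'b::metric_space"
  assumes C: "C \<ge> 0" and loc: "\<And>x. \<exists>\<delta>>0. \<forall>y. dist y x < \<delta> \<longrightarrow> dist (h y) (h x) \<le> C * dist y x"
  shows "dist (h x) (h y) \<le> C * dist x y"
proof -
  define c where "c t = x + t *\<^sub>R (y - x)" for t :: real
  have dc: "dist (c s) (c t) = \<bar>s - t\<bar> * dist x y" for s t
  proof -
    have "c s - c t = (s - t) *\<^sub>R (y - x)" by (simp add: c_def algebra_simps)
    then show ?thesis by (simp add: dist_norm norm_minus_commute)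
  qed
  have "dist (h (c 0)) (h (c 1)) \<le> C * ((1 - 0) * dist x y)"
  proof (rule Bolzano[where P = "\<lambda>s t. dist (h (c s)) (h (c t)) \<le> C * ((t - s) * dist x y)"])
    fix s t u assume "dist (h (c s)) (h (c t)) \<le> C * ((t - s) * dist x y)" "dist (h (c t)) (h (c u)) \<le> C * ((u - t) * dist x y)"
    then show "dist (h (c s)) (h (c u)) \<le> C * ((u - s) * dist x y)"
      using dist_triangle[of "h (c s)" "h (c u)" "h (c t)"] by (simp add: algebra_simps)
  next
    fix t :: real
    obtain \<delta> where \<delta>: "\<delta> > 0" "\<And>z. dist z (c t) < \<delta> \<Longrightarrow> dist (h z) (h (c t)) \<le> C * dist z (c t)" using loc by blast
    define d where "d = \<delta> / (1 + dist x y)"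
    have d1: "1 + dist x y > 0" by (simp add: add_pos_nonneg)
    then have d: "d > 0" "d * dist x y < \<delta>" using \<delta>(1) by (auto simp: d_def field_simps)
    have near: "dist (h (c s)) (h (c t)) \<le> C * (\<bar>s - t\<bar> * dist x y)" if "\<bar>s - t\<bar> < d" for s
    proof -
      have "\<bar>s - t\<bar> * dist x y \<le> d * dist x y" using that by (intro mult_right_mono) auto
      then show ?thesis using \<delta>(2)[of "c s"] d unfolding dc by simp
    qed
    show "\<exists>d>0. \<forall>s u. s \<le> t \<and> t \<le> u \<and> u - s < d \<longrightarrow> dist (h (c s)) (h (c u)) \<le> C * ((u - s) * dist x y)"
    proof (intro exI[of _ d] conjI allI impI d(1))
      fix s u assume "s \<le> t \<and> t \<le> u \<and> u - s < d"
      then have "dist (h (c s)) (h (c t)) \<le> C * ((t - s) * dist x y)" "dist (h (c u)) (h (c t)) \<le> C * ((u - t) * dist x y)"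
        using near[of s] near[of u] by auto
      then show "dist (h (c s)) (h (c u)) \<le> C * ((u - s) * dist x y)"
        using dist_triangle2[of "h (c s)" "h (c u)" "h (c t)"] by (simp add: algebra_simps)
    qed
  qed auto
  then show ?thesis by (simp add: c_def)
qed

lemma tame_lip:
  fixes g :: "'a::euclidean_space \<Rightarrow> 'a"
  assumes "lip_class.tame j \<kappa> g"
  shows "dist (g x) (g y) \<le> max 2 j * dist x y"
proof (rule locally_lipschitz_imp_lipschitz)
  fix z
  have m: "j * d \<le> max 2 j * d" "2 * d \<le> max 2 j * d" if "d \<ge> 0" for d using that by (intro mult_right_mono; simp)+
  have "lip_class.locP j z g \<or> (\<forall>z'. dist (g z') z' \<le> dist z' z / 2)" using assms unfolding lip_class.tame_def by blast
  then show "\<exists>\<delta>>0. \<forall>y. dist y z < \<delta> \<longrightarrow> dist (g y) (g z) \<le> max 2 j * dist y z"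
  proof
    assume "lip_class.locP j z g"
    then obtain V where V: "open V" "z \<in> V" "bilip j V g" unfolding lip_class.locP_def by blast
    then obtain \<delta> where \<delta>: "\<delta> > 0" "ball z \<delta> \<subseteq> V" using openE by blast
    have "dist (g y) (g z) \<le> max 2 j * dist y z" if "dist y z < \<delta>" for y
      using bilipD(2)[OF V(3), of y z] that \<delta>(2) V(2) m(1)[of "dist y z"] by (force simp: dist_commute)
    then show ?thesis using \<delta>(1) by blast
  next
    assume *: "\<forall>z'. dist (g z') z' \<le> dist z' z / 2"
    have "dist (g y) (g z) \<le> max 2 j * dist y z" for y
    proof -
      have "dist (g z) z \<le> 0" using spec[OF *, of z] by simp
      then have "g z = z" by simp
      then have "dist (g y) (g z) \<le> 2 * dist y z"
        using spec[OF *, of y] dist_triangle[of "g y" z y] zero_le_dist[of y z] by (simp del: zero_le_dist)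
      then show ?thesis using m(2)[of "dist y z"] by simp
    qed
    then show ?thesis by (intro exI[of _ 1]) auto
  qed
qed simp

lemma tame_lip_bilip:
  fixes g :: "'a::euclidean_space \<Rightarrow> 'a"
  assumes "lip_class.tame j \<kappa> g" "lip_class.tame j \<kappa> g'" "homeomorphism UNIV UNIV g g'"
  shows "bilip (max 2 j) UNIV g"
  unfolding bilip_def
  using tame_lip[OF assms(1)] tame_lip[OF assms(2), of "g _" "g _"] homeomorphism_apply1[OF assms(3)] by auto

text \<open>At an exceptional point the displacement bound first gives that \<open>g\<close> fixes
  it, then that \<open>g\<close> changes distances from it by factors between 1/2 and 3/2; hence the
  ratio 3.\<close>

lemma tame_qs_pq:
  fixes g :: "'a::euclidean_space \<Rightarrow> 'a"
  assumes "qs_class.tame j \<kappa> g"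
  shows "pq (\<lambda>M. max (j M) (3 * M)) UNIV z g"
proof -
  have "qs_class.locP j z g \<or> (\<forall>z'. dist (g z') z' \<le> dist z' z / 2)" using assms unfolding qs_class.tame_def by blast
  then show ?thesis
  proof
    assume "qs_class.locP j z g"
    then obtain V where V: "open V" "z \<in> V" "qs j V g" unfolding qs_class.locP_def by blast
    show ?thesis by (rule pq_mono[OF qs_pq[OF V(3,1,2)]]) simp
  next
    assume *: "\<forall>z'. dist (g z') z' \<le> dist z' z / 2"
    have "dist (g z) z \<le> 0" using spec[OF *, of z] by simp
    then have "g z = z" by simp
    then have "(1/2) * dist a z \<le> dist (g a) (g z) \<and> dist (g a) (g z) \<le> 3 * (1/2) * dist a z" for a
      using spec[OF *, of a] dist_triangle[of "g a" z a] dist_triangle3[of a z "g a"] by simp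
    then have "pq (\<lambda>M. 3 * M) UNIV z g" by (intro pq_pointwise_bilip[of "1/2" 1]) auto
    then show ?thesis by (rule pq_mono) simp
  qed
qed

section \<open>Stereographic projection and charts\<close>

definition unproj :: "real \<Rightarrow> 'a::euclidean_space \<Rightarrow> 'a \<times> real"
  where "unproj s w = ((2 / (1 + (norm w)\<^sup>2)) *\<^sub>R w, s * (((norm w)\<^sup>2 - 1) / ((norm w)\<^sup>2 + 1)))"

definition proj :: "real \<Rightarrow> 'a::euclidean_space \<times> real \<Rightarrow> 'a"
  where "proj s = (\<lambda>(x, t). x /\<^sub>R (1 - s * t))"

lemma stereographic_eq: "stereographic s = (unit_sphere - {(0, s)}, proj s)"
  by (simp add: stereographic_def proj_def)

text \<open>The conformal factor of the inverse stereographic projection is 2 / (bracket w)^2. In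
  these terms chordal distances are products: 2 |v - w| divided by both brackets, and 2 divided by
  one bracket for the distance to the pole.\<close>

definition bracket :: "'a::euclidean_space \<Rightarrow> real"
  where "bracket w = sqrt (1 + (norm w)\<^sup>2)"

lemma bracket: "bracket w \<ge> 1" "bracket w > 0" "(bracket w)\<^sup>2 = 1 + (norm w)\<^sup>2" "norm w \<le> bracket w" "bracket w \<le> 1 + norm w"
proof -
  show "bracket w \<ge> 1" by (simp add: bracket_def)
  then show "bracket w > 0" by linarith
  show "(bracket w)\<^sup>2 = 1 + (norm w)\<^sup>2" by (simp add: bracket_def add_nonneg_nonneg)
  show "norm w \<le> bracket w" unfolding bracket_def by (rule real_le_rsqrt) simp
  show "bracket w \<le> 1 + norm w" unfolding bracket_def by (rule real_le_lsqrt) (auto simp: power2_sum)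
qed

lemma bracket_lipschitz: "bracket v \<le> bracket w + dist v w"
proof -
  have "1 + (norm v)\<^sup>2 \<le> (bracket w + dist v w)\<^sup>2"
  proof -
    have "norm v \<le> norm w + dist v w" by (metis dist_norm norm_triangle_sub)
    then have "(norm v)\<^sup>2 \<le> (norm w + dist v w)\<^sup>2" by (rule power_mono) simp
    also have "\<dots> = (norm w)\<^sup>2 + 2 * (norm w * dist v w) + (dist v w)\<^sup>2" by (simp add: power2_sum)
    also have "norm w * dist v w \<le> bracket w * dist v w" using bracket(4) by (rule mult_right_mono) simp
    finally show ?thesis using bracket(3)[of w] by (simp add: power2_sum)
  qed
  then show ?thesis unfolding bracket_def[of v] by (intro real_le_lsqrt) (auto intro: add_nonneg_nonneg less_imp_le[OF bracket(2)])
qed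

lemma inner_unproj:
  assumes "s * s = 1"
  shows "unproj s v \<bullet> unproj s w = 1 - 2 * (dist v w)\<^sup>2 / ((bracket v)\<^sup>2 * (bracket w)\<^sup>2)"
proof -
  define a b c where "a = (norm v)\<^sup>2" and "b = (norm w)\<^sup>2" and "c = v \<bullet> w"
  have ab: "a \<ge> 0" "b \<ge> 0" by (auto simp: a_def b_def)
  have "(dist v w)\<^sup>2 = a + b - 2 * c"
    by (simp add: a_def b_def c_def dist_norm power2_norm_eq_inner inner_diff inner_commute)
  then have rhs: "1 - 2 * (dist v w)\<^sup>2 / ((bracket v)\<^sup>2 * (bracket w)\<^sup>2) = 1 - 2 * (a + b - 2 * c) / ((1 + a) * (1 + b))"
    by (simp add: bracket(3) a_def b_def)
  have "unproj s v \<bullet> unproj s w = (2 / (1 + a)) * (2 / (1 + b)) * c + (s * s) * ((a - 1) / (a + 1)) * ((b - 1) / (b + 1))"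
    by (simp add: unproj_def a_def b_def c_def inner_prod_def mult_ac)
  also have "\<dots> = 1 - 2 * (a + b - 2 * c) / ((1 + a) * (1 + b))"
    unfolding assms using ab by (simp add: divide_simps add_nonneg_eq_0_iff) (simp add: algebra_simps)
  finally show ?thesis using rhs by simp
qed

lemma unproj_in_sphere [simp]:
  assumes "s * s = 1"
  shows "unproj s w \<in> unit_sphere"
  using inner_unproj[OF assms, of w w] by (simp add: norm_eq_1)

lemma dist_sphere: "p \<in> sphere 0 1 \<Longrightarrow> q \<in> sphere 0 1 \<Longrightarrow> (dist p q)\<^sup>2 = 2 - 2 * (p \<bullet> q)" for p q :: "'a::real_inner"
  by (simp add: dist_norm power2_norm_eq_inner inner_diff inner_commute) (simp add: norm_eq_sqrt_inner)

lemma dist_unproj: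
  assumes "s * s = 1"
  shows "dist (unproj s v) (unproj s w) = 2 * dist v w / (bracket v * bracket w)"
proof -
  have "(dist (unproj s v) (unproj s w))\<^sup>2 = (2 * dist v w / (bracket v * bracket w))\<^sup>2"
    using dist_sphere[OF unproj_in_sphere[OF assms] unproj_in_sphere[OF assms], of v w] inner_unproj[OF assms, of v w]
    by (simp add: power_divide power_mult_distrib)
  then show ?thesis by (rule power2_eq_imp_eq) (auto simp: less_imp_le[OF bracket(2)])
qed

lemma pole_in_sphere: "s * s = 1 \<Longrightarrow> (0, s) \<in> (unit_sphere :: ('a::euclidean_space \<times> real) set)"
  by (simp add: norm_Pair power2_eq_square)

lemma dist_unproj_pole:
  fixes w :: "'a::euclidean_space"
  assumes "s * s = 1"
  shows "dist (unproj s w) (0, s) = 2 / bracket w"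
proof -
  have "unproj s w \<bullet> (0, s) = (s * s) * (((norm w)\<^sup>2 - 1) / ((norm w)\<^sup>2 + 1))" by (simp add: unproj_def)
  also have "\<dots> = 1 - 2 / (bracket w)\<^sup>2"
    unfolding assms bracket(3) by (simp add: divide_simps add_nonneg_eq_0_iff)
  finally have "(dist (unproj s w) (0, s))\<^sup>2 = (2 / bracket w)\<^sup>2"
    using dist_sphere[OF unproj_in_sphere[OF assms, of w] pole_in_sphere[OF assms]] by (simp add: power_divide)
  then show ?thesis by (rule power2_eq_imp_eq) (auto simp: less_imp_le[OF bracket(2)])
qed

lemma unproj_neq_pole: "s * s = 1 \<Longrightarrow> unproj s w \<noteq> (0, s)"
  using dist_unproj_pole[of s w] bracket(2)[of w] by auto

lemma proj_unproj [simp]: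
  assumes "s * s = 1"
  shows "proj s (unproj s w) = w"
proof -
  define q where "q = (norm w)\<^sup>2"
  have q: "1 + q > 0" by (simp add: q_def add_pos_nonneg)
  have "1 - s * (s * ((q - 1) / (q + 1))) = 1 - (s * s) * ((q - 1) / (q + 1))" by simp
  also have "\<dots> = 2 / (1 + q)" unfolding assms using q by (simp add: field_simps)
  finally have *: "1 - s * (s * ((q - 1) / (q + 1))) = 2 / (1 + q)" .
  have "2 / (1 + q) \<noteq> 0" using q by simp
  from left_inverse[OF this] show ?thesis
    unfolding proj_def unproj_def q_def[symmetric] prod.case * by (simp only: scaleR_scaleR scaleR_one)
qed

lemma sphere_pole_cases:
  assumes s: "s * s = 1" and p: "(x, t) \<in> (unit_sphere :: ('a::euclidean_space \<times> real) set)" "(x, t) \<noteq> (0, s)"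
  shows "1 - s * t \<noteq> 0"
proof
  assume "1 - s * t = 0"
  then have "s * (s * t) = s" by simp
  then have t: "t = s" using s by (metis mult.assoc mult_1)
  have "(norm x)\<^sup>2 + t\<^sup>2 = 1" using p(1) by (simp add: norm_Pair)
  then show False using t p(2) s by (simp add: power2_eq_square)
qed

lemma unproj_proj:
  assumes s: "s * s = 1" and p: "p \<in> (unit_sphere :: ('a::euclidean_space \<times> real) set)" "p \<noteq> (0, s)"
  shows "unproj s (proj s p) = p"
proof -
  obtain x t where xt: "p = (x, t)" by (cases p)
  define d where "d = 1 - s * t"
  have d: "d \<noteq> 0" using sphere_pole_cases[OF s] p by (simp add: xt d_def)
  have "(norm x)\<^sup>2 + t\<^sup>2 = 1" using p(1) by (simp add: xt norm_Pair)
  moreover have "(s * t)\<^sup>2 = (s * s) * t\<^sup>2" by (simp add: power2_eq_square)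
  ultimately have "(norm x)\<^sup>2 = 1 - (s * t)\<^sup>2" using s by simp
  also have "\<dots> = d * (2 - d)" by (simp add: d_def power2_eq_square algebra_simps)
  finally have "(norm (x /\<^sub>R d))\<^sup>2 = (2 - d) / d" using d by (simp add: power_mult_distrib power2_eq_square divide_simps)
  then have q: "1 + (norm (x /\<^sub>R d))\<^sup>2 = 2 / d" "(norm (x /\<^sub>R d))\<^sup>2 - 1 = 2 * (1 - d) / d"
    using d by (simp_all add: field_simps)
  have "unproj s (x /\<^sub>R d) = ((2 / (2 / d)) *\<^sub>R (x /\<^sub>R d), s * ((2 * (1 - d) / d) / (2 / d)))"
    unfolding unproj_def q(2) using q(1) by (simp add: add.commute)
  also have "\<dots> = (x, s * (1 - d))" using d by simp
  also have "s * (1 - d) = (s * s) * t" by (simp add: d_def)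
  finally show ?thesis using s by (simp add: xt proj_def d_def)
qed

lemma homeomorphism_proj:
  assumes s: "s * s = 1"
  shows "homeomorphism (unit_sphere - {(0, s)}) UNIV (proj s) (unproj s :: 'a::euclidean_space \<Rightarrow> _)"
proof -
  have "1 - s * snd p \<noteq> 0" if "p \<in> unit_sphere - {(0, s)}" for p :: "'a \<times> real"
    using sphere_pole_cases[OF s, of "fst p" "snd p"] that by simp
  then have "continuous_on (unit_sphere - {(0, s)}) (\<lambda>p :: 'a \<times> real. fst p /\<^sub>R (1 - s * snd p))"
    by (intro continuous_intros ballI)
  then have c1: "continuous_on (unit_sphere - {(0, s)}) (proj s :: 'a \<times> real \<Rightarrow> 'a)" by (simp add: proj_def case_prod_beta)
  have c2: "continuous_on UNIV (unproj s :: 'a \<Rightarrow> _)"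
    unfolding unproj_def by (intro continuous_intros) (auto simp: add_nonneg_eq_0_iff)
  have un: "unproj s w \<in> unit_sphere - {(0, s)}" for w :: 'a
    using unproj_neq_pole[OF s, of w] unproj_in_sphere[OF s, of w] by blast
  show ?thesis
  proof (rule homeomorphismI[OF c1 c2])
    show "unproj s ` (UNIV :: 'a set) \<subseteq> unit_sphere - {(0, s)}" by (intro image_subsetI un)
    show "unproj s (proj s p) = p" if "p \<in> unit_sphere - {(0, s)}" for p :: "'a \<times> real"
      using unproj_proj[OF s, of p] that by simp
  qed (use proj_unproj[OF s] in simp_all)
qed

lemma proj_other_unproj:
  assumes "s * s = 1"
  shows "proj (- s) (unproj s w) = w /\<^sub>R (w \<bullet> w)"
proof (cases "w = 0")
  case True
  then show ?thesis by (simp add: proj_def unproj_def)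
next
  case False
  define q where "q = w \<bullet> w"
  have q: "q > 0" using False by (simp add: q_def)
  have "1 - (- s) * (s * ((q - 1) / (q + 1))) = 1 + (s * s) * ((q - 1) / (q + 1))" by simp
  also have "\<dots> = 2 * q / (1 + q)" unfolding assms using q by (simp add: field_simps)
  finally have *: "1 - (- s) * (s * ((q - 1) / (q + 1))) = 2 * q / (1 + q)" .
  have "q * 2 + q * (q * 2) > 0" using q by (intro add_pos_pos mult_pos_pos) auto
  then have "inverse (2 * q / (1 + q)) * (2 / (1 + q)) = inverse q" using q by (simp add: field_simps)
  then show ?thesis
    unfolding proj_def unproj_def power2_norm_eq_inner q_def[symmetric] prod.case * by (simp only: scaleR_scaleR)
qed

section \<open>Smoothness of the stereographic transition maps\<close>

inductive rat :: "'a::euclidean_space set \<Rightarrow> ('a \<Rightarrow> real) \<Rightarrow> bool" for S where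
  const: "rat S (\<lambda>x. c)"
| coord: "rat S (\<lambda>x. x \<bullet> v)"
| add: "rat S f \<Longrightarrow> rat S g \<Longrightarrow> rat S (\<lambda>x. f x + g x)"
| mult: "rat S f \<Longrightarrow> rat S g \<Longrightarrow> rat S (\<lambda>x. f x * g x)"
| inverse: "rat S f \<Longrightarrow> (\<And>x. x \<in> S \<Longrightarrow> f x \<noteq> 0) \<Longrightarrow> rat S (\<lambda>x. inverse (f x))"
| cong: "rat S f \<Longrightarrow> (\<And>x. x \<in> S \<Longrightarrow> f x = g x) \<Longrightarrow> rat S g"

lemma rat_sum: "finite I \<Longrightarrow> (\<And>i. i \<in> I \<Longrightarrow> rat S (f i)) \<Longrightarrow> rat S (\<lambda>x. \<Sum>i\<in>I. f i x)"
  by (induction I rule: finite_induct) (auto intro: rat.const rat.add)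

lemma rat_norm: "rat S (\<lambda>x. x \<bullet> x)"
proof -
  have "rat S (\<lambda>x. \<Sum>b\<in>Basis. (x \<bullet> b) * (x \<bullet> b))" by (intro rat_sum rat.mult rat.coord) simp
  then show ?thesis by (simp flip: euclidean_inner)
qed

text \<open>The class is closed under directional derivatives, so continuous differentiability of
  every order follows by induction. Closure under equality on \<open>S\<close> is what admits
  \<open>frechet_derivative\<close>, identified with a rational expression only there.\<close>

lemma rat_has_derivative:
  assumes "rat S f" "open S"
  shows "\<exists>D. (\<forall>x\<in>S. (f has_derivative D x) (at x)) \<and> (\<forall>v. rat S (\<lambda>x. D x v))"
  using assms(1)
proof induction
  case (const c)
  show ?case by (intro exI[of _ "\<lambda>x h. 0"]) (auto intro: rat.const)
next
  case (coord v)
  show ?case by (intro exI[of _ "\<lambda>x h. h \<bullet> v"]) (auto intro: rat.const has_derivative_inner_left has_derivative_ident)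
next
  case (add f g)
  then obtain D E where D: "\<And>x. x \<in> S \<Longrightarrow> (f has_derivative D x) (at x)" "\<And>v. rat S (\<lambda>x. D x v)"
    and E: "\<And>x. x \<in> S \<Longrightarrow> (g has_derivative E x) (at x)" "\<And>v. rat S (\<lambda>x. E x v)" by blast
  show ?case by (intro exI[of _ "\<lambda>x h. D x h + E x h"] conjI ballI allI has_derivative_add rat.add D E)
next
  case (mult f g)
  then obtain D E where D: "\<And>x. x \<in> S \<Longrightarrow> (f has_derivative D x) (at x)" "\<And>v. rat S (\<lambda>x. D x v)"
    and E: "\<And>x. x \<in> S \<Longrightarrow> (g has_derivative E x) (at x)" "\<And>v. rat S (\<lambda>x. E x v)" by blast
  show ?case
    by (intro exI[of _ "\<lambda>x h. f x * E x h + D x h * g x"] conjI ballI allI has_derivative_mult rat.add rat.mult mult.hyps D E)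
next
  case (inverse f)
  then obtain D where D: "\<And>x. x \<in> S \<Longrightarrow> (f has_derivative D x) (at x)" "\<And>v. rat S (\<lambda>x. D x v)" by blast
  have "((\<lambda>x. inverse (f x)) has_derivative (\<lambda>h. (- 1) * (inverse (f x) * D x h * inverse (f x)))) (at x)" if "x \<in> S" for x
    using Deriv.has_derivative_inverse[OF inverse.hyps(2)[OF that] D(1)[OF that]] by simp
  moreover have "rat S (\<lambda>x. (- 1) * (inverse (f x) * D x v * inverse (f x)))" for v
    by (intro rat.mult rat.const rat.inverse inverse.hyps D)
  ultimately show ?case by (intro exI[of _ "\<lambda>x h. (- 1) * (inverse (f x) * D x h * inverse (f x))"]) blast
next
  case (cong f g)
  then obtain D where D: "\<And>x. x \<in> S \<Longrightarrow> (f has_derivative D x) (at x)" "\<And>v. rat S (\<lambda>x. D x v)" by blast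
  then show ?case using has_derivative_transform_within_open[OF D(1) assms(2)] cong.hyps(2) by blast
qed

lemma rat_C_on:
  fixes f :: "'a::euclidean_space \<Rightarrow> 'b::euclidean_space"
  assumes "open S" "\<And>u. rat S (\<lambda>x. f x \<bullet> u)"
  shows "C_on k S f"
  using assms(2)
proof (induction k arbitrary: f)
  case (0 f)
  have "continuous_on S (\<lambda>x. f x \<bullet> b)" for b
  proof -
    obtain D where D: "\<And>x. x \<in> S \<Longrightarrow> ((\<lambda>x. f x \<bullet> b) has_derivative D x) (at x)"
      using rat_has_derivative[OF 0 assms(1)] by blast
    show ?thesis by (intro continuous_at_imp_continuous_on ballI has_derivative_continuous[OF D])
  qed
  then have "continuous_on S f" using continuous_on_componentwise[of S f] by blast
  then show ?case by simp
next
  case (Suc k f)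
  have dif: "f differentiable at x" if "x \<in> S" for x
  proof -
    have "\<forall>b\<in>Basis. (\<lambda>x. f x \<bullet> b) differentiable at x"
      using rat_has_derivative[OF Suc.prems assms(1)] that unfolding differentiable_def by blast
    then show ?thesis using differentiable_componentwise_within[of f x UNIV] by blast
  qed
  have "C_on k S (\<lambda>x. frechet_derivative f (at x) v)" for v
  proof (rule Suc.IH)
    fix u
    obtain D where D: "\<And>x. x \<in> S \<Longrightarrow> ((\<lambda>x. f x \<bullet> u) has_derivative D x) (at x)" "\<And>v. rat S (\<lambda>x. D x v)"
      using rat_has_derivative[OF Suc.prems assms(1)] by blast
    have "D x v = frechet_derivative f (at x) v \<bullet> u" if "x \<in> S" for x
    proof -
      have "((\<lambda>x. f x \<bullet> u) has_derivative (\<lambda>h. frechet_derivative f (at x) h \<bullet> u)) (at x)"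
        using dif[OF that] by (intro has_derivative_inner_left) (simp add: frechet_derivative_works)
      then show ?thesis using has_derivative_unique[OF D(1)[OF that]] by metis
    qed
    then show "rat S (\<lambda>x. frechet_derivative f (at x) v \<bullet> u)" by (rule rat.cong[OF D(2)[of v]])
  qed
  then show ?case using dif by simp
qed

lemma inv_into_proj:
  assumes s: "s * s = 1"
  shows "inv_into (unit_sphere - {(0, s)}) (proj s) w = (unproj s w :: 'a::euclidean_space \<times> real)"
proof (rule inv_into_f_eq)
  show "inj_on (proj s) (unit_sphere - {(0, s)} :: ('a \<times> real) set)"
    by (rule inj_on_inverseI) (rule homeomorphism_apply1[OF homeomorphism_proj[OF s]])
  show "unproj s w \<in> unit_sphere - {(0, s)}" using unproj_neq_pole[OF s, of w] unproj_in_sphere[OF s, of w] by blast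
qed (rule proj_unproj[OF s])

lemma smooth_transition:
  fixes s t :: real
  assumes st: "s \<in> {1, - 1}" "t \<in> {1, - 1}"
  shows "smooth_on (proj s ` ((unit_sphere - {(0, s)}) \<inter> (unit_sphere - {(0, t)})))
    ((proj t :: 'a::euclidean_space \<times> real \<Rightarrow> 'a) \<circ> inv_into (unit_sphere - {(0, s)}) (proj s))" (is "smooth_on ?S ?f")
proof -
  have s: "s * s = 1" using st by auto
  have f: "?f w = proj t (unproj s w)" for w :: 'a by (simp add: inv_into_proj[OF s])
  have img: "?S = {w. unproj s w \<noteq> (0, t)}"
  proof (intro equalityI subsetI)
    fix w assume "w \<in> ?S"
    then obtain p where p: "p \<in> unit_sphere" "p \<noteq> (0, s)" "p \<noteq> (0, t)" "w = proj s p" by blast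
    then show "w \<in> {w. unproj s w \<noteq> (0, t)}" using unproj_proj[OF s p(1,2)] by simp
  next
    fix w :: 'a assume "w \<in> {w. unproj s w \<noteq> (0, t)}"
    then show "w \<in> ?S"
      using unproj_neq_pole[OF s, of w] unproj_in_sphere[OF s, of w] proj_unproj[OF s, of w]
      by (intro image_eqI[of _ _ "unproj s w"]) simp_all
  qed
  show ?thesis
  proof (cases "t = s")
    case True
    then have "?S = UNIV" using img unproj_neq_pole[OF s] by auto
    moreover have "?f w = w" for w unfolding f using True s by simp
    then have "rat UNIV (\<lambda>w. ?f w \<bullet> u)" for u by (simp add: rat.coord)
    then have "C_on k UNIV ?f" for k by (intro rat_C_on open_UNIV)
    ultimately show ?thesis unfolding smooth_on_def by simp
  next
    case False
    then have t: "t = - s" using st by auto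
    have S: "?S = - {0}"
    proof -
      have "unproj s (0 :: 'a) = (0, t)" by (simp add: unproj_def t)
      moreover have "w = 0" if "unproj s w = (0, t)" for w :: 'a
        using proj_unproj[OF s, of w] that by (simp add: proj_def)
      ultimately show ?thesis unfolding img by auto
    qed
    have "rat (- {0}) (\<lambda>w. ?f w \<bullet> u)" for u
    proof -
      have "rat (- {0}) (\<lambda>w. inverse (w \<bullet> w) * (w \<bullet> u))" by (intro rat.mult rat.inverse rat_norm rat.coord) auto
      moreover have "?f w \<bullet> u = inverse (w \<bullet> w) * (w \<bullet> u)" for w
        by (subst f) (simp add: t proj_other_unproj[OF s])
      ultimately show ?thesis by simp
    qed
    then have "C_on k (- {0}) ?f" for k by (intro rat_C_on) auto
    then show ?thesis unfolding smooth_on_def S by blast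
  qed
qed

lemma stereographic_charts:
  assumes "s \<in> {1, - 1}"
  shows "(stereographic s :: ('a::euclidean_space \<times> real) set \<times> _) \<in> sphere_charts"
proof -
  have s: "s * s = 1" using assms by auto
  have "openin (top_of_set unit_sphere) (unit_sphere - {(0, s)} :: ('a \<times> real) set)"
    using assms by (intro openin_diff openin_subtopology_self closedin_singleton) auto
  moreover have "proj s ` (unit_sphere - {(0, s)}) = (UNIV :: 'a set)"
    by (rule homeomorphism_image1[OF homeomorphism_proj[OF s]])
  ultimately have "coordinate_chart (stereographic s :: ('a \<times> real) set \<times> _)"
    unfolding coordinate_chart_def stereographic_eq using homeomorphism_proj[OF s, where 'a = 'a] by auto
  moreover have "smoothly_compatible (stereographic s) (stereographic t :: ('a \<times> real) set \<times> _)" if "t \<in> {1, - 1}" for t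
    unfolding smoothly_compatible_def stereographic_eq
    using smooth_transition[OF assms that, where 'a = 'a] smooth_transition[OF that assms, where 'a = 'a]
    by (simp add: Int_commute)
  ultimately show ?thesis unfolding sphere_charts_def by blast
qed

text \<open>\<open>C_on\<close> provides continuity of the derivative in each fixed direction only.
  Bounds for the finitely many basis directions on a compact ball are combined into a bound of the
  operator norm.\<close>

lemma C_on_Suc_locally_lipschitz:
  fixes f :: "'a::euclidean_space \<Rightarrow> 'b::euclidean_space"
  assumes "C_on (Suc 0) S f" "open S" "x \<in> S"
  shows "\<exists>\<delta>>0. \<exists>B>0. \<forall>y\<in>ball x \<delta>. \<forall>z\<in>ball x \<delta>. dist (f y) (f z) \<le> B * dist y z"
proof -
  obtain \<delta> where \<delta>: "\<delta> > 0" "cball x \<delta> \<subseteq> S" using assms open_contains_cball by blast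
  define D where "D y = frechet_derivative f (at y)" for y
  have D: "(f has_derivative D y) (at y)" if "y \<in> S" for y
    using assms(1) that by (simp add: D_def frechet_derivative_works)
  have cD: "continuous_on S (\<lambda>y. D y v)" for v using assms(1) by (simp add: D_def)
  have "\<exists>B. \<forall>y\<in>cball x \<delta>. norm (D y b) \<le> B" for b
  proof -
    have "compact ((\<lambda>y. D y b) ` cball x \<delta>)"
      by (rule compact_continuous_image[OF continuous_on_subset[OF cD \<delta>(2)] compact_cball])
    from compact_imp_bounded[OF this] show ?thesis by (simp add: bounded_iff)
  qed
  then have "\<forall>b. \<exists>B. \<forall>y\<in>cball x \<delta>. norm (D y b) \<le> B" by blast
  from choice[OF this] obtain B where B: "\<And>b y. y \<in> cball x \<delta> \<Longrightarrow> norm (D y b) \<le> B b" by blast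
  define M where "M = (\<Sum>b\<in>Basis. B b)"
  have on: "onorm (D y) \<le> M" if y: "y \<in> cball x \<delta>" for y
  proof (rule onorm_bound)
    have l: "bounded_linear (D y)" using D \<delta> y has_derivative_bounded_linear by blast
    have B0: "0 \<le> B b" for b using order_trans[OF norm_ge_zero B[OF y]] .
    show "0 \<le> M" unfolding M_def by (intro sum_nonneg B0)
    fix v
    have "D y v = D y (\<Sum>b\<in>Basis. (v \<bullet> b) *\<^sub>R b)" by (simp add: euclidean_representation)
    also have "\<dots> = (\<Sum>b\<in>Basis. (v \<bullet> b) *\<^sub>R D y b)"
      using l by (simp add: bounded_linear.linear linear_sum linear_scale)
    also have "norm \<dots> \<le> (\<Sum>b\<in>Basis. B b * norm v)"
    proof (rule order_trans[OF norm_sum sum_mono])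
      fix b :: 'a assume "b \<in> Basis"
      then have "\<bar>v \<bullet> b\<bar> * norm (D y b) \<le> norm v * B b"
        using Basis_le_norm B[OF y] by (intro mult_mono) auto
      then show "norm ((v \<bullet> b) *\<^sub>R D y b) \<le> B b * norm v" by (simp add: mult.commute)
    qed
    finally show "norm (D y v) \<le> M * norm v" by (simp add: M_def sum_distrib_right)
  qed
  have "dist (f y) (f z) \<le> (\<bar>M\<bar> + 1) * dist y z" if "y \<in> ball x \<delta>" "z \<in> ball x \<delta>" for y z
  proof -
    have "norm (f y - f z) \<le> M * norm (y - z)"
    proof (rule differentiable_bound[of "cball x \<delta>" f D])
      fix w assume "w \<in> cball x \<delta>"
      then show "(f has_derivative D w) (at w within cball x \<delta>)"
        using D \<delta>(2) has_derivative_at_withinI by blast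
    qed (use that on in auto)
    also have "\<dots> \<le> (\<bar>M\<bar> + 1) * norm (y - z)" by (intro mult_right_mono) auto
    finally show ?thesis by (simp add: dist_norm)
  qed
  then show ?thesis using \<delta>(1) by (intro exI[of _ \<delta>] conjI exI[of _ "\<bar>M\<bar> + 1"]) auto
qed

section \<open>Quasiconformal maps of the sphere\<close>

lemma bracket_near:
  assumes "dist v w < 1 / 2"
  shows "bracket w / 2 \<le> bracket v" "bracket v \<le> 2 * bracket w"
  using bracket_lipschitz[of v w] bracket_lipschitz[of w v] bracket(1)[of v] bracket(1)[of w] assms by (auto simp: dist_commute)

lemma dist_proj:
  assumes s: "s * s = 1" and "p \<in> unit_sphere" "p \<noteq> (0, s)" "q \<in> unit_sphere" "q \<noteq> (0, s)"
  shows "dist (proj s p) (proj s q) = dist p q * (bracket (proj s p) * bracket (proj s q)) / 2"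
proof -
  have "dist p q = 2 * dist (proj s p) (proj s q) / (bracket (proj s p) * bracket (proj s q))"
    using dist_unproj[OF s, of "proj s p" "proj s q"] unproj_proj[OF s assms(2,3)] unproj_proj[OF s assms(4,5)] by simp
  moreover have "bracket (proj s p) > 0" "bracket (proj s q) > 0" by (intro bracket)+
  ultimately show ?thesis by (simp add: field_simps)
qed

text \<open>On a ball of radius 1/2 the bracket varies by a factor of at most 2, wherever the centre
  is; hence a constant independent of \<open>w\<close>.\<close>

lemma pq_unproj:
  assumes s: "s * s = 1"
  shows "pq (\<lambda>M. 4 * M) UNIV w (unproj s)"
proof (rule pq_pointwise_bilip[of "1 / (bracket w)\<^sup>2" "1/2"])
  show "1 / (bracket w)\<^sup>2 > 0" using bracket(2)[of w] by simp
  fix a assume "dist a w < 1/2"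
  note n = bracket_near[OF this]
  have d: "dist (unproj s a) (unproj s w) = 2 * dist a w / (bracket a * bracket w)" by (rule dist_unproj[OF s])
  have pos: "bracket a > 0" "bracket w > 0" by (rule bracket)+
  have 1: "1 / (bracket w)\<^sup>2 \<le> 2 / (bracket a * bracket w)" "2 / (bracket a * bracket w) \<le> 4 * (1 / (bracket w)\<^sup>2)"
    using n pos by (simp_all add: field_simps power2_eq_square)
  show "1 / (bracket w)\<^sup>2 * dist a w \<le> dist (unproj s a) (unproj s w) \<and>
      dist (unproj s a) (unproj s w) \<le> 4 * (1 / (bracket w)\<^sup>2) * dist a w"
    using mult_right_mono[OF 1(1), of "dist a w"] mult_right_mono[OF 1(2), of "dist a w"] unfolding d by simp
qed auto

lemma pq_proj:
  assumes s: "s * s = 1" and q: "q \<in> unit_sphere" "q \<noteq> (0, s)"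
  shows "pq (\<lambda>M. 4 * M) (unit_sphere - {(0, s)}) q (proj s)"
proof -
  let ?V = "unit_sphere - {(0, s)}"
  define w where "w = proj s q"
  have "continuous_on ?V (proj s)" by (rule homeomorphism_cont1[OF homeomorphism_proj[OF s]])
  moreover have "q \<in> ?V" using q by simp
  ultimately obtain \<delta> where \<delta>: "\<delta> > 0" "\<And>a. a \<in> ?V \<Longrightarrow> dist a q < \<delta> \<Longrightarrow> dist (proj s a) w < 1 / 2"
    unfolding continuous_on_iff w_def by (metis half_gt_zero zero_less_one)
  show ?thesis
  proof (rule pq_pointwise_bilip[of "(bracket w)\<^sup>2 / 4" \<delta>])
    show "(bracket w)\<^sup>2 / 4 > 0" using bracket(2)[of w] by simp
    fix a assume a: "a \<in> ?V" "dist a q < \<delta>"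
    note n = bracket_near[OF \<delta>(2)[OF a]]
    have d: "dist (proj s a) (proj s q) = dist a q * (bracket (proj s a) * bracket w) / 2"
      using dist_proj[OF s, of a q] a q by (simp add: w_def)
    have pos: "bracket w > 0" by (rule bracket)
    have 1: "(bracket w)\<^sup>2 / 4 \<le> bracket (proj s a) * bracket w / 2" "bracket (proj s a) * bracket w / 2 \<le> 4 * ((bracket w)\<^sup>2 / 4)"
      using n pos by (simp_all add: power2_eq_square)
    show "(bracket w)\<^sup>2 / 4 * dist a q \<le> dist (proj s a) (proj s q) \<and>
        dist (proj s a) (proj s q) \<le> 4 * ((bracket w)\<^sup>2 / 4) * dist a q"
      using mult_right_mono[OF 1(1), of "dist a q"] mult_right_mono[OF 1(2), of "dist a q"] unfolding d by (simp add: mult_ac)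
  qed (use \<delta> in auto)
qed

text \<open>Compactness and injectivity turn the supremum and infimum into a maximum and a positive
  minimum, so no default value of \<open>SUP\<close>, \<open>INF\<close> or division
  interferes.\<close>

lemma sphere_ratio:
  fixes h :: "'a::euclidean_space \<Rightarrow> 'a"
  assumes sub: "cball x \<epsilon> \<subseteq> W" and cont: "continuous_on W h" and inj: "inj_on h W" and \<epsilon>: "\<epsilon> > 0"
  shows "(SUP y\<in>h ` sphere x \<epsilon>. dist (h x) y) / (INF y\<in>h ` sphere x \<epsilon>. dist (h x) y) \<le> C \<longleftrightarrow> metric_ratio C h x \<epsilon>"
proof -
  define D where "D a = dist (h x) (h a)" for a
  have sph: "sphere x \<epsilon> \<subseteq> W" "sphere x \<epsilon> \<noteq> {}" using sub \<epsilon> by auto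
  have cD: "continuous_on (sphere x \<epsilon>) D"
    unfolding D_def by (intro continuous_on_dist continuous_on_const continuous_on_subset[OF cont sph(1)])
  obtain b0 where b0: "b0 \<in> sphere x \<epsilon>" "\<And>b. b \<in> sphere x \<epsilon> \<Longrightarrow> D b0 \<le> D b"
    using continuous_attains_inf[OF compact_sphere sph(2) cD] by blast
  obtain a0 where a0: "a0 \<in> sphere x \<epsilon>" "\<And>a. a \<in> sphere x \<epsilon> \<Longrightarrow> D a \<le> D a0"
    using continuous_attains_sup[OF compact_sphere sph(2) cD] by blast
  have "x \<noteq> b0" using b0(1) \<epsilon> by auto
  moreover have "x \<in> W" "b0 \<in> W" using sub \<epsilon> b0(1) by auto
  ultimately have D0: "D b0 > 0" using inj by (simp add: D_def inj_on_eq_iff)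
  have "(SUP y\<in>h ` sphere x \<epsilon>. dist (h x) y) = D a0"
    by (rule cSup_eq_maximum) (use a0 in \<open>auto simp: D_def\<close>)
  moreover have "(INF y\<in>h ` sphere x \<epsilon>. dist (h x) y) = D b0"
    by (rule cInf_eq_minimum) (use b0 in \<open>auto simp: D_def\<close>)
  moreover have "D a0 / D b0 \<le> C \<longleftrightarrow> metric_ratio C h x \<epsilon>"
  proof
    assume "D a0 / D b0 \<le> C"
    then have C: "D a0 \<le> C * D b0" using D0 by (simp add: pos_divide_le_eq)
    have "0 \<le> D a0" by (simp add: D_def)
    then have "0 \<le> C * D b0" using C by linarith
    then have C0: "C \<ge> 0" using D0 by (simp add: zero_le_mult_iff)
    have "D a \<le> C * D b" if "a \<in> sphere x \<epsilon>" "b \<in> sphere x \<epsilon>" for a b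
      using a0(2)[OF that(1)] mult_left_mono[OF b0(2)[OF that(2)] C0] C by linarith
    then show "metric_ratio C h x \<epsilon>" unfolding metric_ratio_def D_def by blast
  next
    assume "metric_ratio C h x \<epsilon>"
    then have "D a0 \<le> C * D b0" using a0(1) b0(1) unfolding metric_ratio_def D_def by blast
    then show "D a0 / D b0 \<le> C" using D0 by (simp add: pos_divide_le_eq)
  qed
  ultimately show ?thesis by simp
qed

lemma quasiconformal_on_metric_qc:
  assumes "quasiconformal_on W h"
  obtains K where "metric_qc h W K"
proof -
  obtain K g where W: "open W" "homeomorphism W (h ` W) h g" and K: "\<And>x. x \<in> W \<Longrightarrow> distortion h x < ereal K"
    using assms unfolding quasiconformal_on_def by blast
  have cont: "continuous_on W h" using W(2) by (simp add: homeomorphism_def)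
  have inj: "inj_on h W" by (rule inj_on_inverseI[of W g]) (rule homeomorphism_apply1[OF W(2)])
  \<comment> \<open>The locale asks for a constant of at least 1.\<close>
  have "metric_qc h W (max 1 K)"
  proof
    fix y assume y: "y \<in> W"
    obtain r where r: "r > 0" "cball y r \<subseteq> W" using W(1) y open_contains_cball by blast
    have "eventually (\<lambda>\<epsilon>. ereal ((SUP z\<in>h ` sphere y \<epsilon>. dist (h y) z) / (INF z\<in>h ` sphere y \<epsilon>. dist (h y) z)) < ereal K) (at_right 0)"
      using K[OF y] unfolding distortion_def by (rule Limsup_lessD)
    then obtain b where b: "b > 0" "\<And>\<epsilon>. 0 < \<epsilon> \<Longrightarrow> \<epsilon> < b \<Longrightarrow>
        (SUP z\<in>h ` sphere y \<epsilon>. dist (h y) z) / (INF z\<in>h ` sphere y \<epsilon>. dist (h y) z) < K"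
      unfolding eventually_at_right_field by auto
    have "metric_ratio (max 1 K) h y \<epsilon>" if "0 < \<epsilon>" "\<epsilon> < min b r" for \<epsilon>
    proof -
      have "cball y \<epsilon> \<subseteq> W" using r(2) that by auto
      then show ?thesis using sphere_ratio[OF _ cont inj that(1), of y "max 1 K"] b(2)[of \<epsilon>] that by fastforce
    qed
    then show "\<exists>\<epsilon>0>0. \<forall>\<epsilon>. 0 < \<epsilon> \<and> \<epsilon> < \<epsilon>0 \<longrightarrow> metric_ratio (max 1 K) h y \<epsilon>"
      using b(1) r(1) by (intro exI[of _ "min b r"]) auto
  qed (use W cont inj in auto)
  then show thesis using that by blast
qed

lemma distortion_le:
  fixes h :: "'a::euclidean_space \<Rightarrow> 'a"
  assumes W: "open W" "x \<in> W" and cont: "continuous_on W h" and inj: "inj_on h W" and pq: "pq H W x h"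
  shows "distortion h x \<le> ereal (H 1)"
proof -
  obtain r where r: "r > 0" "cball x r \<subseteq> W" using W open_contains_cball by blast
  obtain \<delta> where \<delta>: "\<delta> > 0" "\<And>a b. a \<in> W \<Longrightarrow> b \<in> W \<Longrightarrow> dist b x < \<delta> \<Longrightarrow> dist a x \<le> 1 * dist b x \<Longrightarrow> dist (h a) (h x) \<le> H 1 * dist (h b) (h x)"
    using pqE[OF pq] by blast
  have "(SUP y\<in>h ` sphere x \<epsilon>. dist (h x) y) / (INF y\<in>h ` sphere x \<epsilon>. dist (h x) y) \<le> H 1"
    if "0 < \<epsilon>" "\<epsilon> < min r \<delta>" for \<epsilon>
  proof -
    have sub: "cball x \<epsilon> \<subseteq> W" using r(2) that by auto
    have "dist (h x) (h a) \<le> H 1 * dist (h x) (h b)" if ab: "a \<in> sphere x \<epsilon>" "b \<in> sphere x \<epsilon>" for a b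
    proof -
      have "a \<in> W" "b \<in> W" using sub ab by auto
      then show ?thesis using \<delta>(2)[of a b] ab \<open>\<epsilon> < min r \<delta>\<close> by (simp add: dist_commute)
    qed
    then have "metric_ratio (H 1) h x \<epsilon>" unfolding metric_ratio_def by blast
    then show ?thesis using sphere_ratio[OF sub cont inj that(1)] by blast
  qed
  then have "eventually (\<lambda>\<epsilon>. ereal ((SUP y\<in>h ` sphere x \<epsilon>. dist (h x) y) / (INF y\<in>h ` sphere x \<epsilon>. dist (h x) y)) \<le> ereal (H 1)) (at_right 0)"
    unfolding eventually_at_right_field using r(1) \<delta>(1) by (intro exI[of _ "min r \<delta>"]) auto
  then show ?thesis unfolding distortion_def by (rule Limsup_bounded)
qed

lemma off_one_pole:
  obtains s :: real where "s \<in> {1, - 1}" "s * s = 1" "(p :: 'a::euclidean_space \<times> real) \<noteq> (0, s)"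
proof (cases "p = (0, 1)")
  case True
  then show ?thesis using that[of "- 1"] by simp
next
  case False
  then show ?thesis using that[of 1] by simp
qed

lemma quasiconformalD:
  assumes "quasiconformal f" "(U, \<phi>) \<in> sphere_charts" "(V, \<psi>) \<in> sphere_charts"
  shows "locally_quasiconformal_on (\<phi> ` {x \<in> U. f x \<in> V}) (\<psi> \<circ> f \<circ> inv_into U \<phi>)"
  using assms unfolding quasiconformal_def by fast

lemma quasiconformal_local_qs:
  fixes f :: "'a::euclidean_space \<times> real \<Rightarrow> 'a \<times> real"
  assumes f: "quasiconformal f" and n: "DIM('a) \<ge> 2"
    and s: "s \<in> {1, - 1}" and t: "t \<in> {1, - 1}" and w: "f (unproj s w) \<in> unit_sphere - {(0, t)}"
  shows "\<exists>H \<delta>. \<delta> > 0 \<and> qs H (ball w \<delta>) (\<lambda>v. proj t (f (unproj s v))) \<and>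
    (\<forall>v\<in>ball w \<delta>. f (unproj s v) \<in> unit_sphere - {(0, t)})"
proof -
  have ss: "s * s = 1" using s by auto
  define V where "V = (\<lambda>s :: real. unit_sphere - {(0, s)} :: ('a \<times> real) set)"
  define h where "h = (\<lambda>v. proj t (f (unproj s v)))"
  define \<Omega> where "\<Omega> = proj s ` {x \<in> V s. f x \<in> V t}"
  have dom: "f (unproj s v) \<in> V t" if v: "v \<in> \<Omega>" for v
  proof -
    obtain x where x: "v = proj s x" "x \<in> V s" "f x \<in> V t" using v unfolding \<Omega>_def by blast
    then have "unproj s v = x" using unproj_proj[OF ss, of x] unfolding V_def by simp
    then show ?thesis using x by simp
  qed
  have w\<Omega>: "w \<in> \<Omega>" unfolding \<Omega>_def V_def
    using w unproj_neq_pole[OF ss, of w] unproj_in_sphere[OF ss, of w] proj_unproj[OF ss, of w]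
    by (intro image_eqI[of _ _ "unproj s w"]) simp_all
  have "locally_quasiconformal_on \<Omega> (proj t \<circ> f \<circ> inv_into (V s) (proj s))"
    using quasiconformalD[OF f, of "V s" "proj s" "V t" "proj t"]
      stereographic_charts[OF s, where 'a = 'a] stereographic_charts[OF t, where 'a = 'a]
    by (simp add: stereographic_eq \<Omega>_def V_def)
  moreover have "proj t \<circ> f \<circ> inv_into (V s) (proj s) = h"
    by (simp add: fun_eq_iff h_def V_def inv_into_proj[OF ss])
  ultimately obtain W where W: "open W" "w \<in> W" "W \<subseteq> \<Omega>" "quasiconformal_on W h"
    using w\<Omega> unfolding locally_quasiconformal_on_def by auto
  obtain K where "metric_qc h W K" using quasiconformal_on_metric_qc[OF W(4)] .
  then interpret metric_qc h W K .
  obtain r where r: "r > 0" "ball w r \<subseteq> W" using W openE by blast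
  obtain H where "qs H (ball w (r / 4)) h" using local_quasisymmetry[OF n, of w "r / 4"] r by auto
  moreover have "f (unproj s v) \<in> V t" if "v \<in> ball w (r / 4)" for v
  proof (rule dom)
    have "ball w (r / 4) \<subseteq> ball w r" using r by (intro subset_ball) simp
    then show "v \<in> \<Omega>" using that r W(3) by blast
  qed
  ultimately show ?thesis unfolding h_def V_def using r(1) by (intro exI[of _ H] exI[of _ "r / 4"]) auto
qed

text \<open>Each point has a neighbourhood with one control function, by local quasisymmetry in
  stereographic charts. Compactness of the sphere reduces these to finitely many, and their maximum
  works everywhere.\<close>

lemma quasiconformal_imp_pq:
  fixes f :: "'a::euclidean_space \<times> real \<Rightarrow> 'a \<times> real"
  assumes f: "quasiconformal f" and n: "DIM('a) \<ge> 2" and im: "f ` unit_sphere \<subseteq> unit_sphere"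
  shows "\<exists>H. \<forall>p\<in>unit_sphere. pq H unit_sphere p f"
proof -
  have loc: "\<exists>H N. open N \<and> p \<in> N \<and> (\<forall>q\<in>N \<inter> unit_sphere. pq H unit_sphere q f)" if p: "p \<in> unit_sphere" for p
  proof -
    obtain s where s: "s \<in> {1, - 1}" "s * s = 1" "p \<noteq> (0, s)" using off_one_pole .
    obtain t where t: "t \<in> {1, - 1}" "t * t = 1" "f p \<noteq> (0, t)" using off_one_pole .
    define w where "w = proj s p"
    have pw: "unproj s w = p" unfolding w_def using unproj_proj[OF s(2) p s(3)] .
    define h where "h = (\<lambda>v. proj t (f (unproj s v)))"
    have "f p \<in> unit_sphere" using im p by blast
    then have "f (unproj s w) \<in> unit_sphere - {(0, t)}" using pw t(3) by simp
    from quasiconformal_local_qs[OF f n s(1) t(1) this] obtain H \<delta> where \<delta>: "\<delta> > 0" and qs: "qs H (ball w \<delta>) h"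
      and fV: "\<And>v. v \<in> ball w \<delta> \<Longrightarrow> f (unproj s v) \<in> unit_sphere - {(0, t)}" unfolding h_def by blast
    define Z where "Z = unproj s ` ball w \<delta>"
    have homs: "homeomorphism (unit_sphere - {(0, s)}) UNIV (proj s) (unproj s :: 'a \<Rightarrow> _)" by (rule homeomorphism_proj[OF s(2)])
    have "openin (top_of_set (unit_sphere - {(0, s)})) Z" unfolding Z_def
      by (rule homeomorphism_imp_open_map[OF homeomorphism_symD[OF homs]]) auto
    then obtain N0 where N0: "open N0" "Z = (unit_sphere - {(0, s)}) \<inter> N0" by (metis openin_open)
    define N where "N = N0 - {(0, s)}"
    have N: "open N" "Z = unit_sphere \<inter> N" using N0 by (auto simp: N_def open_delete)
    have projZ: "proj s q \<in> ball w \<delta>" if "q \<in> Z" for q using that s(2) by (auto simp: Z_def)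
    have eq: "f q = unproj t (h (proj s q))" if q: "q \<in> Z" for q
    proof -
      have "unproj s (proj s q) = q" using q s(2) by (auto simp: Z_def)
      then show ?thesis using fV[OF projZ[OF q]] unproj_proj[OF t(2), of "f q"] by (simp add: h_def)
    qed
    have cZ: "continuous_on Z (proj s)"
      using homeomorphism_cont1[OF homs] by (rule continuous_on_subset) (use N0 in auto)
    have ch: "continuous_on (ball w \<delta>) h" using qs by (simp add: qs_def)
    \<comment> \<open>The inner 4 comes from the projection and the outer 4 from the inverse
      projection; neither depends on the point.\<close>
    have pq: "pq (\<lambda>M. 4 * H (4 * M)) unit_sphere q f" if q: "q \<in> N \<inter> unit_sphere" for q
    proof -
      have qZ: "q \<in> Z" using q N by auto
      have q': "q \<in> unit_sphere" "q \<noteq> (0, s)" using qZ N0 by auto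
      have 1: "pq (\<lambda>M. 4 * M) Z q (proj s)"
        by (rule pq_subset[OF pq_proj[OF s(2) q']]) (use N0 in auto)
      have 2: "pq H (proj s ` Z) (proj s q) h"
        by (rule pq_subset[OF qs_pq[OF qs open_ball projZ[OF qZ]]]) simp
      have 3: "pq (\<lambda>M. H (4 * M)) Z q (h \<circ> proj s)" using pq_comp[OF 1 cZ qZ 2] .
      have 4: "continuous_on Z (h \<circ> proj s)"
        by (rule continuous_on_compose[OF cZ continuous_on_subset[OF ch]]) (use projZ in blast)
      have 5: "pq (\<lambda>M. 4 * H (4 * M)) Z q (unproj t \<circ> (h \<circ> proj s))"
        by (rule pq_comp[OF 3 4 qZ pq_subset[OF pq_unproj[OF t(2)]]]) simp
      have "pq (\<lambda>M. 4 * H (4 * M)) Z q f" by (rule pq_cong[OF 5 qZ]) (simp add: eq)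
      then show ?thesis unfolding N(2) by (rule pq_local) (use N q in auto)
    qed
    have "p \<in> Z" unfolding Z_def using pw \<delta> by (intro image_eqI[of _ _ w]) auto
    then show ?thesis using pq N by blast
  qed
  then have "\<forall>p. \<exists>H N. p \<in> unit_sphere \<longrightarrow> open N \<and> p \<in> N \<and> (\<forall>q\<in>N \<inter> unit_sphere. pq H unit_sphere q f)" by blast
  from choice[OF this] obtain HH where "\<forall>p. \<exists>N. p \<in> unit_sphere \<longrightarrow> open N \<and> p \<in> N \<and> (\<forall>q\<in>N \<inter> unit_sphere. pq (HH p) unit_sphere q f)" ..
  from choice[OF this] obtain NN where HN: "\<And>p. p \<in> unit_sphere \<Longrightarrow> open (NN p) \<and> p \<in> NN p \<and> (\<forall>q\<in>NN p \<inter> unit_sphere. pq (HH p) unit_sphere q f)"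
    by blast
  obtain C where C: "C \<subseteq> unit_sphere" "finite C" "unit_sphere \<subseteq> (\<Union>p\<in>C. NN p)"
    using compactE_image[OF compact_sphere, of unit_sphere NN 0 1] HN by blast
  define H where "H M = Max ((\<lambda>p. HH p M) ` C)" for M
  have "pq H unit_sphere q f" if q: "q \<in> unit_sphere" for q
  proof -
    obtain p where p: "p \<in> C" "q \<in> NN p" using C(3) q by blast
    then have "pq (HH p) unit_sphere q f" using HN C(1) q by blast
    then show ?thesis by (rule pq_mono) (use C(2) p(1) in \<open>simp add: H_def\<close>)
  qed
  then show ?thesis by blast
qed

lemma chart_overlap_open:
  assumes "coordinate_chart (U, \<phi>)" "openin (top_of_set unit_sphere) V"
  shows "open (\<phi> ` (U \<inter> V))"
proof -
  obtain g where U: "openin (top_of_set unit_sphere) U" "open (\<phi> ` U)" "homeomorphism U (\<phi> ` U) \<phi> g"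
    using assms(1) unfolding coordinate_chart_def by auto
  have "openin (top_of_set U) (U \<inter> V)"
    by (rule openin_subset_trans[OF openin_Int[OF U(1) assms(2)]]) (use openin_imp_subset[OF U(1)] in auto)
  then have "openin (top_of_set (\<phi> ` U)) (\<phi> ` (U \<inter> V))" by (rule homeomorphism_imp_open_map[OF U(3)])
  then show ?thesis using U(2) by (simp add: openin_open_eq)
qed

text \<open>Compatibility with a stereographic chart makes both transition maps continuously
  differentiable, hence locally Lipschitz, and the stereographic chart itself is locally bilipschitz
  by the chordal distance formula.\<close>

lemma chart_locally_bilip:
  fixes U :: "('a::euclidean_space \<times> real) set"
  assumes chart: "(U, \<phi>) \<in> sphere_charts" and q: "q \<in> U"
  shows "\<exists>N L. openin (top_of_set unit_sphere) N \<and> q \<in> N \<and> N \<subseteq> U \<and> L > 0 \<and>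
    (\<forall>a\<in>N. \<forall>b\<in>N. dist (\<phi> a) (\<phi> b) \<le> L * dist a b \<and> dist a b \<le> L * dist (\<phi> a) (\<phi> b))"
proof -
  have cc: "coordinate_chart (U, \<phi>)" using chart by (simp add: sphere_charts_def)
  then obtain g where U: "openin (top_of_set unit_sphere) U" "open (\<phi> ` U)" "homeomorphism U (\<phi> ` U) \<phi> g"
    unfolding coordinate_chart_def by auto
  have US: "U \<subseteq> unit_sphere" using U(1) openin_imp_subset by blast
  have injU: "inj_on \<phi> U" by (rule inj_on_inverseI) (rule homeomorphism_apply1[OF U(3)])
  obtain s where s: "s \<in> {1, - 1}" "s * s = 1" "q \<noteq> (0, s)" using off_one_pole .
  define V where "V = (unit_sphere - {(0, s)} :: ('a \<times> real) set)"
  have ccV: "coordinate_chart (V, proj s)"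
    using stereographic_charts[OF s(1), where 'a = 'a] by (simp add: sphere_charts_def stereographic_eq V_def)
  have oV: "openin (top_of_set unit_sphere) V" using ccV by (simp add: coordinate_chart_def)
  define T where "T = \<phi> \<circ> inv_into V (proj s)"
  define T' where "T' = proj s \<circ> inv_into U \<phi>"
  have "smoothly_compatible (U, \<phi>) (V, proj s)"
    using chart s(1) by (simp add: sphere_charts_def stereographic_eq V_def) blast
  then have sm: "C_on (Suc 0) (proj s ` (U \<inter> V)) T" "C_on (Suc 0) (\<phi> ` (U \<inter> V)) T'"
    unfolding smoothly_compatible_def smooth_on_def T_def T'_def by blast+
  have op: "open (proj s ` (U \<inter> V))" "open (\<phi> ` (U \<inter> V))"
    using chart_overlap_open[OF ccV U(1)] chart_overlap_open[OF cc oV] by (simp_all add: Int_commute)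
  have qV: "q \<in> U \<inter> V" using q US s(3) by (auto simp: V_def)
  define w where "w = proj s q"
  obtain \<delta> B where B: "\<delta> > 0" "B > 0" "\<And>x y. x \<in> ball w \<delta> \<Longrightarrow> y \<in> ball w \<delta> \<Longrightarrow> dist (T x) (T y) \<le> B * dist x y"
    using C_on_Suc_locally_lipschitz[OF sm(1) op(1) imageI[OF qV]] unfolding w_def by blast
  obtain \<delta>' B' where B': "\<delta>' > 0" "B' > 0" "\<And>x y. x \<in> ball (\<phi> q) \<delta>' \<Longrightarrow> y \<in> ball (\<phi> q) \<delta>' \<Longrightarrow> dist (T' x) (T' y) \<le> B' * dist x y"
    using C_on_Suc_locally_lipschitz[OF sm(2) op(2) imageI[OF qV]] by blast
  define N where "N = (U \<inter> \<phi> -` ball (\<phi> q) \<delta>') \<inter> (V \<inter> proj s -` ball w (min \<delta> 1))"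
  have N: "openin (top_of_set unit_sphere) N"
  proof -
    have 1: "continuous_on V (proj s)" unfolding V_def by (rule homeomorphism_cont1[OF homeomorphism_proj[OF s(2)]])
    have 2: "continuous_on U \<phi>" by (rule homeomorphism_cont1[OF U(3)])
    have "openin (top_of_set U) (U \<inter> \<phi> -` ball (\<phi> q) \<delta>')"
      by (rule continuous_openin_preimage_gen[OF 2 open_ball])
    moreover have "openin (top_of_set V) (V \<inter> proj s -` ball w (min \<delta> 1))"
      by (rule continuous_openin_preimage_gen[OF 1 open_ball])
    ultimately show ?thesis unfolding N_def using openin_trans U(1) oV by blast
  qed
  define J where "J = bracket w + 1"
  have J: "J > 0" using bracket(2)[of w] by (simp add: J_def)
  define L where "L = B * J\<^sup>2 + 2 * B'"
  have L: "L > 0" using B B' J by (simp add: L_def add_pos_pos)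
  have "dist (\<phi> a) (\<phi> b) \<le> L * dist a b \<and> dist a b \<le> L * dist (\<phi> a) (\<phi> b)" if a: "a \<in> N" and b: "b \<in> N" for a b
  proof -
    have *: "T (proj s x) = \<phi> x \<and> T' (\<phi> x) = proj s x \<and> proj s x \<in> ball w \<delta> \<and> \<phi> x \<in> ball (\<phi> q) \<delta>' \<and>
        bracket (proj s x) \<le> J \<and> x \<in> unit_sphere \<and> x \<noteq> (0, s)" if "x \<in> N" for x
    proof -
      have x: "x \<in> U" "x \<in> V" "proj s x \<in> ball w (min \<delta> 1)" "\<phi> x \<in> ball (\<phi> q) \<delta>'" using that by (auto simp: N_def)
      have xs: "x \<in> unit_sphere" "x \<noteq> (0, s)" using x(2) by (auto simp: V_def)
      have "inv_into V (proj s) (proj s x) = x"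
        unfolding V_def inv_into_proj[OF s(2)] using unproj_proj[OF s(2) xs] .
      moreover have "bracket (proj s x) \<le> J"
        using bracket_lipschitz[of "proj s x" w] x(3) by (simp add: J_def dist_commute)
      ultimately show ?thesis using x xs inv_into_f_f[OF injU x(1)] by (simp add: T_def T'_def)
    qed
    note A = *[OF a] and Bb = *[OF b]
    define d where "d = dist (proj s a) (proj s b)"
    have jj: "bracket (proj s a) * bracket (proj s b) \<le> J * J" "1 \<le> bracket (proj s a) * bracket (proj s b)"
      using A Bb bracket(1)[of "proj s a"] bracket(1)[of "proj s b"] bracket(2)[of "proj s b"] J
      by (auto intro!: mult_mono simp: mult_ge1_I)
    have "d = dist a b * (bracket (proj s a) * bracket (proj s b)) / 2"
      unfolding d_def using A Bb by (intro dist_proj[OF s(2)]) auto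
    moreover have "0 \<le> J * (J * dist a b)" using J by simp
    ultimately have d1: "d \<le> J\<^sup>2 * dist a b" and d2: "dist a b \<le> 2 * d"
      using mult_left_mono[OF jj(1), of "dist a b"] mult_left_mono[OF jj(2), of "dist a b"]
      by (simp_all add: power2_eq_square mult_ac)
    have "dist (\<phi> a) (\<phi> b) \<le> B * d" using B(3)[of "proj s a" "proj s b"] A Bb by (simp add: d_def)
    also have "\<dots> \<le> B * (J\<^sup>2 * dist a b)" using d1 B by (intro mult_left_mono) auto
    also have "\<dots> \<le> L * dist a b" using B' by (simp add: L_def algebra_simps)
    finally have 1: "dist (\<phi> a) (\<phi> b) \<le> L * dist a b" .
    have "d \<le> B' * dist (\<phi> a) (\<phi> b)" using B'(3)[of "\<phi> a" "\<phi> b"] A Bb by (simp add: d_def)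
    then have "dist a b \<le> 2 * B' * dist (\<phi> a) (\<phi> b)" using d2 by linarith
    also have "\<dots> \<le> L * dist (\<phi> a) (\<phi> b)" using B J by (intro mult_right_mono) (auto simp: L_def)
    finally show ?thesis using 1 by blast
  qed
  moreover have "q \<in> N" using qV B(1) B'(1) by (simp add: N_def w_def)
  ultimately show ?thesis using N L by (intro exI[of _ N] exI[of _ L]) (auto simp: N_def)
qed

text \<open>In any two charts the control function of \<open>f\<close> is altered only through the
  local bilipschitz constants of the charts. These depend on the place, but on a small neighbourhood
  they bound the distortion by one number, which is what local quasiconformality asks for.\<close>

lemma pq_imp_quasiconformal:
  fixes f :: "'a::euclidean_space \<times> real \<Rightarrow> 'a \<times> real"
  assumes f: "homeomorphism unit_sphere unit_sphere f f'" and pq: "\<And>p. p \<in> unit_sphere \<Longrightarrow> pq H unit_sphere p f"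
  shows "quasiconformal f"
proof -
  have "locally_quasiconformal_on (\<phi> ` {x \<in> U. f x \<in> V}) (\<psi> \<circ> f \<circ> inv_into U \<phi>)"
    if U: "(U, \<phi>) \<in> sphere_charts" and V: "(V, \<psi>) \<in> sphere_charts" for U V \<phi> \<psi>
    unfolding locally_quasiconformal_on_def
  proof
    fix x assume "x \<in> \<phi> ` {x \<in> U. f x \<in> V}"
    then obtain q where q: "q \<in> U" "f q \<in> V" "x = \<phi> q" by blast
    have ccU: "coordinate_chart (U, \<phi>)" using U by (simp add: sphere_charts_def)
    then obtain g where oU: "openin (top_of_set unit_sphere) U" and gU: "homeomorphism U (\<phi> ` U) \<phi> g"
      unfolding coordinate_chart_def by auto
    have ccV: "coordinate_chart (V, \<psi>)" using V by (simp add: sphere_charts_def)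
    obtain N1 L1 where N1: "openin (top_of_set unit_sphere) N1" "q \<in> N1" "N1 \<subseteq> U" "L1 > 0"
      and L1: "\<And>a b. a \<in> N1 \<Longrightarrow> b \<in> N1 \<Longrightarrow> dist (\<phi> a) (\<phi> b) \<le> L1 * dist a b \<and> dist a b \<le> L1 * dist (\<phi> a) (\<phi> b)"
      using chart_locally_bilip[OF U q(1)] by blast
    obtain N2 L2 where N2: "openin (top_of_set unit_sphere) N2" "f q \<in> N2" "N2 \<subseteq> V" "L2 > 0"
      and L2: "\<And>a b. a \<in> N2 \<Longrightarrow> b \<in> N2 \<Longrightarrow> dist (\<psi> a) (\<psi> b) \<le> L2 * dist a b \<and> dist a b \<le> L2 * dist (\<psi> a) (\<psi> b)"
      using chart_locally_bilip[OF V q(2)] by blast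
    have cf: "continuous_on unit_sphere f" "f ` unit_sphere = unit_sphere"
      using f by (auto simp: homeomorphism_def)
    have injf: "inj_on f unit_sphere" by (rule inj_on_inverseI) (rule homeomorphism_apply1[OF f])
    define N where "N = N1 \<inter> (unit_sphere \<inter> f -` N2)"
    have oN: "openin (top_of_set unit_sphere) N" unfolding N_def
      by (intro openin_Int N1(1) continuous_openin_preimage[OF cf(1) _ N2(1)]) (use cf(2) in auto)
    have NS: "N \<subseteq> unit_sphere" "N \<subseteq> N1" "N \<subseteq> U" using N1(3) by (auto simp: N_def)
    have fN: "f a \<in> N2" if "a \<in> N" for a using that by (simp add: N_def)
    have qN: "q \<in> N" using N1(2) N2(2) q(1) openin_imp_subset[OF oU] by (auto simp: N_def)
    define W where "W = \<phi> ` N"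
    define h where "h = \<psi> \<circ> f \<circ> inv_into U \<phi>"
    have injU: "inj_on \<phi> U" by (rule inj_on_inverseI) (rule homeomorphism_apply1[OF gU])
    have inv: "inv_into U \<phi> (\<phi> a) = a" if "a \<in> N" for a using inv_into_f_f[OF injU subsetD[OF NS(3) that]] .
    have h: "h (\<phi> a) = \<psi> (f a)" if "a \<in> N" for a using inv[OF that] by (simp add: h_def)
    have oW: "open W" using chart_overlap_open[OF ccU oN] NS(3) by (simp add: W_def Int_absorb1)
    have invW: "inv_into U \<phi> ` W = N" by (simp add: W_def image_image inv)
    have pq_inv: "pq (\<lambda>M. (L1 * L1) * M) W (\<phi> a) (inv_into U \<phi>)" if a: "a \<in> N" for a
    proof (rule pq_pointwise_bilip[of "1 / L1" 1])
      fix y assume "y \<in> W"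
      then obtain b where b: "b \<in> N" "y = \<phi> b" by (auto simp: W_def)
      show "1 / L1 * dist y (\<phi> a) \<le> dist (inv_into U \<phi> y) (inv_into U \<phi> (\<phi> a)) \<and>
        dist (inv_into U \<phi> y) (inv_into U \<phi> (\<phi> a)) \<le> L1 * L1 * (1 / L1) * dist y (\<phi> a)"
        using L1[OF subsetD[OF NS(2) b(1)] subsetD[OF NS(2) a]] N1(4) by (simp add: inv[OF a] inv[OF b(1)] b(2) field_simps)
    qed (use N1 in auto)
    have pq_psi: "pq (\<lambda>M. (L2 * L2) * M) (f ` N) (f a) \<psi>" if a: "a \<in> N" for a
    proof (rule pq_pointwise_bilip[of "1 / L2" 1])
      fix y assume "y \<in> f ` N"
      then show "1 / L2 * dist y (f a) \<le> dist (\<psi> y) (\<psi> (f a)) \<and> dist (\<psi> y) (\<psi> (f a)) \<le> L2 * L2 * (1 / L2) * dist y (f a)"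
        using L2[of y "f a"] fN a N2(4) by (auto simp: field_simps)
    qed (use N2 in auto)
    have c1: "continuous_on W (inv_into U \<phi>)"
    proof -
      have "continuous_on W g" using homeomorphism_cont2[OF gU] NS(3) by (auto simp: W_def intro: continuous_on_subset)
      moreover have "inv_into U \<phi> y = g y" if "y \<in> W" for y
        using that inv homeomorphism_apply1[OF gU] NS(3) by (auto simp: W_def)
      ultimately show ?thesis by (simp cong: continuous_on_cong)
    qed
    have c2: "continuous_on N f" using cf(1) NS(1) continuous_on_subset by blast
    have c3: "continuous_on W (f \<circ> inv_into U \<phi>)"
      by (rule continuous_on_compose[OF c1]) (simp add: invW c2)
    have c\<psi>: "continuous_on V \<psi>" using ccV unfolding coordinate_chart_def homeomorphism_def by auto
    have ch: "continuous_on W h" unfolding h_def o_assoc[symmetric]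
    proof (rule continuous_on_compose[OF c3 continuous_on_subset[OF c\<psi>]])
      show "(f \<circ> inv_into U \<phi>) ` W \<subseteq> V" unfolding image_comp[symmetric] invW using fN N2(3) by blast
    qed
    have injh: "inj_on h W"
    proof (rule inj_onI)
      fix y z assume "y \<in> W" "z \<in> W" and e: "h y = h z"
      then obtain a b where ab: "a \<in> N" "y = \<phi> a" "b \<in> N" "z = \<phi> b" by (auto simp: W_def)
      then have "dist (f a) (f b) \<le> L2 * 0" using L2[of "f a" "f b"] fN e h by auto
      then have "f a = f b" by simp
      then show "y = z" using injf ab NS(1) by (metis inj_onD subsetD)
    qed
    have dist: "distortion h y \<le> ereal (L2 * L2 * H (L1 * L1 * 1))" if "y \<in> W" for y
    proof -
      obtain a where a: "a \<in> N" "y = \<phi> a" using \<open>y \<in> W\<close> by (auto simp: W_def)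
      have yW: "\<phi> a \<in> W" using a by (simp add: W_def)
      have "pq H N a f" using pq_subset[OF pq NS(1)] a(1) NS(1) by blast
      then have "pq H (inv_into U \<phi> ` W) (inv_into U \<phi> (\<phi> a)) f" by (simp add: invW inv[OF a(1)])
      from pq_comp[OF pq_inv[OF a(1)] c1 yW this]
      have 1: "pq (\<lambda>M. H (L1 * L1 * M)) W (\<phi> a) (f \<circ> inv_into U \<phi>)" .
      have "pq (\<lambda>M. (L2 * L2) * M) ((f \<circ> inv_into U \<phi>) ` W) ((f \<circ> inv_into U \<phi>) (\<phi> a)) \<psi>"
        unfolding image_comp[symmetric] invW o_apply inv[OF a(1)] by (rule pq_psi[OF a(1)])
      from pq_comp[OF 1 c3 yW this]
      have "pq (\<lambda>M. L2 * L2 * H (L1 * L1 * M)) W (\<phi> a) h" by (simp add: h_def o_assoc)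
      from distortion_le[OF oW yW ch injh this] show ?thesis by (simp add: a(2))
    qed
    have "open (h ` W)" by (rule invariance_of_domain[OF ch oW injh])
    moreover have "\<exists>g. homeomorphism W (h ` W) h g" by (rule invariance_of_domain_homeomorphism[OF oW ch _ injh]) auto
    \<comment> \<open>The summand 1 provides the strict inequality in the definition.\<close>
    moreover have "\<forall>y\<in>W. distortion h y < ereal (L2 * L2 * H (L1 * L1 * 1) + 1)"
      using dist by (fastforce intro: le_less_trans)
    ultimately have "quasiconformal_on W h" unfolding quasiconformal_on_def using oW by blast
    moreover have "x \<in> W" using q(3) qN by (simp add: W_def)
    moreover have "W \<subseteq> \<phi> ` {x \<in> U. f x \<in> V}" unfolding W_def using NS(3) fN N2(3) by blast
    ultimately show "\<exists>W. open W \<and> x \<in> W \<and> W \<subseteq> \<phi> ` {x \<in> U. f x \<in> V} \<and> quasiconformal_on W (\<psi> \<circ> f \<circ> inv_into U \<phi>)"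
      using oW unfolding h_def by blast
  qed
  then show ?thesis unfolding quasiconformal_def by blast
qed

section \<open>Extension of Euclidean maps to the sphere\<close>

text \<open>The distance to the north pole is 2 divided by the bracket. So such a bound for the
  inverse of \<open>F\<close> is a Lipschitz bound at the pole for the extension of
  \<open>F\<close>.\<close>

definition growth :: "real \<Rightarrow> ('a::euclidean_space \<Rightarrow> 'a) \<Rightarrow> bool"
  where "growth C F \<longleftrightarrow> 0 < C \<and> (\<forall>w. bracket (F w) \<le> C * bracket w)"

lemma growth_comp:
  assumes "growth C F" "growth D G"
  shows "growth (D * C) (G \<circ> F)"
  unfolding growth_def
proof (intro conjI allI)
  show "0 < D * C" using assms by (simp add: growth_def)
  fix w
  have "D * bracket (F w) \<le> D * (C * bracket w)" using assms by (intro mult_left_mono) (auto simp: growth_def)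
  moreover have "bracket (G (F w)) \<le> D * bracket (F w)" using assms by (simp add: growth_def)
  ultimately show "bracket ((G \<circ> F) w) \<le> D * C * bracket w" by (simp add: mult.assoc)
qed

lemma growth_bilip:
  assumes "bilip M UNIV a"
  shows "growth (bracket (a 0) + M) a"
  unfolding growth_def
proof (intro conjI allI)
  have M: "M > 0" using assms by (simp add: bilip_def)
  show "0 < bracket (a 0) + M" using M bracket(2)[of "a 0"] by simp
  fix w
  have "bracket (a w) \<le> bracket (a 0) + dist (a w) (a 0)" by (rule bracket_lipschitz)
  also have "dist (a w) (a 0) \<le> M * norm w" using bilipD(2)[OF assms, of w 0] by simp
  also have "M * norm w \<le> M * bracket w" using M bracket(4) by (intro mult_left_mono) auto
  also have "bracket (a 0) \<le> bracket (a 0) * bracket w" using bracket(1)[of w] bracket(2)[of "a 0"] by (simp add: mult_le_cancel_left1)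
  finally show "bracket (a w) \<le> (bracket (a 0) + M) * bracket w" by (simp add: algebra_simps)
qed

lemma growth_displacement:
  assumes "\<And>z. dist (g z) z \<le> (\<kappa> + norm z) / 2"
  shows "growth (2 + \<bar>\<kappa>\<bar>) g"
  unfolding growth_def
proof (intro conjI allI)
  fix w
  have "bracket (g w) \<le> bracket w + dist (g w) w" by (rule bracket_lipschitz)
  also have "dist (g w) w \<le> \<bar>\<kappa>\<bar> + norm w" using assms[of w] norm_ge_zero[of w] abs_ge_self[of \<kappa>] by argo
  also have "\<bar>\<kappa>\<bar> \<le> \<bar>\<kappa>\<bar> * bracket w" using bracket(1)[of w] by (simp add: mult_le_cancel_left1)
  also have "norm w \<le> bracket w" by (rule bracket)
  finally show "bracket (g w) \<le> (2 + \<bar>\<kappa>\<bar>) * bracket w" by (simp add: algebra_simps)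
qed simp

definition sphere_map :: "('a::euclidean_space \<Rightarrow> 'a) \<Rightarrow> 'a \<times> real \<Rightarrow> 'a \<times> real"
  where "sphere_map F = (\<lambda>p\<in>unit_sphere. if p = (0, 1) then (0, 1) else unproj 1 (F (proj 1 p)))"

lemma sphere_map_pole [simp]: "sphere_map F (0, 1) = (0, 1)"
  using pole_in_sphere[OF mult_1, where 'a = 'a] by (simp add: sphere_map_def)

lemma sphere_map_unproj [simp]: "sphere_map F (unproj 1 w) = unproj 1 (F w)"
  using unproj_in_sphere[OF mult_1, of w] unproj_neq_pole[OF mult_1, of w] by (simp add: sphere_map_def)

lemma sphere_cases:
  assumes "p \<in> unit_sphere"
  obtains "p = (0, 1)" | w where "p = unproj 1 (w :: 'a::euclidean_space)"
  using unproj_proj[OF mult_1 assms] by metis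

lemma sphere_map_in_sphere:
  assumes p: "p \<in> unit_sphere"
  shows "sphere_map F p \<in> unit_sphere"
  using p
proof (cases p rule: sphere_cases)
  case (2 w)
  then show ?thesis using unproj_in_sphere[OF mult_1, of "F w"] by simp
qed simp

lemma sphere_map_compose: "p \<in> unit_sphere \<Longrightarrow> sphere_map F (sphere_map G p) = sphere_map (F \<circ> G) p"
  by (cases p rule: sphere_cases) auto

lemma sphere_map_ident: "p \<in> unit_sphere \<Longrightarrow> (\<And>w. F w = w) \<Longrightarrow> sphere_map F p = p"
  by (cases p rule: sphere_cases) auto

lemma sphere_map_pole_dist:
  assumes p: "p \<in> unit_sphere" and F': "growth C F'" "\<And>w. F' (F w) = w"
  shows "dist (sphere_map F p) (0, 1) \<le> C * dist p (0, 1)"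
  using p
proof (cases p rule: sphere_cases)
  case (2 w)
  have "bracket w \<le> C * bracket (F w)" using F' unfolding growth_def by metis
  moreover have "bracket w > 0" "bracket (F w) > 0" by (rule bracket)+
  ultimately have "2 / bracket (F w) \<le> C * (2 / bracket w)" by (simp add: field_simps)
  then show ?thesis unfolding 2 sphere_map_unproj dist_unproj_pole[OF mult_1] .
qed simp

lemma sphere_map_continuous:
  assumes F: "continuous_on UNIV F" and F': "growth C F'" "\<And>w. F' (F w) = w"
  shows "continuous_on unit_sphere (sphere_map F)"
proof -
  let ?V = "unit_sphere - {(0, 1)} :: ('a \<times> real) set"
  have hom: "homeomorphism ?V UNIV (proj 1) (unproj 1 :: 'a \<Rightarrow> _)" by (rule homeomorphism_proj[OF mult_1])
  have "continuous_on ?V (unproj 1 \<circ> (F \<circ> proj 1))"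
    by (intro continuous_on_compose homeomorphism_cont1[OF hom]
      continuous_on_subset[OF F] continuous_on_subset[OF homeomorphism_cont2[OF hom]]) auto
  then have V: "continuous_on ?V (sphere_map F)"
    by (rule continuous_on_eq) (simp add: sphere_map_def)
  show ?thesis
    unfolding continuous_on_eq_continuous_within
  proof
    fix p :: "'a \<times> real" assume p: "p \<in> unit_sphere"
    show "continuous (at p within unit_sphere) (sphere_map F)"
    proof (cases "p = (0, 1)")
      case True
      have C: "C > 0" using F' by (simp add: growth_def)
      have "\<exists>d>0. \<forall>q\<in>unit_sphere. dist q p < d \<longrightarrow> dist (sphere_map F q) (sphere_map F p) < e" if e: "e > 0" for e
      proof (intro exI[of _ "e / C"] conjI ballI impI)
        fix q assume q: "q \<in> unit_sphere" "dist q p < e / C"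
        have "C * dist q p < e" using q(2) C by (simp add: field_simps)
        then show "dist (sphere_map F q) (sphere_map F p) < e"
          using sphere_map_pole_dist[OF q(1) F'] True by simp
      qed (use C e in auto)
      then show ?thesis unfolding continuous_within_eps_delta by blast
    next
      case False
      then have "continuous (at p within ?V) (sphere_map F)" using V p by (simp add: continuous_on_eq_continuous_within)
      moreover have "at p within ?V = at p within unit_sphere"
        by (rule at_within_nhd[of p "- {(0, 1)}"]) (use False in auto)
      ultimately show ?thesis by simp
    qed
  qed
qed

lemma sphere_map_homeomorphism:
  assumes F: "homeomorphism UNIV UNIV F F'" and C: "growth C F" "growth C F'"
  shows "homeomorphism unit_sphere unit_sphere (sphere_map F) (sphere_map F')"
proof -
  have i: "F' (F w) = w" "F (F' w) = w" for w using F by (auto simp: homeomorphism_def)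
  have c: "continuous_on UNIV F" "continuous_on UNIV F'" using F by (auto simp: homeomorphism_def)
  show ?thesis
  proof (rule homeomorphismI[OF sphere_map_continuous[OF c(1) C(2) i(1)] sphere_map_continuous[OF c(2) C(1) i(2)]])
    fix p :: "'a \<times> real" assume p: "p \<in> unit_sphere"
    show "sphere_map F' (sphere_map F p) = p" "sphere_map F (sphere_map F' p) = p"
      unfolding sphere_map_compose[OF p] by (rule sphere_map_ident[OF p]; simp add: i)+
  qed (intro image_subsetI sphere_map_in_sphere; assumption)+
qed

text \<open>At the pole the growth of \<open>F\<close> and of its inverse gives a pointwise
  bilipschitz bound; elsewhere the projections are conformal. One control function serves all
  points.\<close>

lemma sphere_map_pq:
  assumes F: "homeomorphism UNIV UNIV F F'" and C: "growth C F" "growth C F'"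
    and pq: "\<And>w. pq H UNIV w F" and p: "p \<in> unit_sphere"
  shows "pq (\<lambda>M. max (4 * H (4 * M)) (C * C * M)) unit_sphere p (sphere_map F)"
proof (cases "p = (0, 1)")
  case True
  have i: "F' (F w) = w" "F (F' w) = w" for w using F by (auto simp: homeomorphism_def)
  have C0: "C > 0" using C by (simp add: growth_def)
  have "pq (\<lambda>M. (C * C) * M) unit_sphere p (sphere_map F)"
  proof (rule pq_pointwise_bilip[of "1 / C" 1])
    fix q :: "'a \<times> real" assume q: "q \<in> unit_sphere"
    have "dist (sphere_map F' (sphere_map F q)) (0, 1) \<le> C * dist (sphere_map F q) (0, 1)"
      using sphere_map_pole_dist[OF sphere_map_in_sphere[OF q] C(1) i(2)] .
    moreover have "sphere_map F' (sphere_map F q) = q"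
      unfolding sphere_map_compose[OF q] by (rule sphere_map_ident[OF q]) (simp add: i)
    ultimately show "1 / C * dist q p \<le> dist (sphere_map F q) (sphere_map F p) \<and>
        dist (sphere_map F q) (sphere_map F p) \<le> C * C * (1 / C) * dist q p"
      using sphere_map_pole_dist[OF q C(2) i(1)] C0 True by (simp add: field_simps)
  qed (use C0 in auto)
  then show ?thesis by (rule pq_mono) simp
next
  case False
  let ?V = "unit_sphere - {(0, 1)} :: ('a \<times> real) set"
  have hom: "homeomorphism ?V UNIV (proj 1) (unproj 1 :: 'a \<Rightarrow> _)" by (rule homeomorphism_proj[OF mult_1])
  have cF: "continuous_on UNIV F" using F by (simp add: homeomorphism_def)
  have pV: "p \<in> ?V" using p False by simp
  have c: "continuous_on ?V (proj 1)" by (rule homeomorphism_cont1[OF hom])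
  have 1: "pq (\<lambda>M. H (4 * M)) ?V p (F \<circ> proj 1)"
    by (rule pq_comp[OF pq_proj[OF mult_1 p False] c pV pq_subset[OF pq]]) simp
  have "continuous_on ?V (F \<circ> proj 1)"
    by (rule continuous_on_compose[OF c continuous_on_subset[OF cF]]) simp
  then have "pq (\<lambda>M. 4 * H (4 * M)) ?V p (unproj 1 \<circ> (F \<circ> proj 1))"
    by (rule pq_comp[OF 1 _ pV pq_subset[OF pq_unproj[OF mult_1]]]) simp
  then have "pq (\<lambda>M. 4 * H (4 * M)) ?V p (sphere_map F)"
    by (rule pq_cong) (use p False in \<open>auto simp: sphere_map_def\<close>)
  then have "pq (\<lambda>M. 4 * H (4 * M)) (unit_sphere \<inter> - {(0, 1)}) p (sphere_map F)" by (simp add: Diff_eq)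
  then have "pq (\<lambda>M. 4 * H (4 * M)) unit_sphere p (sphere_map F)"
    by (rule pq_local) (use False in auto)
  then show ?thesis by (rule pq_mono) simp
qed

lemma sphere_map_lipschitz:
  assumes F: "homeomorphism UNIV UNIV F F'" and C: "growth C F" "growth C F'" and M: "bilip M UNIV F"
    and p: "p \<in> unit_sphere" and q: "q \<in> unit_sphere"
  shows "dist (sphere_map F p) (sphere_map F q) \<le> (C + M * (C * C)) * dist p q"
proof -
  have i: "F' (F w) = w" for w using F by (auto simp: homeomorphism_def)
  have C0: "C > 0" "M > 0" using C M by (auto simp: growth_def bilip_def)
  have le: "C * d \<le> (C + M * (C * C)) * d" "M * (C * C) * d \<le> (C + M * (C * C)) * d" if "d \<ge> 0" for d :: real
    using that C0 by (intro mult_right_mono; simp)+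
  show ?thesis
  proof (cases "p = (0, 1) \<or> q = (0, 1)")
    case True
    then have "dist (sphere_map F p) (sphere_map F q) \<le> C * dist p q"
    proof
      assume "p = (0, 1)"
      then show ?thesis using sphere_map_pole_dist[OF q C(2) i] by (simp add: dist_commute)
    next
      assume "q = (0, 1)"
      then show ?thesis using sphere_map_pole_dist[OF p C(2) i] by simp
    qed
    then show ?thesis using le(1)[of "dist p q"] by simp
  next
    case False
    then obtain v w where vw: "p = unproj 1 v" "q = unproj 1 w"
      using unproj_proj[OF mult_1 p] unproj_proj[OF mult_1 q] by metis
    have j: "bracket x > 0" for x :: 'a by (rule bracket)
    have jj: "bracket x \<le> C * bracket (F x)" for x using C(2) i[of x] unfolding growth_def by metis
    have "bracket v * bracket w \<le> (C * bracket (F v)) * (C * bracket (F w))"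
      using jj[of v] jj[of w] j[of w] j[of v] C0 j[of "F v"] by (intro mult_mono) auto
    then have "1 / (bracket (F v) * bracket (F w)) \<le> C * C / (bracket v * bracket w)"
      using j[of v] j[of w] j[of "F v"] j[of "F w"] by (simp add: field_simps)
    then have "(2 * dist (F v) (F w)) * (1 / (bracket (F v) * bracket (F w))) \<le> (2 * (M * dist v w)) * (C * C / (bracket v * bracket w))"
      using bilipD(2)[OF M, of v w] C0 j[of "F v"] j[of "F w"] by (intro mult_mono) auto
    then have "dist (sphere_map F p) (sphere_map F q) \<le> M * (C * C) * dist p q"
      unfolding vw sphere_map_unproj dist_unproj[OF mult_1] by (simp add: mult_ac)
    then show ?thesis using le(2)[of "dist p q"] by simp
  qed
qed

lemma sphere_map_bilip:
  assumes F: "homeomorphism UNIV UNIV F F'" and C: "growth C F" "growth C F'" and M: "bilip M UNIV F"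
  shows "\<exists>K. bilip K unit_sphere (sphere_map F)"
proof -
  let ?K = "C + M * (C * C)"
  have i: "F' (F w) = w" "F (F' w) = w" for w using F by (auto simp: homeomorphism_def)
  have M': "bilip M UNIV F'"
    using bilip_inverse[OF M, of F'] F by (simp add: homeomorphism_def)
  have K: "?K > 0" using C M by (simp add: growth_def bilip_def add_pos_pos)
  have "dist p q \<le> ?K * dist (sphere_map F p) (sphere_map F q)" if "p \<in> unit_sphere" "q \<in> unit_sphere" for p q
  proof -
    have inv: "sphere_map F' (sphere_map F x) = x" if "x \<in> unit_sphere" for x :: "'a \<times> real"
      unfolding sphere_map_compose[OF that] by (rule sphere_map_ident[OF that]) (simp add: i)
    show ?thesis
      using sphere_map_lipschitz[OF homeomorphism_symD[OF F] C(2,1) M' sphere_map_in_sphere[OF that(1)] sphere_map_in_sphere[OF that(2)], of F F]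
      unfolding inv[OF that(1)] inv[OF that(2)] .
  qed
  then have "bilip ?K unit_sphere (sphere_map F)"
    unfolding bilip_def using sphere_map_lipschitz[OF F C M] K by blast
  then show ?thesis by blast
qed

section \<open>Geodesic and chordal distance\<close>

lemma sin_lower:
  assumes "0 \<le> x" "x \<le> pi / 2"
  shows "x / 4 \<le> sin x"
\<comment> \<open>Up to \<pi>/3 the cosine is at least 1/2; beyond, the sine is at least 1/2, while
  x/4 is less than 1/2.\<close>
proof (cases "x \<le> pi / 3")
  case True
  have "x / 2 - sin x \<le> 0 / 2 - sin 0"
  proof (rule DERIV_nonpos_imp_nonincreasing[OF assms(1)])
    fix y assume y: "0 \<le> y" "y \<le> x"
    have "cos (pi / 3) \<le> cos y" using y True by (intro cos_monotone_0_pi_le) auto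
    then have "1 / 2 - cos y \<le> 0" by (simp add: cos_60)
    moreover have "((\<lambda>y. y / 2 - sin y) has_real_derivative 1 / 2 - cos y) (at y)" by (auto intro!: derivative_eq_intros)
    ultimately show "\<exists>z. ((\<lambda>y. y / 2 - sin y) has_real_derivative z) (at y) \<and> z \<le> 0" by blast
  qed
  then show ?thesis using assms by simp
next
  case False
  then have "sin (pi / 6) \<le> sin x" using assms by (intro sin_monotone_2pi_le) auto
  then show ?thesis using assms pi_less_4 by (simp add: sin_30)
qed

text \<open>The chord of an angle is twice the sine of half the angle. The comparison allows the
  bilipschitz condition and the closeness to the identity to be handled in the ambient norm.\<close>

lemma sdist_bounds:
  assumes p: "p \<in> unit_sphere" and q: "q \<in> unit_sphere"
  shows "dist p q \<le> sdist p q" "sdist p q \<le> 4 * dist p q"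
proof -
  have n: "norm p = 1" "norm q = 1" using p q by auto
  have b: "\<bar>p \<bullet> q\<bar> \<le> 1" using Cauchy_Schwarz_ineq2[of p q] n by simp
  define x where "x = sdist p q / 2"
  have x: "0 \<le> x" "x \<le> pi / 2" using b arccos_bounded[of "p \<bullet> q"] by (auto simp: x_def sdist_def abs_le_iff)
  have "p \<bullet> q = cos (2 * x)" using b by (simp add: x_def sdist_def cos_arccos abs_le_iff)
  then have "(dist p q)\<^sup>2 = (2 * sin x)\<^sup>2"
    using dist_sphere[OF p q] by (simp add: cos_double_sin power_mult_distrib)
  moreover have "sin x \<ge> 0" using x by (intro sin_ge_zero) auto
  ultimately have d: "dist p q = 2 * sin x" by (intro power2_eq_imp_eq[of _ "2 * sin x"]) auto
  show "dist p q \<le> sdist p q" using d sin_x_le_x[OF x(1)] by (simp add: x_def)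
  show "sdist p q \<le> 4 * dist p q" using d sin_lower[OF x] by (simp add: x_def)
qed

lemma bilipschitz_iff:
  fixes f :: "'a::euclidean_space \<times> real \<Rightarrow> 'a \<times> real"
  assumes f: "f ` unit_sphere \<subseteq> unit_sphere"
  shows "bilipschitz f \<longleftrightarrow> (\<exists>M. bilip M unit_sphere f)"
proof
  assume "bilipschitz f"
  then obtain L where L: "L > 0" "\<And>x y. x \<in> unit_sphere \<Longrightarrow> y \<in> unit_sphere \<Longrightarrow>
      sdist x y / L \<le> sdist (f x) (f y) \<and> sdist (f x) (f y) \<le> L * sdist x y"
    unfolding bilipschitz_def by blast
  have "bilip (4 * L) unit_sphere f"
    unfolding bilip_def
  proof (intro conjI ballI)
    fix x y :: "'a \<times> real" assume xy: "x \<in> unit_sphere" "y \<in> unit_sphere"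
    have "f x \<in> unit_sphere" "f y \<in> unit_sphere" using xy f by blast+
    note s = sdist_bounds[OF xy] sdist_bounds[OF this]
    have "sdist x y \<le> L * sdist (f x) (f y)" using L(1) L(2)[OF xy] by (simp add: field_simps)
    also have "\<dots> \<le> L * (4 * dist (f x) (f y))" using s L(1) by (intro mult_left_mono) auto
    finally show "dist x y \<le> 4 * L * dist (f x) (f y)" using s by simp
    have "L * sdist x y \<le> L * (4 * dist x y)" using s L(1) by (intro mult_left_mono) auto
    then show "dist (f x) (f y) \<le> 4 * L * dist x y" using s L(2)[OF xy] by simp
  qed (use L in simp)
  then show "\<exists>M. bilip M unit_sphere f" by blast
next
  assume "\<exists>M. bilip M unit_sphere f"
  then obtain M where M: "bilip M unit_sphere f" by blast
  have M0: "M > 0" using M by (simp add: bilip_def)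
  have "sdist x y / (4 * M) \<le> sdist (f x) (f y) \<and> sdist (f x) (f y) \<le> (4 * M) * sdist x y"
    if xy: "x \<in> unit_sphere" "y \<in> unit_sphere" for x y
  proof -
    have "f x \<in> unit_sphere" "f y \<in> unit_sphere" using xy f by blast+
    note s = sdist_bounds[OF xy] sdist_bounds[OF this]
    have "dist x y \<le> M * sdist (f x) (f y)"
      using bilipD(1)[OF M xy] mult_left_mono[OF s(3), of M] M0 by linarith
    moreover have "dist (f x) (f y) \<le> M * sdist x y"
      using bilipD(2)[OF M xy] mult_left_mono[OF s(1), of M] M0 by linarith
    ultimately show ?thesis using s M0 by (simp add: field_simps)
  qed
  then show "bilipschitz f" unfolding bilipschitz_def using M0 by (intro exI[of _ "4 * M"]) auto
qed

section \<open>Orientation\<close>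

text \<open>
  Near a point \<open>c\<close> where \<open>f\<close> is the identity the homotopy below is constant, and off \<open>c\<close> it is the
  straight line homotopy in a Euclidean model of the punctured sphere.
\<close>

lemma identity_on_open_imp_orientation_preserving:
  fixes f :: "'a::euclidean_space \<times> real \<Rightarrow> 'a \<times> real"
  assumes f: "homeomorphism unit_sphere unit_sphere f f'"
    and U: "openin (top_of_set unit_sphere) U" "c \<in> U" "\<And>x. x \<in> U \<Longrightarrow> f x = x"
  shows "orientation_preserving f"
proof -
  define S where "S = (unit_sphere :: ('a \<times> real) set)"
  define V where "V = S - {c}"
  have US: "U \<subseteq> S" using U(1) openin_imp_subset unfolding S_def by blast
  have cS: "c \<in> S" using US U(2) by blast
  have cont: "continuous_on S f" and im: "f ` S = S" and f'f: "\<And>x. x \<in> S \<Longrightarrow> f' (f x) = x"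
    using f unfolding S_def homeomorphism_def by auto
  obtain b :: "'a \<times> real" where b: "b \<in> Basis" using nonempty_Basis by blast
  define T where "T = {x. b \<bullet> x = 0}"
  have "V homeomorphic T"
    unfolding V_def S_def T_def
    by (rule homeomorphic_punctured_sphere_hyperplane) (use cS b in \<open>auto simp: S_def\<close>)
  then obtain h k where hk: "homeomorphism V T h k" unfolding homeomorphic_def by blast
  have ch: "continuous_on V h" "continuous_on T k" and hV: "\<And>x. x \<in> V \<Longrightarrow> h x \<in> T" and kT: "\<And>y. y \<in> T \<Longrightarrow> k y \<in> V"
    and kh: "\<And>x. x \<in> V \<Longrightarrow> k (h x) = x"
    using hk by (auto simp: homeomorphism_def)
  have cT: "convex T" unfolding T_def by (rule convex_hyperplane)
  have fV: "f x \<in> V" if "x \<in> V" for x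
  proof -
    \<comment> \<open>As \<open>f\<close> is injective and fixes \<open>c\<close>, it maps the
      punctured sphere to itself.\<close>
    have "f x \<noteq> c" using f'f[of x] f'f[OF cS] U(2,3) that by (auto simp: V_def)
    then show ?thesis using that im by (auto simp: V_def)
  qed
  define l where "l = (\<lambda>z. (1 - fst z) *\<^sub>R h (f (snd z)) + fst z *\<^sub>R h (snd z))"
  define H where "H = (\<lambda>z :: real \<times> ('a \<times> real). if snd z \<in> V then k (l z) else snd z)"
  have lT: "l z \<in> T" if "z \<in> {0..1} \<times> V" for z
  proof -
    have "snd z \<in> V" "0 \<le> fst z" "fst z \<le> 1" using that by auto
    then show ?thesis
      unfolding l_def using convexD[OF cT hV[OF fV] hV, of "snd z" "snd z" "1 - fst z" "fst z"] by simp
  qed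
  have HV: "continuous_on ({0..1} \<times> V) H"
  proof -
    have 1: "continuous_on ({0..1} \<times> V) (\<lambda>z :: real \<times> ('a \<times> real). h (snd z))"
      by (rule continuous_on_compose2[OF ch(1)]) (auto intro: continuous_intros)
    have "continuous_on ({0..1} \<times> V) (\<lambda>z :: real \<times> ('a \<times> real). f (snd z))"
      by (rule continuous_on_compose2[OF cont]) (auto intro: continuous_intros simp: V_def)
    then have "continuous_on ({0..1} \<times> V) (\<lambda>z :: real \<times> ('a \<times> real). h (f (snd z)))"
      by (rule continuous_on_compose2[OF ch(1)]) (use fV in auto)
    then have "continuous_on ({0..1} \<times> V) l" unfolding l_def using 1 by (intro continuous_intros)
    then have "continuous_on ({0..1} \<times> V) (\<lambda>z. k (l z))"
      by (rule continuous_on_compose2[OF ch(2)]) (use lT in blast)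
    then show ?thesis by (rule continuous_on_eq) (auto simp: H_def)
  qed
  have Hid: "H z = snd z" if "snd z \<in> U" for z
  proof (cases "snd z \<in> V")
    case True
    have "l z = h (snd z)" using U(3)[OF that] by (simp add: l_def algebra_simps flip: scaleR_add_left)
    then show ?thesis using True kh by (simp add: H_def)
  qed (simp add: H_def)
  have "continuous_on ({0..1} \<times> U) (\<lambda>z :: real \<times> ('a \<times> real). snd z)"
    by (rule continuous_on_snd[OF continuous_on_id])
  then have HU: "continuous_on ({0..1} \<times> U) H"
    by (rule continuous_on_eq) (simp add: Hid mem_Times_iff)
  have "{0..1} \<times> V \<union> {0..1} \<times> U = {0..1::real} \<times> S" using US U(2) by (auto simp: V_def)
  moreover have "openin (top_of_set ({0..1::real} \<times> S)) ({0..1} \<times> V)" "openin (top_of_set ({0..1::real} \<times> S)) ({0..1} \<times> U)"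
  proof -
    have "openin (top_of_set S) V" unfolding V_def using cS by (intro openin_diff openin_subtopology_self closedin_singleton) auto
    then show "openin (top_of_set ({0..1::real} \<times> S)) ({0..1} \<times> V)"
      by (intro openin_Times openin_subtopology_self)
    show "openin (top_of_set ({0..1::real} \<times> S)) ({0..1} \<times> U)"
      using U(1) unfolding S_def by (intro openin_Times openin_subtopology_self)
  qed
  ultimately have HS: "continuous_on ({0..1} \<times> S) H"
    using continuous_on_Un_local_open[of "{0..1} \<times> V" "{0..1} \<times> U" H] HV HU by simp
  have HimS: "H z \<in> S" if "z \<in> {0..1} \<times> S" for z
    using that kT lT[of z] by (cases z) (auto simp: H_def V_def)
  have "homotopic_with (\<lambda>_. True) (top_of_set S) (top_of_set S) f id"
  proof (rule iffD2[OF homotopic_with], simp, intro exI[of _ H] conjI)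
    have "continuous_map (top_of_set ({0..1} \<times> S)) (top_of_set S) H"
      using HS HimS by (auto simp: continuous_map_in_subtopology)
    then show "continuous_map (prod_topology (top_of_set {0..1}) (top_of_set S)) (top_of_set S) H"
      by (simp add: subtopology_Times[symmetric] flip: euclidean_product_topology)
    show "\<forall>x\<in>topspace (top_of_set S). H (0, x) = f x"
    proof
      fix x assume "x \<in> topspace (top_of_set S)"
      then have x: "x \<in> S" by simp
      show "H (0, x) = f x"
      proof (cases "x \<in> V")
        case True
        then show ?thesis using kh[OF fV[OF True]] by (simp add: H_def l_def)
      next
        case False
        then show ?thesis using x U(2,3) by (auto simp: H_def V_def)
      qed
    qed
    show "\<forall>x\<in>topspace (top_of_set S). H (1, x) = id x" using kh by (auto simp: H_def l_def)
  qed simp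
  then have "hom_induced n (top_of_set S) {} (top_of_set S) {} f = hom_induced n (top_of_set S) {} (top_of_set S) {} id" for n
    by (rule homology_homotopy_empty)
  then show ?thesis unfolding orientation_preserving_def S_def[symmetric] by (simp add: hom_induced_id)
qed

section \<open>Generation by ball supported maps\<close>

text \<open>For norm w < R + 2 the bracket is at most R + 3, and the point stays at distance at
  least 2/(R + 3) from the pole. Its image keeps half of that, so the product of the two brackets is
  at most 2(R + 3)^2, which is the factor converting chordal into Euclidean distance.\<close>

lemma near_chart:
  fixes f :: "'a::euclidean_space \<times> real \<Rightarrow> 'a \<times> real"
  assumes R: "R \<ge> 0" and \<eta>: "0 < \<eta>" "\<eta> \<le> 1" and f: "f ` unit_sphere \<subseteq> unit_sphere"
    and near: "\<And>p. p \<in> unit_sphere \<Longrightarrow> dist (f p) p < \<eta> / (R + 3)\<^sup>2" and w: "norm w < R + 2"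
  shows "f (unproj 1 w) \<in> unit_sphere - {(0, 1)}" "dist (proj 1 (f (unproj 1 w))) w < \<eta>"
proof -
  define p where "p = unproj 1 w"
  have p: "p \<in> unit_sphere" "p \<noteq> (0, 1)" using unproj_in_sphere[OF mult_1] unproj_neq_pole[OF mult_1] by (auto simp: p_def simp del: mem_sphere_0)
  have fp: "f p \<in> unit_sphere" using f p by blast
  have jw: "0 < bracket w" "bracket w \<le> R + 3" using bracket(2,5)[of w] w by linarith+
  have R3: "R + 3 > 0" "1 \<le> R + 3" using R by auto
  have "\<eta> / (R + 3)\<^sup>2 \<le> 1 / (R + 3)"
    using \<eta> R3 by (simp add: power2_eq_square divide_simps)
  then have d: "dist (f p) p < 1 / (R + 3)" using near[OF p(1)] by linarith
  have "2 / (R + 3) \<le> 2 / bracket w" using jw R3 by (simp add: frac_le)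
  also have "\<dots> = dist p (0, 1)" unfolding p_def by (rule dist_unproj_pole[OF mult_1, symmetric])
  also have "\<dots> \<le> dist (f p) p + dist (f p) (0, 1)" by (rule dist_triangle3)
  finally have fN: "1 / (R + 3) < dist (f p) (0, 1)" using d by simp
  then have "f p \<noteq> (0, 1)" using R3 by auto
  then show fV: "f (unproj 1 w) \<in> unit_sphere - {(0, 1)}" using fp by (simp add: p_def)
  define v where "v = proj 1 (f p)"
  have uv: "unproj 1 v = f p" unfolding v_def using unproj_proj[OF mult_1 fp \<open>f p \<noteq> (0, 1)\<close>] .
  have jv: "0 < bracket v" by (rule bracket)
  have "1 / (R + 3) < 2 / bracket v" using fN dist_unproj_pole[OF mult_1, of v] uv by simp
  then have "bracket v < 2 * (R + 3)" using jv R3 by (simp add: field_simps)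
  then have jj: "bracket v * bracket w \<le> 2 * (R + 3) * (R + 3)" using jw jv R3 by (intro mult_mono) auto
  have "dist v w = dist (f p) p * (bracket v * bracket w) / 2"
    using dist_proj[OF mult_1 fp \<open>f p \<noteq> (0, 1)\<close> p] by (simp add: v_def p_def)
  also have "\<dots> \<le> dist (f p) p * (2 * (R + 3) * (R + 3)) / 2"
    using jj by (intro divide_right_mono mult_left_mono) auto
  also have "\<dots> = dist (f p) p * (R + 3)\<^sup>2" by (simp add: power2_eq_square)
  also have "\<dots> < \<eta>" using near[OF p(1)] R3 by (simp add: pos_less_divide_eq)
  finally show "dist (proj 1 (f (unproj 1 w))) w < \<eta>" by (simp add: v_def p_def)
qed

context regularity_class
begin

lemma P_finite_ub: "finite I \<Longrightarrow> \<exists>k. \<forall>i\<in>I. \<forall>S f. P i S f \<longrightarrow> P k S f"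
proof (induction I rule: finite_induct)
  case (insert j I)
  then obtain k where "\<forall>i\<in>I. \<forall>S f. P i S f \<longrightarrow> P k S f" by blast
  then show ?case using P_ub[of k _ _ j] by blast
qed simp

lemma locP_compact:
  assumes K: "compact K" and loc: "\<And>w. w \<in> K \<Longrightarrow> \<exists>i. locP i w f"
  shows "\<exists>i. \<forall>w\<in>K. locP i w f"
proof -
  have "\<forall>w. \<exists>i V. w \<in> K \<longrightarrow> open V \<and> w \<in> V \<and> P i V f" using loc unfolding locP_def by blast
  from choice[OF this] obtain I where "\<forall>w. \<exists>V. w \<in> K \<longrightarrow> open V \<and> w \<in> V \<and> P (I w) V f" ..
  from choice[OF this] obtain V where V: "\<And>w. w \<in> K \<Longrightarrow> open (V w) \<and> w \<in> V w \<and> P (I w) (V w) f" by blast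
  obtain C where C: "C \<subseteq> K" "finite C" "K \<subseteq> (\<Union>w\<in>C. V w)"
    using compactE_image[OF K, of K V] V by blast
  obtain k where k: "\<And>i S f. i \<in> I ` C \<Longrightarrow> P i S f \<Longrightarrow> P k S f" using P_finite_ub[of "I ` C"] C(2) by blast
  have "locP k w f" if w: "w \<in> K" for w
  proof -
    obtain c where c: "c \<in> C" "w \<in> V c" using C(3) w by blast
    then have "P k (V c) f" using k[of "I c"] V C(1) by blast
    then show ?thesis unfolding locP_def using V C(1) c by blast
  qed
  then show ?thesis by blast
qed

text \<open>Regularity of the inverse on the ball of radius \<open>R\<close> is deduced from that of
  \<open>f\<close> at the preimages. These may lie outside by up to 1, hence the ball of radius R +
  1; the radius R + 2 gives the inverse relation on an open neighbourhood of them.\<close>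

lemma sphere_interpolation:
  "\<exists>R \<epsilon>. 0 \<le> R \<and> 0 < \<epsilon> \<and> \<epsilon> \<le> 1 \<and> (\<forall>f f'. homeomorphism unit_sphere unit_sphere f f' \<longrightarrow>
    (\<forall>p\<in>unit_sphere. dist (f p) p < \<epsilon> / (R + 3)\<^sup>2) \<longrightarrow>
    (\<forall>w\<in>cball 0 (R + 1). \<exists>i. locP i w (\<lambda>v. proj 1 (f (unproj 1 v)))) \<longrightarrow>
    (\<exists>a a' M g g' j \<kappa> U V. homeomorphism UNIV UNIV a a' \<and> bilip M UNIV a \<and> bilip M UNIV a' \<and>
      homeomorphism UNIV UNIV g g' \<and> tame j \<kappa> g \<and> tame j \<kappa> g' \<and>
      open U \<and> U \<noteq> {} \<and> (\<forall>z\<in>U. a (g (a' z)) = z) \<and>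
      open V \<and> V \<noteq> {} \<and> (\<forall>w\<in>V. f (unproj 1 w) = unproj 1 (a (g (a' w))))))"
proof -
  from interpolation obtain R \<epsilon>0 where R: "0 < \<epsilon>0" "0 \<le> R" and int: "\<forall>f f' i.
    (\<forall>w. norm w \<le> R \<longrightarrow> locP i w f \<and> locP i w f' \<and> dist (f w) w \<le> \<epsilon>0 \<and> dist (f' w) w \<le> \<epsilon>0 \<and> f' (f w) = w \<and> f (f' w) = w) \<longrightarrow>
    (\<exists>a a' M g g' j \<kappa> U V. homeomorphism UNIV UNIV a a' \<and> bilip M UNIV a \<and> bilip M UNIV a' \<and>
      homeomorphism UNIV UNIV g g' \<and> tame j \<kappa> g \<and> tame j \<kappa> g' \<and>
      open U \<and> U \<noteq> {} \<and> (\<forall>z\<in>U. g z = z) \<and> open V \<and> V \<noteq> {} \<and> (\<forall>w\<in>V. a (g (a' w)) = f w))"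
    by (elim exE conjE)
  define \<epsilon> where "\<epsilon> = min \<epsilon>0 1"
  have \<epsilon>: "0 < \<epsilon>" "\<epsilon> \<le> 1" "\<epsilon> \<le> \<epsilon>0" using R by (auto simp: \<epsilon>_def)
  show ?thesis
  proof (rule exI[of _ R], rule exI[of _ \<epsilon>], intro conjI allI impI)
    fix f f' :: "'a \<times> real \<Rightarrow> 'a \<times> real"
    assume f: "homeomorphism unit_sphere unit_sphere f f'"
      and near: "\<forall>p\<in>unit_sphere. dist (f p) p < \<epsilon> / (R + 3)\<^sup>2"
      and loc: "\<forall>w\<in>cball 0 (R + 1). \<exists>i. locP i w (\<lambda>v. proj 1 (f (unproj 1 v)))"
    have f'f: "f' (f p) = p" and ff': "f (f' p) = p" if "p \<in> unit_sphere" for p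
      using f that by (auto simp: homeomorphism_def simp del: mem_sphere_0)
    have fS: "f ` unit_sphere \<subseteq> unit_sphere" "f' ` unit_sphere \<subseteq> unit_sphere" using f by (auto simp: homeomorphism_def simp del: mem_sphere_0)
    have near': "dist (f' p) p < \<epsilon> / (R + 3)\<^sup>2" if "p \<in> unit_sphere" for p
      using near ff'[OF that] fS(2) that by (metis dist_commute image_subset_iff)
    define h h' where "h = (\<lambda>v. proj 1 (f (unproj 1 v)))" and "h' = (\<lambda>v. proj 1 (f' (unproj 1 v)))"
    have u: "unproj 1 w \<in> unit_sphere" for w :: 'a by (rule unproj_in_sphere[OF mult_1])
    have h: "f (unproj 1 w) \<in> unit_sphere - {(0, 1)} \<and> dist (h w) w < \<epsilon>" if "norm w < R + 2" for w
      using near_chart[OF R(2) \<epsilon>(1,2) fS(1) _ that] near unfolding h_def by blast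
    have h': "f' (unproj 1 w) \<in> unit_sphere - {(0, 1)} \<and> dist (h' w) w < \<epsilon>" if "norm w < R + 2" for w
      using near_chart[OF R(2) \<epsilon>(1,2) fS(2) _ that] near' unfolding h'_def by blast
    have h'h: "h' (h w) = w" if "norm w < R + 2" for w
    proof -
      have "unproj 1 (h w) = f (unproj 1 w)" unfolding h_def using h[OF that] unproj_proj[OF mult_1] by blast
      then show ?thesis using f'f[OF u] by (simp add: h'_def)
    qed
    have hh': "h (h' w) = w" if "norm w < R + 2" for w
    proof -
      have "unproj 1 (h' w) = f' (unproj 1 w)" unfolding h'_def using h'[OF that] unproj_proj[OF mult_1] by blast
      then show ?thesis using ff'[OF u] by (simp add: h_def)
    qed
    have "\<exists>i. \<forall>w\<in>cball 0 (R + 1). locP i w h"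
      by (rule locP_compact[OF compact_cball]) (use loc in \<open>simp add: h_def\<close>)
    then obtain i where i: "\<And>w. norm w \<le> R + 1 \<Longrightarrow> locP i w h" by force
    have i': "locP i w h'" if w: "norm w \<le> R" for w
    proof -
      have w2: "norm w < R + 2" using w by simp
      have "norm (h' w) \<le> norm w + dist (h' w) w" by (metis dist_norm norm_triangle_sub)
      then have n: "norm (h' w) < R + 1" using h'[OF w2] \<epsilon>(2) w by linarith
      have "locP i (h (h' w)) h'"
        by (rule locP_inverse[OF i, of _ "ball 0 (R + 2)"]) (use n h'h in auto)
      then show ?thesis using hh'[OF w2] by simp
    qed
    obtain a a' M g g' j \<kappa> U V where res: "homeomorphism UNIV UNIV a a'" "bilip M UNIV a" "bilip M UNIV a'"
      "homeomorphism UNIV UNIV g g'" "tame j \<kappa> g" "tame j \<kappa> g'"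
      and U: "open U" "U \<noteq> {}" "\<And>z. z \<in> U \<Longrightarrow> g z = z" and V: "open V" "V \<noteq> {}" "\<And>w. w \<in> V \<Longrightarrow> a (g (a' w)) = h w"
    proof -
      have "locP i w h \<and> locP i w h' \<and> dist (h w) w \<le> \<epsilon>0 \<and> dist (h' w) w \<le> \<epsilon>0 \<and> h' (h w) = w \<and> h (h' w) = w" if w: "norm w \<le> R" for w
      proof -
        have "norm w < R + 2" "norm w \<le> R + 1" using w by auto
        then show ?thesis using i i'[OF w] h[of w] h'[of w] h'h[of w] hh'[of w] \<epsilon>(3) by force
      qed
      then have "\<forall>w. norm w \<le> R \<longrightarrow> locP i w h \<and> locP i w h' \<and> dist (h w) w \<le> \<epsilon>0 \<and> dist (h' w) w \<le> \<epsilon>0 \<and> h' (h w) = w \<and> h (h' w) = w"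
        by blast
      from int[rule_format, OF this[rule_format]] show thesis using that by blast
    qed
    \<comment> \<open>Nothing confines \<open>V\<close> to the controlled ball, so \<open>f\<close>
      may send one of its points to the pole, where \<open>proj 1\<close> has a meaningless value.
      That point is removed; something is left because an open set is not a singleton.\<close>
    define V' where "V' = V - {proj 1 (f' (0, 1))}"
    have "open V'" using V(1) by (simp add: V'_def open_delete)
    moreover have "V' \<noteq> {}"
    proof
      assume "V' = {}"
      then have "V = {proj 1 (f' (0, 1))}" using V(2) by (auto simp: V'_def)
      then show False using V(1) not_open_singleton by metis
    qed
    moreover have "f (unproj 1 w) = unproj 1 (a (g (a' w)))" if w: "w \<in> V'" for w
    proof -
      have "f (unproj 1 w) \<noteq> (0, 1)"
      proof
        assume "f (unproj 1 w) = (0, 1)"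
        then have "proj 1 (f' (0, 1)) = w" using f'f[OF u, of w] proj_unproj[OF mult_1, of w] by simp
        then show False using w by (simp add: V'_def)
      qed
      moreover have "f (unproj 1 w) \<in> unit_sphere" using fS(1) u by blast
      ultimately have "unproj 1 (h w) = f (unproj 1 w)" unfolding h_def using unproj_proj[OF mult_1] by blast
      then show ?thesis using V(3)[of w] w by (simp add: V'_def)
    qed
    moreover have "open (a ` U)"
      by (rule invariance_of_domain[OF continuous_on_subset[OF bilip_continuous[OF res(2)]] U(1) inj_on_subset[OF bilip_inj[OF res(2)]]]) auto
    moreover have "\<forall>z\<in>a ` U. a (g (a' z)) = z" using U(3) homeomorphism_apply1[OF res(1)] by simp
    moreover have "a ` U \<noteq> {}" using U(2) by simp
    ultimately show "\<exists>a a' M g g' j \<kappa> U V. homeomorphism UNIV UNIV a a' \<and> bilip M UNIV a \<and> bilip M UNIV a' \<and>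
      homeomorphism UNIV UNIV g g' \<and> tame j \<kappa> g \<and> tame j \<kappa> g' \<and>
      open U \<and> U \<noteq> {} \<and> (\<forall>z\<in>U. a (g (a' z)) = z) \<and>
      open V \<and> V \<noteq> {} \<and> (\<forall>w\<in>V. f (unproj 1 w) = unproj 1 (a (g (a' w))))"
      using res by blast
  qed (use \<epsilon> R in auto)
qed

end

lemma chart_bilip:
  fixes f :: "'a::euclidean_space \<times> real \<Rightarrow> 'a \<times> real"
  assumes f: "bilip M unit_sphere f" and B: "\<And>w. w \<in> B \<Longrightarrow> bracket w \<le> J \<and>
      f (unproj 1 w) \<in> unit_sphere - {(0, 1)} \<and> bracket (proj 1 (f (unproj 1 w))) \<le> J"
    and J: "J > 0"
  shows "bilip (M * (J * J)) B (\<lambda>w. proj 1 (f (unproj 1 w)))"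
  unfolding bilip_def
proof (intro conjI ballI)
  have M: "M > 0" using f by (simp add: bilip_def)
  show "0 < M * (J * J)" using M J by simp
  have le: "d \<le> 2 * d'" "d' \<le> d * (J * J) / 2" if d: "d = 2 * d' / (x * y)" and x: "1 \<le> x" "x \<le> J" and y: "1 \<le> y" "y \<le> J" and d': "0 \<le> d'" for d d' x y :: real
  proof -
    have xy: "1 \<le> x * y" "x * y \<le> J * J" using x y J by (auto intro: mult_mono simp: mult_ge1_I)
    have d0: "0 \<le> d" using d d' x y by simp
    have e: "2 * d' = d * (x * y)" using d x y by (simp add: field_simps)
    have "d * 1 \<le> d * (x * y)" "d * (x * y) \<le> d * (J * J)" using xy d0 by (intro mult_left_mono; simp)+
    then show "d \<le> 2 * d'" "d' \<le> d * (J * J) / 2" using e by auto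
  qed
  fix v w assume vw: "v \<in> B" "w \<in> B"
  define p q where "p = unproj 1 v" and "q = unproj 1 w"
  define v' w' where "v' = proj 1 (f p)" and "w' = proj 1 (f q)"
  have pq: "p \<in> unit_sphere" "q \<in> unit_sphere" unfolding p_def q_def by (rule unproj_in_sphere[OF mult_1])+
  have fpq: "unproj 1 v' = f p" "unproj 1 w' = f q"
    unfolding v'_def w'_def p_def q_def using B[OF vw(1)] B[OF vw(2)] unproj_proj[OF mult_1] by blast+
  have j: "bracket v \<le> J" "bracket w \<le> J" "bracket v' \<le> J" "bracket w' \<le> J"
    using B[OF vw(1)] B[OF vw(2)] unfolding v'_def w'_def p_def q_def by auto
  have 1: "dist p q = 2 * dist v w / (bracket v * bracket w)" unfolding p_def q_def by (rule dist_unproj[OF mult_1])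
  have 2: "dist (f p) (f q) = 2 * dist v' w' / (bracket v' * bracket w')" unfolding fpq[symmetric] by (rule dist_unproj[OF mult_1])
  note a = le[OF 1 bracket(1) j(1) bracket(1) j(2) zero_le_dist] and b = le[OF 2 bracket(1) j(3) bracket(1) j(4) zero_le_dist]
  have JJ: "J * J \<ge> 0" by simp
  have "dist v w \<le> dist p q * (J * J) / 2" by (rule a)
  also have "\<dots> \<le> (M * dist (f p) (f q)) * (J * J) / 2"
    using bilipD(1)[OF f pq] JJ by (intro divide_right_mono mult_right_mono) auto
  also have "\<dots> \<le> (M * (2 * dist v' w')) * (J * J) / 2"
    using b(1) M JJ by (intro divide_right_mono mult_right_mono mult_left_mono) auto
  finally show "dist v w \<le> M * (J * J) * dist (proj 1 (f (unproj 1 v))) (proj 1 (f (unproj 1 w)))"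
    by (simp add: v'_def w'_def p_def q_def mult_ac)
  have "dist v' w' \<le> dist (f p) (f q) * (J * J) / 2" by (rule b)
  also have "\<dots> \<le> (M * dist p q) * (J * J) / 2"
    using bilipD(2)[OF f pq] JJ by (intro divide_right_mono mult_right_mono) auto
  also have "\<dots> \<le> (M * (2 * dist v w)) * (J * J) / 2"
    using a(1) M JJ by (intro divide_right_mono mult_right_mono mult_left_mono) auto
  finally show "dist (proj 1 (f (unproj 1 v))) (proj 1 (f (unproj 1 w))) \<le> M * (J * J) * dist v w"
    by (simp add: v'_def w'_def p_def q_def mult_ac)
qed

lemma openin_unproj:
  assumes "open U"
  shows "openin (top_of_set unit_sphere) (unproj 1 ` (U :: 'a::euclidean_space set))"
proof -
  have "openin (top_of_set (unit_sphere - {(0, 1)})) (unproj 1 ` U)"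
    by (rule homeomorphism_imp_open_map[OF homeomorphism_symD[OF homeomorphism_proj[OF mult_1]]]) (use assms in simp)
  moreover have "openin (top_of_set unit_sphere) (unit_sphere - {(0, 1)} :: ('a \<times> real) set)"
    using stereographic_charts[of 1, where 'a = 'a] by (simp add: sphere_charts_def coordinate_chart_def stereographic_eq)
  ultimately show ?thesis by (rule openin_trans)
qed

lemma conjugate_growth:
  assumes a: "homeomorphism UNIV UNIV a a'" "bilip M UNIV a" "bilip M UNIV a'"
    and g: "homeomorphism UNIV UNIV g g'"
    and d: "\<And>z. dist (g z) z \<le> (\<kappa> + norm z) / 2" "\<And>z. dist (g' z) z \<le> (\<kappa> + norm z) / 2"
  obtains C where "homeomorphism UNIV UNIV (a \<circ> g \<circ> a') (a \<circ> g' \<circ> a')"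
    "growth C (a \<circ> g \<circ> a')" "growth C (a \<circ> g' \<circ> a')"
proof -
  have "homeomorphism UNIV UNIV (a \<circ> g \<circ> a') (a \<circ> g' \<circ> a')"
    using homeomorphism_compose[OF homeomorphism_compose[OF homeomorphism_symD[OF a(1)] g] a(1)] by (simp add: o_assoc)
  moreover note growth_comp[OF growth_bilip[OF a(3)] growth_comp[OF growth_displacement[OF d(1)] growth_bilip[OF a(2)]]]
  moreover note growth_comp[OF growth_bilip[OF a(3)] growth_comp[OF growth_displacement[OF d(2)] growth_bilip[OF a(2)]]]
  ultimately show ?thesis by (rule that)
qed

text \<open>The two maps satisfying \<open>Q\<close> are the factors \<Phi> and \<Phi>^-1 f, each
  the identity on a nonempty open set. Asking for \<open>Q\<close> of the second factor directly
  lets each class establish it by its own composition argument.\<close>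

definition interpolates :: "('a::euclidean_space \<times> real \<Rightarrow> 'a \<times> real) \<Rightarrow> (('a \<times> real \<Rightarrow> 'a \<times> real) \<Rightarrow> bool) \<Rightarrow> bool"
  where "interpolates f Q \<longleftrightarrow> (\<exists>\<Phi> \<Phi>' U V. homeomorphism unit_sphere unit_sphere \<Phi> \<Phi>' \<and> \<Phi> \<in> extensional unit_sphere \<and>
    Q \<Phi> \<and> Q (\<lambda>p\<in>unit_sphere. \<Phi>' (f p)) \<and>
    openin (top_of_set unit_sphere) U \<and> U \<noteq> {} \<and> (\<forall>p\<in>U. \<Phi> p = p) \<and>
    openin (top_of_set unit_sphere) V \<and> V \<noteq> {} \<and> (\<forall>p\<in>V. \<Phi> p = f p))"

lemma interpolatesI:
  assumes "homeomorphism unit_sphere unit_sphere (sphere_map F) (sphere_map F')"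
    and "Q (sphere_map F)" "Q (\<lambda>p\<in>unit_sphere. sphere_map F' (f p))"
    and "open U" "U \<noteq> {}" "\<And>z. z \<in> U \<Longrightarrow> F z = z" and "open V" "V \<noteq> {}" "\<And>w. w \<in> V \<Longrightarrow> f (unproj 1 w) = unproj 1 (F w)"
  shows "interpolates f Q"
  unfolding interpolates_def
proof (intro exI conjI)
  show "sphere_map F \<in> extensional unit_sphere" by (simp add: sphere_map_def)
  show "\<forall>p\<in>unproj 1 ` U. sphere_map F p = p" "\<forall>p\<in>unproj 1 ` V. sphere_map F p = f p" using assms(6,9) by auto
  show "openin (top_of_set unit_sphere) (unproj 1 ` U)" "openin (top_of_set unit_sphere) (unproj 1 ` V)"
    using openin_unproj assms(4,7) by blast+
qed (use assms in auto)

lemma bilipschitz_interpolates: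
  "\<exists>\<epsilon>>0. \<forall>f f'. homeomorphism unit_sphere unit_sphere f f' \<longrightarrow>
    (\<forall>p\<in>unit_sphere. dist (f p) p < \<epsilon>) \<longrightarrow> bilipschitz f \<longrightarrow> interpolates (f :: 'a::euclidean_space \<times> real \<Rightarrow> _) bilipschitz"
proof -
  from lip_class.sphere_interpolation[where 'a = 'a] obtain R \<epsilon> where R: "0 \<le> R" and \<epsilon>: "0 < \<epsilon>" "\<epsilon> \<le> 1"
    and int: "\<forall>f f'. homeomorphism unit_sphere unit_sphere f f' \<longrightarrow>
    (\<forall>p\<in>unit_sphere. dist (f p) p < \<epsilon> / (R + 3)\<^sup>2) \<longrightarrow>
    (\<forall>w\<in>cball 0 (R + 1). \<exists>i. lip_class.locP i w (\<lambda>v :: 'a. proj 1 (f (unproj 1 v)))) \<longrightarrow>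
    (\<exists>a a' M g g' j \<kappa> U V. homeomorphism UNIV UNIV a a' \<and> bilip M UNIV a \<and> bilip M UNIV a' \<and>
      homeomorphism UNIV UNIV g g' \<and> lip_class.tame j \<kappa> g \<and> lip_class.tame j \<kappa> g' \<and>
      open U \<and> U \<noteq> {} \<and> (\<forall>z\<in>U. a (g (a' z)) = z) \<and>
      open V \<and> V \<noteq> {} \<and> (\<forall>w\<in>V. f (unproj 1 w) = unproj 1 (a (g (a' w)))))"
    by (elim exE conjE)
  show ?thesis
  proof (intro exI[of _ "\<epsilon> / (R + 3)\<^sup>2"] conjI allI impI)
    show "0 < \<epsilon> / (R + 3)\<^sup>2" using \<epsilon> R by simp
    fix f f' :: "'a \<times> real \<Rightarrow> 'a \<times> real"
    assume f: "homeomorphism unit_sphere unit_sphere f f'" and near: "\<forall>p\<in>unit_sphere. dist (f p) p < \<epsilon> / (R + 3)\<^sup>2"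
      and lip: "bilipschitz f"
    have fS: "f ` unit_sphere \<subseteq> unit_sphere" using homeomorphism_image1[OF f] by blast
    obtain K where K: "bilip K unit_sphere f" using lip bilipschitz_iff[OF fS] by blast
    have "bracket w \<le> R + 4 \<and> f (unproj 1 w) \<in> unit_sphere - {(0, 1)} \<and> bracket (proj 1 (f (unproj 1 w))) \<le> R + 4"
      if "w \<in> ball 0 (R + 2)" for w
    proof -
      have w: "norm w < R + 2" using that by simp
      note nc = near_chart[OF R \<epsilon> fS bspec[OF near] w]
      have "bracket w \<le> R + 3" using bracket(5)[of w] w by simp
      moreover have "bracket (proj 1 (f (unproj 1 w))) \<le> bracket w + dist (proj 1 (f (unproj 1 w))) w" by (rule bracket_lipschitz)
      ultimately show ?thesis using nc \<epsilon>(2) by (intro conjI) linarith+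
    qed
    then have "bilip (K * ((R + 4) * (R + 4))) (ball 0 (R + 2)) (\<lambda>w. proj 1 (f (unproj 1 w)))"
      using R by (intro chart_bilip[OF K]) auto
    then have "\<forall>w\<in>cball 0 (R + 1). \<exists>i. lip_class.locP i w (\<lambda>v. proj 1 (f (unproj 1 v)))"
      unfolding lip_class.locP_def by (intro ballI exI[of _ "K * ((R + 4) * (R + 4))"] exI[of _ "ball 0 (R + 2)"]) auto
    from int[rule_format, OF f bspec[OF near] bspec[OF this]]
    obtain a a' M g g' j \<kappa> U V where a: "homeomorphism UNIV UNIV a a'" "bilip M UNIV a" "bilip M UNIV a'"
      and g: "homeomorphism UNIV UNIV g g'" "lip_class.tame j \<kappa> g" "lip_class.tame j \<kappa> g'"
      and U: "open U" "U \<noteq> {}" "\<forall>z\<in>U. a (g (a' z)) = z"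
      and V: "open V" "V \<noteq> {}" "\<forall>w\<in>V. f (unproj 1 w) = unproj 1 (a (g (a' w)))" by blast
    define F F' where "F = a \<circ> g \<circ> a'" and "F' = a \<circ> g' \<circ> a'"
    have d: "dist (g z) z \<le> (\<kappa> + norm z) / 2" "dist (g' z) z \<le> (\<kappa> + norm z) / 2" for z
      using g(2,3) unfolding lip_class.tame_def by blast+
    obtain C where F: "homeomorphism UNIV UNIV F F'" and C: "growth C F" "growth C F'"
      using conjugate_growth[OF a g(1) d] unfolding F_def F'_def .
    have "bilip (M * (max 2 j * M)) UNIV F" "bilip (M * (max 2 j * M)) UNIV F'"
      unfolding F_def F'_def o_assoc[symmetric]
      using bilip_comp[OF a(3) bilip_subset[OF bilip_comp[OF tame_lip_bilip[OF g(2,3,1)] bilip_subset[OF a(2)]]]]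
        bilip_comp[OF a(3) bilip_subset[OF bilip_comp[OF tame_lip_bilip[OF g(3,2) homeomorphism_symD[OF g(1)]] bilip_subset[OF a(2)]]]]
      by (simp_all add: o_assoc)
    then obtain K1 K2 where K12: "bilip K1 unit_sphere (sphere_map F)" "bilip K2 unit_sphere (sphere_map F')"
      using sphere_map_bilip[OF F C] sphere_map_bilip[OF homeomorphism_symD[OF F] C(2,1)] by blast
    have "bilip (K * K2) unit_sphere (sphere_map F' \<circ> f)" by (rule bilip_comp[OF K bilip_subset[OF K12(2) fS]])
    then have 1: "bilip (K * K2) unit_sphere (\<lambda>p\<in>unit_sphere. sphere_map F' (f p))" by (simp add: bilip_def)
    have "(\<lambda>p\<in>unit_sphere. sphere_map F' (f p)) ` unit_sphere \<subseteq> unit_sphere"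
    proof (rule image_subsetI)
      fix p :: "'a \<times> real" assume p: "p \<in> unit_sphere"
      then have "sphere_map F' (f p) \<in> unit_sphere" using fS by (intro sphere_map_in_sphere) blast
      then show "(\<lambda>p\<in>unit_sphere. sphere_map F' (f p)) p \<in> unit_sphere" using p by simp
    qed
    from bilipschitz_iff[OF this] 1 have Q: "bilipschitz (\<lambda>p\<in>unit_sphere. sphere_map F' (f p))" by blast
    have "sphere_map F ` unit_sphere \<subseteq> unit_sphere" by (intro image_subsetI sphere_map_in_sphere)
    from bilipschitz_iff[OF this] K12(1) have Q': "bilipschitz (sphere_map F)" by blast
    have "\<And>z. z \<in> U \<Longrightarrow> F z = z" "\<And>w. w \<in> V \<Longrightarrow> f (unproj 1 w) = unproj 1 (F w)"
      using U(3) V(3) by (simp_all add: F_def)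
    from interpolatesI[OF sphere_map_homeomorphism[OF F C] Q' Q U(1,2) this(1) V(1,2) this(2)]
    show "interpolates f bilipschitz" .
  qed
qed

lemma quasiconformal_interpolates:
  assumes n: "DIM('a::euclidean_space) \<ge> 2"
  shows "\<exists>\<epsilon>>0. \<forall>f f'. homeomorphism unit_sphere unit_sphere f f' \<longrightarrow>
    (\<forall>p\<in>unit_sphere. dist (f p) p < \<epsilon>) \<longrightarrow> quasiconformal f \<longrightarrow> interpolates (f :: 'a \<times> real \<Rightarrow> _) quasiconformal"
proof -
  from qs_class.sphere_interpolation[where 'a = 'a] obtain R \<epsilon> where R: "0 \<le> R" and \<epsilon>: "0 < \<epsilon>" "\<epsilon> \<le> 1"
    and int: "\<forall>f f'. homeomorphism unit_sphere unit_sphere f f' \<longrightarrow>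
    (\<forall>p\<in>unit_sphere. dist (f p) p < \<epsilon> / (R + 3)\<^sup>2) \<longrightarrow>
    (\<forall>w\<in>cball 0 (R + 1). \<exists>i. qs_class.locP i w (\<lambda>v :: 'a. proj 1 (f (unproj 1 v)))) \<longrightarrow>
    (\<exists>a a' M g g' j \<kappa> U V. homeomorphism UNIV UNIV a a' \<and> bilip M UNIV a \<and> bilip M UNIV a' \<and>
      homeomorphism UNIV UNIV g g' \<and> qs_class.tame j \<kappa> g \<and> qs_class.tame j \<kappa> g' \<and>
      open U \<and> U \<noteq> {} \<and> (\<forall>z\<in>U. a (g (a' z)) = z) \<and>
      open V \<and> V \<noteq> {} \<and> (\<forall>w\<in>V. f (unproj 1 w) = unproj 1 (a (g (a' w)))))"
    by (elim exE conjE)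
  show ?thesis
  proof (intro exI[of _ "\<epsilon> / (R + 3)\<^sup>2"] conjI allI impI)
    show "0 < \<epsilon> / (R + 3)\<^sup>2" using \<epsilon> R by simp
    fix f f' :: "'a \<times> real \<Rightarrow> 'a \<times> real"
    assume f: "homeomorphism unit_sphere unit_sphere f f'" and near: "\<forall>p\<in>unit_sphere. dist (f p) p < \<epsilon> / (R + 3)\<^sup>2"
      and qc: "quasiconformal f"
    have fS: "f ` unit_sphere \<subseteq> unit_sphere" using homeomorphism_image1[OF f] by blast
    obtain H where H: "\<And>p. p \<in> unit_sphere \<Longrightarrow> pq H unit_sphere p f" using quasiconformal_imp_pq[OF qc n fS] by blast
    have "\<exists>i. qs_class.locP i w (\<lambda>v. proj 1 (f (unproj 1 v)))" if "w \<in> cball 0 (R + 1)" for w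
    proof -
      have w: "norm w < R + 2" using that by simp
      obtain H \<delta> where "\<delta> > 0" "qs H (ball w \<delta>) (\<lambda>v. proj 1 (f (unproj 1 v)))"
        using quasiconformal_local_qs[OF qc n _ _ near_chart(1)[OF R \<epsilon> fS bspec[OF near] w]] by blast
      then show ?thesis unfolding qs_class.locP_def by (intro exI[of _ H] exI[of _ "ball w \<delta>"]) auto
    qed
    from int[rule_format, OF f bspec[OF near] this]
    obtain a a' M g g' j \<kappa> U V where a: "homeomorphism UNIV UNIV a a'" "bilip M UNIV a" "bilip M UNIV a'"
      and g: "homeomorphism UNIV UNIV g g'" "qs_class.tame j \<kappa> g" "qs_class.tame j \<kappa> g'"
      and U: "open U" "U \<noteq> {}" "\<forall>z\<in>U. a (g (a' z)) = z"
      and V: "open V" "V \<noteq> {}" "\<forall>w\<in>V. f (unproj 1 w) = unproj 1 (a (g (a' w)))" by blast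
    define F F' where "F = a \<circ> g \<circ> a'" and "F' = a \<circ> g' \<circ> a'"
    have d: "dist (g z) z \<le> (\<kappa> + norm z) / 2" "dist (g' z) z \<le> (\<kappa> + norm z) / 2" for z
      using g(2,3) unfolding qs_class.tame_def by blast+
    obtain C where F: "homeomorphism UNIV UNIV F F'" and C: "growth C F" "growth C F'"
      using conjugate_growth[OF a g(1) d] unfolding F_def F'_def .
    have M: "M > 0" using a by (simp add: bilip_def)
    have pqb: "pq (\<lambda>t. (M * M) * t) UNIV w b" if "bilip M UNIV b" for b :: "'a \<Rightarrow> 'a" and w
      by (rule pq_pointwise_bilip[of "1 / M" 1]) (use bilipD[OF that] M in \<open>auto simp: field_simps\<close>)
    \<comment> \<open>The inner and outer \<open>M * M\<close> come from the inverse of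
      \<open>a\<close> and from \<open>a\<close>; the maximum in between is the control function of
      a tame map.\<close>
    define HF where "HF t = (M * M) * max (j ((M * M) * t)) (3 * ((M * M) * t))" for t
    have pqF: "pq HF UNIV w (a \<circ> (h \<circ> a'))" if h: "qs_class.tame j \<kappa> h" "continuous_on UNIV h" for h w
    proof -
      have 1: "pq (\<lambda>t. max (j ((M * M) * t)) (3 * ((M * M) * t))) UNIV w (h \<circ> a')"
        by (rule pq_comp[OF pqb[OF a(3)] bilip_continuous[OF a(3)] UNIV_I pq_subset[OF tame_qs_pq[OF h(1)]]]) simp
      have "continuous_on UNIV (h \<circ> a')"
        by (rule continuous_on_compose[OF bilip_continuous[OF a(3)] continuous_on_subset[OF h(2)]]) simp
      from pq_comp[OF 1 this UNIV_I pq_subset[OF pqb[OF a(2)]]] show ?thesis unfolding HF_def by simp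
    qed
    have pF: "pq HF UNIV w F" "pq HF UNIV w F'" for w
      using pqF[OF g(2)] pqF[OF g(3)] g(1) unfolding F_def F'_def homeomorphism_def by (simp_all add: o_assoc)
    have pS: "pq (\<lambda>t. max (4 * HF (4 * t)) (C * C * t)) unit_sphere p (sphere_map F)"
      "pq (\<lambda>t. max (4 * HF (4 * t)) (C * C * t)) unit_sphere p (sphere_map F')" if "p \<in> unit_sphere" for p
      using sphere_map_pq[OF F C pF(1) that] sphere_map_pq[OF homeomorphism_symD[OF F] C(2,1) pF(2) that] .
    note hS = sphere_map_homeomorphism[OF F C]
    define \<Psi> where "\<Psi> = (\<lambda>p\<in>unit_sphere. sphere_map F' (f p))"
    have "pq (\<lambda>t. max (4 * HF (4 * H t)) (C * C * H t)) unit_sphere p \<Psi>" if p: "p \<in> unit_sphere" for p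
    proof -
      have "f p \<in> unit_sphere" using fS p by blast
      from pq_comp[OF H[OF p] homeomorphism_cont1[OF f] p pq_subset[OF pS(2)[OF this] fS]]
      show ?thesis by (rule pq_cong) (use p in \<open>auto simp: \<Psi>_def\<close>)
    qed
    moreover have "homeomorphism unit_sphere unit_sphere \<Psi> (f' \<circ> sphere_map F)"
      by (rule homeomorphism_cong[OF homeomorphism_compose[OF f homeomorphism_symD[OF hS]]]) (auto simp: \<Psi>_def)
    ultimately have Q: "quasiconformal \<Psi>" by (intro pq_imp_quasiconformal)
    have "\<And>z. z \<in> U \<Longrightarrow> F z = z" "\<And>w. w \<in> V \<Longrightarrow> f (unproj 1 w) = unproj 1 (F w)"
      using U(3) V(3) by (simp_all add: F_def)
    from interpolatesI[OF hS pq_imp_quasiconformal[OF hS pS(1)] Q[unfolded \<Psi>_def] U(1,2) this(1) V(1,2) this(2)]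
    show "interpolates f quasiconformal" .
  qed
qed

section \<open>Factorisation into ball supported maps\<close>

definition homeo_group :: "(('a::euclidean_space \<times> real \<Rightarrow> 'a \<times> real) \<Rightarrow> bool) \<Rightarrow> ('a \<times> real \<Rightarrow> 'a \<times> real) monoid"
  where "homeo_group Q = (BijGroup unit_sphere) \<lparr>carrier := {f \<in> oriented_homeos. Q f}\<rparr>"

text \<open>The complement of the open ball about the antipode of \<open>c\<close> with radius \<pi>
  - \<eta> is the closed ball of radius \<eta> about \<open>c\<close>, which lies in
  \<open>U\<close>. The identity is treated apart because \<open>supported_on\<close> excludes
  it.\<close>

lemma identity_on_open_generated:
  fixes f :: "'a::euclidean_space \<times> real \<Rightarrow> 'a \<times> real"
  assumes f: "f \<in> carrier (homeo_group Q)" and U: "openin (top_of_set unit_sphere) U" "c \<in> U" "\<And>x. x \<in> U \<Longrightarrow> f x = x"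
  shows "f \<in> generate (homeo_group Q) (ball_supported (homeo_group Q))"
proof (cases "f = (\<lambda>x\<in>unit_sphere. x)")
  case True
  then have "f = \<one>\<^bsub>homeo_group Q\<^esub>" by (simp add: homeo_group_def BijGroup_def)
  then show ?thesis using generate.one by metis
next
  case False
  have US: "U \<subseteq> unit_sphere" using openin_imp_subset[OF U(1)] .
  then have c: "c \<in> unit_sphere" using U(2) by blast
  obtain e where e: "e > 0" "\<And>x. x \<in> unit_sphere \<Longrightarrow> dist x c < e \<Longrightarrow> x \<in> U"
    using U(1,2) unfolding openin_euclidean_subtopology_iff by blast
  define \<eta> where "\<eta> = min (e / 2) 1"
  have \<eta>: "0 < \<eta>" "\<eta> < e" "\<eta> < pi" using e(1) pi_gt3 by (auto simp: \<eta>_def)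
  have mc: "- c \<in> unit_sphere" using c by simp
  have "x \<in> U" if x: "x \<in> unit_sphere - sball (- c) (pi - \<eta>)" for x
  proof -
    have xS: "x \<in> unit_sphere" using x by blast
    have "\<bar>x \<bullet> c\<bar> \<le> norm x * norm c" by (rule Cauchy_Schwarz_ineq2)
    then have "\<bar>x \<bullet> c\<bar> \<le> 1" using xS c by simp
    then have "sdist x (- c) = pi - sdist x c" by (simp add: sdist_def arccos_minus abs_le_iff)
    then have "sdist x c \<le> \<eta>" using x by (auto simp: sball_def)
    then show ?thesis using e(2)[OF xS] sdist_bounds(1)[OF xS c] \<eta>(2) by simp
  qed
  then have "supported_on f (sball (- c) (pi - \<eta>))" using False U(3) unfolding supported_on_def by blast
  moreover have "sball (- c) (pi - \<eta>) \<in> sballs"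
    unfolding sballs_def
    by (rule CollectI, rule exI[of _ "- c"], rule exI[of _ "pi - \<eta>"]) (use mc \<eta> in simp)
  ultimately have "f \<in> ball_supported (homeo_group Q)" unfolding ball_supported_def using f by blast
  then show ?thesis by (rule generate.incl)
qed

text \<open>Orientation has to be checked for neither factor separately: being the identity on an
  open set already implies it.\<close>

lemma homeo_group_carrierI:
  assumes "homeomorphism unit_sphere unit_sphere f f'" "f \<in> extensional unit_sphere" "Q f"
    and U: "openin (top_of_set unit_sphere) U" "c \<in> U" "\<And>x. x \<in> U \<Longrightarrow> f x = x"
  shows "f \<in> carrier (homeo_group Q)"
proof -
  have "bij_betw f unit_sphere unit_sphere"
    by (rule bij_betw_byWitness[of _ f']) (use assms(1) in \<open>auto simp: homeomorphism_def simp del: mem_sphere_0\<close>)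
  then show ?thesis
    using assms(1-3) identity_on_open_imp_orientation_preserving[OF assms(1) U]
    unfolding homeo_group_def oriented_homeos_def Bij_def by auto
qed

text \<open>Where \<Phi> agrees with \<open>f\<close>, the second factor \<Phi>^-1 f is the
  identity; so both factors are ball supported or trivial, and their product is
  \<open>f\<close>.\<close>

lemma interpolates_generated:
  fixes f :: "'a::euclidean_space \<times> real \<Rightarrow> 'a \<times> real"
  assumes f: "f \<in> carrier (homeo_group Q)" and int: "interpolates f Q"
  shows "f \<in> generate (homeo_group Q) (ball_supported (homeo_group Q))"
proof -
  let ?G = "homeo_group Q"
  obtain f' where fh: "homeomorphism unit_sphere unit_sphere f f'" and fe: "f \<in> extensional unit_sphere"
    using f unfolding homeo_group_def oriented_homeos_def Bij_def by auto
  obtain \<Phi> \<Phi>' U V where \<Phi>: "homeomorphism unit_sphere unit_sphere \<Phi> \<Phi>'" "\<Phi> \<in> extensional unit_sphere" "Q \<Phi>"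
    and Q: "Q (\<lambda>p\<in>unit_sphere. \<Phi>' (f p))"
    and U: "openin (top_of_set unit_sphere) U" "U \<noteq> {}" "\<And>p. p \<in> U \<Longrightarrow> \<Phi> p = p"
    and V: "openin (top_of_set unit_sphere) V" "V \<noteq> {}" "\<And>p. p \<in> V \<Longrightarrow> \<Phi> p = f p"
    using int unfolding interpolates_def by blast
  obtain u v where uv: "u \<in> U" "v \<in> V" using U V by blast
  define \<Psi> where "\<Psi> = (\<lambda>p\<in>unit_sphere. \<Phi>' (f p))"
  have \<Psi>h: "homeomorphism unit_sphere unit_sphere \<Psi> (f' \<circ> \<Phi>)"
    by (rule homeomorphism_cong[OF homeomorphism_compose[OF fh homeomorphism_symD[OF \<Phi>(1)]]]) (auto simp: \<Psi>_def)
  have \<Psi>V: "\<Psi> p = p" if "p \<in> V" for p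
  proof -
    have "p \<in> unit_sphere" using openin_imp_subset[OF V(1)] that by blast
    then show ?thesis using V(3)[OF that] homeomorphism_apply1[OF \<Phi>(1)] by (simp add: \<Psi>_def flip: V(3)[OF that])
  qed
  have \<Phi>G: "\<Phi> \<in> carrier ?G" by (rule homeo_group_carrierI[where f' = \<Phi>' and U = U and c = u]) (use \<Phi> U uv in auto)
  have \<Psi>G: "\<Psi> \<in> carrier ?G"
    by (rule homeo_group_carrierI[where f' = "f' \<circ> \<Phi>" and U = V and c = v]) (use \<Psi>h \<Psi>V V uv Q in \<open>auto simp: \<Psi>_def\<close>)
  have Bij: "\<Phi> \<in> Bij unit_sphere" "\<Psi> \<in> Bij unit_sphere"
    using \<Phi>G \<Psi>G by (auto simp: homeo_group_def oriented_homeos_def)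
  have "f = \<Phi> \<otimes>\<^bsub>?G\<^esub> \<Psi>"
  proof
    fix p
    have m: "\<Phi> \<otimes>\<^bsub>?G\<^esub> \<Psi> = compose unit_sphere \<Phi> \<Psi>" using Bij by (simp add: homeo_group_def BijGroup_def)
    show "f p = (\<Phi> \<otimes>\<^bsub>?G\<^esub> \<Psi>) p"
    proof (cases "p \<in> unit_sphere")
      case True
      then have "f p \<in> unit_sphere" using homeomorphism_image1[OF fh] by blast
      then show ?thesis unfolding m using True homeomorphism_apply2[OF \<Phi>(1)] by (simp add: compose_def \<Psi>_def del: mem_sphere_0)
    next
      case False
      then show ?thesis unfolding m using extensional_arb[OF fe] by (simp add: compose_def del: mem_sphere_0)
    qed
  qed
  moreover have "\<Phi> \<in> generate ?G (ball_supported ?G)" by (rule identity_on_open_generated[OF \<Phi>G U(1) uv(1) U(3)])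
  moreover have "\<Psi> \<in> generate ?G (ball_supported ?G)" by (rule identity_on_open_generated[OF \<Psi>G V(1) uv(2) \<Psi>V])
  ultimately show ?thesis using generate.eng by metis
qed

lemma near_identity_generated:
  assumes "\<exists>\<epsilon>>0. \<forall>f f'. homeomorphism unit_sphere unit_sphere f f' \<longrightarrow>
    (\<forall>p\<in>unit_sphere. dist (f p) p < \<epsilon>) \<longrightarrow> Q f \<longrightarrow> interpolates (f :: 'a::euclidean_space \<times> real \<Rightarrow> _) Q"
  shows "\<exists>\<epsilon>>0. {f \<in> carrier (homeo_group Q). sup_dist \<one>\<^bsub>homeo_group Q\<^esub> f < \<epsilon>} \<subseteq>
    generate (homeo_group Q) (ball_supported (homeo_group Q))"
proof -
  obtain \<epsilon> where \<epsilon>: "\<epsilon> > 0" and int: "\<And>f f'. homeomorphism unit_sphere unit_sphere f f' \<Longrightarrow>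
    (\<And>p. p \<in> unit_sphere \<Longrightarrow> dist (f p) p < \<epsilon>) \<Longrightarrow> Q f \<Longrightarrow> interpolates f Q" using assms by blast
  have "f \<in> generate (homeo_group Q) (ball_supported (homeo_group Q))"
    if f: "f \<in> carrier (homeo_group Q)" and s: "sup_dist \<one>\<^bsub>homeo_group Q\<^esub> f < \<epsilon>" for f
  proof (rule interpolates_generated[OF f])
    obtain f' where fh: "homeomorphism unit_sphere unit_sphere f f'" and Q: "Q f"
      using f unfolding homeo_group_def oriented_homeos_def by auto
    have "dist (f p) p < \<epsilon>" if p: "p \<in> unit_sphere" for p
    proof -
      have fp: "f p \<in> unit_sphere" using homeomorphism_image1[OF fh] p by blast
      have one: "\<one>\<^bsub>homeo_group Q\<^esub> = (\<lambda>x\<in>unit_sphere. x)" by (simp add: homeo_group_def BijGroup_def)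
      have "sdist x (f x) \<le> pi" if x: "x \<in> unit_sphere" for x
      proof -
        have "f x \<in> unit_sphere" using homeomorphism_image1[OF fh] x by blast
        then have "\<bar>x \<bullet> f x\<bar> \<le> 1" using Cauchy_Schwarz_ineq2[of x "f x"] x by simp
        then show ?thesis unfolding sdist_def using arccos_bounded[of "x \<bullet> f x"] by (auto simp: abs_le_iff)
      qed
      \<comment> \<open>Without an upper bound the real supremum would say nothing about its
        members; geodesic distances are at most \<pi>.\<close>
      then have "bdd_above ((\<lambda>x. sdist (\<one>\<^bsub>homeo_group Q\<^esub> x) (f x)) ` unit_sphere)"
        unfolding one by (intro bdd_aboveI2[of _ _ pi]) (simp del: mem_sphere_0)
      then have "sdist (\<one>\<^bsub>homeo_group Q\<^esub> p) (f p) \<le> sup_dist \<one>\<^bsub>homeo_group Q\<^esub> f"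
        unfolding sup_dist_def using p by (intro cSUP_upper)
      then have "sdist p (f p) < \<epsilon>" using s p unfolding one by (simp del: mem_sphere_0)
      then show ?thesis using sdist_bounds(1)[OF p fp] by (simp add: dist_commute)
    qed
    then show "interpolates f Q" using int[OF fh _ Q] by blast
  qed
  then show ?thesis using \<epsilon> by blast
qed

theorem lemma3p6:
  fixes G :: "((real ^ 'n) \<times> real \<Rightarrow> (real ^ 'n) \<times> real) monoid"
  assumes "CARD('n) \<ge> 2"
    and "G = LIP \<or> G = QC"
  shows "\<exists>\<epsilon>>0. {f \<in> carrier G. sup_dist \<one>\<^bsub>G\<^esub> f < \<epsilon>} \<subseteq> generate G (ball_supported G)"
proof -
  have n: "DIM(real ^ 'n) \<ge> 2" using assms(1) by simp
  show ?thesis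
    using near_identity_generated[OF bilipschitz_interpolates[where 'a = "real ^ 'n"]]
      near_identity_generated[OF quasiconformal_interpolates[OF n]] assms(2)
    unfolding homeo_group_def LIP_def[symmetric] QC_def[symmetric] by blast
qed

end
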